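(* In the setting of the vintage capital problem with convex-linear cost described in the context, let $R\in C^1(\mathbb R)$ be concave with $R'$ Lipschitz continuous, and set $$w_1=-A^{-1}BM_{\frac1{2\beta}}B^*(\lambda-A_0^* )^{-1}\alpha,\qquad w_2=A^{-1}BM_{\frac1{2\beta}}q .$$ Then there exists an equilibrium point $x\in H$ if and only if there exists a real number $\eta$ satisfying $$\eta=R'(\langle\alpha,w_2+\eta w_1\rangle).$$ In that case $x=w_2+\eta w_1$. Moreover, if $R''\le0$, then such an equilibrium point does exist and is unique.
   Context: Spaces and operators. Let $\bar s\in(0,+\infty]$, $\mu>0$, $\lambda>0$, $H=L^2(0,\bar s)$, $U=\mathbb R\times H$. $A_0f=-f'-\mu f$ with $D(A_0)=\{f\in H^1(0,\bar s): f(0)=0\}$, the generator of a strongly continuous semigroup on $H$. Its adjoint is $A_0^*f=f'-\mu f$ on $V:=D(A_0^* )=\{f\in H^1(0,\bar s): f(\bar s)=0\}$, endowed with $(v|w)_V=(v|w)_H+(A_0^*v|A_0^*w)_H$. $V'$ is the dual of $V$, with $V\subset H\equiv H'\subset V'$ and duality pairing $\langle\cdot,\cdot\rangle$. The semigroup extends to a strongly continuous semigroup $e^{tA}$ on $V'$ with generator $A$, $D(A)=H$, extending $A_0$; $A$ is invertible with bounded inverse on $V'$. $B\in L(U,V')$ is $B(u_0,u_1)=u_1+u_0\delta_0$, with $\delta_0$ the Dirac delta at $0$; its adjoint is $B^*:V\to U$, $B^*f=(f(0),f)$. Data. $\alpha\in V$ is positive and $g_0(x)=-R(\langle\alpha,x\rangle)$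 for $x\in V'$. The control cost is $$h_0(u)=\int_0^{\bar s}u_1(s)[\beta_1(s)u_1(s)+q_1(s)]\,ds+u_0[\beta_0u_0+q_0],\qquad u=(u_0,u_1)\in U,$$ where $\beta=(\beta_0,\beta_1)\in\mathbb R\times L^\infty(0,\bar s)$ with $\beta_0\ge\epsilon$ and $\beta_1(s)\ge\epsilon$ for some $\epsilon>0$, and $q=(q_0,q_1)\in U$. $M_{\frac1{2\beta}}:U\to U$ is $M_{\frac1{2\beta}}(u_0,u_1)=\left(\frac{u_0}{2\beta_0},\frac{u_1(\cdot)}{2\beta_1(\cdot)}\right)$. The convex conjugate $h_0^*$ of $h_0$ has derivative $(h_0^* )'(u)=M_{\frac1{2\beta}}(u-q)$. Value function and equilibrium points. For $x\in V'$ and $u\in L^2_\lambda(0,+\infty;U)=\{u:\ \tau\mapsto u(\tau)e^{-\lambda\tau/2}\in L^2(0,+\infty;U)\}$, let $y(\tau)=e^{\tau A}x+\int_0^\tau e^{(\tau-\sigma)A}Bu(\sigma)\,d\sigma$ and $$\Psi(x)=\inf_{u\in L^2_\lambda(0,+\infty;U)}\int_0^{+\infty}e^{-\lambda\tau}[g_0(y(\tau))+h_0(u(\tau))]\,d\tau .$$ $\Psi'$ denotes the Fréchet derivative of $\Psi$, viewed as a $V$-valued map on $V'$. An equilibrium point is a stationary solution of the closed loop equation, i.e. $x\in D(A)$ such that $Ax+B(h_0^* )'(-B^*\Psi'(x))=0$. *)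

theory Defs
  imports "HOL-Analysis.Analysis"
begin

section \<open>The Hilbert space of square integrable functions modulo null sets\<close>

definition square_integrable :: "(real \<Rightarrow> real) \<Rightarrow> bool" where
  "square_integrable f \<longleftrightarrow> f \<in> borel_measurable lborel \<and> integrable lborel (\<lambda>s. (f s)\<^sup>2)"

lemma square_integrable_zero: "square_integrable (\<lambda>_. 0)"
  by (simp add: square_integrable_def)

lemma square_integrable_mult:
  assumes "square_integrable f" "square_integrable g"
  shows "integrable lborel (\<lambda>s. f s * g s)"
proof (rule Bochner_Integration.integrable_bound)
  show "integrable lborel (\<lambda>s. (f s)\<^sup>2 + (g s)\<^sup>2)"
    using assms by (simp add: square_integrable_def)
  show "(\<lambda>s. f s * g s) \<in> borel_measurable lborel"
    using assms by (auto simp: square_integrable_def)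
  show "AE s in lborel. norm (f s * g s) \<le> norm ((f s)\<^sup>2 + (g s)\<^sup>2)"
  proof (intro AE_I2)
    fix s
    have "2 * \<bar>f s\<bar> * \<bar>g s\<bar> \<le> (f s)\<^sup>2 + (g s)\<^sup>2"
      using sum_squares_bound[of "\<bar>f s\<bar>" "\<bar>g s\<bar>"] by simp
    moreover have "0 \<le> \<bar>f s\<bar> * \<bar>g s\<bar>" by simp
    ultimately have "\<bar>f s\<bar> * \<bar>g s\<bar> \<le> (f s)\<^sup>2 + (g s)\<^sup>2" by linarith
    then show "norm (f s * g s) \<le> norm ((f s)\<^sup>2 + (g s)\<^sup>2)"
      by (simp add: abs_mult)
  qed
qed

lemma square_integrable_add:
  assumes "square_integrable f" "square_integrable g"
  shows "square_integrable (\<lambda>s. f s + g s)"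
proof -
  have "(\<lambda>s. (f s + g s)\<^sup>2) = (\<lambda>s. (f s)\<^sup>2 + (g s)\<^sup>2 + 2 * (f s * g s))"
    by (auto simp: power2_eq_square algebra_simps)
  then show ?thesis
    using assms square_integrable_mult[OF assms] by (auto simp: square_integrable_def)
qed

lemma square_integrable_scale:
  assumes "square_integrable f"
  shows "square_integrable (\<lambda>s. c * f s)"
  using assms by (auto simp: square_integrable_def power_mult_distrib)

definition L2_rel :: "(real \<Rightarrow> real) \<Rightarrow> (real \<Rightarrow> real) \<Rightarrow> bool" where
  "L2_rel f g \<longleftrightarrow> square_integrable f \<and> square_integrable g \<and> (AE s in lborel. f s = g s)"

quotient_type L2 = "real \<Rightarrow> real" / partial: L2_rel
proof (rule part_equivpI)
  show "\<exists>x. L2_rel x x"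
    using square_integrable_zero by (auto simp: L2_rel_def)
  show "symp L2_rel"
    by (auto simp: L2_rel_def symp_def elim!: AE_mp)
  show "transp L2_rel"
  proof (rule transpI)
    fix f g h assume "L2_rel f g" "L2_rel g h"
    then show "L2_rel f h" unfolding L2_rel_def by (auto elim!: AE_mp)
  qed
qed

text \<open>\<open>rep_L2 f\<close> is some representative of the class \<open>f\<close>;
  \<open>abs_L2 f\<close> is the class of a square integrable function \<open>f\<close>.\<close>

instantiation L2 :: real_inner
begin

lift_definition zero_L2 :: L2 is "\<lambda>_. 0"
  by (simp add: L2_rel_def square_integrable_zero)

lift_definition plus_L2 :: "L2 \<Rightarrow> L2 \<Rightarrow> L2" is "\<lambda>f g s. f s + g s"
  unfolding L2_rel_def by (auto intro: square_integrable_add)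

lift_definition scaleR_L2 :: "real \<Rightarrow> L2 \<Rightarrow> L2" is "\<lambda>c f s. c * f s"
  unfolding L2_rel_def by (auto intro: square_integrable_scale)

lift_definition inner_L2 :: "L2 \<Rightarrow> L2 \<Rightarrow> real" is "\<lambda>f g. \<integral>s. f s * g s \<partial>lborel"
proof -
  fix f f' g g' :: "real \<Rightarrow> real"
  assume "L2_rel f f'" "L2_rel g g'"
  then show "(\<integral>s. f s * g s \<partial>lborel) = (\<integral>s. f' s * g' s \<partial>lborel)"
    unfolding L2_rel_def square_integrable_def
    by (intro Bochner_Integration.integral_cong_AE) auto
qed

definition uminus_L2 :: "L2 \<Rightarrow> L2" where "uminus_L2 f = (-1) *\<^sub>R f"
definition minus_L2 :: "L2 \<Rightarrow> L2 \<Rightarrow> L2" where "minus_L2 f g = f + (- g)" for f g :: L2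
definition norm_L2 :: "L2 \<Rightarrow> real" where "norm_L2 f = sqrt (inner f f)"
definition dist_L2 :: "L2 \<Rightarrow> L2 \<Rightarrow> real" where "dist_L2 f g = norm (f - g)" for f g :: L2
definition sgn_L2 :: "L2 \<Rightarrow> L2" where "sgn_L2 f = inverse (norm f) *\<^sub>R f" for f :: L2
definition uniformity_L2 :: "(L2 \<times> L2) filter" where
  "uniformity_L2 = (INF e\<in>{0<..}. principal {(f, g). dist f g < e})"
definition open_L2 :: "L2 set \<Rightarrow> bool" where
  "open_L2 X \<longleftrightarrow> (\<forall>f\<in>X. \<forall>\<^sub>F (f', g) in uniformity. f' = f \<longrightarrow> g \<in> X)" for X :: "L2 set"

instance
proof
  fix f g h :: L2 and a b :: real
  show "f + g + h = f + (g + h)"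
    by transfer (auto simp: L2_rel_def add.assoc intro!: square_integrable_add)
  show add_comm: "f + g = g + f" for f g :: L2
    by transfer (auto simp: L2_rel_def add.commute intro!: square_integrable_add)
  show "0 + f = f"
    by transfer (auto simp: L2_rel_def)
  show "- f + f = 0"
    unfolding uminus_L2_def
    by transfer (auto simp: L2_rel_def square_integrable_zero)
  show "f - g = f + - g" by (rule minus_L2_def)
  show "a *\<^sub>R (f + g) = a *\<^sub>R f + a *\<^sub>R g"
    by transfer (auto simp: L2_rel_def distrib_left intro!: square_integrable_add square_integrable_scale)
  show "(a + b) *\<^sub>R f = a *\<^sub>R f + b *\<^sub>R f"
    by transfer (auto simp: L2_rel_def distrib_right intro!: square_integrable_add square_integrable_scale)
  show "a *\<^sub>R b *\<^sub>R f = (a * b) *\<^sub>R f"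
    by transfer (auto simp: L2_rel_def mult.assoc intro!: square_integrable_scale)
  show "1 *\<^sub>R f = f"
    by transfer (auto simp: L2_rel_def)
  show "dist f g = norm (f - g)" by (rule dist_L2_def)
  show "sgn f = inverse (norm f) *\<^sub>R f" by (rule sgn_L2_def)
  show "uniformity = (INF e\<in>{0<..}. principal {(f :: L2, g). dist f g < e})"
    by (rule uniformity_L2_def)
  show "open X \<longleftrightarrow> (\<forall>f\<in>X. \<forall>\<^sub>F (f', g) in uniformity. f' = f \<longrightarrow> g \<in> X)" for X :: "L2 set"
    by (rule open_L2_def)
  show "inner f g = inner g f"
    by transfer (simp add: mult.commute)
  show "inner (f + g) h = inner f h + inner g h"
    by transfer
      (auto simp: L2_rel_def distrib_right square_integrable_mult intro!: Bochner_Integration.integral_add)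
  show "inner (a *\<^sub>R f) g = a * inner f g"
    by transfer (simp add: mult.assoc)
  show "0 \<le> inner f f"
    by transfer simp
  show "inner f f = 0 \<longleftrightarrow> f = 0"
  proof transfer
    fix f assume f: "L2_rel f f"
    then have "integrable lborel (\<lambda>s. f s * f s)"
      by (auto simp: L2_rel_def square_integrable_mult)
    then have "(\<integral>s. f s * f s \<partial>lborel) = 0 \<longleftrightarrow> (AE s in lborel. f s * f s = 0)"
      by (intro integral_nonneg_eq_0_iff_AE) auto
    then show "(\<integral>s. f s * f s \<partial>lborel) = 0 \<longleftrightarrow> L2_rel f (\<lambda>_. 0)"
      using f by (simp add: L2_rel_def square_integrable_zero)
  qed
  show "norm f = sqrt (inner f f)" by (rule norm_L2_def)
qed

end

text \<open>\<open>L\<^sup>2(0, sbar)\<close>, identified with the closed subspace of the functions on the line that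
  vanish almost everywhere outside \<open>(0, sbar)\<close>.\<close>
definition H_space :: "ereal \<Rightarrow> L2 set" where
  "H_space sbar = {f. AE s in lborel. s \<notin> einterval 0 sbar \<longrightarrow> rep_L2 f s = 0}"

definition U_space :: "ereal \<Rightarrow> (real \<times> L2) set" where
  "U_space sbar = UNIV \<times> H_space sbar"

section \<open>Sobolev functions on the interval\<close>

text \<open>\<open>g\<close> is the derivative of \<open>f\<close> in \<open>L\<^sup>2(0, sbar)\<close>, and \<open>F\<close>, restricted to
  \<open>[0, sbar)\<close>, is the continuous representative of \<open>f\<close>.\<close>
definition H1_witness :: "ereal \<Rightarrow> L2 \<Rightarrow> L2 \<Rightarrow> (real \<Rightarrow> real) \<Rightarrow> bool" where
  "H1_witness sbar f g F \<longleftrightarrow>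
     f \<in> H_space sbar \<and> g \<in> H_space sbar \<and>
     (AE s in lborel. s \<in> einterval 0 sbar \<longrightarrow> rep_L2 f s = F s) \<and>
     (\<forall>s::real. 0 \<le> s \<and> ereal s < sbar \<longrightarrow> F s = F 0 + (LBINT r=0..s. rep_L2 g r))"

definition H1_space :: "ereal \<Rightarrow> L2 set" where
  "H1_space sbar = {f. \<exists>g F. H1_witness sbar f g F}"

definition weak_deriv :: "ereal \<Rightarrow> L2 \<Rightarrow> L2" where
  "weak_deriv sbar f = (THE g. \<exists>F. H1_witness sbar f g F)"

text \<open>Only the values on \<open>[0, sbar)\<close> are meaningful, and these are uniquely determined.\<close>
definition cont_rep :: "ereal \<Rightarrow> L2 \<Rightarrow> real \<Rightarrow> real" where
  "cont_rep sbar f = (SOME F. \<exists>g. H1_witness sbar f g F)"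

text \<open>The filter of reals increasing to \<open>sbar\<close>; for \<open>sbar = \<infinity>\<close> this is \<open>at_top\<close>, and the
  boundary condition \<open>f(sbar) = 0\<close> below then holds automatically.\<close>
definition right_end :: "ereal \<Rightarrow> real filter" where
  "right_end sbar = filtercomap ereal (at_left sbar)"

definition dom_A0 :: "ereal \<Rightarrow> L2 set" where
  "dom_A0 sbar = {f \<in> H1_space sbar. cont_rep sbar f 0 = 0}"

definition A0 :: "ereal \<Rightarrow> real \<Rightarrow> L2 \<Rightarrow> L2" where
  "A0 sbar \<mu> f = - weak_deriv sbar f - \<mu> *\<^sub>R f"

definition V_space :: "ereal \<Rightarrow> L2 set" where
  "V_space sbar = {f \<in> H1_space sbar. (cont_rep sbar f \<longlongrightarrow> 0) (right_end sbar)}"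

definition A0_adj :: "ereal \<Rightarrow> real \<Rightarrow> L2 \<Rightarrow> L2" where
  "A0_adj sbar \<mu> f = weak_deriv sbar f - \<mu> *\<^sub>R f"

definition V_inner :: "ereal \<Rightarrow> real \<Rightarrow> L2 \<Rightarrow> L2 \<Rightarrow> real" where
  "V_inner sbar \<mu> v w = inner v w + inner (A0_adj sbar \<mu> v) (A0_adj sbar \<mu> w)"

definition V_norm :: "ereal \<Rightarrow> real \<Rightarrow> L2 \<Rightarrow> real" where
  "V_norm sbar \<mu> v = sqrt (V_inner sbar \<mu> v v)"

section \<open>The dual of \<open>V\<close>\<close>

definition V_functionals :: "ereal \<Rightarrow> real \<Rightarrow> (L2 \<Rightarrow> real) set" where
  "V_functionals sbar \<mu> = {\<phi>.
     (\<forall>v\<in>V_space sbar. \<forall>w\<in>V_space sbar. \<phi> (v + w) = \<phi> v + \<phi> w) \<and>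
     (\<forall>c. \<forall>v\<in>V_space sbar. \<phi> (c *\<^sub>R v) = c * \<phi> v) \<and>
     (\<exists>K. \<forall>v\<in>V_space sbar. \<bar>\<phi> v\<bar> \<le> K * V_norm sbar \<mu> v)}"

text \<open>Since \<open>V\<close> depends on the parameter \<open>sbar\<close>, its dual cannot be a single concrete type.
  Instead, the type \<open>'d\<close> is the dual of \<open>V\<close> by means of a pairing \<open>dp\<close>: the map
  \<open>x \<mapsto> dp _ x\<close> is a linear isometric bijection from \<open>'d\<close> onto the bounded linear functionals
  on \<open>V\<close> with the dual norm.\<close>
definition is_dual_of_V ::
    "ereal \<Rightarrow> real \<Rightarrow> (L2 \<Rightarrow> 'd::real_normed_vector \<Rightarrow> real) \<Rightarrow> bool" where
  "is_dual_of_V sbar \<mu> dp \<longleftrightarrow>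
     (\<forall>v\<in>V_space sbar. linear (dp v)) \<and>
     (\<forall>x. (\<lambda>v. dp v x) \<in> V_functionals sbar \<mu>) \<and>
     (\<forall>\<phi>\<in>V_functionals sbar \<mu>. \<exists>x. \<forall>v\<in>V_space sbar. dp v x = \<phi> v) \<and>
     (\<forall>x. norm x = (SUP v\<in>{v \<in> V_space sbar. V_norm sbar \<mu> v \<le> 1}. \<bar>dp v x\<bar>))"

text \<open>The embedding of \<open>H = H'\<close> into \<open>V'\<close>.\<close>
definition emb :: "ereal \<Rightarrow> (L2 \<Rightarrow> 'd \<Rightarrow> real) \<Rightarrow> L2 \<Rightarrow> 'd" where
  "emb sbar dp f = (THE x. \<forall>v\<in>V_space sbar. dp v x = inner v f)"

definition delta0 :: "ereal \<Rightarrow> (L2 \<Rightarrow> 'd \<Rightarrow> real) \<Rightarrow> 'd" where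
  "delta0 sbar dp = (THE x. \<forall>v\<in>V_space sbar. dp v x = cont_rep sbar v 0)"

definition B_op :: "ereal \<Rightarrow> (L2 \<Rightarrow> 'd::real_normed_vector \<Rightarrow> real) \<Rightarrow> real \<times> L2 \<Rightarrow> 'd" where
  "B_op sbar dp u = emb sbar dp (snd u) + fst u *\<^sub>R delta0 sbar dp"

definition B_adj :: "ereal \<Rightarrow> L2 \<Rightarrow> real \<times> L2" where
  "B_adj sbar f = (cont_rep sbar f 0, f)"

section \<open>Semigroups and generators\<close>

text \<open>Strongly continuous semigroups of bounded linear operators on the subspace \<open>X\<close>.\<close>
definition C0_semigroup_on :: "'a::real_normed_vector set \<Rightarrow> (real \<Rightarrow> 'a \<Rightarrow> 'a) \<Rightarrow> bool" where
  "C0_semigroup_on X S \<longleftrightarrow>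
     (\<forall>t\<ge>0. (\<forall>x\<in>X. S t x \<in> X) \<and>
        (\<forall>x\<in>X. \<forall>y\<in>X. S t (x + y) = S t x + S t y) \<and>
        (\<forall>c. \<forall>x\<in>X. S t (c *\<^sub>R x) = c *\<^sub>R S t x) \<and>
        (\<exists>K. \<forall>x\<in>X. norm (S t x) \<le> K * norm x)) \<and>
     (\<forall>x\<in>X. S 0 x = x) \<and>
     (\<forall>s\<ge>0. \<forall>t\<ge>0. \<forall>x\<in>X. S (s + t) x = S s (S t x)) \<and>
     (\<forall>x\<in>X. ((\<lambda>t. S t x) \<longlongrightarrow> x) (at_right 0))"

definition generator_graph ::
    "'a::real_normed_vector set \<Rightarrow> (real \<Rightarrow> 'a \<Rightarrow> 'a) \<Rightarrow> ('a \<times> 'a) set" where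
  "generator_graph X S =
     {(x, y). x \<in> X \<and> y \<in> X \<and> ((\<lambda>t. (S t x - x) /\<^sub>R t) \<longlongrightarrow> y) (at_right 0)}"

definition gen_dom :: "(real \<Rightarrow> 'a::real_normed_vector \<Rightarrow> 'a) \<Rightarrow> 'a set" where
  "gen_dom T = Domain (generator_graph UNIV T)"

definition gen :: "(real \<Rightarrow> 'a::real_normed_vector \<Rightarrow> 'a) \<Rightarrow> 'a \<Rightarrow> 'a" where
  "gen T x = (THE y. (x, y) \<in> generator_graph UNIV T)"

definition gen_inv :: "(real \<Rightarrow> 'a::real_normed_vector \<Rightarrow> 'a) \<Rightarrow> 'a \<Rightarrow> 'a" where
  "gen_inv T = inv_into (gen_dom T) (gen T)"

text \<open>\<open>T\<close> is the semigroup \<open>e\<^bsup>tA\<^esup>\<close> on \<open>V'\<close>: the strongly continuous extension to \<open>V'\<close> of the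
  strongly continuous semigroup \<open>S\<close> on \<open>H\<close> generated by \<open>A\<^sub>0\<close>.\<close>
definition is_extended_semigroup ::
    "ereal \<Rightarrow> real \<Rightarrow> (L2 \<Rightarrow> 'd::real_normed_vector \<Rightarrow> real) \<Rightarrow> (real \<Rightarrow> 'd \<Rightarrow> 'd) \<Rightarrow> bool" where
  "is_extended_semigroup sbar \<mu> dp T \<longleftrightarrow>
     C0_semigroup_on UNIV T \<and>
     (\<exists>S. C0_semigroup_on (H_space sbar) S \<and>
        generator_graph (H_space sbar) S = {(f, A0 sbar \<mu> f) |f. f \<in> dom_A0 sbar} \<and>
        (\<forall>t\<ge>0. \<forall>f\<in>H_space sbar. T t (emb sbar dp f) = emb sbar dp (S t f)))"

section \<open>Control problem\<close>

definition h0 :: "ereal \<Rightarrow> real \<Rightarrow> (real \<Rightarrow> real) \<Rightarrow> real \<times> L2 \<Rightarrow> real \<times> L2 \<Rightarrow> real" where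
  "h0 sbar \<beta>0 \<beta>1 q u =
     (LBINT s=0..sbar. rep_L2 (snd u) s * (\<beta>1 s * rep_L2 (snd u) s + rep_L2 (snd q) s)) +
     fst u * (\<beta>0 * fst u + fst q)"

definition M_op :: "ereal \<Rightarrow> real \<Rightarrow> (real \<Rightarrow> real) \<Rightarrow> real \<times> L2 \<Rightarrow> real \<times> L2" where
  "M_op sbar \<beta>0 \<beta>1 u =
     (fst u / (2 * \<beta>0),
      abs_L2 (\<lambda>s. indicator (einterval 0 sbar) s * (rep_L2 (snd u) s / (2 * \<beta>1 s))))"

definition convex_conjugate_on :: "'a::real_inner set \<Rightarrow> ('a \<Rightarrow> real) \<Rightarrow> 'a \<Rightarrow> real" where
  "convex_conjugate_on S h p = (SUP u\<in>S. inner p u - h u)"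

definition gradient_on :: "'a::real_inner set \<Rightarrow> ('a \<Rightarrow> real) \<Rightarrow> 'a \<Rightarrow> 'a" where
  "gradient_on S f p =
     (THE g. g \<in> S \<and> (f has_derivative (\<lambda>d. inner g d)) (at p within S))"

definition controls :: "ereal \<Rightarrow> real \<Rightarrow> (real \<Rightarrow> real \<times> L2) set" where
  "controls sbar lam = {u.
     (\<forall>\<tau>>0. u \<tau> \<in> U_space sbar) \<and>
     set_borel_measurable lborel {0<..} u \<and>
     set_integrable lborel {0<..} (\<lambda>\<tau>. (norm (exp (- lam * \<tau> / 2) *\<^sub>R u \<tau>))\<^sup>2)}"

definition mild_solution ::
    "ereal \<Rightarrow> (L2 \<Rightarrow> 'd::{banach,second_countable_topology} \<Rightarrow> real) \<Rightarrow> (real \<Rightarrow> 'd \<Rightarrow> 'd) \<Rightarrow>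
     'd \<Rightarrow> (real \<Rightarrow> real \<times> L2) \<Rightarrow> real \<Rightarrow> 'd" where
  "mild_solution sbar dp T x u \<tau> =
     T \<tau> x + (LINT \<sigma>:{0..\<tau>}|lborel. T (\<tau> - \<sigma>) (B_op sbar dp (u \<sigma>)))"

definition value_function ::
    "ereal \<Rightarrow> real \<Rightarrow> (L2 \<Rightarrow> 'd::{banach,second_countable_topology} \<Rightarrow> real) \<Rightarrow>
     (real \<Rightarrow> 'd \<Rightarrow> 'd) \<Rightarrow> ('d \<Rightarrow> real) \<Rightarrow> (real \<times> L2 \<Rightarrow> real) \<Rightarrow> 'd \<Rightarrow> real" where
  "value_function sbar lam dp T g h x =
     (INF u\<in>controls sbar lam.
        LINT \<tau>:{0<..}|lborel. exp (- lam * \<tau>) * (g (mild_solution sbar dp T x u \<tau>) + h (u \<tau>)))"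

text \<open>Here \<open>p \<in> V\<close> is the derivative of the value function at \<open>x\<close>.\<close>
definition is_equilibrium ::
    "ereal \<Rightarrow> real \<Rightarrow> (L2 \<Rightarrow> 'd::{banach,second_countable_topology} \<Rightarrow> real) \<Rightarrow>
     (real \<Rightarrow> 'd \<Rightarrow> 'd) \<Rightarrow> ('d \<Rightarrow> real) \<Rightarrow> (real \<times> L2 \<Rightarrow> real) \<Rightarrow> 'd \<Rightarrow> bool" where
  "is_equilibrium sbar lam dp T g h x \<longleftrightarrow>
     x \<in> gen_dom T \<and>
     (\<exists>p\<in>V_space sbar.
        (value_function sbar lam dp T g h has_derivative (\<lambda>z. dp p z)) (at x) \<and>
        gen T x + B_op sbar dp
          (gradient_on (U_space sbar) (convex_conjugate_on (U_space sbar) h) (- B_adj sbar p)) = 0)"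

text \<open>The resolvent \<open>(lam - A\<^sub>0\<^sup>*)\<^sup>-\<^sup>1\<close>.\<close>
definition resolvent_A0_adj :: "ereal \<Rightarrow> real \<Rightarrow> real \<Rightarrow> L2 \<Rightarrow> L2" where
  "resolvent_A0_adj sbar \<mu> lam =
     inv_into (V_space sbar) (\<lambda>v. lam *\<^sub>R v - A0_adj sbar \<mu> v)"

end

theory Submission
  imports Defs
begin

text \<open>
  The embedding \<open>H \<rightarrow> V'\<close> and the duality between \<open>A\<close> and \<open>A\<^sub>0\<^sup>*\<close> turn \<open>A\<close> into a bijection \<open>H \<rightarrow> V'\<close>,
  so that for a costate \<open>p = - \<eta> (\<lambda> - A\<^sub>0\<^sup>*)\<^sup>-\<^sup>1 \<alpha>\<close> the stationary closed loop equation has the unique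
  solution \<open>x = w\<^sub>2 + \<eta> w\<^sub>1\<close>. The point is that \<open>\<Psi>' x = p\<close> exactly for
  \<open>\<eta> = R'(\<langle>\<alpha>, x\<rangle>)\<close>.

  Given \<open>\<eta> = R'(\<langle>\<alpha>, x\<rangle>)\<close>, convexity bounds \<open>\<Psi>\<close> near \<open>x\<close> from below by its tangent with
  slope \<open>p\<close>, while the constant control bounds \<open>\<Psi>\<close> from above by the same tangent plus a quadratic
  term, as \<open>R'\<close> is Lipschitz; hence \<open>\<Psi>' x = p\<close>. If, on the other hand, \<open>\<Psi>' x = p\<close> for some \<open>p\<close> and
  the closed loop equation holds, the dynamic programming inequality on short time intervals and
  the strong convexity of the control cost force the constant control to be optimal at \<open>x\<close>. The
  quadratic upper bound then touches \<open>\<Psi>\<close> at \<open>x\<close>, so that its slope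
  \<open>- R'(\<langle>\<alpha>, x\<rangle>) (\<lambda> - A\<^sub>0\<^sup>*)\<^sup>-\<^sup>1 \<alpha>\<close> is \<open>p\<close>.

  Since \<open>(\<lambda> - A\<^sub>0\<^sup>*)\<^sup>-\<^sup>1\<close> and \<open>(- A\<^sub>0\<^sup>*)\<^sup>-\<^sup>1\<close> preserve positivity, \<open>\<langle>\<alpha>, w\<^sub>1\<rangle> \<ge> 0\<close>, and
  \<open>\<eta> \<mapsto> \<eta> - R'(\<langle>\<alpha>, w\<^sub>2 + \<eta> w\<^sub>1\<rangle>)\<close> is strictly increasing with exactly one zero.
\<close>

section \<open>The space of square integrable functions\<close>

text \<open>About \<open>T\<close> it is only given that it extends some semigroup generated by
  \<open>A0\<close>: neither a growth bound nor the domain of its generator. Hence everything is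
  transported through \<open>AA\<close>, the transpose of \<open>A0_adj\<close>: dissipativity of
  \<open>A0\<close> gives decay on V', and decay leaves no room for a domain larger than H. \<Psi>
  is a mere infimum, so its derivative must come from two-sided bounds. The lower one is computable
  because the discounted integral of the pairing of \<alpha> with the state is affine in the
  control, with weight \<open>rr\<close>; minimising over controls thus becomes a pointwise problem.
  The hard direction starts from a derivative \<open>p\<close> about which nothing is known. On
  [0,t] the terms linear in the deviation from the constant control cancel only up to a factor
  O(\<delta>), since the semigroup moves \<open>p\<close> slightly. The gain \<epsilon> times the
  squared deviation absorbs them at cost t * O(\<delta>^2), while the optimality gap carries a
  factor of order lam * t; so the gap is O(\<delta>^2). This requires norm continuity of the adjoint
  orbit of \<open>p\<close>, uniformly in the control.\<close>

lemma square_integrable_rep: "square_integrable (rep_L2 f)"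
  using Quotient3_L2 unfolding Quotient3_def L2_rel_def by blast

lemma rep_abs_L2:
  assumes "square_integrable f"
  shows "AE s in lborel. rep_L2 (abs_L2 f) s = f s"
proof -
  have "L2_rel f f" using assms by (simp add: L2_rel_def)
  then have "L2_rel (rep_L2 (abs_L2 f)) f"
    using Quotient3_L2 unfolding Quotient3_def by metis
  then show ?thesis by (simp add: L2_rel_def)
qed

lemma L2_eqI:
  assumes "AE s in lborel. rep_L2 f s = rep_L2 g s"
  shows "f = g"
proof -
  have "L2_rel (rep_L2 f) (rep_L2 g)"
    using assms square_integrable_rep by (simp add: L2_rel_def)
  then show ?thesis using Quotient3_L2 unfolding Quotient3_def by metis
qed

lemma rep_measurable [measurable]: "rep_L2 f \<in> borel_measurable borel"
  using square_integrable_rep[of f] by (simp add: square_integrable_def)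

lemma rep_plus: "AE s in lborel. rep_L2 (f + g) s = rep_L2 f s + rep_L2 g s"
proof -
  have "f + g = abs_L2 (\<lambda>s. rep_L2 f s + rep_L2 g s)"
    by (simp add: plus_L2_def)
  then show ?thesis
    by (simp add: rep_abs_L2 square_integrable_add square_integrable_rep)
qed

lemma rep_scaleR: "AE s in lborel. rep_L2 (c *\<^sub>R f) s = c * rep_L2 f s"
proof -
  have "c *\<^sub>R f = abs_L2 (\<lambda>s. c * rep_L2 f s)"
    by (simp add: scaleR_L2_def)
  then show ?thesis
    by (simp add: rep_abs_L2 square_integrable_scale square_integrable_rep)
qed

lemma rep_zero: "AE s in lborel. rep_L2 0 s = 0"
  using rep_abs_L2[OF square_integrable_zero] by (simp add: zero_L2_def)

lemma rep_minus: "AE s in lborel. rep_L2 (- f) s = - rep_L2 f s"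
  using rep_scaleR[of "-1" f] by simp

lemma rep_diff: "AE s in lborel. rep_L2 (f - g) s = rep_L2 f s - rep_L2 g s"
  using rep_plus[of f "- g"] rep_minus[of g] by auto

lemma inner_L2_integral: "inner f g = (\<integral>s. rep_L2 f s * rep_L2 g s \<partial>lborel)"
  by (simp add: inner_L2_def)

lemma integrable_rep_mult [simp]: "integrable lborel (\<lambda>s. rep_L2 f s * rep_L2 g s)"
  by (intro square_integrable_mult square_integrable_rep)

lemma integrable_rep_square [simp]: "integrable lborel (\<lambda>s. (rep_L2 f s)\<^sup>2)"
  using square_integrable_rep by (simp add: square_integrable_def)

lemma norm_L2_integral: "(norm f)\<^sup>2 = (\<integral>s. (rep_L2 f s)\<^sup>2 \<partial>lborel)"
  unfolding power2_norm_eq_inner inner_L2_integral by (simp add: power2_eq_square)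

lemma norm_L2_nn_integral: "ennreal ((norm f)\<^sup>2) = (\<integral>\<^sup>+s. ennreal ((rep_L2 f s)\<^sup>2) \<partial>lborel)"
  by (simp add: norm_L2_integral nn_integral_eq_integral)

lemma norm_diff_L2_nn_integral:
  "ennreal ((norm (f - g))\<^sup>2) = (\<integral>\<^sup>+s. ennreal ((rep_L2 f s - rep_L2 g s)\<^sup>2) \<partial>lborel)"
  unfolding norm_L2_nn_integral
  by (intro nn_integral_cong_AE) (use rep_diff[of f g] in auto)

lemma inner_abs_L2:
  assumes "square_integrable f"
  shows "inner (abs_L2 f) g = (\<integral>s. f s * rep_L2 g s \<partial>lborel)"
proof -
  have [measurable]: "f \<in> borel_measurable borel" using assms by (simp add: square_integrable_def)
  show ?thesis
    unfolding inner_L2_integral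
    by (intro integral_cong_AE) (use rep_abs_L2[OF assms] in auto)
qed

lemma square_integrableI_nn:
  assumes [measurable]: "f \<in> borel_measurable lborel" and "(\<integral>\<^sup>+s. ennreal ((f s)\<^sup>2) \<partial>lborel) < \<infinity>"
  shows "square_integrable f"
  using assms unfolding square_integrable_def by (auto intro!: integrableI_nonneg)

lemma summable_convergent_differences:
  fixes a :: "nat \<Rightarrow> real"
  assumes "summable (\<lambda>n. a (Suc n) - a n)"
  shows "convergent a"
proof -
  obtain l where "(\<lambda>n. \<Sum>i<n. a (Suc i) - a i) \<longlonglongrightarrow> l"
    using assms summable_LIMSEQ by blast
  then have "(\<lambda>n. (\<Sum>i<n. a (Suc i) - a i) + a 0) \<longlonglongrightarrow> l + a 0" by (intro tendsto_intros)
  then have "a \<longlonglongrightarrow> l + a 0" by (simp add: sum_lessThan_telescope)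
  then show ?thesis by (auto simp: convergent_def)
qed

lemma Cauchy_fast_subsequence:
  fixes X :: "nat \<Rightarrow> 'a::real_normed_vector"
  assumes "Cauchy X" and e: "\<And>n. 0 < e n"
  obtains r where "strict_mono r" and "\<And>n. norm (X (r (Suc n)) - X (r n)) < e n"
proof -
  have N: "\<exists>N. \<forall>m\<ge>N. \<forall>n\<ge>N. norm (X m - X n) < e k" for k
    using assms(1) e[of k] unfolding Cauchy_iff by blast
  then obtain N where N: "\<And>k m n. N k \<le> m \<Longrightarrow> N k \<le> n \<Longrightarrow> norm (X m - X n) < e k" by metis
  have "\<exists>f. \<forall>n. N n \<le> f n \<and> f n < f (Suc n)"
  proof (rule dependent_nat_choice)
    show "\<exists>x. N 0 \<le> x" by blast
    show "\<exists>y. N (Suc n) \<le> y \<and> x < y" for x n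
      by (rule exI[of _ "max (N (Suc n)) (Suc x)"]) auto
  qed
  then obtain r where r: "\<And>n. N n \<le> r n" "\<And>n. r n < r (Suc n)" by metis
  show thesis
  proof (rule that)
    show "strict_mono r" using r(2) by (simp add: strict_mono_Suc_iff)
    show "norm (X (r (Suc n)) - X (r n)) < e n" for n
      using N[of n "r (Suc n)" "r n"] r(1)[of n] r(2)[of n] by simp
  qed
qed

lemma ennreal_le_suminf: "t n \<le> (\<Sum>n. t n :: ennreal)"
  using sum_le_suminf[of t "{n}"] by simp

lemma ennreal_finite_cases: "X \<noteq> \<infinity> \<Longrightarrow> \<exists>C\<ge>0. X = ennreal C"
  by (cases X) auto

text \<open>Riesz-Fischer. Along a subsequence with steps below (1/2)^n, the squared steps weighted
  by 2^n still have summable integrals; so at almost every point the steps are dominated by a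
  geometric series of ratio 1 / sqrt 2, and the values converge. Fatou's lemma upgrades this to
  convergence in norm, and the Cauchy property carries it to the full sequence.\<close>

lemma L2_Cauchy_convergent:
  fixes X :: "nat \<Rightarrow> L2"
  assumes X: "Cauchy X"
  shows "convergent X"
proof -
  obtain r where r: "strict_mono r"
    and small: "\<And>n. norm (X (r (Suc n)) - X (r n)) < (1/2)^n"
    using Cauchy_fast_subsequence[OF X, of "\<lambda>n. (1/2)^n"] by auto
  define x where "x n = rep_L2 (X (r n))" for n
  have x [measurable]: "x n \<in> borel_measurable borel" for n by (simp add: x_def)
  have int: "(\<integral>\<^sup>+s. ennreal ((x m s - x n s)\<^sup>2) \<partial>lborel) = ennreal ((norm (X (r m) - X (r n)))\<^sup>2)" for m n
    by (simp add: x_def norm_diff_L2_nn_integral)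
  have "(\<integral>\<^sup>+s. (\<Sum>n. ennreal (2^n * (x (Suc n) s - x n s)\<^sup>2)) \<partial>lborel)
      = (\<Sum>n. \<integral>\<^sup>+s. ennreal (2^n * (x (Suc n) s - x n s)\<^sup>2) \<partial>lborel)"
    by (intro nn_integral_suminf) simp
  also have "\<dots> = (\<Sum>n. ennreal (2^n * (norm (X (r (Suc n)) - X (r n)))\<^sup>2))"
    by (simp add: ennreal_mult' nn_integral_cmult int)
  also have "\<dots> \<le> (\<Sum>n. ennreal ((1/2)^n))"
  proof (rule suminf_le)
    fix n
    have "(norm (X (r (Suc n)) - X (r n)))\<^sup>2 \<le> ((1/2)^n)\<^sup>2"
      using small[of n] by (intro power_mono) auto
    then have "2^n * (norm (X (r (Suc n)) - X (r n)))\<^sup>2 \<le> 2^n * (((1/2)^n)\<^sup>2 :: real)"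
      by (intro mult_left_mono) auto
    also have "\<dots> = (1/2)^n"
    proof -
      have "2^n * (1/2)^n = (1::real)" by (simp flip: power_mult_distrib)
      then show ?thesis by (simp only: power2_eq_square mult.assoc[symmetric] mult_1_left)
    qed
    finally show "ennreal (2^n * (norm (X (r (Suc n)) - X (r n)))\<^sup>2) \<le> ennreal ((1/2)^n)"
      by (intro ennreal_leI)
  qed (rule summableI)+
  also have "\<dots> = ennreal (\<Sum>n. (1/2)^n)"
    by (rule suminf_ennreal2) (auto intro: summable_geometric)
  also have "\<dots> < \<infinity>" by simp
  finally have fin: "(\<integral>\<^sup>+s. (\<Sum>n. ennreal (2^n * (x (Suc n) s - x n s)\<^sup>2)) \<partial>lborel) < \<infinity>" .
  have "AE s in lborel. (\<Sum>n. ennreal (2^n * (x (Suc n) s - x n s)\<^sup>2)) \<noteq> \<infinity>"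
    by (rule nn_integral_PInf_AE[OF _ less_imp_neq[OF fin]]) measurable
  then have conv: "AE s in lborel. convergent (\<lambda>n. x n s)"
  proof eventually_elim
    case (elim s)
    let ?S = "\<Sum>n. ennreal (2^n * (x (Suc n) s - x n s)\<^sup>2)"
    have le: "ennreal (2^n * (x (Suc n) s - x n s)\<^sup>2) \<le> ?S" for n
      by (rule ennreal_le_suminf)
    obtain C where C: "0 \<le> C" "?S = ennreal C" using ennreal_finite_cases[OF elim] by blast
    have sq: "2^n * (x (Suc n) s - x n s)\<^sup>2 \<le> C" for n
      using order_trans[OF le[of n] eq_refl[OF C(2)]] unfolding ennreal_le_iff[OF C(1)] .
    have geo: "norm (x (Suc n) s - x n s) \<le> sqrt C * (1 / sqrt 2)^n" for n
    proof (rule power2_le_imp_le)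
      have "(norm (x (Suc n) s - x n s))\<^sup>2 \<le> C * (1/2)^n"
        using sq[of n] by (simp add: field_simps power_divide)
      also have "\<dots> = (sqrt C * (1 / sqrt 2)^n)\<^sup>2"
      proof -
        have "((1 / sqrt 2)^n)\<^sup>2 = ((1 / sqrt 2)\<^sup>2)^n"
          by (simp only: power_mult[symmetric] mult.commute)
        then show ?thesis using C(1) by (simp add: power_mult_distrib power_divide)
      qed
      finally show "(norm (x (Suc n) s - x n s))\<^sup>2 \<le> (sqrt C * (1 / sqrt 2)^n)\<^sup>2" .
      show "0 \<le> sqrt C * (1 / sqrt 2)^n" using C(1) by (intro mult_nonneg_nonneg) auto
    qed
    have pos: "0 < 1 / sqrt 2" by simp
    have lt1: "1 / sqrt 2 < 1" by simp
    have "summable (\<lambda>n. sqrt C * (1 / sqrt 2)^n)"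
      by (rule summable_mult[OF summable_geometric]) (simp only: real_norm_def abs_of_pos[OF pos] lt1)
    then have "summable (\<lambda>n. x (Suc n) s - x n s)"
      by (rule summable_comparison_test'[where N = 0]) (rule geo)
    then show ?case by (rule summable_convergent_differences)
  qed
  define f where "f s = lim (\<lambda>n. x n s)" for s
  have f [measurable]: "f \<in> borel_measurable borel"
    unfolding f_def by (rule borel_measurable_lim_metric) simp
  have lim: "AE s in lborel. (\<lambda>n. x n s) \<longlonglongrightarrow> f s"
    using conv by eventually_elim (simp add: f_def convergent_LIMSEQ_iff)
  \<comment> \<open>Fatou in the index \<open>m\<close> with \<open>n\<close> fixed. With
    \<open>e = 1\<close> it shows that the limit is square integrable; with half of the tolerance it
    gives convergence in norm.\<close>
  have fatou: "(\<integral>\<^sup>+s. ennreal ((f s - x n s)\<^sup>2) \<partial>lborel) \<le> ennreal (e\<^sup>2)"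
    if "\<And>m. m \<ge> n \<Longrightarrow> norm (X (r m) - X (r n)) \<le> e" for n e
  proof -
    have "(\<integral>\<^sup>+s. ennreal ((f s - x n s)\<^sup>2) \<partial>lborel)
        = (\<integral>\<^sup>+s. liminf (\<lambda>m. ennreal ((x m s - x n s)\<^sup>2)) \<partial>lborel)"
    proof (intro nn_integral_cong_AE, use lim in eventually_elim)
      case (elim s)
      then have "(\<lambda>m. ennreal ((x m s - x n s)\<^sup>2)) \<longlonglongrightarrow> ennreal ((f s - x n s)\<^sup>2)"
        by (intro tendsto_intros)
      then show ?case by (rule lim_imp_Liminf[OF sequentially_bot, symmetric])
    qed
    also have "\<dots> \<le> liminf (\<lambda>m. \<integral>\<^sup>+s. ennreal ((x m s - x n s)\<^sup>2) \<partial>lborel)"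
      by (intro nn_integral_liminf) simp
    also have "\<dots> \<le> ennreal (e\<^sup>2)"
      unfolding int
    proof (rule Liminf_le)
      show "\<forall>\<^sub>F m in sequentially. ennreal ((norm (X (r m) - X (r n)))\<^sup>2) \<le> ennreal (e\<^sup>2)"
        using eventually_ge_at_top[of n]
        by eventually_elim (auto intro!: ennreal_leI power_mono that)
    qed simp
    finally show ?thesis .
  qed
  have Cr: "Cauchy (\<lambda>n. X (r n))" using Cauchy_subseq_Cauchy[OF X r] by (simp add: o_def)
  obtain n0 where n0: "\<And>m. m \<ge> n0 \<Longrightarrow> norm (X (r m) - X (r n0)) \<le> 1"
    using Cr unfolding Cauchy_iff by (meson less_eq_real_def order_refl zero_less_one)
  have "square_integrable (\<lambda>s. f s - x n0 s)"
    using fatou[of n0 1] n0 by (intro square_integrableI_nn) (auto simp: le_less_trans)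
  then have "square_integrable (\<lambda>s. (f s - x n0 s) + x n0 s)"
    unfolding x_def by (intro square_integrable_add square_integrable_rep)
  then have fsq: "square_integrable f" by simp
  have eq: "ennreal ((norm (X (r n) - abs_L2 f))\<^sup>2) = (\<integral>\<^sup>+s. ennreal ((f s - x n s)\<^sup>2) \<partial>lborel)" for n
    unfolding norm_diff_L2_nn_integral x_def
    by (intro nn_integral_cong_AE) (use rep_abs_L2[OF fsq] in \<open>auto simp: power2_commute\<close>)
  have "(\<lambda>n. X (r n)) \<longlonglongrightarrow> abs_L2 f"
  proof (rule LIMSEQ_I)
    fix e :: real assume "0 < e"
    then obtain N where N: "\<And>m n. m \<ge> N \<Longrightarrow> n \<ge> N \<Longrightarrow> norm (X (r m) - X (r n)) < e / 2"
      using Cr unfolding Cauchy_iff by (meson half_gt_zero)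
    have "norm (X (r n) - abs_L2 f) < e" if "n \<ge> N" for n
    proof -
      have "ennreal ((norm (X (r n) - abs_L2 f))\<^sup>2) \<le> ennreal ((e/2)\<^sup>2)"
        unfolding eq by (rule fatou) (use N that in \<open>auto simp: less_imp_le\<close>)
      then have "norm (X (r n) - abs_L2 f) \<le> e / 2"
        using \<open>0 < e\<close> by (simp add: power2_le_iff_abs_le)
      then show ?thesis using \<open>0 < e\<close> by linarith
    qed
    then show "\<exists>N. \<forall>n\<ge>N. norm (X (r n) - abs_L2 f) < e" by blast
  qed
  then show ?thesis
    using Cauchy_converges_subseq[OF X r, of "abs_L2 f"] by (auto simp: o_def convergent_def)
qed

instance L2 :: banach
  by standard (rule L2_Cauchy_convergent)

section \<open>Riesz representation on closed subspaces\<close>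

text \<open>The energy \<open>Q\<close> is minimised over \<open>X\<close>: the parallelogram
  identity \<open>par\<close> makes a minimising sequence Cauchy, and the vanishing first variation
  at the minimiser is the representation. Linearity and boundedness are asked on \<open>X\<close>
  only, because \<open>AA_surj\<close> applies this to a functional built from the inverse of
  \<open>A0_adj\<close>, which has a meaning on H alone.\<close>

lemma riesz_representation:
  fixes \<phi> :: "'a::{real_inner,banach} \<Rightarrow> real"
  assumes X: "subspace X" "closed X"
    and add: "\<And>v w. v \<in> X \<Longrightarrow> w \<in> X \<Longrightarrow> \<phi> (v + w) = \<phi> v + \<phi> w"
    and scale: "\<And>c v. v \<in> X \<Longrightarrow> \<phi> (c *\<^sub>R v) = c * \<phi> v"
    and bound: "\<And>v. v \<in> X \<Longrightarrow> \<bar>\<phi> v\<bar> \<le> K * norm v"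
  shows "\<exists>f\<in>X. \<forall>v\<in>X. \<phi> v = inner v f"
proof -
  define Q where "Q v = (norm v)\<^sup>2 / 2 - \<phi> v" for v
  have low: "- K\<^sup>2 / 2 \<le> Q v" if "v \<in> X" for v
  proof -
    have "0 \<le> (norm v - K)\<^sup>2" by simp
    then show ?thesis using bound[OF that] unfolding Q_def by (simp add: power2_eq_square algebra_simps)
  qed
  have X0: "0 \<in> X" using X(1) by (rule subspace_0)
  have bdd: "bdd_below (Q ` X)" using low by (auto intro!: bdd_belowI)
  define m where "m = Inf (Q ` X)"
  have m_le: "m \<le> Q v" if "v \<in> X" for v
    unfolding m_def using bdd that by (intro cInf_lower) auto
  have "\<exists>v\<in>X. Q v < m + e" if "0 < e" for e
    using cInf_lessD[of "Q ` X" "m + e"] X0 that unfolding m_def by auto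
  then have "\<exists>v. v \<in> X \<and> Q v < m + inverse (real (Suc n))" for n
    by (metis inverse_positive_iff_positive of_nat_0_less_iff zero_less_Suc)
  then obtain v where v: "\<And>n. v n \<in> X" "\<And>n. Q (v n) < m + inverse (real (Suc n))" by metis
  have par: "(norm (a - b))\<^sup>2 / 4 = Q a + Q b - 2 * Q ((1/2) *\<^sub>R (a + b))" if "a \<in> X" "b \<in> X" for a b
  proof -
    have "\<phi> ((1/2) *\<^sub>R (a + b)) = (\<phi> a + \<phi> b) / 2"
      using scale[of "a + b" "1/2"] add[OF that] subspace_add[OF X(1) that] by simp
    then show ?thesis
      by (simp add: Q_def power2_norm_eq_inner inner_commute inner_add_left inner_add_right
          inner_diff_left inner_diff_right field_simps)
  qed
  have close: "(norm (v i - v j))\<^sup>2 \<le> 8 * inverse (real (Suc N))" if "N \<le> i" "N \<le> j" for i j N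
  proof -
    have "m \<le> Q ((1/2) *\<^sub>R (v i + v j))"
      using v(1) X(1) by (intro m_le subspace_scale subspace_add)
    moreover have "inverse (real (Suc i)) \<le> inverse (real (Suc N))"
      "inverse (real (Suc j)) \<le> inverse (real (Suc N))"
      using that by auto
    ultimately show ?thesis
      using par[OF v(1) v(1), of i j] v(2)[of i] v(2)[of j] by linarith
  qed
  have "Cauchy v"
    unfolding Cauchy_iff
  proof (intro allI impI)
    fix e :: real assume "0 < e"
    then obtain N where "inverse (real (Suc N)) < e\<^sup>2 / 8"
      using reals_Archimedean[of "e\<^sup>2/8"] by auto
    then have "norm (v i - v j) < e" if "N \<le> i" "N \<le> j" for i j
      using close[OF that] \<open>0 < e\<close> by (intro power_less_imp_less_base[of _ 2 e]) auto
    then show "\<exists>M. \<forall>m\<ge>M. \<forall>n\<ge>M. norm (v m - v n) < e" by blast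
  qed
  then obtain f where f: "v \<longlonglongrightarrow> f" using Cauchy_convergent convergent_def by blast
  have fX: "f \<in> X" using closed_sequentially[OF X(2)] v(1) f by blast
  have diff: "\<phi> (a - b) = \<phi> a - \<phi> b" if "a \<in> X" "b \<in> X" for a b
    using add[of a "- b"] scale[of b "-1"] that subspace_neg[OF X(1)] by simp
  have "(\<lambda>n. \<phi> (v n)) \<longlonglongrightarrow> \<phi> f"
  proof (rule Lim_null_comparison[THEN LIM_zero_cancel])
    show "\<forall>\<^sub>F n in sequentially. norm (\<phi> (v n) - \<phi> f) \<le> \<bar>K\<bar> * norm (v n - f)"
    proof (intro always_eventually allI)
      fix n
      have "\<bar>\<phi> (v n - f)\<bar> \<le> K * norm (v n - f)"
        using v(1) fX X(1) by (intro bound subspace_diff)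
      also have "\<dots> \<le> \<bar>K\<bar> * norm (v n - f)" by (intro mult_right_mono) auto
      finally show "norm (\<phi> (v n) - \<phi> f) \<le> \<bar>K\<bar> * norm (v n - f)"
        using diff[OF v(1) fX, of n] by simp
    qed
    show "(\<lambda>n. \<bar>K\<bar> * norm (v n - f)) \<longlonglongrightarrow> 0"
      using tendsto_mult_right_zero[OF tendsto_norm_zero[OF LIM_zero[OF f]]] .
  qed
  then have "(\<lambda>n. Q (v n)) \<longlonglongrightarrow> Q f"
    unfolding Q_def by (intro tendsto_intros f) auto
  moreover have "(\<lambda>n. m + inverse (real (Suc n))) \<longlonglongrightarrow> m + 0"
    by (intro tendsto_intros LIMSEQ_inverse_real_of_nat)
  ultimately have Qf: "Q f \<le> m"
    using LIMSEQ_le[of "\<lambda>n. Q (v n)" "Q f" "\<lambda>n. m + inverse (real (Suc n))"] v(2)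
    by (auto simp: less_imp_le)
  have "\<phi> w = inner w f" if w: "w \<in> X" for w
  proof (rule ccontr)
    define d where "d = inner w f - \<phi> w"
    assume "\<phi> w \<noteq> inner w f"
    then have d: "d \<noteq> 0" by (simp add: d_def)
    have ineq: "0 \<le> t * d + t\<^sup>2 * (norm w)\<^sup>2 / 2" for t
    proof -
      have "Q f \<le> Q (f + t *\<^sub>R w)"
        using Qf m_le[of "f + t *\<^sub>R w"] fX w X(1)
        by (meson order_trans subspace_add subspace_scale)
      then show ?thesis
        using add[of f "t *\<^sub>R w"] scale[of w t] fX w subspace_scale[OF X(1) w, of t]
        unfolding Q_def d_def power2_norm_eq_inner
        by (simp add: inner_commute algebra_simps power2_eq_square)
    qed
    have "\<phi> 0 = 0" using scale[OF X0, of 0] by simp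
    then have "w \<noteq> 0" using ineq[of "- d"] d by (auto simp: d_def power2_eq_square zero_le_mult_iff)
    then have w2: "(norm w)\<^sup>2 > 0" by simp
    \<comment> \<open>The inserted \<open>t\<close> is the minimiser of the quadratic in
      \<open>ineq\<close>; the minimum is negative as soon as \<open>d \<noteq> 0\<close>.\<close>
    have "(- d / (norm w)\<^sup>2) * d + (- d / (norm w)\<^sup>2)\<^sup>2 * (norm w)\<^sup>2 / 2 = - (d\<^sup>2 / (norm w)\<^sup>2) / 2"
      using \<open>w \<noteq> 0\<close> by (simp add: field_simps power2_eq_square)
    then have "0 \<le> - (d\<^sup>2 / (norm w)\<^sup>2) / 2"
      using ineq[of "- d / (norm w)\<^sup>2"] by linarith
    then show False using d w2 by (simp add: divide_le_0_iff)
  qed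
  then show ?thesis using fX by blast
qed

lemma subspace_closure:
  fixes V :: "'a::real_normed_vector set"
  assumes V: "subspace V"
  shows "subspace (closure V)"
proof (rule subspaceI)
  show "0 \<in> closure V" using subspace_0[OF V] closure_subset by blast
  show "x + y \<in> closure V" if xy: "x \<in> closure V" "y \<in> closure V" for x y
  proof -
    obtain f g where fg: "\<And>n. f n \<in> V" "f \<longlonglongrightarrow> x" "\<And>n. g n \<in> V" "g \<longlonglongrightarrow> y"
      using xy unfolding closure_sequential by blast
    have "(\<lambda>n. f n + g n) \<longlonglongrightarrow> x + y" by (intro tendsto_add fg)
    moreover have "f n + g n \<in> V" for n using V fg by (intro subspace_add)
    ultimately show ?thesis unfolding closure_sequential by (intro exI[of _ "\<lambda>n. f n + g n"]) auto
  qed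
  show "c *\<^sub>R x \<in> closure V" if x: "x \<in> closure V" for c x
  proof -
    obtain f where f: "\<And>n. f n \<in> V" "f \<longlonglongrightarrow> x"
      using x unfolding closure_sequential by blast
    have "(\<lambda>n. c *\<^sub>R f n) \<longlonglongrightarrow> c *\<^sub>R x" by (intro tendsto_intros f)
    moreover have "c *\<^sub>R f n \<in> V" for n using V f by (intro subspace_scale)
    ultimately show ?thesis unfolding closure_sequential by (intro exI[of _ "\<lambda>n. c *\<^sub>R f n"]) auto
  qed
qed

text \<open>Riesz representation on \<open>closure V\<close> produces the orthogonal projection
  \<open>f\<close> of \<open>g\<close>; the remainder \<open>g - f\<close> annihilates
  \<open>V\<close> and hence vanishes, so \<open>g\<close> lies in the closure.\<close>

lemma dense_subspace_if_trivial_annihilator: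
  fixes V X :: "'a::{real_inner,banach} set"
  assumes V: "subspace V" "V \<subseteq> X" and X: "subspace X" "closed X"
    and triv: "\<And>h. h \<in> X \<Longrightarrow> (\<And>v. v \<in> V \<Longrightarrow> inner h v = 0) \<Longrightarrow> h = 0"
    and g: "g \<in> X" and e: "0 < e"
  shows "\<exists>v\<in>V. norm (g - v) < e"
proof -
  have "\<exists>f\<in>closure V. \<forall>v\<in>closure V. inner v g = inner v f"
  proof (rule riesz_representation)
    show "\<bar>inner v g\<bar> \<le> norm g * norm v" for v
      using Cauchy_Schwarz_ineq2[of v g] by (simp add: mult.commute)
  qed (use V in \<open>auto simp: subspace_closure inner_add_left\<close>)
  then obtain f where f: "f \<in> closure V" "\<And>v. v \<in> closure V \<Longrightarrow> inner v g = inner v f" by blast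
  have "closure V \<subseteq> X" using V(2) X(2) by (rule closure_minimal)
  then have "g - f = 0"
    using f g closure_subset[of V]
    by (intro triv subspace_diff X) (auto simp: inner_diff_right inner_commute[of "g - f"] subset_iff)
  then have "g \<in> closure V" using f by simp
  then obtain v where "v \<in> V" "dist v g < e" using e by (auto simp: closure_approachable)
  then show ?thesis by (auto simp: dist_norm norm_minus_commute)
qed

subsection \<open>Multiplication operators\<close>

text \<open>One operator in three roles: with the indicator of the age interval it is the projection
  onto \<open>H_space\<close>, with the indicator of a half line it isolates a tail, and with
  \<open>m\<beta>\<close> and \<open>mi\<close> it multiplies by the coefficients of the control
  cost.\<close>

definition mult_L2 :: "(real \<Rightarrow> real) \<Rightarrow> L2 \<Rightarrow> L2" where
  "mult_L2 m f = abs_L2 (\<lambda>s. m s * rep_L2 f s)"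

definition ess_bounded :: "(real \<Rightarrow> real) \<Rightarrow> real \<Rightarrow> bool" where
  "ess_bounded m K \<longleftrightarrow> m \<in> borel_measurable borel \<and> (AE s in lborel. \<bar>m s\<bar> \<le> K)"

lemma AE_lborel_ex:
  assumes "AE s in lborel. P (s::real)" shows "\<exists>s. P s"
proof (rule ccontr)
  assume "\<nexists>s. P s"
  then have "eventually (\<lambda>_. False) (ae_filter (lborel :: real measure))" using assms by simp
  then show False
    using ae_filter_eq_bot_iff[of "lborel :: real measure"] unfolding eventually_False by simp
qed

lemma ess_bounded_nonneg: "ess_bounded m K \<Longrightarrow> 0 \<le> K"
  unfolding ess_bounded_def using AE_lborel_ex abs_ge_zero order_trans by metis

lemma square_integrable_ess_bounded:
  assumes m: "ess_bounded m K" and f: "square_integrable f"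
  shows "square_integrable (\<lambda>s. m s * f s)"
proof -
  have [measurable]: "m \<in> borel_measurable borel" "f \<in> borel_measurable borel"
    using m f by (auto simp: ess_bounded_def square_integrable_def)
  have "integrable lborel (\<lambda>s. (m s * f s)\<^sup>2)"
  proof (rule Bochner_Integration.integrable_bound)
    show "integrable lborel (\<lambda>s. K\<^sup>2 * (f s)\<^sup>2)"
      using f by (simp add: square_integrable_def)
    have "AE s in lborel. \<bar>m s\<bar> \<le> K" using m by (simp add: ess_bounded_def)
    then show "AE s in lborel. norm ((m s * f s)\<^sup>2) \<le> norm (K\<^sup>2 * (f s)\<^sup>2)"
    proof eventually_elim
      case (elim s)
      then have "\<bar>m s\<bar>\<^sup>2 \<le> K\<^sup>2" by (intro power_mono) auto
      then show ?case by (simp add: power_mult_distrib mult_right_mono)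
    qed
  qed simp
  then show ?thesis by (simp add: square_integrable_def)
qed

lemma rep_mult_L2:
  assumes "ess_bounded m K"
  shows "AE s in lborel. rep_L2 (mult_L2 m f) s = m s * rep_L2 f s"
  unfolding mult_L2_def
  by (intro rep_abs_L2 square_integrable_ess_bounded[OF assms] square_integrable_rep)

lemma inner_mult_L2:
  assumes "ess_bounded m K"
  shows "inner (mult_L2 m f) g = (\<integral>s. m s * (rep_L2 f s * rep_L2 g s) \<partial>lborel)"
  unfolding mult_L2_def
  by (subst inner_abs_L2)
    (auto intro!: square_integrable_ess_bounded[OF assms] square_integrable_rep simp: mult.assoc)

lemma mult_L2_selfadjoint:
  assumes "ess_bounded m K"
  shows "inner (mult_L2 m f) g = inner f (mult_L2 m g)"
  using inner_mult_L2[OF assms, of f g] inner_mult_L2[OF assms, of g f]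
  by (simp add: inner_commute mult.commute)

lemma norm_mult_L2_le:
  assumes m: "ess_bounded m K"
  shows "norm (mult_L2 m f) \<le> K * norm f"
proof (rule power2_le_imp_le)
  have [measurable]: "m \<in> borel_measurable borel" using m by (simp add: ess_bounded_def)
  have "(norm (mult_L2 m f))\<^sup>2 = (\<integral>s. (m s * rep_L2 f s)\<^sup>2 \<partial>lborel)"
    unfolding norm_L2_integral
    by (intro integral_cong_AE) (use rep_mult_L2[OF m, of f] in auto)
  also have "\<dots> \<le> (\<integral>s. K\<^sup>2 * (rep_L2 f s)\<^sup>2 \<partial>lborel)"
  proof (rule integral_mono_AE)
    show "integrable lborel (\<lambda>s. (m s * rep_L2 f s)\<^sup>2)"
      using square_integrable_ess_bounded[OF m square_integrable_rep] by (simp add: square_integrable_def)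
    have "AE s in lborel. \<bar>m s\<bar> \<le> K" using m by (simp add: ess_bounded_def)
    then show "AE s in lborel. (m s * rep_L2 f s)\<^sup>2 \<le> K\<^sup>2 * (rep_L2 f s)\<^sup>2"
    proof eventually_elim
      case (elim s)
      then have "\<bar>m s\<bar>\<^sup>2 \<le> K\<^sup>2" by (intro power_mono) auto
      then show ?case by (simp add: power_mult_distrib mult_right_mono)
    qed
  qed simp
  also have "\<dots> = (K * norm f)\<^sup>2" by (simp add: power_mult_distrib norm_L2_integral)
  finally show "(norm (mult_L2 m f))\<^sup>2 \<le> (K * norm f)\<^sup>2" .
qed (use ess_bounded_nonneg[OF m] in simp)

lemma bounded_linear_mult_L2:
  assumes m: "ess_bounded m K"
  shows "bounded_linear (mult_L2 m)"
proof (rule bounded_linear_intro)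
  show "mult_L2 m (f + g) = mult_L2 m f + mult_L2 m g" for f g
    by (rule L2_eqI, use rep_mult_L2[OF m, of f] rep_mult_L2[OF m, of g] rep_mult_L2[OF m, of "f+g"]
        rep_plus[of f g] rep_plus[of "mult_L2 m f" "mult_L2 m g"] in eventually_elim) (simp add: algebra_simps)
  show "mult_L2 m (c *\<^sub>R f) = c *\<^sub>R mult_L2 m f" for c f
    by (rule L2_eqI, use rep_mult_L2[OF m, of f] rep_mult_L2[OF m, of "c *\<^sub>R f"]
        rep_scaleR[of c f] rep_scaleR[of c "mult_L2 m f"] in eventually_elim) (simp add: algebra_simps)
  show "norm (mult_L2 m f) \<le> norm f * K" for f
    using norm_mult_L2_le[OF m] by (simp add: mult.commute)
qed

lemma ess_bounded_indicator: "A \<in> sets borel \<Longrightarrow> ess_bounded (indicator A) 1"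
  by (auto simp: ess_bounded_def indicator_def)

text \<open>As the fixed points of a bounded projection, \<open>H_space\<close> is a closed subspace
  and an admissible carrier for \<open>projected_semigroup\<close>.\<close>

lemma H_space_iff: "f \<in> H_space sbar \<longleftrightarrow> mult_L2 (indicator (einterval 0 sbar)) f = f"
proof
  note eb = ess_bounded_indicator[of "einterval 0 sbar", simplified]
  assume "f \<in> H_space sbar"
  then have "AE s in lborel. s \<notin> einterval 0 sbar \<longrightarrow> rep_L2 f s = 0" by (simp add: H_space_def)
  then show "mult_L2 (indicator (einterval 0 sbar)) f = f"
    using rep_mult_L2[OF eb, of f] by (intro L2_eqI, elim AE_mp) (auto simp: indicator_def)
next
  note eb = ess_bounded_indicator[of "einterval 0 sbar", simplified]
  assume eq: "mult_L2 (indicator (einterval 0 sbar)) f = f"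
  show "f \<in> H_space sbar"
    unfolding H_space_def mem_Collect_eq
    using rep_mult_L2[OF eb, of f, unfolded eq] by eventually_elim (auto simp: indicator_def split: if_splits)
qed

lemma subspace_H_space: "subspace (H_space sbar)"
proof -
  interpret bounded_linear "mult_L2 (indicator (einterval 0 sbar))"
    by (intro bounded_linear_mult_L2[of _ 1] ess_bounded_indicator) simp
  show ?thesis by (rule subspaceI) (auto simp: H_space_iff zero add scaleR)
qed

lemma closed_H_space: "closed (H_space sbar)"
proof -
  interpret bounded_linear "mult_L2 (indicator (einterval 0 sbar))"
    by (intro bounded_linear_mult_L2[of _ 1] ess_bounded_indicator) simp
  have "H_space sbar = {f. mult_L2 (indicator (einterval 0 sbar)) f = f}"
    using H_space_iff by blast
  then show ?thesis by (simp add: closed_Collect_eq linear_continuous_on bounded_linear_axioms)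
qed

lemma mult_L2_H_space:
  assumes m: "ess_bounded m K" and f: "f \<in> H_space sbar"
  shows "mult_L2 m f \<in> H_space sbar"
proof -
  have "AE s in lborel. s \<notin> einterval 0 sbar \<longrightarrow> rep_L2 f s = 0" using f by (simp add: H_space_def)
  then show ?thesis
    unfolding H_space_def mem_Collect_eq
    using rep_mult_L2[OF m, of f] by eventually_elim simp
qed

subsection \<open>Primitives\<close>

lemma set_integrable_rep:
  "set_integrable lborel {a..b} (rep_L2 g)"
proof -
  have "square_integrable (indicator {a..b} :: real \<Rightarrow> real)"
  proof -
    have "integrable lborel (indicator {a..b} :: real \<Rightarrow> real)"
      by (rule integrable_real_indicator) (auto simp: emeasure_lborel_Icc_eq)
    moreover have "(\<lambda>s. (indicator {a..b} s)\<^sup>2) = (indicator {a..b} :: real \<Rightarrow> real)"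
      by (auto simp: indicator_def)
    ultimately show ?thesis by (simp add: square_integrable_def)
  qed
  then show ?thesis
    unfolding set_integrable_def
    using square_integrable_mult[OF _ square_integrable_rep[of g]] by simp
qed

lemma interval_integral_0:
  "0 \<le> s \<Longrightarrow> (LBINT r=0..ereal s. f r) = (LBINT r:{0..s}. f r :: real)"
  using interval_integral_Icc[of 0 s f] by (simp add: zero_ereal_def)

lemma continuous_on_primitive:
  fixes g :: "real \<Rightarrow> real"
  assumes g: "\<And>c. set_integrable lborel {0..c} g"
  shows "continuous_on {0..} (\<lambda>s. LBINT r:{0..s}. g r)"
proof -
  have *: "continuous_on {0..c} (\<lambda>s. LBINT r:{0..s}. g r)" for c
    using indefinite_integral_continuous_1[OF set_borel_integral_eq_integral(1)[OF g[of c]]]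
    by (simp add: set_borel_integral_eq_integral(2)[OF g])
  show ?thesis
    unfolding continuous_on_eq_continuous_within
  proof
    fix x :: real assume x: "x \<in> {0..}"
    have "continuous (at x within {0..x+1}) (\<lambda>s. LBINT r:{0..s}. g r)"
      using * x by (auto simp: continuous_on_eq_continuous_within)
    moreover have "at x within {0..x+1} = at x within {0..}"
    proof (rule at_within_nhd[of _ "{..<x+1}"])
      show "{0..x+1} \<inter> {..<x+1} - {x} = {0..} \<inter> {..<x+1} - {x}" by auto
    qed auto
    ultimately show "continuous (at x within {0..}) (\<lambda>s. LBINT r:{0..s}. g r)" by simp
  qed
qed

text \<open>The truncated function \<open>f\<close> has zero integral over every ray
  \<open>{..a}\<close>. Rays form an intersection-stable generator of the Borel sets, so Dynkin's
  argument extends this to all Borel sets, and a density with zero integrals vanishes almost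
  everywhere.\<close>

lemma primitive_zero_imp_AE_zero:
  fixes h :: "real \<Rightarrow> real"
  assumes int: "set_integrable lborel {0..c} h"
    and zero: "\<And>s. 0 \<le> s \<Longrightarrow> s \<le> c \<Longrightarrow> (LBINT r:{0..s}. h r) = 0" and "0 \<le> c"
  shows "AE s in lborel. s \<in> {0..c} \<longrightarrow> h s = 0"
proof -
  define f where "f s = indicator {0..c} s * h s" for s
  have fint: "integrable lborel f"
    using int unfolding f_def set_integrable_def by simp
  have low: "(LBINT r:{..a}. f r) = 0" for a
  proof (cases "0 \<le> a")
    case True
    have "(LBINT r:{..a}. f r) = (LBINT r:{0..min a c}. h r)"
      unfolding set_lebesgue_integral_def f_def
      by (intro Bochner_Integration.integral_cong) (auto simp: indicator_def)
    then show ?thesis using zero[of "min a c"] True \<open>0 \<le> c\<close> by simp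
  next
    case False
    then have "(LBINT r:{..a}. f r) = (LBINT r:{..a}. 0)"
      unfolding set_lebesgue_integral_def f_def
      by (intro Bochner_Integration.integral_cong) (auto simp: indicator_def)
    then show ?thesis by simp
  qed
  have total: "(LBINT r. f r) = 0"
    using zero[of c] \<open>0 \<le> c\<close> unfolding set_lebesgue_integral_def f_def by simp
  have "(LBINT r:A. f r) = 0" if "A \<in> sets borel" for A
  proof -
    have "{..a} \<inter> {..b} = {..min a b}" for a b :: real by auto
    then have "Int_stable (range (atMost :: real \<Rightarrow> real set))"
      by (auto simp: Int_stable_def)
    moreover have "range (atMost :: real \<Rightarrow> real set) \<subseteq> Pow UNIV" by simp
    moreover have "A \<in> sigma_sets UNIV (range (atMost :: real \<Rightarrow> real set))"
      using that by (simp add: borel_eq_atMost)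
    ultimately show ?thesis
    proof (induction rule: sigma_sets_induct_disjoint[where \<Omega> = UNIV])
      case (basic A) then show ?case using low by auto
    next
      case empty then show ?case by (simp add: set_lebesgue_integral_def)
    next
      case (compl A)
      then have A: "A \<in> sets lborel" by (simp add: borel_eq_atMost)
      have "(LBINT r:(UNIV - A). f r) = (LBINT r. f r - indicator A r * f r)"
        unfolding set_lebesgue_integral_def
        by (intro Bochner_Integration.integral_cong) (auto simp: indicator_def)
      also have "\<dots> = (LBINT r. f r) - (LBINT r:A. f r)"
        unfolding set_lebesgue_integral_def
        using integrable_mult_indicator[OF A fint] fint
        by (subst Bochner_Integration.integral_diff) auto
      finally show ?case using compl total by simp
    next
      case (union A)
      then have A: "A i \<in> sets lborel" for i by (auto simp: borel_eq_atMost)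
      have "(\<Union>i. A i) \<in> sets lborel" using A by blast
      then have "set_integrable lborel (\<Union>i. A i) f"
        unfolding set_integrable_def by (rule integrable_mult_indicator[OF _ fint])
      have "(LBINT r:(\<Union>i. A i). f r) = (\<Sum>i. LBINT r:A i. f r)"
        by (rule lebesgue_integral_countable_add)
          (use A union \<open>set_integrable lborel (\<Union>i. A i) f\<close> in \<open>auto simp: disjoint_family_on_def\<close>)
      then show ?case using union by simp
    qed
  qed
  then have "AE s in lborel. f s = 0"
    by (rule sigma_finite_measure.density_zero[OF lborel.sigma_finite_measure_axioms fint]) simp
  then show ?thesis by eventually_elim (simp add: f_def indicator_def split: if_splits)
qed

text \<open>Integration by parts for absolutely continuous functions, by Fubini: the product of the
  two integrals is an integral over the square \<open>{0..s} \<times> {0..s}\<close>, which is cut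
  along the diagonal. The part \<open>y \<le> x\<close>, integrated over \<open>y\<close> first,
  gives \<open>g * H\<close>; the part \<open>x < y\<close>, integrated over \<open>x\<close> first,
  gives \<open>G * h\<close>.\<close>

lemma product_of_primitives:
  fixes g h :: "real \<Rightarrow> real"
  assumes g: "set_integrable lborel {0..s} g" and h: "set_integrable lborel {0..s} h"
  defines "G \<equiv> \<lambda>x. LBINT r:{0..x}. g r" and "H \<equiv> \<lambda>x. LBINT r:{0..x}. h r"
  shows "G s * H s = (LBINT x:{0..s}. g x * H x + G x * h x)"
    and "set_integrable lborel {0..s} (\<lambda>x. g x * H x + G x * h x)"
proof -
  define g' where "g' x = indicator {0..s} x * g x" for x
  define h' where "h' x = indicator {0..s} x * h x" for x
  have g': "integrable lborel g'" and h': "integrable lborel h'"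
    using g h unfolding g'_def h'_def set_integrable_def by simp_all
  have [measurable]: "g' \<in> borel_measurable borel" "h' \<in> borel_measurable borel"
    using g' h' by auto
  define K where "K x y = (if y \<le> x then g' x * h' y else 0)" for x y :: real
  define K' where "K' x y = (if x < y then g' x * h' y else 0)" for x y :: real
  have Km [measurable]: "(\<lambda>(x, y). K x y) \<in> borel_measurable (lborel \<Otimes>\<^sub>M lborel)"
    unfolding K_def split_beta by measurable
  have K'm [measurable]: "(\<lambda>(x, y). K' x y) \<in> borel_measurable (lborel \<Otimes>\<^sub>M lborel)"
    unfolding K'_def split_beta by measurable
  have prod: "integrable (lborel \<Otimes>\<^sub>M lborel) (\<lambda>(x, y). g' x * h' y)"
    using g' h' by (intro lborel_pair.Fubini_integrable) (auto simp: abs_mult split_beta)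
  have Kint: "integrable (lborel \<Otimes>\<^sub>M lborel) (\<lambda>(x, y). K x y)"
    by (rule Bochner_Integration.integrable_bound[OF prod Km]) (auto simp: K_def indicator_def)
  have K'int: "integrable (lborel \<Otimes>\<^sub>M lborel) (\<lambda>(x, y). K' x y)"
    by (rule Bochner_Integration.integrable_bound[OF prod K'm]) (auto simp: K'_def indicator_def)
  define KK where "KK z = K (fst z) (snd z)" for z
  define KK' where "KK' z = K' (fst z) (snd z)" for z
  have KK_eq: "KK = (\<lambda>(x, y). K x y)" and KK'_eq: "KK' = (\<lambda>(x, y). K' x y)"
    by (auto simp: KK_def KK'_def)
  have KKint: "integrable (lborel \<Otimes>\<^sub>M lborel) KK" and KK'int: "integrable (lborel \<Otimes>\<^sub>M lborel) KK'"
    unfolding KK_eq KK'_eq by (fact Kint, fact K'int)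
  have Hx: "(LBINT y. K x y) = indicator {0..s} x * (g x * H x)" for x
  proof (cases "x \<in> {0..s}")
    case True
    have "(LBINT y. K x y) = (LBINT y. g x * (indicator {0..x} y * h y))"
      using True by (intro Bochner_Integration.integral_cong) (auto simp: K_def g'_def h'_def indicator_def)
    then show ?thesis using True by (simp add: H_def set_lebesgue_integral_def)
  next
    case False
    then have "g' x = 0" by (simp add: g'_def del: atLeastAtMost_iff)
    then have "K x y = 0" for y by (simp add: K_def)
    then show ?thesis using False by simp
  qed
  have Gy: "(LBINT x. K' x y) = indicator {0..s} y * (G y * h y)" for y
    proof (cases "y \<in> {0..s}")
      case True
      have "(LBINT x. K' x y) = (LBINT x. h y * (indicator {0..<y} x * g x))"
      proof (intro Bochner_Integration.integral_cong refl)
        fix x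
        show "K' x y = h y * (indicator {0..<y} x * g x)"
        proof (cases "0 \<le> x \<and> x < y")
          case True
          then show ?thesis using \<open>y \<in> {0..s}\<close> by (simp add: K'_def g'_def h'_def)
        next
          case False
          then show ?thesis by (cases "x < y") (simp_all add: K'_def g'_def)
        qed
      qed
      also have "\<dots> = h y * (LBINT x:{0..<y}. g x)" by (simp add: set_lebesgue_integral_def)
      also have "(LBINT x:{0..<y}. g x) = G y"
        unfolding G_def
        by (rule set_integral_discrete_difference[of "{y}"]) (use True in auto)
      finally show ?thesis using True by simp
    next
      case False
      then have "h' y = 0" by (simp add: h'_def del: atLeastAtMost_iff)
      then have "K' x y = 0" for x by (simp add: K'_def)
      then show ?thesis using False by simp
    qed
  have "G s * H s = (LBINT x. g' x) * (LBINT y. h' y)"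
    by (simp add: G_def H_def g'_def h'_def set_lebesgue_integral_def)
  also have "\<dots> = (LBINT x. LBINT y. K x y + K' x y)"
  proof -
    have "(LBINT x. LBINT y. K x y + K' x y) = (LBINT x. LBINT y. g' x * h' y)"
      by (intro Bochner_Integration.integral_cong refl) (simp add: K_def K'_def)
    then show ?thesis by simp
  qed
  also have "\<dots> = integral\<^sup>L (lborel \<Otimes>\<^sub>M lborel) (\<lambda>z. KK z + KK' z)"
    using lborel_pair.integral_fst'[OF Bochner_Integration.integrable_add[OF KKint KK'int]]
    by (simp add: KK_def KK'_def)
  also have "\<dots> = integral\<^sup>L (lborel \<Otimes>\<^sub>M lborel) KK + integral\<^sup>L (lborel \<Otimes>\<^sub>M lborel) KK'"
    by (rule Bochner_Integration.integral_add[OF KKint KK'int])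
  also have "integral\<^sup>L (lborel \<Otimes>\<^sub>M lborel) KK = (LBINT x. indicator {0..s} x * (g x * H x))"
    using lborel_pair.integral_fst'[OF KKint] by (simp add: KK_def Hx)
  also have "integral\<^sup>L (lborel \<Otimes>\<^sub>M lborel) KK' = (LBINT y. indicator {0..s} y * (G y * h y))"
    using lborel_pair.integral_snd[OF K'int] by (simp add: KK'_eq Gy)
  finally have eq: "G s * H s = (LBINT x. indicator {0..s} x * (g x * H x)) +
    (LBINT y. indicator {0..s} y * (G y * h y))" .
  have i1: "integrable lborel (\<lambda>x. indicator {0..s} x * (g x * H x))"
    using lborel_pair.integrable_fst'[OF KKint] by (simp add: KK_def Hx)
  have i2: "integrable lborel (\<lambda>y. indicator {0..s} y * (G y * h y))"
    using lborel_pair.integrable_snd[OF K'int] by (simp add: Gy)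
  show "set_integrable lborel {0..s} (\<lambda>x. g x * H x + G x * h x)"
    using Bochner_Integration.integrable_add[OF i1 i2] by (simp add: set_integrable_def algebra_simps)
  show "G s * H s = (LBINT x:{0..s}. g x * H x + G x * h x)"
  proof -
    have "G s * H s = (LBINT x. indicator {0..s} x * (g x * H x) + indicator {0..s} x * (G x * h x))"
      by (rule trans[OF eq Bochner_Integration.integral_add[OF i1 i2, symmetric]])
    then show ?thesis by (simp only: set_lebesgue_integral_def real_scaleR_def distrib_left)
  qed
qed

section \<open>Sobolev functions\<close>

lemma H1_witness_iff:
  "H1_witness sbar f g F \<longleftrightarrow> f \<in> H_space sbar \<and> g \<in> H_space sbar \<and>
     (AE s in lborel. s \<in> einterval 0 sbar \<longrightarrow> rep_L2 f s = F s) \<and>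
     (\<forall>s\<ge>0. ereal s < sbar \<longrightarrow> F s = F 0 + (LBINT r:{0..s}. rep_L2 g r))"
  unfolding H1_witness_def by (auto simp: interval_integral_0)

lemma H1_witness_add:
  assumes "H1_witness sbar f g F" "H1_witness sbar f' g' F'"
  shows "H1_witness sbar (f + f') (g + g') (\<lambda>s. F s + F' s)"
proof -
  have "AE s in lborel. s \<in> einterval 0 sbar \<longrightarrow> rep_L2 (f + f') s = F s + F' s"
  proof -
    have "AE s in lborel. s \<in> einterval 0 sbar \<longrightarrow> rep_L2 f s = F s"
      "AE s in lborel. s \<in> einterval 0 sbar \<longrightarrow> rep_L2 f' s = F' s"
      using assms by (simp_all add: H1_witness_iff)
    then show ?thesis using rep_plus[of f f'] by eventually_elim simp
  qed
  moreover have "(LBINT r:{0..s}. rep_L2 (g + g') r) = (LBINT r:{0..s}. rep_L2 g r) + (LBINT r:{0..s}. rep_L2 g' r)" for s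
  proof -
    have "(LBINT r:{0..s}. rep_L2 (g + g') r) = (LBINT r:{0..s}. rep_L2 g r + rep_L2 g' r)"
      by (intro set_lebesgue_integral_cong_AE) (use rep_plus[of g g'] in auto)
    then show ?thesis by (simp add: set_integral_add set_integrable_rep)
  qed
  ultimately show ?thesis
    using assms subspace_H_space[of sbar] by (simp add: H1_witness_iff subspace_add)
qed

lemma H1_witness_scale:
  assumes "H1_witness sbar f g F"
  shows "H1_witness sbar (c *\<^sub>R f) (c *\<^sub>R g) (\<lambda>s. c * F s)"
proof -
  have "AE s in lborel. s \<in> einterval 0 sbar \<longrightarrow> rep_L2 (c *\<^sub>R f) s = c * F s"
  proof -
    have "AE s in lborel. s \<in> einterval 0 sbar \<longrightarrow> rep_L2 f s = F s"
      using assms by (simp_all add: H1_witness_iff)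
    then show ?thesis using rep_scaleR[of c f] by eventually_elim simp
  qed
  moreover have "(LBINT r:{0..s}. rep_L2 (c *\<^sub>R g) r) = c * (LBINT r:{0..s}. rep_L2 g r)" for s
  proof -
    have "(LBINT r:{0..s}. rep_L2 (c *\<^sub>R g) r) = (LBINT r:{0..s}. c * rep_L2 g r)"
      by (intro set_lebesgue_integral_cong_AE) (use rep_scaleR[of c g] in auto)
    then show ?thesis by simp
  qed
  ultimately show ?thesis
    using assms subspace_H_space[of sbar] by (simp add: H1_witness_iff subspace_scale algebra_simps)
qed

lemma H1_witness_continuous:
  assumes "H1_witness sbar f g F"
  shows "continuous_on {s. 0 \<le> s \<and> ereal s < sbar} F"
proof -
  have "continuous_on {0..} (\<lambda>s. F 0 + (LBINT r:{0..s}. rep_L2 g r))"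
    by (intro continuous_intros continuous_on_primitive set_integrable_rep)
  then have "continuous_on {s. 0 \<le> s \<and> ereal s < sbar} (\<lambda>s. F 0 + (LBINT r:{0..s}. rep_L2 g r))"
    by (rule continuous_on_subset) auto
  then show ?thesis
    by (rule continuous_on_eq) (use assms in \<open>auto simp: H1_witness_iff\<close>)
qed

lemma AE_continuous_imp_zero:
  fixes D :: "real \<Rightarrow> real"
  assumes "open S" and cont: "continuous_on S D" and ae: "AE s in lborel. s \<in> S \<longrightarrow> D s = 0" and s: "s \<in> S"
  shows "D s = 0"
proof (rule ccontr)
  assume "D s \<noteq> 0"
  let ?A = "{s \<in> S. D s \<noteq> 0}"
  have A: "?A = S \<inter> D -` (- {0})" by auto
  have "open ?A"
    unfolding A using continuous_open_preimage[OF cont \<open>open S\<close>, of "- {0}"] by (simp add: open_Compl)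
  moreover have "AE s in lebesgue. s \<notin> ?A"
    using AE_completion[OF ae] by (auto elim: eventually_mono)
  then have "?A \<in> null_sets lebesgue"
    using \<open>open ?A\<close> by (subst AE_iff_null_sets) auto
  then have "negligible ?A" by (simp add: negligible_iff_null_sets)
  ultimately show False
    using open_not_negligible[of ?A] s \<open>D s \<noteq> 0\<close> by blast
qed

section \<open>Weak derivatives, continuous representatives and Green's identity on the age
  interval\<close>

locale age_interval =
  fixes sbar :: ereal
  assumes sbar_pos: "0 < sbar"
begin

abbreviation "H \<equiv> H_space sbar"
abbreviation "V \<equiv> V_space sbar"
abbreviation "W \<equiv> H1_witness sbar"
abbreviation "Dw \<equiv> weak_deriv sbar"
abbreviation "ev \<equiv> cont_rep sbar"

text \<open>\<open>F\<close> is continuous and almost everywhere zero, hence zero inside the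
  interval, and at 0 by continuity from the right. So all primitives of \<open>g\<close> vanish,
  which forces \<open>g\<close> to vanish as well.\<close>

lemma witness_zero_unique:
  assumes w: "W 0 g F"
  shows "g = 0" "\<And>s. 0 \<le> s \<Longrightarrow> ereal s < sbar \<Longrightarrow> F s = 0"
proof -
  have cont: "continuous_on {s. 0 \<le> s \<and> ereal s < sbar} F" by (rule H1_witness_continuous[OF w])
  have "AE s in lborel. s \<in> einterval 0 sbar \<longrightarrow> F s = 0"
  proof -
    have "AE s in lborel. s \<in> einterval 0 sbar \<longrightarrow> rep_L2 0 s = F s"
      using w by (simp add: H1_witness_iff)
    then show ?thesis using rep_zero by eventually_elim simp
  qed
  then have pos: "F s = 0" if "s \<in> einterval 0 sbar" for s
    using that cont
    by (intro AE_continuous_imp_zero[of "einterval 0 sbar" F])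
      (auto simp: einterval_iff zero_ereal_def elim: continuous_on_subset)
  obtain b where b: "0 < b" "ereal b < sbar"
    using sbar_pos by (metis ereal_dense2 ereal_less(2))
  have "continuous_on {0..b} F"
    by (rule continuous_on_subset[OF cont])
      (use b in \<open>auto intro: le_less_trans[of _ "ereal b"]\<close>)
  then have "(F \<longlongrightarrow> F 0) (at 0 within {0..b})"
    using b by (auto simp: continuous_on_def)
  then have "(F \<longlongrightarrow> F 0) (at_right 0)"
    using b by (simp add: at_within_Icc_at_right)
  moreover have "((\<lambda>_::real. 0) \<longlongrightarrow> F 0) (at_right 0) \<longleftrightarrow> (F \<longlongrightarrow> F 0) (at_right 0)"
  proof (rule tendsto_cong)
    have "\<forall>\<^sub>F s in at_right 0. s \<in> {0<..<b}" using b by (intro eventually_at_right_real)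
    then show "\<forall>\<^sub>F s in at_right 0. 0 = F s"
    proof eventually_elim
      case (elim s)
      then have "ereal s < sbar" using less_trans[of "ereal s" "ereal b" sbar] b by simp
      then show ?case using pos[of s] elim by (simp add: einterval_iff zero_ereal_def)
    qed
  qed
  ultimately have F0: "F 0 = 0"
    using tendsto_unique[of "at_right (0::real)" "\<lambda>_. 0::real" "F 0" 0] by (simp add: tendsto_const_iff)
  show F: "F s = 0" if "0 \<le> s" "ereal s < sbar" for s
    using F0 pos[of s] that by (cases "s = 0") (auto simp: einterval_iff zero_ereal_def)
  have prim0: "(LBINT r:{0..s}. rep_L2 g r) = 0" if "0 \<le> s" "ereal s < sbar" for s
    using w F[OF that] F0 that by (auto simp: H1_witness_iff)
  \<comment> \<open>Rational right ends exhaust the interval while leaving only countably many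
    exceptional null sets.\<close>
  have "AE s in lborel. \<forall>c\<in>\<rat>. 0 \<le> c \<and> ereal c < sbar \<longrightarrow> s \<in> {0..c} \<longrightarrow> rep_L2 g s = 0"
  proof (subst AE_ball_countable[OF countable_rat], intro ballI)
    fix c :: real
    show "AE s in lborel. 0 \<le> c \<and> ereal c < sbar \<longrightarrow> s \<in> {0..c} \<longrightarrow> rep_L2 g s = 0"
    proof (cases "0 \<le> c \<and> ereal c < sbar")
      case True
      then have "AE s in lborel. s \<in> {0..c} \<longrightarrow> rep_L2 g s = 0"
        by (intro primitive_zero_imp_AE_zero set_integrable_rep prim0) (auto intro: le_less_trans[of _ "ereal c"])
      then show ?thesis by eventually_elim simp
    qed auto
  qed
  moreover have "AE s in lborel. s \<notin> einterval 0 sbar \<longrightarrow> rep_L2 g s = 0"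
    using w by (simp add: H1_witness_iff H_space_def)
  ultimately have "AE s in lborel. rep_L2 g s = 0"
  proof eventually_elim
    case (elim s)
    show ?case
    proof (cases "s \<in> einterval 0 sbar")
      case True
      then obtain b where b: "ereal s < ereal b" "ereal b < sbar"
        by (metis einterval_iff ereal_dense2)
      then obtain c where "c \<in> \<rat>" "s < c" "c < b" using Rats_dense_in_real[of s b] by auto
      then show ?thesis
        using elim True b less_trans[of "ereal c" "ereal b" sbar]
        by (auto simp: einterval_iff zero_ereal_def)
    qed (use elim in simp)
  qed
  then show "g = 0" using rep_zero by (intro L2_eqI) (auto elim: AE_mp)
qed

text \<open>This gives a meaning to the definite description in \<open>weak_deriv\<close> and, on
  \<open>[0, sbar)\<close>, to the choice in \<open>cont_rep\<close>.\<close>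

lemma witness_unique:
  assumes "W f g F" "W f g' F'"
  shows "g' = g" "\<And>s. 0 \<le> s \<Longrightarrow> ereal s < sbar \<Longrightarrow> F' s = F s"
proof -
  have "W 0 (g' - g) (\<lambda>s. F' s - F s)"
    using H1_witness_add[OF assms(2) H1_witness_scale[OF assms(1), of "-1"]] by simp
  from witness_zero_unique[OF this] show "g' = g" "\<And>s. 0 \<le> s \<Longrightarrow> ereal s < sbar \<Longrightarrow> F' s = F s"
    by auto
qed

lemma H1_witness_weak_deriv:
  assumes "f \<in> H1_space sbar"
  shows "W f (Dw f) (ev f)"
proof -
  obtain g F where w: "W f g F" using assms by (auto simp: H1_space_def)
  then have "Dw f = g" unfolding weak_deriv_def using witness_unique(1) by blast
  moreover have "\<exists>g. W f g (ev f)"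
    unfolding cont_rep_def using w by (intro someI_ex[of "\<lambda>F. \<exists>g. W f g F"]) blast
  ultimately show ?thesis using witness_unique(1)[OF w] by blast
qed

lemma witness_H1:
  assumes "W f g F"
  shows "f \<in> H1_space sbar" "Dw f = g" "\<And>s. 0 \<le> s \<Longrightarrow> ereal s < sbar \<Longrightarrow> ev f s = F s"
proof -
  show f: "f \<in> H1_space sbar" using assms by (auto simp: H1_space_def)
  show "Dw f = g" "\<And>s. 0 \<le> s \<Longrightarrow> ereal s < sbar \<Longrightarrow> ev f s = F s"
    using witness_unique[OF assms H1_witness_weak_deriv[OF f]] by auto
qed

lemma H1_subset_H: "H1_space sbar \<subseteq> H"
  by (auto simp: H1_space_def H1_witness_def)

lemma Dw_H: "f \<in> H1_space sbar \<Longrightarrow> Dw f \<in> H"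
  using H1_witness_weak_deriv by (auto simp: H1_witness_def)

lemma zero_dom: "ereal 0 < sbar" using sbar_pos by (simp add: zero_ereal_def)

lemma H1_add:
  assumes "f \<in> H1_space sbar" "f' \<in> H1_space sbar"
  shows "f + f' \<in> H1_space sbar" "Dw (f + f') = Dw f + Dw f'"
    "\<And>s. 0 \<le> s \<Longrightarrow> ereal s < sbar \<Longrightarrow> ev (f + f') s = ev f s + ev f' s"
  using witness_H1[OF H1_witness_add[OF assms[THEN H1_witness_weak_deriv]]] by auto

lemma H1_scale:
  assumes "f \<in> H1_space sbar"
  shows "c *\<^sub>R f \<in> H1_space sbar" "Dw (c *\<^sub>R f) = c *\<^sub>R Dw f"
    "\<And>s. 0 \<le> s \<Longrightarrow> ereal s < sbar \<Longrightarrow> ev (c *\<^sub>R f) s = c * ev f s"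
  using witness_H1[OF H1_witness_scale[OF assms[THEN H1_witness_weak_deriv], of c]] by auto

lemma eventually_right_end: "\<forall>\<^sub>F s in right_end sbar. 0 < s \<and> ereal s < sbar"
proof -
  have "\<forall>\<^sub>F x in at_left sbar. 0 < x \<and> x < sbar"
    using sbar_pos eventually_at_left by blast
  then have "\<forall>\<^sub>F s in right_end sbar. 0 < ereal s \<and> ereal s < sbar"
    unfolding right_end_def by (rule eventually_filtercomapI)
  then show ?thesis by (simp add: zero_ereal_def)
qed

text \<open>Boundary terms at the right end are taken along one fixed sequence, so that finite and
  infinite \<open>sbar\<close> are treated alike and dominated convergence applies.\<close>

definition endseq :: "nat \<Rightarrow> real" where
  "endseq = (SOME X. incseq X \<and> (\<forall>i. 0 < X i \<and> ereal (X i) < sbar) \<and> (\<lambda>i. ereal (X i)) \<longlonglongrightarrow> sbar)"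

lemma endseq: "incseq endseq" "0 < endseq i" "ereal (endseq i) < sbar" "(\<lambda>i. ereal (endseq i)) \<longlonglongrightarrow> sbar"
proof -
  have "\<exists>X. incseq X \<and> (\<forall>i. 0 < X i \<and> ereal (X i) < sbar) \<and> (\<lambda>i. ereal (X i)) \<longlonglongrightarrow> sbar"
    using ereal_incseq_approx[OF sbar_pos] by (metis ereal_less(2))
  from someI_ex[OF this]
  show "incseq endseq" "0 < endseq i" "ereal (endseq i) < sbar" "(\<lambda>i. ereal (endseq i)) \<longlonglongrightarrow> sbar"
    unfolding endseq_def by auto
qed

lemma filterlim_endseq: "filterlim endseq (right_end sbar) sequentially"
  unfolding right_end_def filterlim_filtercomap_iff o_def
  using endseq(3,4) by (auto simp: filterlim_at intro!: always_eventually less_imp_neq)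

lemma eventually_le_endseq: "ereal s < sbar \<Longrightarrow> \<forall>\<^sub>F n in sequentially. s \<le> endseq n"
  using order_tendstoD(1)[OF endseq(4), of "ereal s"] by (auto elim: eventually_mono)

lemma set_integral_endseq:
  fixes \<phi> :: "real \<Rightarrow> real"
  assumes int: "integrable lborel \<phi>" and z: "AE s in lborel. s \<notin> einterval 0 sbar \<longrightarrow> \<phi> s = 0"
  shows "(\<lambda>n. LBINT r:{0..endseq n}. \<phi> r) \<longlonglongrightarrow> (LBINT r. \<phi> r)"
  unfolding set_lebesgue_integral_def
proof (rule integral_dominated_convergence[where w = "\<lambda>s. norm (\<phi> s)"])
  show "AE s in lborel. (\<lambda>n. indicator {0..endseq n} s *\<^sub>R \<phi> s) \<longlonglongrightarrow> \<phi> s"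
    using z
  proof eventually_elim
    case (elim s)
    show ?case
    proof (cases "s \<in> einterval 0 sbar")
      case True
      then have "\<forall>\<^sub>F n in sequentially. s \<le> endseq n"
        by (intro eventually_le_endseq) (simp add: einterval_iff)
      then have "\<forall>\<^sub>F n in sequentially. indicator {0..endseq n} s *\<^sub>R \<phi> s = \<phi> s"
        by (rule eventually_mono) (use True in \<open>simp add: einterval_iff zero_ereal_def\<close>)
      then show ?thesis by (rule tendsto_eventually)
    qed (use elim in simp)
  qed
  show "AE s in lborel. norm (indicator {0..endseq n} s *\<^sub>R \<phi> s) \<le> norm (\<phi> s)" for n
    by (simp add: indicator_def)
qed (use int in auto)

text \<open>\<open>product_of_primitives\<close> concerns primitives starting at 0, so it is applied
  to \<open>F - F 0\<close> and \<open>F' - F' 0\<close>, and the boundary values are restored at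
  the end.\<close>

lemma green:
  assumes w: "W f g F" and w': "W f' g' F'" and s: "0 \<le> s" "ereal s < sbar"
  shows "F s * F' s = F 0 * F' 0 +
    (LBINT r:{0..s}. rep_L2 g r * rep_L2 f' r + rep_L2 f r * rep_L2 g' r)"
proof -
  define G' where "G' x = (LBINT r:{0..x}. rep_L2 g r)" for x
  define H' where "H' x = (LBINT r:{0..x}. rep_L2 g' r)" for x
  have F: "G' x = F x - F 0" and F': "H' x = F' x - F' 0" if "0 \<le> x" "x \<le> s" for x
    using w w' that s le_less_trans[of "ereal x" "ereal s" sbar] by (auto simp: H1_witness_iff G'_def H'_def)
  have in1: "set_integrable lborel {0..s} (\<lambda>r. rep_L2 a r * rep_L2 b r)" for a b
    unfolding set_integrable_def by (intro integrable_mult_indicator) auto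
  have ae: "AE r in lborel. r \<in> {0..s} \<longrightarrow> rep_L2 f r = F r" "AE r in lborel. r \<in> {0..s} \<longrightarrow> rep_L2 f' r = F' r"
  proof -
    have nz: "AE r in lborel. r \<noteq> (0::real)" by (rule AE_lborel_singleton)
    have in_I: "r \<in> einterval 0 sbar" if "r \<noteq> 0" "0 \<le> r" "r \<le> s" for r
      using that s le_less_trans[of "ereal r" "ereal s" sbar] by (auto simp: einterval_iff zero_ereal_def)
    have "AE s in lborel. s \<in> einterval 0 sbar \<longrightarrow> rep_L2 f s = F s"
      using w by (simp add: H1_witness_iff)
    then show "AE r in lborel. r \<in> {0..s} \<longrightarrow> rep_L2 f r = F r"
      using nz by eventually_elim (auto dest: in_I)
    have "AE s in lborel. s \<in> einterval 0 sbar \<longrightarrow> rep_L2 f' s = F' s"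
      using w' by (simp add: H1_witness_iff)
    then show "AE r in lborel. r \<in> {0..s} \<longrightarrow> rep_L2 f' r = F' r"
      using nz by eventually_elim (auto dest: in_I)
  qed
  have "G' s * H' s = (LBINT x:{0..s}. rep_L2 g x * H' x + G' x * rep_L2 g' x)"
    unfolding G'_def H'_def by (rule product_of_primitives(1)[OF set_integrable_rep set_integrable_rep])
  also have "\<dots> = (LBINT x:{0..s}. (rep_L2 g x * rep_L2 f' x + rep_L2 f x * rep_L2 g' x) -
      (F' 0 * rep_L2 g x + F 0 * rep_L2 g' x))"
  proof -
    have sint: "set_integrable lborel {0..s} (\<lambda>x. rep_L2 g x * H' x + G' x * rep_L2 g' x)"
      unfolding G'_def H'_def by (rule product_of_primitives(2)[OF set_integrable_rep set_integrable_rep])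
    show ?thesis
      unfolding set_lebesgue_integral_def
    proof (rule integral_cong_AE)
      show "(\<lambda>x. indicator {0..s} x *\<^sub>R (rep_L2 g x * H' x + G' x * rep_L2 g' x)) \<in> borel_measurable lborel"
        using sint unfolding set_integrable_def by (rule borel_measurable_integrable)
      show "AE x in lborel. indicator {0..s} x *\<^sub>R (rep_L2 g x * H' x + G' x * rep_L2 g' x) =
         indicator {0..s} x *\<^sub>R ((rep_L2 g x * rep_L2 f' x + rep_L2 f x * rep_L2 g' x) -
         (F' 0 * rep_L2 g x + F 0 * rep_L2 g' x))"
        using ae
      proof eventually_elim
        case (elim x)
        show ?case
        proof (cases "x \<in> {0..s}")
          case True
          then have e: "G' x = F x - F 0" "H' x = F' x - F' 0" "rep_L2 f x = F x" "rep_L2 f' x = F' x"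
            using F[of x] F'[of x] elim by simp_all
          show ?thesis unfolding e by (simp add: algebra_simps)
        qed simp
      qed
    qed simp
  qed
  also have "\<dots> = (LBINT x:{0..s}. rep_L2 g x * rep_L2 f' x + rep_L2 f x * rep_L2 g' x) -
      (F' 0 * G' s + F 0 * H' s)"
    unfolding G'_def H'_def
    by (simp add: set_integral_diff(2) set_integral_add set_integrable_rep in1)
  finally show ?thesis using F[of s] F'[of s] s by (simp add: algebra_simps)
qed

text \<open>Both integrands are products of square integrable functions, so the product of the two
  boundary values converges at the right end, even though neither factor is assumed to have a
  limit.\<close>

lemma green_limit:
  assumes w: "W f g F" and w': "W f' g' F'"
  shows "(\<lambda>n. F (endseq n) * F' (endseq n)) \<longlonglongrightarrow> F 0 * F' 0 + inner g f' + inner f g'"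
proof -
  have eq: "F (endseq n) * F' (endseq n) = F 0 * F' 0 +
      (LBINT r:{0..endseq n}. rep_L2 g r * rep_L2 f' r + rep_L2 f r * rep_L2 g' r)" for n
    using endseq(2,3)[of n] by (intro green[OF w w']) auto
  have z: "AE s in lborel. s \<notin> einterval 0 sbar \<longrightarrow> rep_L2 g s * rep_L2 f' s + rep_L2 f s * rep_L2 g' s = 0"
  proof -
    have "AE s in lborel. s \<notin> einterval 0 sbar \<longrightarrow> rep_L2 g s = 0"
      "AE s in lborel. s \<notin> einterval 0 sbar \<longrightarrow> rep_L2 f s = 0"
      using w by (simp_all add: H1_witness_iff H_space_def)
    then show ?thesis by eventually_elim simp
  qed
  have "(\<lambda>n. F 0 * F' 0 + (LBINT r:{0..endseq n}. rep_L2 g r * rep_L2 f' r + rep_L2 f r * rep_L2 g' r))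
    \<longlonglongrightarrow> F 0 * F' 0 + (LBINT r. rep_L2 g r * rep_L2 f' r + rep_L2 f r * rep_L2 g' r)"
    by (intro tendsto_intros set_integral_endseq z) auto
  then show ?thesis unfolding eq by (simp add: inner_L2_integral add.assoc)
qed

lemma V_H1: "v \<in> V \<Longrightarrow> v \<in> H1_space sbar"
  by (simp add: V_space_def)

lemma V_endseq: "v \<in> V \<Longrightarrow> (\<lambda>n. ev v (endseq n)) \<longlonglongrightarrow> 0"
  unfolding V_space_def using filterlim_compose[OF _ filterlim_endseq] by blast

lemma V_subset_H: "V \<subseteq> H" using V_H1 H1_subset_H by blast

lemma V_memI:
  assumes w: "W f g F" and lim: "(F \<longlongrightarrow> 0) (right_end sbar)"
  shows "f \<in> V"
proof -
  have "(ev f \<longlongrightarrow> 0) (right_end sbar) \<longleftrightarrow> (F \<longlongrightarrow> 0) (right_end sbar)"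
    by (rule tendsto_cong, use eventually_right_end in eventually_elim) (simp add: witness_H1(3)[OF w])
  then show ?thesis using witness_H1(1)[OF w] lim by (simp add: V_space_def)
qed

lemma subspace_V: "subspace V"
proof (rule subspaceI)
  have "AE s in lborel. s \<in> einterval 0 sbar \<longrightarrow> rep_L2 0 s = 0" using rep_zero by eventually_elim simp
  moreover have "(LBINT r:{0..s}. rep_L2 0 r) = 0" for s
  proof -
    have "(LBINT r:{0..s}. rep_L2 0 r) = (LBINT r:{0..s}. 0)"
      by (intro set_lebesgue_integral_cong_AE) (use rep_zero in auto)
    then show ?thesis by simp
  qed
  ultimately have "W 0 0 (\<lambda>_. 0)"
    using subspace_0[OF subspace_H_space] by (simp add: H1_witness_iff)
  then show "0 \<in> V" by (rule V_memI) simp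
  show "v + w \<in> V" if vw: "v \<in> V" "w \<in> V" for v w
  proof (rule V_memI)
    show "W (v + w) (Dw v + Dw w) (\<lambda>s. ev v s + ev w s)"
      using vw by (intro H1_witness_add H1_witness_weak_deriv V_H1)
    show "((\<lambda>s. ev v s + ev w s) \<longlongrightarrow> 0) (right_end sbar)"
      using tendsto_add[of "ev v" 0 "right_end sbar" "ev w" 0] vw by (simp add: V_space_def)
  qed
  show "c *\<^sub>R v \<in> V" if v: "v \<in> V" for c v
  proof (rule V_memI)
    show "W (c *\<^sub>R v) (c *\<^sub>R Dw v) (\<lambda>s. c * ev v s)"
      using v by (intro H1_witness_scale H1_witness_weak_deriv V_H1)
    show "((\<lambda>s. c * ev v s) \<longlongrightarrow> 0) (right_end sbar)"
      using tendsto_mult_right_zero[of "ev v" "right_end sbar" c] v by (simp add: V_space_def)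
  qed
qed

text \<open>The boundary term at \<open>sbar\<close> vanishes on \<open>V\<close> and the one at 0
  remains. This identity is behind both the coercivity of the resolvent equation and the trace bound
  \<open>ev0_square_le\<close>.\<close>

lemma V_inner_deriv:
  assumes v: "v \<in> V"
  shows "inner v (Dw v) = - (ev v 0)\<^sup>2 / 2"
proof -
  note w = H1_witness_weak_deriv[OF V_H1[OF v]]
  have "(\<lambda>n. ev v (endseq n) * ev v (endseq n)) \<longlonglongrightarrow> 0 * 0" by (intro tendsto_mult V_endseq[OF v])
  from LIMSEQ_unique[OF this green_limit[OF w w]] show ?thesis
    by (simp add: power2_eq_square inner_commute)
qed

text \<open>Nothing is prescribed at \<open>sbar\<close> for elements of \<open>dom_A0\<close>, but
  the boundary term there is a limit of squares.\<close>

lemma dom_A0_inner_deriv: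
  assumes f: "f \<in> dom_A0 sbar"
  shows "0 \<le> inner f (Dw f)"
proof -
  have w: "W f (Dw f) (ev f)" and 0: "ev f 0 = 0" using f H1_witness_weak_deriv by (auto simp: dom_A0_def)
  have "0 \<le> inner (Dw f) f + inner f (Dw f)"
    using green_limit[OF w w] 0 by (intro LIMSEQ_le_const[of "\<lambda>n. ev f (endseq n) * ev f (endseq n)"]) auto
  then show ?thesis by (simp add: inner_commute)
qed

text \<open>Only \<open>v\<close> is known to vanish at the right end. Green's identity for
  \<open>f\<close> with itself makes the squares of the boundary values of \<open>f\<close>
  convergent, hence \<open>f\<close> is bounded along \<open>endseq\<close>, and the product of the
  boundary values tends to 0.\<close>

lemma A0_duality:
  assumes v: "v \<in> V" and f: "f \<in> dom_A0 sbar"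
  shows "inner v (Dw f) + inner (Dw v) f = 0"
proof -
  note wv = H1_witness_weak_deriv[OF V_H1[OF v]]
  have w: "W f (Dw f) (ev f)" and 0: "ev f 0 = 0" using f H1_witness_weak_deriv by (auto simp: dom_A0_def)
  have "Bseq (\<lambda>n. ev f (endseq n) * ev f (endseq n))"
    using green_limit[OF w w] by (intro convergent_imp_Bseq) (auto simp: convergent_def)
  then obtain K where K: "\<And>n. norm (ev f (endseq n) * ev f (endseq n)) \<le> K"
    unfolding Bseq_def by blast
  have bd: "\<bar>ev f (endseq n)\<bar> \<le> sqrt K" for n
    using K[of n] by (intro real_le_rsqrt) (simp add: power2_eq_square)
  have "(\<lambda>n. ev v (endseq n) * ev f (endseq n)) \<longlonglongrightarrow> 0"
  proof (rule Lim_null_comparison)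
    show "\<forall>\<^sub>F n in sequentially. norm (ev v (endseq n) * ev f (endseq n)) \<le> norm (ev v (endseq n)) * sqrt K"
      using bd by (intro always_eventually allI) (simp add: abs_mult mult_left_mono)
    show "(\<lambda>n. norm (ev v (endseq n)) * sqrt K) \<longlonglongrightarrow> 0"
      using tendsto_mult_left_zero[OF tendsto_norm_zero[OF V_endseq[OF v]]] .
  qed
  from LIMSEQ_unique[OF this green_limit[OF wv w]] show ?thesis
    by (simp add: 0 inner_commute add.commute)
qed

end

section \<open>Exponential kernels\<close>

text \<open>Schur's test: writing the kernel as the square of its root, Cauchy-Schwarz costs one row
  integral, and Tonelli followed by the column bound costs the second factor
  \<open>c\<close>.\<close>

lemma schur_test:
  fixes k :: "real \<Rightarrow> real \<Rightarrow> real" and \<phi> :: "real \<Rightarrow> ennreal"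
  assumes k [measurable]: "(\<lambda>(x, y). k x y) \<in> borel_measurable (lborel \<Otimes>\<^sub>M lborel)"
    and \<phi> [measurable]: "\<phi> \<in> borel_measurable lborel" and nonneg: "\<And>x y. 0 \<le> k x y"
    and rows: "\<And>x. (\<integral>\<^sup>+y. ennreal (k x y) \<partial>lborel) \<le> c"
    and cols: "\<And>y. (\<integral>\<^sup>+x. ennreal (k x y) \<partial>lborel) \<le> c"
  shows "(\<integral>\<^sup>+x. (\<integral>\<^sup>+y. ennreal (k x y) * \<phi> y \<partial>lborel)\<^sup>2 \<partial>lborel) \<le> c * (c * (\<integral>\<^sup>+y. (\<phi> y)\<^sup>2 \<partial>lborel))"
proof -
  have km [measurable]: "(\<lambda>y. k x y) \<in> borel_measurable lborel" for x
    using measurable_compose[OF measurable_Pair1'[of x lborel lborel] k] by simp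
  have point: "(\<integral>\<^sup>+y. ennreal (k x y) * \<phi> y \<partial>lborel)\<^sup>2 \<le> c * (\<integral>\<^sup>+y. ennreal (k x y) * (\<phi> y)\<^sup>2 \<partial>lborel)" for x
  proof -
    have sq: "ennreal (sqrt (k x y)) * ennreal (sqrt (k x y)) = ennreal (k x y)" for y
      using nonneg[of x y] by (simp flip: ennreal_mult)
    have "(\<integral>\<^sup>+y. ennreal (k x y) * \<phi> y \<partial>lborel)\<^sup>2 =
        (\<integral>\<^sup>+y. ennreal (sqrt (k x y)) * (ennreal (sqrt (k x y)) * \<phi> y) \<partial>lborel)\<^sup>2"
      by (simp add: mult.assoc[symmetric] sq)
    also have "\<dots> \<le> (\<integral>\<^sup>+y. (ennreal (sqrt (k x y)))\<^sup>2 \<partial>lborel) *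
        (\<integral>\<^sup>+y. (ennreal (sqrt (k x y)) * \<phi> y)\<^sup>2 \<partial>lborel)"
      by (intro Cauchy_Schwarz_nn_integral) measurable
    also have "\<dots> = (\<integral>\<^sup>+y. ennreal (k x y) \<partial>lborel) * (\<integral>\<^sup>+y. ennreal (k x y) * (\<phi> y)\<^sup>2 \<partial>lborel)"
      by (simp only: power_mult_distrib power2_eq_square[of "ennreal _"] sq)
    also have "\<dots> \<le> c * (\<integral>\<^sup>+y. ennreal (k x y) * (\<phi> y)\<^sup>2 \<partial>lborel)"
      by (intro mult_right_mono rows) simp
    finally show ?thesis .
  qed
  have "(\<integral>\<^sup>+x. (\<integral>\<^sup>+y. ennreal (k x y) * \<phi> y \<partial>lborel)\<^sup>2 \<partial>lborel) \<le>
      (\<integral>\<^sup>+x. c * (\<integral>\<^sup>+y. ennreal (k x y) * (\<phi> y)\<^sup>2 \<partial>lborel) \<partial>lborel)"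
    by (intro nn_integral_mono point)
  also have "\<dots> = c * (\<integral>\<^sup>+x. \<integral>\<^sup>+y. ennreal (k x y) * (\<phi> y)\<^sup>2 \<partial>lborel \<partial>lborel)"
    by (intro nn_integral_cmult) measurable
  also have "(\<integral>\<^sup>+x. \<integral>\<^sup>+y. ennreal (k x y) * (\<phi> y)\<^sup>2 \<partial>lborel \<partial>lborel) =
      (\<integral>\<^sup>+y. \<integral>\<^sup>+x. ennreal (k x y) * (\<phi> y)\<^sup>2 \<partial>lborel \<partial>lborel)"
    by (rule lborel_pair.Fubini'[symmetric]) measurable
  also have "\<dots> = (\<integral>\<^sup>+y. (\<integral>\<^sup>+x. ennreal (k x y) \<partial>lborel) * (\<phi> y)\<^sup>2 \<partial>lborel)"
    by (intro nn_integral_cong nn_integral_multc) measurable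
  also have "\<dots> \<le> (\<integral>\<^sup>+y. c * (\<phi> y)\<^sup>2 \<partial>lborel)"
    by (intro nn_integral_mono mult_right_mono cols) simp
  also have "\<dots> = c * (\<integral>\<^sup>+y. (\<phi> y)\<^sup>2 \<partial>lborel)"
    by (intro nn_integral_cmult) measurable
  finally show ?thesis by (simp add: mult_left_mono)
qed

text \<open>The causal exponential serves both as discount factor and as resolvent kernel; its cut
  at 0 lets all integrals run over the whole line.\<close>

definition expk :: "real \<Rightarrow> real \<Rightarrow> real" where
  "expk \<kappa> t = (if 0 \<le> t then exp (- \<kappa> * t) else 0)"

lemma expk_measurable [measurable]: "expk \<kappa> \<in> borel_measurable borel"
  unfolding expk_def by measurable

lemma expk_nonneg [simp]: "0 \<le> expk \<kappa> t"
  by (simp add: expk_def)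

lemma expk_square: "(expk \<kappa> t)\<^sup>2 = expk (2 * \<kappa>) t"
  by (simp add: expk_def power2_eq_square flip: exp_add)

lemma nn_integral_expk:
  assumes "0 < \<kappa>" shows "(\<integral>\<^sup>+t. ennreal (expk \<kappa> t) \<partial>lborel) = ennreal (1 / \<kappa>)"
proof -
  have "(\<integral>\<^sup>+t. ennreal (exp (- \<kappa> * t)) * indicator {0 ..} t \<partial>lborel) = ennreal (0 - (- exp (- \<kappa> * 0) / \<kappa>))"
  proof (rule nn_integral_FTC_atLeast)
    show "((\<lambda>t. - exp (- \<kappa> * t) / \<kappa>) has_real_derivative exp (- \<kappa> * t)) (at t)" for t
      using assms by (auto intro!: derivative_eq_intros)
    have "filterlim (\<lambda>t. - \<kappa> * t) at_bot at_top"
      using filterlim_tendsto_neg_mult_at_bot[OF tendsto_const[of "- \<kappa>"] _ filterlim_ident] assms by simp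
    then have "((\<lambda>t. exp (- \<kappa> * t)) \<longlongrightarrow> 0) at_top"
      by (rule filterlim_compose[OF exp_at_bot])
    from tendsto_divide[OF tendsto_minus[OF this] tendsto_const[of \<kappa>]]
    show "((\<lambda>t. - exp (- \<kappa> * t) / \<kappa>) \<longlongrightarrow> 0) at_top" using assms by simp
  qed auto
  moreover have "(\<integral>\<^sup>+t. ennreal (exp (- \<kappa> * t)) * indicator {0 ..} t \<partial>lborel) = (\<integral>\<^sup>+t. ennreal (expk \<kappa> t) \<partial>lborel)"
    by (intro nn_integral_cong) (simp add: expk_def indicator_def)
  ultimately show ?thesis by simp
qed

lemma nn_integral_expk_shift:
  assumes "0 < \<kappa>"
  shows "(\<integral>\<^sup>+r. ennreal (expk \<kappa> (r - s)) \<partial>lborel) = ennreal (1 / \<kappa>)"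
    and "(\<integral>\<^sup>+r. ennreal (expk \<kappa> (s - r)) \<partial>lborel) = ennreal (1 / \<kappa>)"
proof -
  show "(\<integral>\<^sup>+r. ennreal (expk \<kappa> (r - s)) \<partial>lborel) = ennreal (1 / \<kappa>)"
    using nn_integral_real_affine[of "\<lambda>t. ennreal (expk \<kappa> t)" 1 "- s"] nn_integral_expk[OF assms]
    by simp
  show "(\<integral>\<^sup>+r. ennreal (expk \<kappa> (s - r)) \<partial>lborel) = ennreal (1 / \<kappa>)"
    using nn_integral_real_affine[of "\<lambda>t. ennreal (expk \<kappa> t)" "-1" s] nn_integral_expk[OF assms]
    by simp
qed

lemma integrable_expk: "0 < \<kappa> \<Longrightarrow> integrable lborel (expk \<kappa>)"
  by (intro integrableI_nonneg) (auto simp: nn_integral_expk)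

lemma integral_expk: "0 < \<kappa> \<Longrightarrow> (LBINT t. expk \<kappa> t) = 1 / \<kappa>"
  by (intro integral_eq_nn_integral[THEN trans]) (auto simp: nn_integral_expk)

text \<open>Rows and columns of the kernel both integrate to \<open>1 / \<kappa>\<close>. The first
  form, looking forward in age, serves the resolvent of the adjoint; the second, looking back in
  time, serves the mild solution.\<close>

lemma exp_convolution_square:
  fixes \<phi> :: "real \<Rightarrow> ennreal"
  assumes "0 < \<kappa>" and [measurable]: "\<phi> \<in> borel_measurable lborel"
  shows "(\<integral>\<^sup>+x. (\<integral>\<^sup>+y. ennreal (expk \<kappa> (y - x)) * \<phi> y \<partial>lborel)\<^sup>2 \<partial>lborel)
      \<le> ennreal (1 / \<kappa>) * (ennreal (1 / \<kappa>) * (\<integral>\<^sup>+y. (\<phi> y)\<^sup>2 \<partial>lborel))" (is ?A)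
    and "(\<integral>\<^sup>+x. (\<integral>\<^sup>+y. ennreal (expk \<kappa> (x - y)) * \<phi> y \<partial>lborel)\<^sup>2 \<partial>lborel)
      \<le> ennreal (1 / \<kappa>) * (ennreal (1 / \<kappa>) * (\<integral>\<^sup>+y. (\<phi> y)\<^sup>2 \<partial>lborel))" (is ?B)
proof -
  show ?A using assms by (intro schur_test) (auto simp: nn_integral_expk_shift split_beta)
  show ?B using assms by (intro schur_test) (auto simp: nn_integral_expk_shift split_beta)
qed

lemma square_integrable_expk:
  assumes "0 < \<kappa>" shows "square_integrable (\<lambda>r. expk \<kappa> (r - s))"
  using assms by (intro square_integrableI_nn) (auto simp: expk_square nn_integral_expk_shift)

lemma norm_expk:
  assumes "0 < \<kappa>" shows "(norm (abs_L2 (\<lambda>r. expk \<kappa> (r - s))))\<^sup>2 = 1 / (2 * \<kappa>)"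
proof -
  have "ennreal ((norm (abs_L2 (\<lambda>r. expk \<kappa> (r - s))))\<^sup>2) = (\<integral>\<^sup>+r. ennreal ((expk \<kappa> (r - s))\<^sup>2) \<partial>lborel)"
    unfolding norm_L2_nn_integral
    by (intro nn_integral_cong_AE) (use rep_abs_L2[OF square_integrable_expk[OF assms], of s] in auto)
  also have "\<dots> = ennreal (1 / (2 * \<kappa>))"
    using assms by (simp add: expk_square nn_integral_expk_shift)
  finally show ?thesis using assms by simp
qed

text \<open>The kernel sees \<open>g\<close> only to the right of \<open>s\<close>. Keeping this
  cut-off explicit is what later gives decay as \<open>s\<close> approaches
  \<open>sbar\<close>.\<close>

lemma LBINT_expk_eq_inner:
  assumes "0 < \<kappa>"
  shows "(LBINT r. expk \<kappa> (r - s) * rep_L2 g r) =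
    inner (abs_L2 (\<lambda>r. expk \<kappa> (r - s))) (mult_L2 (indicator {s..}) g)"
proof -
  note eb = ess_bounded_indicator[of "{s..}", simplified]
  show ?thesis
    unfolding inner_abs_L2[OF square_integrable_expk[OF assms]]
    by (intro integral_cong_AE, measurable, use rep_mult_L2[OF eb, of g] in eventually_elim)
      (simp add: expk_def indicator_def)
qed

lemma integrable_expk_rep:
  "0 < \<kappa> \<Longrightarrow> integrable lborel (\<lambda>r. expk \<kappa> (r - s) * rep_L2 g r)"
  by (intro square_integrable_mult square_integrable_expk square_integrable_rep)

section \<open>The resolvent of the adjoint\<close>

context age_interval begin

text \<open>\<open>F\<close> is the solution of \<open>\<kappa> v - v' = g\<close> that vanishes at
  the right end: the values of \<open>g\<close> beyond \<open>s\<close> are discounted back to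
  \<open>s\<close> at rate \<open>\<kappa>\<close>.\<close>

context
  fixes \<kappa> :: real and g :: L2 and F :: "real \<Rightarrow> real"
  assumes \<kappa>: "0 < \<kappa>" and g: "g \<in> H"
  defines "F \<equiv> \<lambda>s. LBINT r. expk \<kappa> (r - s) * rep_L2 g r"
begin

lemma resolvent_measurable [measurable]: "F \<in> borel_measurable borel"
  unfolding F_def by measurable

lemma resolvent_square_integrable: "square_integrable F"
proof (rule square_integrableI_nn)
  have "(\<integral>\<^sup>+s. ennreal ((F s)\<^sup>2) \<partial>lborel) \<le>
      (\<integral>\<^sup>+s. (\<integral>\<^sup>+r. ennreal (expk \<kappa> (r - s)) * ennreal \<bar>rep_L2 g r\<bar> \<partial>lborel)\<^sup>2 \<partial>lborel)"
  proof (rule nn_integral_mono)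
    fix s
    have "ennreal \<bar>F s\<bar> \<le> (\<integral>\<^sup>+r. ennreal (norm (expk \<kappa> (r - s) * rep_L2 g r)) \<partial>lborel)"
      using integral_norm_bound_ennreal[OF integrable_expk_rep[OF \<kappa>, of s g]] by (simp add: F_def)
    also have "\<dots> = (\<integral>\<^sup>+r. ennreal (expk \<kappa> (r - s)) * ennreal \<bar>rep_L2 g r\<bar> \<partial>lborel)"
      by (simp add: abs_mult ennreal_mult)
    finally have "(ennreal \<bar>F s\<bar>)\<^sup>2 \<le> (\<integral>\<^sup>+r. ennreal (expk \<kappa> (r - s)) * ennreal \<bar>rep_L2 g r\<bar> \<partial>lborel)\<^sup>2"
      by (intro power_mono) auto
    then show "ennreal ((F s)\<^sup>2) \<le> (\<integral>\<^sup>+r. ennreal (expk \<kappa> (r - s)) * ennreal \<bar>rep_L2 g r\<bar> \<partial>lborel)\<^sup>2"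
      by (simp add: ennreal_power)
  qed
  also have "\<dots> \<le> ennreal (1 / \<kappa>) * (ennreal (1 / \<kappa>) * (\<integral>\<^sup>+r. (ennreal \<bar>rep_L2 g r\<bar>)\<^sup>2 \<partial>lborel))"
    by (intro exp_convolution_square(1) \<kappa>) simp
  also have "(\<integral>\<^sup>+r. (ennreal \<bar>rep_L2 g r\<bar>)\<^sup>2 \<partial>lborel) = ennreal ((norm g)\<^sup>2)"
    by (simp add: norm_L2_nn_integral ennreal_power)
  also have "ennreal (1 / \<kappa>) * (ennreal (1 / \<kappa>) * ennreal ((norm g)\<^sup>2)) < \<infinity>"
    by (simp add: ennreal_mult_less_top)
  finally show "(\<integral>\<^sup>+s. ennreal ((F s)\<^sup>2) \<partial>lborel) < \<infinity>" .
qed simp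

text \<open>Cauchy-Schwarz against the kernel, whose squared norm is
  \<open>1 / (2 * \<kappa>)\<close>. The tails of \<open>g\<close> shrink to zero, so this yields
  the boundary condition of \<open>V\<close>.\<close>

lemma resolvent_bound: "(F s)\<^sup>2 \<le> (norm (mult_L2 (indicator {s..}) g))\<^sup>2 / (2 * \<kappa>)"
proof -
  have "(F s)\<^sup>2 \<le> (norm (abs_L2 (\<lambda>r. expk \<kappa> (r - s))))\<^sup>2 * (norm (mult_L2 (indicator {s..}) g))\<^sup>2"
    unfolding F_def LBINT_expk_eq_inner[OF \<kappa>]
    using Cauchy_Schwarz_ineq by (simp add: power2_norm_eq_inner)
  then show ?thesis by (simp add: norm_expk[OF \<kappa>])
qed

lemma tail_antimono:
  assumes "s \<le> t"
  shows "norm (mult_L2 (indicator {t..}) g) \<le> norm (mult_L2 (indicator {s..}) g)"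
proof -
  note eb = ess_bounded_indicator[of "{_..}", simplified]
  have "mult_L2 (indicator {t..}) g = mult_L2 (indicator {t..}) (mult_L2 (indicator {s..}) g)"
    by (intro L2_eqI, use rep_mult_L2[OF eb, of t g] rep_mult_L2[OF eb, of s g]
        rep_mult_L2[OF eb, of t "mult_L2 (indicator {s..}) g"] in eventually_elim)
      (use assms in \<open>auto simp: indicator_def\<close>)
  then show ?thesis using norm_mult_L2_le[OF eb, of t "mult_L2 (indicator {s..}) g"] by simp
qed

lemma tail_tendsto_zero: "(\<lambda>n. (norm (mult_L2 (indicator {endseq n..}) g))\<^sup>2) \<longlonglongrightarrow> 0"
proof (rule tendsto_sandwich[OF _ _ tendsto_const])
  have z: "AE s in lborel. s \<notin> einterval 0 sbar \<longrightarrow> (rep_L2 g s)\<^sup>2 = 0"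
    using g unfolding H_space_def by auto
  have "(\<lambda>n. (norm g)\<^sup>2 - (LBINT r:{0..endseq n}. (rep_L2 g r)\<^sup>2)) \<longlonglongrightarrow> (norm g)\<^sup>2 - (LBINT r. (rep_L2 g r)\<^sup>2)"
    by (intro tendsto_intros set_integral_endseq z) simp
  then show "(\<lambda>n. (norm g)\<^sup>2 - (LBINT r:{0..endseq n}. (rep_L2 g r)\<^sup>2)) \<longlonglongrightarrow> 0"
    by (simp add: norm_L2_integral)
  note eb = ess_bounded_indicator[of "{_..}", simplified]
  have "(norm (mult_L2 (indicator {endseq n..}) g))\<^sup>2 \<le> (norm g)\<^sup>2 - (LBINT r:{0..endseq n}. (rep_L2 g r)\<^sup>2)" for n
  proof -
    have i: "integrable lborel (\<lambda>r. indicator A r * (rep_L2 g r)\<^sup>2)" if "A \<in> sets lborel" for A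
      using integrable_mult_indicator[OF that integrable_rep_square] by simp
    have "(norm (mult_L2 (indicator {endseq n..}) g))\<^sup>2 = (LBINT r. indicator {endseq n..} r * (rep_L2 g r)\<^sup>2)"
      unfolding norm_L2_integral
      by (intro integral_cong_AE, measurable, use rep_mult_L2[OF eb, of "endseq n" g] in eventually_elim)
        (simp add: indicator_def)
    also have "\<dots> \<le> (LBINT r. (rep_L2 g r)\<^sup>2 - indicator {0..endseq n} r * (rep_L2 g r)\<^sup>2)"
    proof (intro integral_mono_AE Bochner_Integration.integrable_diff i integrable_rep_square)
      show "AE r in lborel. indicator {endseq n..} r * (rep_L2 g r)\<^sup>2 \<le> (rep_L2 g r)\<^sup>2 - indicator {0..endseq n} r * (rep_L2 g r)\<^sup>2"
        using AE_lborel_singleton[of "endseq n"] by eventually_elim (auto simp: indicator_def)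
    qed auto
    also have "\<dots> = (norm g)\<^sup>2 - (LBINT r:{0..endseq n}. (rep_L2 g r)\<^sup>2)"
      by (simp add: Bochner_Integration.integral_diff i norm_L2_integral set_lebesgue_integral_def)
    finally show ?thesis .
  qed
  then show "\<forall>\<^sub>F n in sequentially. (norm (mult_L2 (indicator {endseq n..}) g))\<^sup>2 \<le>
      (norm g)\<^sup>2 - (LBINT r:{0..endseq n}. (rep_L2 g r)\<^sup>2)"
    by (intro always_eventually allI)
qed auto

lemma resolvent_tendsto_zero: "(F \<longlongrightarrow> 0) (right_end sbar)"
proof (rule tendstoI)
  fix e :: real assume "0 < e"
  then have "\<forall>\<^sub>F n in sequentially. (norm (mult_L2 (indicator {endseq n..}) g))\<^sup>2 < 2 * \<kappa> * e\<^sup>2"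
    using \<kappa> by (intro order_tendstoD(2)[OF tail_tendsto_zero]) simp
  then obtain n where n: "(norm (mult_L2 (indicator {endseq n..}) g))\<^sup>2 < 2 * \<kappa> * e\<^sup>2"
    using eventually_happens'[OF sequentially_bot] by blast
  have "\<forall>\<^sub>F x in at_left sbar. ereal (endseq n) < x"
    using endseq(3)[of n] by (auto simp: eventually_at_left[OF sbar_pos] intro: exI[of _ "ereal (endseq n)"])
  then have "\<forall>\<^sub>F s in right_end sbar. ereal (endseq n) < ereal s"
    unfolding right_end_def by (rule eventually_filtercomapI)
  then show "\<forall>\<^sub>F s in right_end sbar. dist (F s) 0 < e"
  proof eventually_elim
    case (elim s)
    have "(F s)\<^sup>2 \<le> (norm (mult_L2 (indicator {s..}) g))\<^sup>2 / (2 * \<kappa>)" by (rule resolvent_bound)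
    also have "\<dots> \<le> (norm (mult_L2 (indicator {endseq n..}) g))\<^sup>2 / (2 * \<kappa>)"
      using elim \<kappa> by (intro divide_right_mono power_mono tail_antimono) auto
    also have "\<dots> < e\<^sup>2" using n \<kappa> by (simp add: field_simps)
    finally show ?case using \<open>0 < e\<close> power2_less_imp_less[of "\<bar>F s\<bar>" e] by simp
  qed
qed

text \<open>\<open>F\<close> is written as \<open>(1 + A x) * (F 0 + B x)\<close> with two
  primitives, the first factor being \<open>exp (\<kappa> * x)\<close>. The product rule in
  integrated form then gives the equation; this matters since \<open>g\<close> is only square
  integrable and \<open>F\<close> need not be differentiable everywhere.\<close>

lemma resolvent_ode:
  assumes s: "0 \<le> s"
  shows "set_integrable lborel {0..s} (\<lambda>r. \<kappa> * F r - rep_L2 g r)"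
    and "F s = F 0 + (LBINT r:{0..s}. \<kappa> * F r - rep_L2 g r)"
proof -
  define A where "A x = (LBINT r:{0..x}. \<kappa> * exp (\<kappa> * r))" for x
  define B where "B x = (LBINT r:{0..x}. - exp (- \<kappa> * r) * rep_L2 g r)" for x
  have inta: "set_integrable lborel {0..x} (\<lambda>r. \<kappa> * exp (\<kappa> * r))" for x
    unfolding set_integrable_def
    by (intro borel_integrable_compact) (auto intro!: continuous_intros)
  have A: "A x = exp (\<kappa> * x) - 1" if "0 \<le> x" for x
  proof -
    have "A x = exp (\<kappa> * x) - exp (\<kappa> * 0)"
      unfolding A_def set_lebesgue_integral_def
    proof (rule integral_FTC_Icc[OF that])
      show "((\<lambda>r. exp (\<kappa> * r)) has_vector_derivative \<kappa> * exp (\<kappa> * r)) (at r within {0..x})" for r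
        by (auto intro!: derivative_eq_intros simp flip: has_real_derivative_iff_has_vector_derivative)
    qed (auto intro!: continuous_intros)
    then show ?thesis by simp
  qed
  have intb: "set_integrable lborel {0..x} (\<lambda>r. - exp (- \<kappa> * r) * rep_L2 g r)" for x
  proof -
    have "integrable lborel (\<lambda>r. indicator {0..x} r *\<^sub>R (expk \<kappa> (r - 0) * rep_L2 g r))"
      by (intro integrable_mult_indicator integrable_expk_rep \<kappa>) simp
    from Bochner_Integration.integrable_minus[OF this] show ?thesis
      unfolding set_integrable_def
      by (rule Bochner_Integration.integrable_cong[THEN iffD1, rotated -1]) (auto simp: expk_def indicator_def)
  qed
  have F: "F x = (1 + A x) * (F 0 + B x)" if x: "0 \<le> x" for x
  proof -
    have "F x = (LBINT r. exp (\<kappa> * x) * (expk \<kappa> (r - 0) * rep_L2 g r +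
        indicator {0..x} r *\<^sub>R (- exp (- \<kappa> * r) * rep_L2 g r)))"
      unfolding F_def
    proof (rule integral_cong_AE)
      show "AE r in lborel. expk \<kappa> (r - x) * rep_L2 g r = exp (\<kappa> * x) * (expk \<kappa> (r - 0) * rep_L2 g r +
          indicator {0..x} r *\<^sub>R (- exp (- \<kappa> * r) * rep_L2 g r))"
        using AE_lborel_singleton[of x]
      proof eventually_elim
        case (elim r)
        have "exp (- \<kappa> * (r - x)) = exp (\<kappa> * x) * exp (- \<kappa> * r)"
          by (simp add: algebra_simps flip: exp_add)
        then show ?case using elim x by (auto simp: expk_def indicator_def)
      qed
    qed measurable
    also have "\<dots> = exp (\<kappa> * x) * (F 0 + B x)"
      unfolding F_def B_def set_lebesgue_integral_def
      using integrable_expk_rep[OF \<kappa>, of 0 g] intb[of x]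
      by (simp add: set_integrable_def)
    finally show ?thesis by (simp add: A[OF x])
  qed
  have prod: "A s * B s = (LBINT x:{0..s}. (\<kappa> * exp (\<kappa> * x)) * B x + A x * (- exp (- \<kappa> * x) * rep_L2 g x))"
    and prodi: "set_integrable lborel {0..s} (\<lambda>x. (\<kappa> * exp (\<kappa> * x)) * B x + A x * (- exp (- \<kappa> * x) * rep_L2 g x))"
    unfolding A_def B_def by (fact product_of_primitives[OF inta intb])+
  define I1 where "I1 x = F 0 * (\<kappa> * exp (\<kappa> * x))" for x
  define I2 where "I2 x = - exp (- \<kappa> * x) * rep_L2 g x" for x
  define I3 where "I3 x = (\<kappa> * exp (\<kappa> * x)) * B x + A x * (- exp (- \<kappa> * x) * rep_L2 g x)" for x
  have i: "set_integrable lborel {0..s} I1" "set_integrable lborel {0..s} I2" "set_integrable lborel {0..s} I3"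
    unfolding I1_def I2_def I3_def using inta intb prodi by auto
  have sum: "\<kappa> * F x - rep_L2 g x = I1 x + (I2 x + I3 x)" if x: "x \<in> {0..s}" for x
  proof -
    have x0: "0 \<le> x" using x by simp
    have "exp (\<kappa> * x) * exp (- \<kappa> * x) = 1" by (simp flip: exp_add)
    then have "exp (\<kappa> * x) * (exp (- \<kappa> * x) * rep_L2 g x) = rep_L2 g x" by (simp add: mult.assoc[symmetric])
    then show ?thesis unfolding I1_def I2_def I3_def F[OF x0] A[OF x0] by (simp add: algebra_simps)
  qed
  have "set_integrable lborel {0..s} (\<lambda>x. I1 x + (I2 x + I3 x))"
    by (intro set_integral_add i)
  then show "set_integrable lborel {0..s} (\<lambda>r. \<kappa> * F r - rep_L2 g r)"
    by (rule set_integrable_cong[THEN iffD1, rotated -1]) (auto simp: sum)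
  have "(LBINT r:{0..s}. \<kappa> * F r - rep_L2 g r) = (LBINT x:{0..s}. I1 x + (I2 x + I3 x))"
    by (intro set_lebesgue_integral_cong) (auto simp: sum)
  also have "\<dots> = (LBINT x:{0..s}. I1 x) + ((LBINT x:{0..s}. I2 x) + (LBINT x:{0..s}. I3 x))"
    by (simp only: set_integral_add i)
  also have "\<dots> = F 0 * A s + (B s + A s * B s)"
    unfolding prod by (simp add: I1_def I2_def I3_def A_def B_def)
  finally show "F s = F 0 + (LBINT r:{0..s}. \<kappa> * F r - rep_L2 g r)"
    unfolding F[OF s] by (simp add: algebra_simps)
qed

text \<open>The solution is \<open>F\<close> restricted to the interval. A nonnegative kernel
  preserves the sign, of the function as well as of its trace at 0; both signs enter
  \<open>aa_x1_nonneg\<close> through the two components of \<open>B_adj\<close>.\<close>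

lemma resolvent_exists:
  "\<exists>v\<in>V. \<kappa> *\<^sub>R v - Dw v = g \<and>
    ((AE s in lborel. s \<in> einterval 0 sbar \<longrightarrow> 0 \<le> rep_L2 g s) \<longrightarrow>
      (AE s in lborel. s \<in> einterval 0 sbar \<longrightarrow> 0 \<le> rep_L2 v s) \<and> 0 \<le> ev v 0)"
proof -
  note eb = ess_bounded_indicator[of "einterval 0 sbar", simplified]
  define v where "v = mult_L2 (indicator (einterval 0 sbar)) (abs_L2 F)"
  have rep: "AE s in lborel. rep_L2 v s = indicator (einterval 0 sbar) s * F s"
    unfolding v_def using rep_mult_L2[OF eb, of "abs_L2 F"] rep_abs_L2[OF resolvent_square_integrable]
    by eventually_elim simp
  have vH: "v \<in> H" unfolding H_space_def mem_Collect_eq using rep by eventually_elim (simp add: indicator_def)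
  have "W v (\<kappa> *\<^sub>R v - g) F"
    unfolding H1_witness_iff
  proof (intro conjI allI impI)
    show "\<kappa> *\<^sub>R v - g \<in> H" by (intro subspace_diff subspace_scale subspace_H_space vH g)
    show "AE s in lborel. s \<in> einterval 0 sbar \<longrightarrow> rep_L2 v s = F s"
      using rep by eventually_elim simp
    fix s assume s: "0 \<le> s" "ereal s < sbar"
    have "(LBINT r:{0..s}. rep_L2 (\<kappa> *\<^sub>R v - g) r) = (LBINT r:{0..s}. \<kappa> * F r - rep_L2 g r)"
    proof (rule set_lebesgue_integral_cong_AE)
      have "AE r in lborel. r \<noteq> (0::real)" by (rule AE_lborel_singleton)
      then show "AE r\<in>{0..s} in lborel. rep_L2 (\<kappa> *\<^sub>R v - g) r = \<kappa> * F r - rep_L2 g r"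
        using rep rep_diff[of "\<kappa> *\<^sub>R v" g] rep_scaleR[of \<kappa> v]
      proof eventually_elim
        case (elim r)
        show ?case
        proof
          assume "r \<in> {0..s}"
          then have "r \<in> einterval 0 sbar"
            using elim(1) s le_less_trans[of "ereal r" "ereal s" sbar] by (auto simp: einterval_iff zero_ereal_def)
          then show "rep_L2 (\<kappa> *\<^sub>R v - g) r = \<kappa> * F r - rep_L2 g r" using elim by simp
        qed
      qed
    qed measurable
    then show "F s = F 0 + (LBINT r:{0..s}. rep_L2 (\<kappa> *\<^sub>R v - g) r)"
      using resolvent_ode(2)[OF s(1)] by simp
  qed (fact vH)
  note w = this
  have "v \<in> V" by (rule V_memI[OF w resolvent_tendsto_zero])
  moreover have "\<kappa> *\<^sub>R v - Dw v = g" by (simp add: witness_H1(2)[OF w])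
  moreover have "(AE s in lborel. s \<in> einterval 0 sbar \<longrightarrow> 0 \<le> rep_L2 v s) \<and> 0 \<le> ev v 0"
    if pos: "AE s in lborel. s \<in> einterval 0 sbar \<longrightarrow> 0 \<le> rep_L2 g s"
  proof -
    have "AE s in lborel. s \<notin> einterval 0 sbar \<longrightarrow> rep_L2 g s = 0" using g by (simp add: H_space_def)
    with pos have "AE s in lborel. 0 \<le> rep_L2 g s" by eventually_elim force
    then have F: "0 \<le> F s" for s
      unfolding F_def by (intro integral_nonneg_AE) (auto elim: eventually_mono)
    have "AE s in lborel. s \<in> einterval 0 sbar \<longrightarrow> 0 \<le> rep_L2 v s"
      using rep by eventually_elim (simp add: F)
    moreover have "ev v 0 = F 0" using witness_H1(3)[OF w] zero_dom by simp
    ultimately show ?thesis using F by simp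
  qed
  ultimately show ?thesis by blast
qed

end

lemma resolvent_coercive:
  assumes v: "v \<in> V"
  shows "\<kappa> * (norm v)\<^sup>2 \<le> inner (\<kappa> *\<^sub>R v - Dw v) v"
  using V_inner_deriv[OF v] by (simp add: inner_diff_left inner_diff_right power2_norm_eq_inner inner_commute)

lemma resolvent_norm_le:
  assumes v: "v \<in> V" and \<kappa>: "0 < \<kappa>"
  shows "norm v \<le> norm (\<kappa> *\<^sub>R v - Dw v) / \<kappa>"
proof (cases "v = 0")
  case False
  have "(\<kappa> * norm v) * norm v \<le> norm (\<kappa> *\<^sub>R v - Dw v) * norm v"
    using resolvent_coercive[OF v, of \<kappa>] norm_cauchy_schwarz[of "\<kappa> *\<^sub>R v - Dw v" v]
    by (simp add: power2_eq_square)
  then have "\<kappa> * norm v \<le> norm (\<kappa> *\<^sub>R v - Dw v)" using False by simp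
  then show ?thesis using \<kappa> by (simp add: field_simps)
qed (use \<kappa> in simp)

text \<open>If \<open>h\<close> annihilates \<open>V\<close>, the solution \<open>v\<close> of
  \<open>v - Dw v = h\<close> is itself orthogonal to \<open>h\<close>, and coercivity forces
  \<open>v = 0\<close>, hence \<open>h = 0\<close>.\<close>

lemma V_dense:
  assumes g: "g \<in> H" and e: "0 < e"
  shows "\<exists>v\<in>V. norm (g - v) < e"
proof (rule dense_subspace_if_trivial_annihilator[OF subspace_V V_subset_H subspace_H_space closed_H_space _ g e])
  fix h assume h: "h \<in> H" and orth: "\<And>v. v \<in> V \<Longrightarrow> inner h v = 0"
  obtain v where v: "v \<in> V" "1 *\<^sub>R v - Dw v = h" using resolvent_exists[of 1, OF _ h] by auto
  have "(norm v)\<^sup>2 \<le> 0" using resolvent_coercive[OF v(1), of 1] orth[OF v(1)] v(2) by simp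
  then have "v = 0" by simp
  moreover have "Dw 0 = 0" using H1_scale(2)[OF V_H1[OF v(1)], of 0] by simp
  ultimately show "h = 0" using v(2) by simp
qed

end

section \<open>Strongly continuous semigroups\<close>

text \<open>Gliding hump: perturbing by \<open>\<plusminus>z\<close> makes \<open>norm (f x)\<close> at least \<open>norm (f z)\<close>, and perturbations
  of size \<open>3 ^ - k\<close> leave this undisturbed afterwards.\<close>

lemma uniform_boundedness:
  fixes f :: "nat \<Rightarrow> 'a::banach \<Rightarrow> 'b::real_normed_vector"
  assumes lin: "\<And>n. bounded_linear (f n)"
    and pointwise: "\<And>x. \<exists>B. \<forall>n. norm (f n x) \<le> B"
  shows "\<exists>K. \<forall>n x. norm (f n x) \<le> K * norm x"
proof (rule ccontr)
  assume unb: "\<nexists>K. \<forall>n x. norm (f n x) \<le> K * norm x"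
  have "\<exists>n. onorm (f n) > K" for K
  proof (rule ccontr)
    assume "\<nexists>n. onorm (f n) > K"
    then have "norm (f n x) \<le> K * norm x" for n x
      using onorm[OF lin, of n x] by (meson linorder_not_le mult_right_mono norm_ge_zero order_trans)
    then show False using unb by blast
  qed
  then have "\<exists>n. onorm (f n) > 4 ^ k" for k :: nat by blast
  then obtain n where n: "\<And>k. onorm (f (n k)) > 4 ^ k" by metis
  define F where "F k = f (n k)" for k
  define N where "N k = onorm (F k)" for k
  have N: "N k > 4 ^ k" for k using n by (simp add: N_def F_def)
  have Npos: "N k > 0" for k using N[of k] by (meson less_trans zero_less_numeral zero_less_power)
  have linF: "bounded_linear (F k)" for k by (simp add: F_def lin)
  have "\<exists>z. norm z = (1/3) ^ k \<and> norm (F k z) > 3/4 * N k * (1/3) ^ k" for k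
  proof -
    have "\<exists>y. norm (F k y) > 3/4 * N k * norm y"
    proof (rule ccontr)
      assume "\<nexists>y. norm (F k y) > 3/4 * N k * norm y"
      then have "onorm (F k) \<le> 3/4 * N k"
        using Npos[of k] by (intro onorm_bound) (auto simp: not_less)
      then show False using Npos[of k] by (simp add: N_def)
    qed
    then obtain y where y: "norm (F k y) > 3/4 * N k * norm y" by blast
    interpret bounded_linear "F k" by (rule linF)
    have "y \<noteq> 0" using y by (auto simp: zero)
    define c where "c = (1/3) ^ k / norm y"
    have c: "0 < c" "c * norm y = (1/3) ^ k" using \<open>y \<noteq> 0\<close> by (auto simp: c_def)
    have "norm (F k (c *\<^sub>R y)) = c * norm (F k y)" using c(1) by (simp add: scaleR)
    moreover have "c * norm (F k y) > c * (3/4 * N k * norm y)"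
      using y c(1) by (intro mult_strict_left_mono) auto
    moreover have "c * (3/4 * N k * norm y) = 3/4 * N k * (1/3) ^ k"
      unfolding c(2)[symmetric] by simp
    moreover have "norm (c *\<^sub>R y) = (1/3) ^ k" using c by simp
    ultimately show ?thesis by (intro exI[of _ "c *\<^sub>R y"] conjI) linarith+
  qed
  then obtain z where z: "\<And>k. norm (z k) = (1/3) ^ k" "\<And>k. norm (F k (z k)) > 3/4 * N k * (1/3) ^ k" by metis
  define x where "x = rec_nat 0 (\<lambda>k y. if norm (F k (y + z k)) \<ge> norm (F k (z k)) then y + z k else y - z k)"
  have x_Suc: "x (Suc k) = (if norm (F k (x k + z k)) \<ge> norm (F k (z k)) then x k + z k else x k - z k)" for k
    by (simp add: x_def)
  have big: "norm (F k (x (Suc k))) \<ge> norm (F k (z k))" for k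
  proof -
    interpret bounded_linear "F k" by (rule linF)
    have "2 *\<^sub>R F k (z k) = F k (x k + z k) - F k (x k - z k)"
      by (simp add: add diff scaleR_2)
    then have "2 * norm (F k (z k)) \<le> norm (F k (x k + z k)) + norm (F k (x k - z k))"
      by (metis abs_numeral norm_scaleR norm_triangle_ineq4)
    then show ?thesis by (auto simp: x_Suc)
  qed
  have step: "norm (x (Suc k) - x k) = (1/3) ^ k" for k by (simp add: x_Suc z(1))
  have tail: "norm (x (k + i) - x k) \<le> 3/2 * (1/3) ^ k * (1 - (1/3) ^ i)" for k i
  proof (induction i)
    case (Suc i)
    have "norm (x (k + Suc i) - x k) \<le> norm (x (Suc (k + i)) - x (k + i)) + norm (x (k + i) - x k)"
      using norm_triangle_ineq[of "x (Suc (k + i)) - x (k + i)" "x (k + i) - x k"] by simp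
    also have "\<dots> \<le> (1/3) ^ (k + i) + 3/2 * (1/3) ^ k * (1 - (1/3) ^ i)"
      using Suc step[of "k + i"] by simp
    also have "\<dots> = 3/2 * (1/3) ^ k * (1 - (1/3) ^ Suc i)"
      unfolding power_add power_Suc by algebra
    finally show ?case .
  qed simp
  have tail': "norm (x (k + i) - x k) \<le> 3/2 * (1/3) ^ k" for k i
  proof -
    have "3/2 * (1/3) ^ k * (1 - (1/3) ^ i) \<le> 3/2 * (1/3) ^ k * (1 :: real)"
      by (intro mult_left_mono) auto
    from order_trans[OF tail[of k i] this] show ?thesis by (simp only: mult_1_right)
  qed
  have p0: "(\<lambda>k. 3 * (1/3 :: real) ^ k) \<longlonglongrightarrow> 3 * 0"
    by (intro tendsto_intros LIMSEQ_realpow_zero) auto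
  have "Cauchy x"
    unfolding Cauchy_iff
  proof (intro allI impI)
    fix e :: real assume "0 < e"
    then obtain k where k: "3 * (1/3) ^ k < e"
      using order_tendstoD(2)[OF p0, of e] eventually_happens'[OF sequentially_bot] by auto
    have "norm (x i - x j) < e" if "k \<le> i" "k \<le> j" for i j
    proof -
      have "norm (x i - x j) \<le> norm (x i - x k) + norm (x j - x k)"
        using norm_triangle_ineq4[of "x i - x k" "x j - x k"] by simp
      then show ?thesis using tail'[of k "i - k"] tail'[of k "j - k"] that k by simp
    qed
    then show "\<exists>M. \<forall>m\<ge>M. \<forall>n\<ge>M. norm (x m - x n) < e" by blast
  qed
  then obtain l where l: "x \<longlonglongrightarrow> l" using Cauchy_convergent convergent_def by blast
  have dist: "norm (l - x (Suc k)) \<le> 1/2 * (1/3) ^ k" for k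
  proof (rule LIMSEQ_le_const2)
    show "(\<lambda>i. norm (x (Suc k + i) - x (Suc k))) \<longlonglongrightarrow> norm (l - x (Suc k))"
      using LIMSEQ_ignore_initial_segment[OF l, of "Suc k"]
      by (intro tendsto_intros) (simp add: add.commute)
    show "\<exists>M. \<forall>i\<ge>M. norm (x (Suc k + i) - x (Suc k)) \<le> 1/2 * (1/3) ^ k"
      using tail'[of "Suc k"] by (auto simp: field_simps)
  qed
  \<comment> \<open>Step \<open>k\<close> secures three quarters of \<open>N k * (1/3) ^ k\<close>,
    and all later steps together can destroy at most half of \<open>N k * (1/3) ^ k\<close>. A
    quarter survives, and \<open>N k > 4 ^ k\<close> makes it grow like
    \<open>(4/3) ^ k\<close>.\<close>
  have low: "norm (F k l) \<ge> 1/4 * (4/3) ^ k" for k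
  proof -
    interpret bounded_linear "F k" by (rule linF)
    have "norm (F k (l - x (Suc k))) \<le> N k * (1/2 * (1/3) ^ k)"
      using order_trans[OF onorm[OF linF] mult_left_mono[OF dist]] Npos[of k] by (simp add: N_def)
    moreover have "norm (F k (x (Suc k))) \<le> norm (F k l) + norm (F k (l - x (Suc k)))"
      using norm_triangle_ineq4[of "F k l" "F k (l - x (Suc k))"] by (simp add: diff)
    moreover have "norm (F k (x (Suc k))) \<ge> 3/4 * N k * (1/3) ^ k" using big[of k] z(2)[of k] by linarith
    ultimately have "norm (F k l) \<ge> 1/4 * (N k * (1/3) ^ k)" by (simp add: algebra_simps)
    moreover have "N k * (1/3) ^ k \<ge> 4 ^ k * (1/3) ^ k" using N[of k] by (intro mult_right_mono) auto
    moreover have "4 ^ k * (1/3) ^ k = (4/3 :: real) ^ k" by (simp flip: power_mult_distrib)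
    ultimately show ?thesis by linarith
  qed
  obtain B where B: "\<And>n. norm (f n l) \<le> B" using pointwise by blast
  obtain k where "4 * B < (4/3 :: real) ^ k" using real_arch_pow[of "4/3"] by auto
  then show False using low[of k] B[of "n k"] by (simp add: F_def)
qed

text \<open>The carrier is the range of a bounded projection, so \<open>S t\<close> composed with
  \<open>P\<close> is a bounded operator on the whole Banach space, to which
  \<open>uniform_boundedness\<close> applies. One theory thus covers H inside \<open>L2\<close> and
  V' as a full type.\<close>

locale projected_semigroup =
  fixes P :: "'a::banach \<Rightarrow> 'a" and X :: "'a set" and S :: "real \<Rightarrow> 'a \<Rightarrow> 'a"
  assumes P: "bounded_linear P" and P_mem: "\<And>x. P x \<in> X" and P_id: "\<And>x. x \<in> X \<Longrightarrow> P x = x"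
    and C0: "C0_semigroup_on X S"
begin

lemma X_eq: "X = {x. P x = x}"
proof (intro set_eqI iffI CollectI)
  show "x \<in> X" if "x \<in> {x. P x = x}" for x using P_mem[of x] that by simp
qed (rule P_id)

lemma subspace_X: "subspace X"
proof -
  interpret bounded_linear P by (rule P)
  show ?thesis unfolding X_eq by (rule subspaceI) (auto simp: zero add scaleR)
qed

lemma S_mem: "0 \<le> t \<Longrightarrow> x \<in> X \<Longrightarrow> S t x \<in> X"
  and S_add: "0 \<le> t \<Longrightarrow> x \<in> X \<Longrightarrow> y \<in> X \<Longrightarrow> S t (x + y) = S t x + S t y"
  and S_scale: "0 \<le> t \<Longrightarrow> x \<in> X \<Longrightarrow> S t (c *\<^sub>R x) = c *\<^sub>R S t x"
  and S_bounded: "0 \<le> t \<Longrightarrow> \<exists>K. \<forall>x\<in>X. norm (S t x) \<le> K * norm x"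
  and S_0: "x \<in> X \<Longrightarrow> S 0 x = x"
  and S_semigroup: "0 \<le> s \<Longrightarrow> 0 \<le> t \<Longrightarrow> x \<in> X \<Longrightarrow> S (s + t) x = S s (S t x)"
  and S_right: "x \<in> X \<Longrightarrow> ((\<lambda>t. S t x) \<longlongrightarrow> x) (at_right 0)"
  using C0 unfolding C0_semigroup_on_def by blast+

lemma S_diff: "0 \<le> t \<Longrightarrow> x \<in> X \<Longrightarrow> y \<in> X \<Longrightarrow> S t (x - y) = S t x - S t y"
  using S_add[of t x "- y"] S_scale[of t y "-1"] subspace_neg[OF subspace_X] by simp

lemma SP_bounded_linear:
  assumes t: "0 \<le> t" shows "bounded_linear (\<lambda>x. S t (P x))"
proof -
  interpret P: bounded_linear P by (rule P)
  obtain K where K: "\<And>x. x \<in> X \<Longrightarrow> norm (S t x) \<le> K * norm x" using S_bounded[OF t] by blast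
  obtain L where L: "\<And>x. norm (P x) \<le> norm x * L" using P.nonneg_bounded by blast
  show ?thesis
  proof (rule bounded_linear_intro)
    show "S t (P (x + y)) = S t (P x) + S t (P y)" for x y by (simp add: P.add S_add t P_mem)
    show "S t (P (c *\<^sub>R x)) = c *\<^sub>R S t (P x)" for c x by (simp add: P.scaleR S_scale t P_mem)
    show "norm (S t (P x)) \<le> norm x * (\<bar>K\<bar> * L)" for x
    proof -
      have "norm (S t (P x)) \<le> \<bar>K\<bar> * norm (P x)"
        using K[OF P_mem, of x] by (meson abs_ge_self mult_right_mono norm_ge_zero order_trans)
      also have "\<dots> \<le> \<bar>K\<bar> * (norm x * L)" by (intro mult_left_mono L) auto
      finally show ?thesis by (simp add: mult.commute mult.left_commute)
    qed
  qed
qed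

text \<open>Otherwise there are times tending to 0 along which the operator norms are unbounded; yet
  by strong continuity these operators converge pointwise, hence are pointwise bounded, against
  \<open>uniform_boundedness\<close>.\<close>

lemma local_bound: "\<exists>d>0. \<exists>M. \<forall>t\<in>{0..d}. \<forall>x\<in>X. norm (S t x) \<le> M * norm x"
proof (rule ccontr)
  assume neg: "\<not> ?thesis"
  have "\<exists>t x. 0 < t \<and> t \<le> 1 / real (Suc n) \<and> x \<in> X \<and> norm (S t x) > real (Suc n) * norm x" for n
  proof -
    have "0 < 1 / real (Suc n)" by simp
    then have "\<not> (\<forall>t\<in>{0..1 / real (Suc n)}. \<forall>x\<in>X. norm (S t x) \<le> real (Suc n) * norm x)"
      using neg by blast
    then obtain t x where tx: "t \<in> {0..1 / real (Suc n)}" "x \<in> X" "norm (S t x) > real (Suc n) * norm x"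
      unfolding ball_simps not_le by blast
    moreover have "t \<noteq> 0"
    proof
      assume "t = 0"
      then have "norm x > real (Suc n) * norm x" using tx S_0 by simp
      moreover have "real (Suc n) * norm x \<ge> 1 * norm x" by (intro mult_right_mono) auto
      ultimately show False by simp
    qed
 
    ultimately have "0 < t" "t \<le> 1 / real (Suc n)" by auto
    with tx show ?thesis by blast
  qed
  then obtain t x where t: "\<And>n. 0 < t n" "\<And>n. t n \<le> 1 / real (Suc n)"
    and x: "\<And>n. x n \<in> X" "\<And>n. norm (S (t n) (x n)) > real (Suc n) * norm (x n)" by metis
  have t0: "filterlim t (at_right 0) sequentially"
  proof -
    have "t \<longlonglongrightarrow> 0"
      by (rule tendsto_sandwich[OF _ _ tendsto_const lim_1_over_n[THEN LIMSEQ_Suc]])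
        (use t in \<open>auto intro!: always_eventually less_imp_le\<close>)
    moreover have "t n \<noteq> 0" for n using t(1)[of n] by simp
    ultimately show ?thesis using t(1) by (simp add: filterlim_at)
  qed
  have "\<exists>K. \<forall>n y. norm (S (t n) (P y)) \<le> K * norm y"
  proof (rule uniform_boundedness)
    show "bounded_linear (\<lambda>y. S (t n) (P y))" for n using t(1)[of n] by (intro SP_bounded_linear) simp
    fix y
    have "(\<lambda>n. S (t n) (P y)) \<longlonglongrightarrow> P y" by (rule filterlim_compose[OF S_right[OF P_mem] t0])
    then have "Bseq (\<lambda>n. S (t n) (P y))" by (intro convergent_imp_Bseq) (auto simp: convergent_def)
    then show "\<exists>B. \<forall>n. norm (S (t n) (P y)) \<le> B" by (auto simp: Bseq_def)
  qed
  then obtain K where K: "\<And>n y. norm (S (t n) (P y)) \<le> K * norm y" by blast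
  obtain n where "K < real n" using reals_Archimedean2 by blast
  then have n: "K < real (Suc n)" by simp
  have "norm (S (t n) (x n)) \<le> K * norm (x n)" using K[of n "x n"] x(1) P_id by simp
  also have "\<dots> \<le> real (Suc n) * norm (x n)" using n by (intro mult_right_mono) auto
  finally show False using x(2)[of n] by simp
qed

lemma compact_bound: "\<exists>M\<ge>0. \<forall>t\<in>{0..a}. \<forall>x\<in>X. norm (S t x) \<le> M * norm x"
proof -
  obtain d M where d: "d > 0" and M: "\<And>t x. t \<in> {0..d} \<Longrightarrow> x \<in> X \<Longrightarrow> norm (S t x) \<le> M * norm x"
    using local_bound by blast
  \<comment> \<open>A constant at least 1 makes its powers monotone, so the bound for several steps
    of length \<open>d\<close> also covers shorter times.\<close>
  define M' where "M' = max 1 M"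
  have M': "norm (S t x) \<le> M' * norm x" if "t \<in> {0..d}" "x \<in> X" for t x
    using M[OF that] by (rule order_trans) (auto simp: M'_def intro: mult_right_mono)
  have M'1: "1 \<le> M'" by (simp add: M'_def)
  have step: "norm (S t x) \<le> M' ^ Suc n * norm x" if "x \<in> X" "0 \<le> t" "t \<le> real (Suc n) * d" for n t x
    using that
  proof (induction n arbitrary: t)
    case 0
    then show ?case using M' by simp
  next
    case (Suc n)
    show ?case
    proof (cases "t \<le> d")
      case True
      then have "norm (S t x) \<le> M' * norm x" using Suc M' by simp
      also have "M' * norm x \<le> M' ^ Suc (Suc n) * norm x"
        using power_increasing[of 1 "Suc (Suc n)" M'] M'1 by (intro mult_right_mono) auto
      finally show ?thesis .
    next
      case False
      have "S t x = S d (S (t - d) x)" using S_semigroup[of d "t - d" x] d False Suc.prems by simp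
      then have "norm (S t x) \<le> M' * norm (S (t - d) x)"
        using M'[of d] d False Suc.prems by (simp add: S_mem)
      also have "\<dots> \<le> M' * (M' ^ Suc n * norm x)"
        using Suc.IH[of "t - d"] Suc.prems False M'1 by (intro mult_left_mono) (auto simp: algebra_simps)
      finally show ?thesis by (simp add: mult.assoc)
    qed
  qed
  obtain n where "a / d < real n" using reals_Archimedean2 by blast
  then have "a \<le> real (Suc n) * d" using d by (simp add: field_simps)
  then have "\<forall>t\<in>{0..a}. \<forall>x\<in>X. norm (S t x) \<le> M' ^ Suc n * norm x" using step by auto
  then show ?thesis using M'1 by (intro exI[of _ "M' ^ Suc n"]) auto
qed

lemma S_near_zero:
  assumes x: "x \<in> X" and e: "0 < e"
  shows "\<exists>d>0. \<forall>h. 0 \<le> h \<and> h < d \<longrightarrow> norm (S h x - x) < e"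
proof -
  have "\<forall>\<^sub>F h in at_right 0. dist (S h x) x < e" using tendstoD[OF S_right[OF x] e] .
  then obtain d where d: "d > 0" "\<And>h. 0 < h \<Longrightarrow> h < d \<Longrightarrow> dist (S h x) x < e"
    unfolding eventually_at_right_field by auto
  have "norm (S h x - x) < e" if "0 \<le> h" "h < d" for h
    using d(2)[of h] that e S_0[OF x] by (cases "h = 0") (auto simp: dist_norm)
  then show ?thesis using d(1) by blast
qed

text \<open>Continuity from the left is the nontrivial side: the increment is \<open>S s\<close>
  applied to \<open>S h x - x\<close> with \<open>s\<close> varying, so the bound uniform on compact
  time intervals is needed.\<close>

lemma orbit_continuous:
  assumes x: "x \<in> X" shows "continuous_on {0..} (\<lambda>t. S t x)"
  unfolding continuous_on_iff
proof (intro ballI allI impI)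
  fix t e :: real assume t: "t \<in> {0..}" and e: "0 < e"
  obtain M where M: "M \<ge> 0" "\<And>s y. s \<in> {0..t} \<Longrightarrow> y \<in> X \<Longrightarrow> norm (S s y) \<le> M * norm y"
    using compact_bound[of t] by blast
  obtain d where d: "d > 0" "\<And>h. 0 \<le> h \<Longrightarrow> h < d \<Longrightarrow> norm (S h x - x) < e / (M + 1)"
    using S_near_zero[OF x, of "e / (M + 1)"] e M(1) by auto
  have close: "norm (S (s + h) x - S s x) < e" if "0 \<le> s" "s \<le> t" "0 \<le> h" "h < d" for s h
  proof -
    have "S (s + h) x - S s x = S s (S h x - x)" using that x by (simp add: S_semigroup S_diff S_mem)
    then have "norm (S (s + h) x - S s x) \<le> M * norm (S h x - x)"
      using M(2)[of s "S h x - x"] that x by (simp add: S_mem subspace_diff[OF subspace_X])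
    also have "\<dots> \<le> M * (e / (M + 1))" using d(2)[of h] that M(1) by (intro mult_left_mono) auto
    also have "\<dots> < e" using M(1) e by (simp add: field_simps)
    finally show ?thesis .
  qed
  have "dist (S s x) (S t x) < e" if s: "s \<in> {0..}" "dist s t < d" for s
  proof (cases "s \<le> t")
    case True
    then have "norm (S (s + (t - s)) x - S s x) < e" using s t by (intro close) (auto simp: dist_real_def)
    then show ?thesis by (simp add: dist_norm norm_minus_commute)
  next
    case False
    then have "norm (S (t + (s - t)) x - S t x) < e" using s t by (intro close) (auto simp: dist_real_def)
    then show ?thesis by (simp add: dist_norm)
  qed
  then show "\<exists>d>0. \<forall>s\<in>{0..}. dist s t < d \<longrightarrow> dist (S s x) (S t x) < e" using d(1) by blast
qed

lemma graph_invariant: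
  assumes xy: "(x, y) \<in> generator_graph X S" and t: "0 \<le> t"
  shows "(S t x, S t y) \<in> generator_graph X S"
proof -
  have x: "x \<in> X" and y: "y \<in> X" and lim: "((\<lambda>h. (S h x - x) /\<^sub>R h) \<longlongrightarrow> y) (at_right 0)"
    using xy by (auto simp: generator_graph_def)
  interpret bounded_linear "\<lambda>x. S t (P x)" by (rule SP_bounded_linear[OF t])
  have "((\<lambda>h. S t (P ((S h x - x) /\<^sub>R h))) \<longlongrightarrow> S t (P y)) (at_right 0)" by (rule tendsto[OF lim])
  moreover have "\<forall>\<^sub>F h in at_right 0. S t (P ((S h x - x) /\<^sub>R h)) = (S h (S t x) - S t x) /\<^sub>R h"
    using eventually_at_right_less[of 0]
  proof eventually_elim
    case (elim h)
    have "S t (S h x) = S h (S t x)"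
      using S_semigroup[of t h x] S_semigroup[of h t x] elim t x by (simp add: add.commute)
    then show ?case
      using elim t x by (simp add: P_id S_mem subspace_diff[OF subspace_X] subspace_scale[OF subspace_X] S_scale S_diff)
  qed
  ultimately have "((\<lambda>h. (S h (S t x) - S t x) /\<^sub>R h) \<longlongrightarrow> S t y) (at_right 0)"
    using P_id[OF y] by (simp add: filterlim_cong[OF refl refl])
  then show ?thesis using x y t by (simp add: generator_graph_def S_mem)
qed

text \<open>The generator only provides a derivative from the right at time 0. For times
  \<open>s < t\<close> the quotient is formed at \<open>s\<close>, where \<open>main\<close> holds
  uniformly, and continuity of the orbit of \<open>y\<close> replaces \<open>S s y\<close> by
  \<open>S t y\<close>; each of the two costs half of \<open>e\<close>.\<close>

lemma orbit_derivative:
  assumes xy: "(x, y) \<in> generator_graph X S" and t: "0 \<le> t"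
  shows "((\<lambda>s. S s x) has_vector_derivative S t y) (at t within {0..})"
  unfolding has_vector_derivative_def has_derivative_within_alt
proof (intro conjI allI impI)
  have x: "x \<in> X" and y: "y \<in> X" and lim: "((\<lambda>h. (S h x - x) /\<^sub>R h) \<longlongrightarrow> y) (at_right 0)"
    using xy by (auto simp: generator_graph_def)
  show "bounded_linear (\<lambda>h. h *\<^sub>R S t y)" by (rule bounded_linear_scaleR_left)
  fix e :: real assume e: "0 < e"
  obtain M where M: "M \<ge> 0" "\<And>s y. s \<in> {0..t} \<Longrightarrow> y \<in> X \<Longrightarrow> norm (S s y) \<le> M * norm y"
    using compact_bound[of t] by blast
  define e' where "e' = e / (2 * (M + 1))"
  have e': "0 < e'" "M * e' \<le> e / 2" using e M(1) by (auto simp: e'_def field_simps)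
  have "\<forall>\<^sub>F h in at_right 0. dist ((S h x - x) /\<^sub>R h) y < e'" using tendstoD[OF lim e'(1)] .
  then obtain d1 where d1: "d1 > 0" "\<And>h. 0 < h \<Longrightarrow> h < d1 \<Longrightarrow> dist ((S h x - x) /\<^sub>R h) y < e'"
    unfolding eventually_at_right_field by auto
  obtain d2 where d2: "d2 > 0" "\<And>s. s \<in> {0..} \<Longrightarrow> dist s t < d2 \<Longrightarrow> dist (S s y) (S t y) < e / 2"
    using orbit_continuous[OF y] t e unfolding continuous_on_iff by (metis atLeast_iff half_gt_zero)
  have quot: "norm (S h x - x - h *\<^sub>R y) \<le> h * e'" if "0 < h" "h < d1" for h
  proof -
    have "S h x - x - h *\<^sub>R y = h *\<^sub>R ((S h x - x) /\<^sub>R h - y)" using that by (simp add: scaleR_diff_right)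
    then have "norm (S h x - x - h *\<^sub>R y) = h * dist ((S h x - x) /\<^sub>R h) y" using that by (simp add: dist_norm)
    also have "\<dots> \<le> h * e'" using d1(2)[OF that] that by (intro mult_left_mono) auto
    finally show ?thesis .
  qed
  have main: "norm (S (s + h) x - S s x - h *\<^sub>R S s y) \<le> h * (e / 2)"
    if "0 \<le> s" "s \<le> t" "0 < h" "h < d1" for s h
  proof -
    have mem: "S h x \<in> X" "S h x - x \<in> X" "S h x - x - h *\<^sub>R y \<in> X"
      using that x y by (auto intro!: subspace_diff[OF subspace_X] subspace_scale[OF subspace_X] S_mem)
    have "S (s + h) x - S s x - h *\<^sub>R S s y = S s (S h x - x - h *\<^sub>R y)"
      using that x y mem by (simp add: S_semigroup S_diff S_scale subspace_scale[OF subspace_X])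
    then have "norm (S (s + h) x - S s x - h *\<^sub>R S s y) \<le> M * norm (S h x - x - h *\<^sub>R y)"
      using M(2)[of s] mem that by simp
    also have "\<dots> \<le> M * (h * e')" using quot that M(1) by (intro mult_left_mono) auto
    also have "\<dots> \<le> h * (e / 2)" using e'(2) that by (metis mult.left_commute mult_left_mono less_imp_le)
    finally show ?thesis .
  qed
  show "\<exists>d>0. \<forall>s\<in>{0..}. norm (s - t) < d \<longrightarrow>
      norm (S s x - S t x - (s - t) *\<^sub>R S t y) \<le> e * norm (s - t)"
  proof (intro exI[of _ "min d1 d2"] conjI ballI impI)
    show "0 < min d1 d2" using d1 d2 by simp
    fix s :: real assume s: "s \<in> {0..}" "norm (s - t) < min d1 d2"
    consider "s = t" | "s > t" | "s < t" by linarith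
    then show "norm (S s x - S t x - (s - t) *\<^sub>R S t y) \<le> e * norm (s - t)"
    proof cases
      case 2
      then have "norm (S (t + (s - t)) x - S t x - (s - t) *\<^sub>R S t y) \<le> (s - t) * (e / 2)"
        using s t by (intro main) auto
      also have "\<dots> \<le> e * norm (s - t)" using 2 e by (simp add: field_simps)
      finally show ?thesis by simp
    next
      case 3
      have n1: "norm (S (s + (t - s)) x - S s x - (t - s) *\<^sub>R S s y) \<le> (t - s) * (e / 2)"
        using 3 s t by (intro main) auto
      have n2: "norm ((t - s) *\<^sub>R (S s y - S t y)) \<le> (t - s) * (e / 2)"
        using d2(2)[of s] 3 s by (auto simp: dist_norm intro!: mult_left_mono)
      have dec: "S s x - S t x - (s - t) *\<^sub>R S t y =
          - ((S (s + (t - s)) x - S s x - (t - s) *\<^sub>R S s y) + (t - s) *\<^sub>R (S s y - S t y))"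
        by (simp add: algebra_simps)
      have "norm (S s x - S t x - (s - t) *\<^sub>R S t y) \<le> (t - s) * (e / 2) + (t - s) * (e / 2)"
        unfolding dec norm_minus_cancel by (rule norm_triangle_mono[OF n1 n2])
      then show ?thesis using 3 by (simp add: field_simps)
    qed simp
  qed
qed

text \<open>The averages of an orbit over \<open>[0, h]\<close> lie in the domain, because the
  semigroup shifts the integral and only two boundary pieces remain (\<open>shift\<close>); they
  converge to \<open>x\<close> as \<open>h\<close> tends to 0.\<close>

lemma domain_dense:
  assumes x: "x \<in> X" and e: "0 < e"
  shows "\<exists>a b. (a, b) \<in> generator_graph X S \<and> norm (x - a) < e"
proof -
  define \<Phi> where "\<Phi> u = integral {0..u} (\<lambda>r. S r x)" for u
  have cont: "continuous_on {a..b} (\<lambda>r. S r x)" if "0 \<le> a" for a b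
    by (rule continuous_on_subset[OF orbit_continuous[OF x]]) (use that in auto)
  have deriv: "((\<lambda>h. (\<Phi> (u + h) - \<Phi> u) /\<^sub>R h) \<longlongrightarrow> S u x) (at_right 0)" if u: "0 \<le> u" for u
  proof -
    have "(\<Phi> has_vector_derivative S u x) (at u within {0..u+1})"
      unfolding \<Phi>_def using u by (intro integral_has_vector_derivative cont) auto
    then have "(\<Phi> has_vector_derivative S u x) (at u within {u..u+1})"
      by (rule has_vector_derivative_within_subset) (use u in auto)
    then have "((\<lambda>y. (1 / norm (y - u)) *\<^sub>R (\<Phi> y - (\<Phi> u + (y - u) *\<^sub>R S u x))) \<longlongrightarrow> 0) (at_right u)"
      by (simp add: has_vector_derivative_def has_derivative_within at_within_Icc_at_right)
    from tendsto_add[OF this tendsto_const[of "S u x"]]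
    have "((\<lambda>y. (1 / norm (y - u)) *\<^sub>R (\<Phi> y - (\<Phi> u + (y - u) *\<^sub>R S u x)) + S u x) \<longlongrightarrow> S u x) (at_right u)"
      by simp
    moreover have "\<forall>\<^sub>F y in at_right u. (1 / norm (y - u)) *\<^sub>R (\<Phi> y - (\<Phi> u + (y - u) *\<^sub>R S u x)) + S u x
        = (\<Phi> y - \<Phi> u) /\<^sub>R (y - u)"
      using eventually_at_right_less[of u]
    proof eventually_elim
      case (elim y)
      then show ?case by (simp add: scaleR_diff_right scaleR_add_right inverse_eq_divide)
    qed
    ultimately have "((\<lambda>y. (\<Phi> y - \<Phi> u) /\<^sub>R (y - u)) \<longlongrightarrow> S u x) (at_right u)"
      by (simp add: filterlim_cong[OF refl refl])
    then show ?thesis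
      by (simp add: filterlim_at_right_to_0[of _ _ u] add.commute)
  qed
  have shift: "S t (P (\<Phi> h)) = \<Phi> (t + h) - \<Phi> t" if "0 \<le> t" "0 \<le> h" for t h
  proof -
    interpret bounded_linear "\<lambda>x. S t (P x)" by (rule SP_bounded_linear[OF that(1)])
    have "S t (P (\<Phi> h)) = integral {0..h} (\<lambda>r. S t (P (S r x)))"
      unfolding \<Phi>_def
      using integral_linear[OF integrable_continuous_real[OF cont[of 0 h]] bounded_linear_axioms] by (simp add: o_def)
    also have "\<dots> = integral {0..h} ((\<lambda>r. S r x) \<circ> (+) t)"
      using that x by (intro Henstock_Kurzweil_Integration.integral_cong) (auto simp: P_id S_mem S_semigroup)
    also have "\<dots> = integral {0+t..h+t} (\<lambda>r. S r x)" by (rule integral_shift_Icc_real)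
    also have "\<dots> = \<Phi> (t + h) - \<Phi> t"
      unfolding \<Phi>_def
      using Henstock_Kurzweil_Integration.integral_combine[of 0 t "t + h" "\<lambda>r. S r x"] that
        integrable_continuous_real[OF cont[of 0 "t + h"]]
      by (simp add: algebra_simps)
    finally show ?thesis .
  qed
  have \<Phi>0: "\<Phi> 0 = 0" by (simp add: \<Phi>_def)
  have \<Phi>X: "\<Phi> h \<in> X" if "0 \<le> h" for h
    using shift[of 0 h] that \<Phi>0 S_0[OF P_mem, of "\<Phi> h"] P_mem[of "\<Phi> h"] by simp
  have graph: "(\<Phi> h, S h x - x) \<in> generator_graph X S" if h: "0 \<le> h" for h
  proof -
    have "((\<lambda>t. (\<Phi> (h + t) - \<Phi> h) /\<^sub>R t - (\<Phi> (0 + t) - \<Phi> 0) /\<^sub>R t) \<longlongrightarrow> S h x - S 0 x) (at_right 0)"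
      using h by (intro tendsto_diff deriv) auto
    moreover have "\<forall>\<^sub>F t in at_right 0. (\<Phi> (h + t) - \<Phi> h) /\<^sub>R t - (\<Phi> (0 + t) - \<Phi> 0) /\<^sub>R t = (S t (\<Phi> h) - \<Phi> h) /\<^sub>R t"
      using eventually_at_right_less[of 0]
    proof eventually_elim
      case (elim t)
      then show ?case using shift[of t h] h \<Phi>X[OF h] \<Phi>0
        by (simp add: P_id add.commute scaleR_diff_right)
    qed
    ultimately have "((\<lambda>t. (S t (\<Phi> h) - \<Phi> h) /\<^sub>R t) \<longlongrightarrow> S h x - S 0 x) (at_right 0)"
      by (simp add: filterlim_cong[OF refl refl])
    then show ?thesis
      using h x \<Phi>X by (simp add: generator_graph_def S_0 S_mem subspace_diff[OF subspace_X])
  qed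
  have "((\<lambda>h. \<Phi> h /\<^sub>R h) \<longlongrightarrow> x) (at_right 0)" using deriv[of 0] x by (simp add: \<Phi>0 S_0)
  then have "\<forall>\<^sub>F h in at_right 0. dist (\<Phi> h /\<^sub>R h) x < e \<and> 0 < h"
    using tendstoD[OF _ e] eventually_at_right_less by (intro eventually_conj) blast+
  then obtain h where h: "dist (\<Phi> h /\<^sub>R h) x < e" "0 < h"
    using eventually_happens'[of "at_right (0::real)"] by (auto simp: trivial_limit_at_right_real)
  have "(\<Phi> h /\<^sub>R h, (S h x - x) /\<^sub>R h) \<in> generator_graph X S"
  proof -
    have "((\<lambda>t. (S t (\<Phi> h) - \<Phi> h) /\<^sub>R t) \<longlongrightarrow> S h x - x) (at_right 0)"
      using graph[of h] h by (simp add: generator_graph_def)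
    then have "((\<lambda>t. ((S t (\<Phi> h) - \<Phi> h) /\<^sub>R t) /\<^sub>R h) \<longlongrightarrow> (S h x - x) /\<^sub>R h) (at_right 0)"
      by (intro tendsto_intros)
    moreover have "\<forall>\<^sub>F t in at_right 0. ((S t (\<Phi> h) - \<Phi> h) /\<^sub>R t) /\<^sub>R h = (S t (\<Phi> h /\<^sub>R h) - \<Phi> h /\<^sub>R h) /\<^sub>R t"
      using eventually_at_right_less[of 0]
    proof eventually_elim
      case (elim t)
      then show ?case using \<Phi>X[of h] h by (simp add: S_scale scaleR_diff_right mult.commute)
    qed
    ultimately have "((\<lambda>t. (S t (\<Phi> h /\<^sub>R h) - \<Phi> h /\<^sub>R h) /\<^sub>R t) \<longlongrightarrow> (S h x - x) /\<^sub>R h) (at_right 0)"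
      by (simp add: filterlim_cong[OF refl refl])
    then show ?thesis
      using h x \<Phi>X by (simp add: generator_graph_def S_mem subspace_diff[OF subspace_X] subspace_scale[OF subspace_X])
  qed
  then show ?thesis using h(1) by (auto simp: dist_norm norm_minus_commute)
qed

end

section \<open>The extrapolation space and the extended semigroup\<close>

locale extended_semigroup = age_interval sbar for sbar :: ereal +
  fixes \<mu> :: real and dp :: "L2 \<Rightarrow> 'd::{banach,second_countable_topology} \<Rightarrow> real"
    and T :: "real \<Rightarrow> 'd \<Rightarrow> 'd"
  assumes \<mu>: "0 < \<mu>" and dual: "is_dual_of_V sbar \<mu> dp"
    and ext: "is_extended_semigroup sbar \<mu> dp T"
begin

abbreviation "As \<equiv> A0_adj sbar \<mu>"
abbreviation "Vn \<equiv> V_norm sbar \<mu>"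
abbreviation "em \<equiv> emb sbar dp"
abbreviation "BB \<equiv> B_op sbar dp"

lemma V_closed: "v \<in> V \<Longrightarrow> w \<in> V \<Longrightarrow> v + w \<in> V" "v \<in> V \<Longrightarrow> c *\<^sub>R v \<in> V" "v \<in> V \<Longrightarrow> w \<in> V \<Longrightarrow> v - w \<in> V" "0 \<in> V"
  using subspace_V subspace_add subspace_scale subspace_diff subspace_0 by blast+

lemma As_add: "v \<in> V \<Longrightarrow> w \<in> V \<Longrightarrow> As (v + w) = As v + As w"
  by (simp add: A0_adj_def H1_add V_H1 algebra_simps)

lemma As_scale: "v \<in> V \<Longrightarrow> As (c *\<^sub>R v) = c *\<^sub>R As v"
  by (simp add: A0_adj_def H1_scale V_H1 algebra_simps)

lemma As_diff: "v \<in> V \<Longrightarrow> w \<in> V \<Longrightarrow> As (v - w) = As v - As w"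
  using As_add[of v "(-1) *\<^sub>R w"] As_scale[of w "-1"] V_closed(2)[of w "-1"] by simp

lemma As_H: "v \<in> V \<Longrightarrow> As v \<in> H"
  using Dw_H V_H1 V_subset_H unfolding A0_adj_def
  by (intro subspace_diff[OF subspace_H_space] subspace_scale[OF subspace_H_space]) auto

lemma Vn_square: "(Vn v)\<^sup>2 = (norm v)\<^sup>2 + (norm (As v))\<^sup>2"
  unfolding V_norm_def V_inner_def by (simp add: power2_norm_eq_inner)

lemma Vn_nonneg [simp]: "0 \<le> Vn v"
  by (simp add: V_norm_def V_inner_def)

lemma norm_le_Vn: "norm v \<le> Vn v"
  by (rule power2_le_imp_le) (simp_all add: Vn_square)

lemma norm_As_le_Vn: "norm (As v) \<le> Vn v"
  by (rule power2_le_imp_le) (simp_all add: Vn_square)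

lemma Vn_scale: "v \<in> V \<Longrightarrow> Vn (c *\<^sub>R v) = \<bar>c\<bar> * Vn v"
  by (rule power2_eq_imp_eq) (simp_all add: Vn_square As_scale power_mult_distrib distrib_left)

text \<open>Coercivity bounds \<open>norm v\<close> by \<open>norm (As v) / \<mu>\<close>, so the
  graph norm is at most \<open>CA\<close> times \<open>norm (As v)\<close>. By duality
  \<open>CA\<close> also bounds the inverse of \<open>AA\<close> and thereby the semigroup on
  V'.\<close>

definition CA :: real where "CA = 1 / \<mu> + 1"

lemma CA_pos: "0 < CA" using \<mu> by (simp add: CA_def add_pos_pos)

lemma As_norm_le: "v \<in> V \<Longrightarrow> norm v \<le> norm (As v) / \<mu>"
  using resolvent_norm_le[OF _ \<mu>, of v] by (simp add: A0_adj_def norm_minus_commute)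

lemma Vn_le: "v \<in> V \<Longrightarrow> Vn v \<le> CA * norm (As v)"
proof -
  assume v: "v \<in> V"
  have "Vn v \<le> norm v + norm (As v)"
    by (rule power2_le_imp_le) (auto simp: Vn_square power2_sum)
  then show ?thesis using As_norm_le[OF v] by (simp add: CA_def algebra_simps)
qed

lemma As_surj: "g \<in> H \<Longrightarrow> \<exists>v\<in>V. As v = g"
  using resolvent_exists[OF \<mu>, of "- g"] subspace_neg[OF subspace_H_space]
  by (force simp: A0_adj_def algebra_simps)

lemma As_inj: "v \<in> V \<Longrightarrow> w \<in> V \<Longrightarrow> As v = As w \<Longrightarrow> v = w"
  using As_norm_le[of "v - w"] by (simp add: As_diff V_closed)

lemma dp_linear: "v \<in> V \<Longrightarrow> linear (dp v)"
  and dp_functional: "(\<lambda>v. dp v x) \<in> V_functionals sbar \<mu>"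
  and dp_repr: "\<phi> \<in> V_functionals sbar \<mu> \<Longrightarrow> \<exists>x. \<forall>v\<in>V. dp v x = \<phi> v"
  and dp_norm: "norm x = (SUP v\<in>{v \<in> V. Vn v \<le> 1}. \<bar>dp v x\<bar>)"
  using dual unfolding is_dual_of_V_def by blast+

lemma dp_add: "v \<in> V \<Longrightarrow> w \<in> V \<Longrightarrow> dp (v + w) x = dp v x + dp w x"
  and dp_scale: "v \<in> V \<Longrightarrow> dp (c *\<^sub>R v) x = c * dp v x"
  using dp_functional[of x] by (auto simp: V_functionals_def)

lemma dp_diff: "v \<in> V \<Longrightarrow> w \<in> V \<Longrightarrow> dp (v - w) x = dp v x - dp w x"
  using dp_add[of v "(-1) *\<^sub>R w"] dp_scale[of w "-1"] V_closed(2)[of w "-1"] by simp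

text \<open>A real supremum is an upper bound only for a family bounded above. Membership in
  \<open>V_functionals\<close> supplies some bound first; after that the supremum gives the sharp
  constant, by scaling \<open>v\<close> to norm one.\<close>

lemma dp_le: assumes v: "v \<in> V" shows "\<bar>dp v x\<bar> \<le> Vn v * norm x"
proof -
  obtain K where K: "\<And>w. w \<in> V \<Longrightarrow> \<bar>dp w x\<bar> \<le> K * Vn w"
    using dp_functional[of x] unfolding V_functionals_def by blast
  show ?thesis
  proof (cases "Vn v = 0")
    case True
    then show ?thesis using K[OF v] by simp
  next
    case False
    then have pos: "0 < Vn v" using Vn_nonneg[of v] by linarith
    let ?u = "(1 / Vn v) *\<^sub>R v"
    have u: "?u \<in> V" "Vn ?u \<le> 1" using v pos by (auto simp: V_closed Vn_scale)
    have "bdd_above ((\<lambda>w. \<bar>dp w x\<bar>) ` {w \<in> V. Vn w \<le> 1})"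
    proof (rule bdd_aboveI2)
      fix w assume w: "w \<in> {w \<in> V. Vn w \<le> 1}"
      have "K * Vn w \<le> \<bar>K\<bar> * Vn w" by (intro mult_right_mono) auto
      also have "\<dots> \<le> \<bar>K\<bar> * 1" using w by (intro mult_left_mono) auto
      finally show "\<bar>dp w x\<bar> \<le> \<bar>K\<bar>" using K[of w] w by simp
    qed
    then have "\<bar>dp ?u x\<bar> \<le> norm x"
      unfolding dp_norm[of x] using u by (intro cSUP_upper) auto
    then show ?thesis using v pos by (simp add: dp_scale abs_mult field_simps)
  qed
qed

lemma dp_bounded_linear: assumes v: "v \<in> V" shows "bounded_linear (dp v)"
proof -
  interpret linear "dp v" by (rule dp_linear[OF v])
  show ?thesis
    by (rule bounded_linear_intro[where K = "Vn v"])
      (use dp_le[OF v] in \<open>auto simp: add scale mult.commute\<close>)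
qed

lemma dual_norm_le:
  assumes "\<And>v. v \<in> V \<Longrightarrow> \<bar>dp v x\<bar> \<le> K * Vn v" "0 \<le> K"
  shows "norm x \<le> K"
  unfolding dp_norm[of x]
proof (rule cSUP_least)
  have "Vn 0 = 0" using Vn_scale[OF V_closed(4), of 0] by simp
  then show "{v \<in> V. Vn v \<le> 1} \<noteq> {}" using V_closed(4) by force
  fix v assume v: "v \<in> {v \<in> V. Vn v \<le> 1}"
  then have "K * Vn v \<le> K * 1" using assms(2) by (intro mult_left_mono) auto
  then show "\<bar>dp v x\<bar> \<le> K" using assms(1)[of v] v by simp
qed

lemma dual_eqI:
  assumes "\<And>v. v \<in> V \<Longrightarrow> dp v x = dp v y"
  shows "x = y"
proof -
  have "dp v (x - y) = 0" if "v \<in> V" for v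
  proof -
    interpret linear "dp v" by (rule dp_linear[OF that])
    show ?thesis using assms[OF that] by (simp add: diff)
  qed
  then have "norm (x - y) \<le> 0" by (intro dual_norm_le) auto
  then show ?thesis by simp
qed

text \<open>Existence from the representation and uniqueness from the norm legitimise the
  descriptions of \<open>emb\<close>, \<open>delta0\<close> and \<open>AA\<close>, each of which
  then reduces to a boundedness check.\<close>

lemma dual_the:
  assumes "\<phi> \<in> V_functionals sbar \<mu>" "v \<in> V"
  shows "dp v (THE x. \<forall>v\<in>V. dp v x = \<phi> v) = \<phi> v"
proof -
  have "\<exists>!x. \<forall>v\<in>V. dp v x = \<phi> v"
    using dp_repr[OF assms(1)] dual_eqI by metis
  from theI'[OF this] show ?thesis using assms(2) by blast
qed

lemma V_functionalsI:
  assumes "\<And>v w. v \<in> V \<Longrightarrow> w \<in> V \<Longrightarrow> \<phi> (v + w) = \<phi> v + \<phi> w"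
    "\<And>c v. v \<in> V \<Longrightarrow> \<phi> (c *\<^sub>R v) = c * \<phi> v" "\<And>v. v \<in> V \<Longrightarrow> \<bar>\<phi> v\<bar> \<le> K * Vn v"
  shows "\<phi> \<in> V_functionals sbar \<mu>"
  using assms unfolding V_functionals_def by blast

lemma dp_em: assumes v: "v \<in> V" shows "dp v (em f) = inner v f"
  unfolding emb_def
proof (rule dual_the[OF _ v])
  have "\<bar>inner w f\<bar> \<le> norm f * Vn w" for w
    using Cauchy_Schwarz_ineq2[of w f] mult_right_mono[OF norm_le_Vn[of w], of "norm f"]
    by (simp add: mult.commute)
  then show "(\<lambda>v. inner v f) \<in> V_functionals sbar \<mu>"
    by (intro V_functionalsI) (simp_all add: inner_add_left)
qed

text \<open>Trace inequality: by \<open>V_inner_deriv\<close> the squared trace is a pairing of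
  \<open>v\<close> with \<open>Dw v\<close>, and the weak derivative is
  \<open>As v + \<mu> v\<close>. This places the Dirac mass at 0 in V'.\<close>

lemma ev0_square_le: assumes v: "v \<in> V" shows "(ev v 0)\<^sup>2 \<le> 2 * (1 + \<mu>) * (Vn v)\<^sup>2"
proof -
  have "(ev v 0)\<^sup>2 = - 2 * inner v (As v + \<mu> *\<^sub>R v)"
    using V_inner_deriv[OF v] by (simp add: A0_adj_def)
  also have "\<dots> \<le> 2 * (norm v * norm (As v + \<mu> *\<^sub>R v))"
    using Cauchy_Schwarz_ineq2[of v "As v + \<mu> *\<^sub>R v"] by simp
  also have "\<dots> \<le> 2 * (Vn v * ((1 + \<mu>) * Vn v))"
  proof -
    have "norm (As v + \<mu> *\<^sub>R v) \<le> norm (As v) + \<mu> * norm v"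
      using norm_triangle_ineq[of "As v" "\<mu> *\<^sub>R v"] \<mu> by simp
    also have "\<dots> \<le> Vn v + \<mu> * Vn v"
      using norm_le_Vn norm_As_le_Vn \<mu> by (intro add_mono mult_left_mono) auto
    finally have "norm (As v + \<mu> *\<^sub>R v) \<le> (1 + \<mu>) * Vn v" by (simp add: algebra_simps)
    then show ?thesis using norm_le_Vn by (intro mult_left_mono mult_mono) auto
  qed
  finally show ?thesis by (simp add: power2_eq_square algebra_simps)
qed

lemma ev0_linear:
  "v \<in> V \<Longrightarrow> w \<in> V \<Longrightarrow> ev (v + w) 0 = ev v 0 + ev w 0" "v \<in> V \<Longrightarrow> ev (c *\<^sub>R v) 0 = c * ev v 0"
  using H1_add(3) H1_scale(3) V_H1 zero_dom by auto

lemma dp_delta0: assumes v: "v \<in> V" shows "dp v (delta0 sbar dp) = ev v 0"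
  unfolding delta0_def
proof (rule dual_the[OF _ v])
  have "\<bar>ev w 0\<bar> \<le> sqrt (2 * (1 + \<mu>)) * Vn w" if "w \<in> V" for w
    using real_sqrt_le_mono[OF ev0_square_le[OF that]] by (simp add: real_sqrt_mult)
  then show "(\<lambda>v. ev v 0) \<in> V_functionals sbar \<mu>"
    by (intro V_functionalsI) (simp_all add: ev0_linear)
qed

lemma dp_BB: assumes v: "v \<in> V" shows "dp v (BB u) = inner (B_adj sbar v) u"
proof -
  interpret linear "dp v" by (rule dp_linear[OF v])
  show ?thesis
    using v by (simp add: B_op_def B_adj_def add scale dp_em dp_delta0 inner_prod_def mult.commute)
qed

definition CB :: real where "CB = sqrt (2 * (1 + \<mu>) + 1)"

lemma norm_B_adj_le: assumes v: "v \<in> V" shows "norm (B_adj sbar v) \<le> CB * Vn v"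
proof (rule power2_le_imp_le)
  have "(norm (B_adj sbar v))\<^sup>2 = (ev v 0)\<^sup>2 + (norm v)\<^sup>2"
    unfolding power2_norm_eq_inner by (simp add: B_adj_def inner_prod_def power2_eq_square)
  also have "\<dots> \<le> 2 * (1 + \<mu>) * (Vn v)\<^sup>2 + (Vn v)\<^sup>2"
    using ev0_square_le[OF v] norm_le_Vn[of v] by (intro add_mono power_mono) auto
  also have "\<dots> = (CB * Vn v)\<^sup>2"
    using \<mu> by (simp add: CB_def power_mult_distrib algebra_simps)
  finally show "(norm (B_adj sbar v))\<^sup>2 \<le> (CB * Vn v)\<^sup>2" .
qed (use \<mu> in \<open>simp add: CB_def\<close>)

lemma CB_nonneg: "0 \<le> CB" using \<mu> by (simp add: CB_def)

lemma norm_BB_le: "norm (BB u) \<le> CB * norm u"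
proof (rule dual_norm_le)
  fix v assume v: "v \<in> V"
  have "\<bar>dp v (BB u)\<bar> \<le> norm (B_adj sbar v) * norm u"
    unfolding dp_BB[OF v] by (rule Cauchy_Schwarz_ineq2)
  also have "\<dots> \<le> CB * Vn v * norm u" by (intro mult_right_mono norm_B_adj_le v) simp
  finally show "\<bar>dp v (BB u)\<bar> \<le> CB * norm u * Vn v" by (simp add: mult.commute mult.left_commute)
qed (simp add: CB_nonneg)

lemma bounded_linear_BB: "bounded_linear BB"
proof (rule bounded_linear_intro)
  show "BB (u + w) = BB u + BB w" for u w
  proof (rule dual_eqI)
    fix v assume v: "v \<in> V"
    interpret linear "dp v" by (rule dp_linear[OF v])
    show "dp v (BB (u + w)) = dp v (BB u + BB w)" by (simp add: add dp_BB[OF v] inner_add_right)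
  qed
  show "BB (c *\<^sub>R u) = c *\<^sub>R BB u" for c u
  proof (rule dual_eqI)
    fix v assume v: "v \<in> V"
    interpret linear "dp v" by (rule dp_linear[OF v])
    show "dp v (BB (c *\<^sub>R u)) = dp v (c *\<^sub>R BB u)" by (simp add: scale dp_BB[OF v])
  qed
  show "norm (BB u) \<le> norm u * CB" for u using norm_BB_le[of u] by (simp add: mult.commute)
qed

text \<open>The operator \<open>A\<close> on \<open>D(A) = H\<close>, as a map from \<open>H\<close> into \<open>V'\<close>.\<close>

definition AA :: "L2 \<Rightarrow> 'd" where
  "AA f = (THE x. \<forall>v\<in>V. dp v x = inner (As v) f)"

lemma dp_AA: assumes v: "v \<in> V" shows "dp v (AA f) = inner (As v) f"
  unfolding AA_def
proof (rule dual_the[OF _ v])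
  have "\<bar>inner (As w) f\<bar> \<le> norm f * Vn w" for w
    using Cauchy_Schwarz_ineq2[of "As w" f] mult_right_mono[OF norm_As_le_Vn[of w], of "norm f"]
    by (simp add: mult.commute)
  then show "(\<lambda>v. inner (As v) f) \<in> V_functionals sbar \<mu>"
    by (intro V_functionalsI) (simp_all add: inner_add_left As_add As_scale)
qed

lemma norm_AA_le: "norm (AA f) \<le> norm f"
proof (rule dual_norm_le)
  fix v assume v: "v \<in> V"
  show "\<bar>dp v (AA f)\<bar> \<le> norm f * Vn v"
    using Cauchy_Schwarz_ineq2[of "As v" f] mult_right_mono[OF norm_As_le_Vn[of v], of "norm f"]
    by (simp add: mult.commute dp_AA[OF v])
qed simp

lemma em_linear: "em (f + g) = em f + em g" "em (c *\<^sub>R f) = c *\<^sub>R em f" "em (f - g) = em f - em g"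
proof -
  show "em (f + g) = em f + em g"
  proof (rule dual_eqI)
    fix v assume v: "v \<in> V"
    interpret linear "dp v" by (rule dp_linear[OF v])
    show "dp v (em (f + g)) = dp v (em f + em g)" by (simp add: add dp_em[OF v] inner_add_right)
  qed
  show "em (c *\<^sub>R f) = c *\<^sub>R em f"
  proof (rule dual_eqI)
    fix v assume v: "v \<in> V"
    interpret linear "dp v" by (rule dp_linear[OF v])
    show "dp v (em (c *\<^sub>R f)) = dp v (c *\<^sub>R em f)" by (simp add: scale dp_em[OF v])
  qed
  show "em (f - g) = em f - em g"
  proof (rule dual_eqI)
    fix v assume v: "v \<in> V"
    interpret linear "dp v" by (rule dp_linear[OF v])
    show "dp v (em (f - g)) = dp v (em f - em g)" by (simp add: diff dp_em[OF v] inner_diff_right)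
  qed
qed

lemma AA_diff: "AA (f - g) = AA f - AA g"
proof (rule dual_eqI)
  fix v assume v: "v \<in> V"
  interpret linear "dp v" by (rule dp_linear[OF v])
  show "dp v (AA (f - g)) = dp v (AA f - AA g)" by (simp add: diff dp_AA[OF v] inner_diff_right)
qed

text \<open>Composing the functional \<open>z\<close> with the inverse \<open>Q\<close> of
  \<open>As\<close> gives a bounded functional on H, whose Riesz representer is the preimage. The
  norm estimate is what later lets bounds on H be read off on V'.\<close>

lemma AA_surj: "\<exists>f\<in>H. AA f = z \<and> norm f \<le> CA * norm z"
proof -
  define Q where "Q g = (SOME v. v \<in> V \<and> As v = g)" for g
  have Q: "Q g \<in> V" "As (Q g) = g" if "g \<in> H" for g
    using As_surj[OF that] someI_ex[of "\<lambda>v. v \<in> V \<and> As v = g"] unfolding Q_def by blast+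
  note sub = subspace_H_space[of sbar]
  have bd: "\<bar>dp (Q g) z\<bar> \<le> CA * norm z * norm g" if "g \<in> H" for g
    using dp_le[OF Q(1)[OF that], of z] mult_right_mono[OF Vn_le[OF Q(1)[OF that]], of "norm z"] Q(2)[OF that]
    by (simp add: mult.commute mult.left_commute)
  have "\<exists>f\<in>H. \<forall>g\<in>H. dp (Q g) z = inner g f"
  proof (rule riesz_representation[OF sub closed_H_space])
    fix g h assume g: "g \<in> H" and h: "h \<in> H"
    have "Q (g + h) = Q g + Q h"
      by (rule As_inj) (use g h Q subspace_add[OF sub] in \<open>auto simp: As_add V_closed\<close>)
    then show "dp (Q (g + h)) z = dp (Q g) z + dp (Q h) z" using Q g h by (simp add: dp_add)
  next
    fix c g assume g: "g \<in> H"
    have "Q (c *\<^sub>R g) = c *\<^sub>R Q g"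
      by (rule As_inj) (use g Q subspace_scale[OF sub] in \<open>auto simp: As_scale V_closed\<close>)
    then show "dp (Q (c *\<^sub>R g)) z = c * dp (Q g) z" using Q g by (simp add: dp_scale)
  qed (fact bd)
  then obtain f where f: "f \<in> H" "\<And>g. g \<in> H \<Longrightarrow> dp (Q g) z = inner g f" by blast
  have "AA f = z"
  proof (rule dual_eqI)
    fix v assume v: "v \<in> V"
    have "Q (As v) = v" by (rule As_inj) (use v Q As_H in auto)
    then show "dp v (AA f) = dp v z" using f(2)[OF As_H[OF v]] by (simp add: dp_AA[OF v])
  qed
  moreover have "norm f \<le> CA * norm z"
  proof (cases "f = 0")
    case False
    have "norm f * norm f \<le> CA * norm z * norm f"
      using bd[OF f(1)] f(2)[OF f(1)] by (simp add: power2_norm_eq_inner power2_eq_square[symmetric])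
    then show ?thesis using False by simp
  qed (use CA_pos in simp)
  ultimately show ?thesis using f(1) by blast
qed

lemma AA_dom_A0: assumes f: "f \<in> dom_A0 sbar" shows "AA f = em (A0 sbar \<mu> f)"
proof (rule dual_eqI)
  fix v assume v: "v \<in> V"
  show "dp v (AA f) = dp v (em (A0 sbar \<mu> f))"
    using A0_duality[OF v f]
    by (simp add: dp_AA[OF v] dp_em[OF v] A0_def A0_adj_def inner_diff_left inner_diff_right)
qed

section \<open>The semigroup on H, its exponential decay, and their transport to V'\<close>

definition SS :: "real \<Rightarrow> L2 \<Rightarrow> L2" where
  "SS = (SOME S. C0_semigroup_on H S \<and>
        generator_graph H S = {(f, A0 sbar \<mu> f) |f. f \<in> dom_A0 sbar} \<and>
        (\<forall>t\<ge>0. \<forall>f\<in>H. T t (em f) = em (S t f)))"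

lemma SS: "C0_semigroup_on H SS"
    "generator_graph H SS = {(f, A0 sbar \<mu> f) |f. f \<in> dom_A0 sbar}"
  and T_em: "0 \<le> t \<Longrightarrow> f \<in> H \<Longrightarrow> T t (em f) = em (SS t f)"
proof -
  have "\<exists>S. C0_semigroup_on H S \<and>
        generator_graph H S = {(f, A0 sbar \<mu> f) |f. f \<in> dom_A0 sbar} \<and>
        (\<forall>t\<ge>0. \<forall>f\<in>H. T t (em f) = em (S t f))"
    using ext unfolding is_extended_semigroup_def by blast
  from someI_ex[OF this, folded SS_def]
  show "C0_semigroup_on H SS"
    "generator_graph H SS = {(f, A0 sbar \<mu> f) |f. f \<in> dom_A0 sbar}"
    "0 \<le> t \<Longrightarrow> f \<in> H \<Longrightarrow> T t (em f) = em (SS t f)" by blast+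
qed

sublocale S: projected_semigroup "mult_L2 (indicator (einterval 0 sbar))" H SS
proof (rule projected_semigroup.intro)
  have eb: "ess_bounded (indicator (einterval 0 sbar)) 1" by (intro ess_bounded_indicator) simp
  show "bounded_linear (mult_L2 (indicator (einterval 0 sbar)))" by (rule bounded_linear_mult_L2[OF eb])
  show "mult_L2 (indicator (einterval 0 sbar)) x \<in> H" for x
    unfolding H_space_def mem_Collect_eq using rep_mult_L2[OF eb, of x] by eventually_elim simp
  show "x \<in> H \<Longrightarrow> mult_L2 (indicator (einterval 0 sbar)) x = x" for x by (simp add: H_space_iff)
  show "C0_semigroup_on H SS" by (rule SS(1))
qed

sublocale T: projected_semigroup "\<lambda>x. x" UNIV T
  using ext by (intro projected_semigroup.intro bounded_linear_ident) (auto simp: is_extended_semigroup_def)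

lemma SS_graph: "f \<in> dom_A0 sbar \<Longrightarrow> (f, A0 sbar \<mu> f) \<in> generator_graph H SS"
  by (auto simp: SS(2))

lemma dom_A0_H: "f \<in> dom_A0 sbar \<Longrightarrow> f \<in> H"
  using H1_subset_H by (auto simp: dom_A0_def)

lemma SS_dom_A0:
  assumes f: "f \<in> dom_A0 sbar" and t: "0 \<le> t"
  shows "SS t f \<in> dom_A0 sbar" "SS t (A0 sbar \<mu> f) = A0 sbar \<mu> (SS t f)"
  using S.graph_invariant[OF SS_graph[OF f] t] by (auto simp: SS(2))

lemma dom_A0_dense: "f \<in> H \<Longrightarrow> 0 < e \<Longrightarrow> \<exists>g\<in>dom_A0 sbar. norm (f - g) < e"
  using S.domain_dense[of f e] by (auto simp: SS(2))

lemma SS_derivative: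
  assumes f: "f \<in> dom_A0 sbar" and t: "0 \<le> t"
  shows "((\<lambda>s. SS s f) has_vector_derivative A0 sbar \<mu> (SS t f)) (at t within {0..})"
  using S.orbit_derivative[OF SS_graph[OF f] t] SS_dom_A0(2)[OF f t] by simp

lemma A0_dissipative: "f \<in> dom_A0 sbar \<Longrightarrow> inner f (A0 sbar \<mu> f) \<le> - \<mu> * (norm f)\<^sup>2"
  using dom_A0_inner_deriv[of f] by (simp add: A0_def inner_diff_right power2_norm_eq_inner)

text \<open>On the domain, dissipativity makes \<open>exp (2 * \<mu> * s)\<close> times the squared
  norm of the orbit nonincreasing. The domain is dense and \<open>SS t\<close> is bounded, which
  extends the estimate to all of H.\<close>

lemma SS_contraction:
  assumes f: "f \<in> H" and t: "0 \<le> t"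
  shows "norm (SS t f) \<le> exp (- \<mu> * t) * norm f"
proof -
  have on_dom: "norm (SS t f) \<le> exp (- \<mu> * t) * norm f" if f: "f \<in> dom_A0 sbar" for f
  proof -
    define N where "N s = exp (2 * \<mu> * s) * inner (SS s f) (SS s f)" for s
    have der: "(N has_real_derivative exp (2 * \<mu> * s) * (2 * \<mu> * inner (SS s f) (SS s f) + 2 * inner (SS s f) (A0 sbar \<mu> (SS s f)))) (at s within {0..})"
      if "0 \<le> s" for s
      unfolding N_def has_real_derivative_iff_has_vector_derivative
      using SS_derivative[OF f that]
      by (auto intro!: derivative_eq_intros simp: has_vector_derivative_def inner_commute algebra_simps)
    have "N t \<le> N 0"
    proof (rule DERIV_nonpos_imp_decreasing_open[OF t])
      fix s assume s: "0 < s" "s < t"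
      have "at s within {0..} = at s" using s by (intro at_within_interior) (simp add: interior_Ici)
      moreover have "exp (2 * \<mu> * s) * (2 * \<mu> * inner (SS s f) (SS s f) + 2 * inner (SS s f) (A0 sbar \<mu> (SS s f))) \<le> 0"
        using A0_dissipative[OF SS_dom_A0(1)[OF f, of s]] s
        by (intro mult_nonneg_nonpos) (auto simp: power2_norm_eq_inner)
      ultimately show "\<exists>y. (N has_real_derivative y) (at s) \<and> y \<le> 0" using der[of s] s by auto
    next
      show "continuous_on {0..t} N"
        unfolding N_def
        by (intro continuous_intros continuous_on_subset[OF S.orbit_continuous[OF dom_A0_H[OF f]]]) auto
    qed
    then have "exp (2 * \<mu> * t) * (norm (SS t f))\<^sup>2 \<le> (norm f)\<^sup>2"
      using S.S_0[OF dom_A0_H[OF f]] by (simp add: N_def power2_norm_eq_inner)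
    moreover have "exp (2 * \<mu> * t) = (exp (\<mu> * t))\<^sup>2"
      by (simp add: power2_eq_square flip: exp_add)
    ultimately have "(exp (\<mu> * t) * norm (SS t f))\<^sup>2 \<le> (norm f)\<^sup>2" by (simp add: power_mult_distrib)
    then have "exp (\<mu> * t) * norm (SS t f) \<le> norm f" by (rule power2_le_imp_le) simp
    then show ?thesis by (simp add: exp_minus field_simps)
  qed
  obtain M where M: "M \<ge> 0" "\<And>y. y \<in> H \<Longrightarrow> norm (SS t y) \<le> M * norm y"
    using S.compact_bound[of t] t by force
  show ?thesis
  proof (rule field_le_epsilon)
    fix e :: real assume e: "0 < e"
    obtain g where g: "g \<in> dom_A0 sbar" "norm (f - g) < e / (M + 1)"
      using dom_A0_dense[OF f, of "e / (M + 1)"] e M(1) by auto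
    have gH: "g \<in> H" by (rule dom_A0_H[OF g(1)])
    have E: "exp (- \<mu> * t) \<le> 1" using \<mu> t by simp
    have "norm (SS t f) \<le> norm (SS t (f - g)) + norm (SS t g)"
      using norm_triangle_ineq[of "SS t (f - g)" "SS t g"] S.S_diff[OF t f gH] by simp
    also have "norm (SS t (f - g)) \<le> M * norm (f - g)"
      using f gH by (intro M subspace_diff[OF subspace_H_space])
    also have "norm (SS t g) \<le> exp (- \<mu> * t) * norm g" by (rule on_dom[OF g(1)])
    also have "norm g \<le> norm f + norm (f - g)"
      using norm_triangle_ineq4[of f "f - g"] by simp
    finally have "norm (SS t f) \<le> M * norm (f - g) + exp (- \<mu> * t) * (norm f + norm (f - g))" by simp
    also have "\<dots> \<le> M * norm (f - g) + (exp (- \<mu> * t) * norm f + 1 * norm (f - g))"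
      unfolding distrib_left using E by (intro add_left_mono mult_right_mono) auto
    also have "\<dots> = exp (- \<mu> * t) * norm f + (M + 1) * norm (f - g)" by (simp add: algebra_simps)
    also have "(M + 1) * norm (f - g) \<le> e" using g(2) M(1) by (simp add: field_simps)
    finally show "norm (SS t f) \<le> exp (- \<mu> * t) * norm f + e" by simp
  qed
qed

lemma SS_norm_le: assumes "f \<in> H" "0 \<le> t" shows "norm (SS t f) \<le> norm f"
proof -
  have "exp (- \<mu> * t) * norm f \<le> 1 * norm f" using \<mu> assms by (intro mult_right_mono) auto
  then show ?thesis using SS_contraction[OF assms] by simp
qed

text \<open>On the domain \<open>AA\<close> is the embedded \<open>A0\<close>, which commutes with
  the semigroup; both sides are bounded in \<open>f\<close>, so density finishes. Since
  \<open>AA\<close> is onto, \<open>T\<close> is hereby conjugate to the contraction semigroup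
  \<open>SS\<close>.\<close>

lemma T_AA:
  assumes f: "f \<in> H" and t: "0 \<le> t"
  shows "T t (AA f) = AA (SS t f)"
proof -
  have on_dom: "T t (AA g) = AA (SS t g)" if g: "g \<in> dom_A0 sbar" for g
  proof -
    have "A0 sbar \<mu> g \<in> H" using SS_graph[OF g] by (simp add: generator_graph_def)
    then show ?thesis using SS_dom_A0[OF g t] by (simp add: AA_dom_A0 g T_em t)
  qed
  interpret Tt: bounded_linear "T t" using T.SP_bounded_linear[OF t] by simp
  obtain K where K: "K \<ge> 0" "\<And>x. norm (T t x) \<le> norm x * K" using Tt.nonneg_bounded by blast
  have "norm (T t (AA f) - AA (SS t f)) \<le> 0"
  proof (rule field_le_epsilon)
    fix e :: real assume e: "0 < e"
    obtain g where g: "g \<in> dom_A0 sbar" "norm (f - g) < e / (K + 1)"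
      using dom_A0_dense[OF f, of "e / (K + 1)"] e K(1) by auto
    have gH: "g \<in> H" by (rule dom_A0_H[OF g(1)])
    have "T t (AA f) - AA (SS t f) = T t (AA (f - g)) - AA (SS t (f - g))"
      using on_dom[OF g(1)] by (simp add: AA_diff Tt.diff S.S_diff[OF t f gH])
    then have "norm (T t (AA f) - AA (SS t f)) \<le> norm (T t (AA (f - g))) + norm (AA (SS t (f - g)))"
      by (simp add: norm_triangle_ineq4)
    also have "norm (T t (AA (f - g))) \<le> norm (f - g) * K"
      using K(2)[of "AA (f - g)"] mult_right_mono[OF norm_AA_le[of "f - g"] K(1)] by linarith
    also have "norm (AA (SS t (f - g))) \<le> norm (f - g)"
      using norm_AA_le[of "SS t (f - g)"] SS_norm_le[of "f - g" t] f gH t subspace_diff[OF subspace_H_space]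
      by (meson order_trans)
    also have "norm (f - g) * K + norm (f - g) = (K + 1) * norm (f - g)" by (simp add: algebra_simps)
    also have "\<dots> \<le> e" using g(2) K(1) by (simp add: field_simps)
    finally show "norm (T t (AA f) - AA (SS t f)) \<le> 0 + e" by simp
  qed
  then show ?thesis by simp
qed

text \<open>The decay on H is carried over by conjugation with \<open>AA\<close>; the factor
  \<open>CA\<close> is the price of its inverse.\<close>

lemma T_bound: assumes t: "0 \<le> t" shows "norm (T t z) \<le> CA * exp (- \<mu> * t) * norm z"
proof -
  obtain f where f: "f \<in> H" "AA f = z" "norm f \<le> CA * norm z" using AA_surj[of z] by blast
  have "norm (T t z) \<le> norm (SS t f)" using T_AA[OF f(1) t] norm_AA_le[of "SS t f"] f(2) by simp
  also have "\<dots> \<le> exp (- \<mu> * t) * norm f" by (rule SS_contraction[OF f(1) t])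
  also have "\<dots> \<le> exp (- \<mu> * t) * (CA * norm z)" by (intro mult_left_mono f) simp
  finally show ?thesis by (simp add: mult.commute mult.left_commute)
qed

lemma T_bound': assumes t: "0 \<le> t" shows "norm (T t z) \<le> CA * norm z"
proof -
  have "CA * exp (- \<mu> * t) * norm z \<le> CA * 1 * norm z"
    using \<mu> t CA_pos by (intro mult_right_mono mult_left_mono) auto
  then show ?thesis using T_bound[OF t, of z] by simp
qed

lemma T_linear: assumes t: "0 \<le> t" shows "bounded_linear (T t)"
  using T.SP_bounded_linear[OF t] by simp

text \<open>Continuity of orbits combined with the bound \<open>CA\<close>, which is uniform in
  time. The joint measurability of the convolution kernel \<open>K\<close> rests on it.\<close>

lemma T_jointly_continuous: "continuous_on ({0..} \<times> UNIV) (\<lambda>(t, z). T t z)"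
  unfolding continuous_on_iff
proof (intro ballI allI impI, clarify)
  fix t z and e :: real assume t: "(0::real) \<le> t" and e: "0 < e"
  obtain d where d: "d > 0" "\<And>s. s \<in> {0..} \<Longrightarrow> dist s t < d \<Longrightarrow> dist (T s z) (T t z) < e / 2"
    using T.orbit_continuous[of z] t e unfolding continuous_on_iff by (metis UNIV_I atLeast_iff half_gt_zero)
  show "\<exists>d>0. \<forall>x'\<in>{0..} \<times> UNIV. dist x' (t, z) < d \<longrightarrow> dist (case x' of (t, z) \<Rightarrow> T t z) (T t z) < e"
  proof (intro exI[of _ "min d (e / (2 * CA))"] conjI ballI impI)
    show "0 < min d (e / (2 * CA))" using d(1) e CA_pos by simp
    fix x' assume x': "x' \<in> {0..} \<times> (UNIV :: 'd set)" "dist x' (t, z) < min d (e / (2 * CA))"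
    obtain s w where sw: "x' = (s, w)" by (cases x')
    have s: "0 \<le> s" "dist s t < d" and w: "norm (w - z) < e / (2 * CA)"
      using x' dist_fst_le[of x' "(t, z)"] dist_snd_le[of x' "(t, z)"] sw by (auto simp: dist_norm)
    interpret bounded_linear "T s" by (rule T_linear[OF s(1)])
    have dec: "T s w - T t z = T s (w - z) + (T s z - T t z)" by (simp add: diff)
    have "norm (T s w - T t z) \<le> norm (T s (w - z)) + norm (T s z - T t z)"
      unfolding dec by (rule norm_triangle_ineq)
    also have "norm (T s (w - z)) \<le> CA * norm (w - z)" by (rule T_bound'[OF s(1)])
    also have "CA * norm (w - z) < e / 2" using w CA_pos by (simp add: field_simps)
    also have "norm (T s z - T t z) < e / 2" using d(2)[of s] s by (simp add: dist_norm)
    finally show "dist (case x' of (t, z) \<Rightarrow> T t z) (T t z) < e" by (simp add: sw dist_norm)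
  qed
qed

text \<open>Strong continuity of the adjoint semigroup on \<open>V\<close>: it is clear on \<open>D(A\<^sub>0\<^sup>*\<^sup>2)\<close>.\<close>

lemma inner_SS_minus_le:
  assumes g: "g \<in> V" and f: "f \<in> H" and t: "0 \<le> t"
  shows "\<bar>inner g (SS t f - f)\<bar> \<le> t * norm (As g) * norm f"
proof -
  have on_dom: "\<bar>inner g (SS t f - f)\<bar> \<le> t * norm (As g) * norm f" if f: "f \<in> dom_A0 sbar" for f
  proof -
    have "norm (inner g (SS t f) - inner g (SS 0 f)) \<le> (norm (As g) * norm f) * norm (t - 0)"
    proof (rule differentiable_bound[where S = "{0..t}" and f' = "\<lambda>s d. d * inner g (A0 sbar \<mu> (SS s f))"])
      fix s assume s: "s \<in> {0..t}"
      have "((\<lambda>s. inner g (SS s f)) has_derivative (\<lambda>d. inner g (d *\<^sub>R A0 sbar \<mu> (SS s f)))) (at s within {0..})"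
        using SS_derivative[OF f, of s] s unfolding has_vector_derivative_def
        by (intro has_derivative_inner_right) auto
      then show "((\<lambda>s. inner g (SS s f)) has_derivative (\<lambda>d. d * inner g (A0 sbar \<mu> (SS s f)))) (at s within {0..t})"
        by (auto intro: has_derivative_subset)
      have "inner g (A0 sbar \<mu> (SS s f)) = inner (As g) (SS s f)"
        using dp_AA[OF g, of "SS s f"] dp_em[OF g, of "A0 sbar \<mu> (SS s f)"] AA_dom_A0[OF SS_dom_A0(1)[OF f, of s]] s
        by simp
      moreover have "norm (SS s f) \<le> norm f" using SS_norm_le[OF dom_A0_H[OF f], of s] s by simp
      ultimately have bd: "\<bar>inner g (A0 sbar \<mu> (SS s f))\<bar> \<le> norm (As g) * norm f"
        using Cauchy_Schwarz_ineq2[of "As g" "SS s f"] mult_left_mono[of "norm (SS s f)" "norm f" "norm (As g)"]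
        by simp
      show "onorm (\<lambda>d. d * inner g (A0 sbar \<mu> (SS s f))) \<le> norm (As g) * norm f"
      proof (rule onorm_bound)
        show "norm (d * inner g (A0 sbar \<mu> (SS s f))) \<le> norm (As g) * norm f * norm d" for d
          using mult_right_mono[OF bd, of "\<bar>d\<bar>"] by (simp add: abs_mult mult.commute)
      qed simp
    qed (use t in auto)
    then show ?thesis using t S.S_0[OF dom_A0_H[OF f]] by (simp add: inner_diff_right mult.commute mult.left_commute)
  qed
  show ?thesis
  proof (rule field_le_epsilon)
    fix e :: real assume e: "0 < e"
    define C where "C = 2 * norm g + t * norm (As g)"
    have C: "0 \<le> C" using t by (simp add: C_def)
    obtain h where h: "h \<in> dom_A0 sbar" "norm (f - h) < e / (C + 1)"
      using dom_A0_dense[OF f, of "e / (C + 1)"] e C by auto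
    have hH: "h \<in> H" by (rule dom_A0_H[OF h(1)])
    have fh: "f - h \<in> H" using f hH by (rule subspace_diff[OF subspace_H_space])
    have "inner g (SS t f - f) = inner g (SS t (f - h) - (f - h)) + inner g (SS t h - h)"
      by (simp add: S.S_diff[OF t f hH] inner_diff_right)
    then have "\<bar>inner g (SS t f - f)\<bar> \<le> \<bar>inner g (SS t (f - h) - (f - h))\<bar> + \<bar>inner g (SS t h - h)\<bar>" by linarith
    also have "\<bar>inner g (SS t (f - h) - (f - h))\<bar> \<le> norm g * (2 * norm (f - h))"
    proof -
      have "norm (SS t (f - h) - (f - h)) \<le> 2 * norm (f - h)"
        using norm_triangle_ineq4[of "SS t (f - h)" "f - h"] SS_norm_le[OF fh t] by simp
      then show ?thesis using Cauchy_Schwarz_ineq2[of g "SS t (f - h) - (f - h)"]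
        by (meson mult_left_mono norm_ge_zero order_trans)
    qed
    also have "\<bar>inner g (SS t h - h)\<bar> \<le> t * norm (As g) * norm h" by (rule on_dom[OF h(1)])
    also have "t * norm (As g) * norm h \<le> t * norm (As g) * (norm f + norm (f - h))"
      using norm_triangle_ineq4[of f "f - h"] t by (intro mult_left_mono) auto
    finally have "\<bar>inner g (SS t f - f)\<bar> \<le> t * norm (As g) * norm f + C * norm (f - h)"
      by (simp add: C_def algebra_simps)
    moreover have "C * norm (f - h) \<le> (C + 1) * norm (f - h)" by (intro mult_right_mono) auto
    moreover have "(C + 1) * norm (f - h) \<le> e" using h(2) C by (simp add: field_simps)
    ultimately show "\<bar>inner g (SS t f - f)\<bar> \<le> t * norm (As g) * norm f + e" by linarith
  qed
qed

text \<open>\<open>As v\<close> is approximated by some \<open>g\<close> in \<open>V\<close>: the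
  error is harmless by contraction, and for \<open>g\<close> the previous lemma gives a rate linear
  in \<open>t\<close>. Each part contributes half of \<open>e\<close>. The bound is uniform in
  \<open>z\<close>, so that \<open>pairing_end\<close> may replace the semigroup by the identity in
  front of any control.\<close>

lemma T_adjoint_continuous:
  assumes v: "v \<in> V" and e: "0 < e"
  shows "\<exists>d>0. \<forall>t z. 0 \<le> t \<and> t \<le> d \<longrightarrow> \<bar>dp v (T t z - z)\<bar> \<le> e * norm z"
proof -
  define e' where "e' = e / (4 * CA)"
  have e': "0 < e'" using e CA_pos by (simp add: e'_def)
  obtain g where g: "g \<in> V" "norm (As v - g) < e'" using V_dense[OF As_H[OF v] e'] by blast
  define d where "d = e / (2 * CA * (norm (As g) + 1))"
  have d: "0 < d" using e CA_pos by (simp add: d_def add_nonneg_pos)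
  have "\<bar>dp v (T t z - z)\<bar> \<le> e * norm z" if t: "0 \<le> t" "t \<le> d" for t z
  proof -
    obtain f where f: "f \<in> H" "AA f = z" "norm f \<le> CA * norm z" using AA_surj[of z] by blast
    have "T t z - z = AA (SS t f - f)" using T_AA[OF f(1) t(1)] f(2) by (simp add: AA_diff)
    then have "dp v (T t z - z) = inner (As v - g) (SS t f - f) + inner g (SS t f - f)"
      by (simp add: dp_AA[OF v] inner_diff_left)
    then have "\<bar>dp v (T t z - z)\<bar> \<le> \<bar>inner (As v - g) (SS t f - f)\<bar> + \<bar>inner g (SS t f - f)\<bar>" by linarith
    also have "\<bar>inner (As v - g) (SS t f - f)\<bar> \<le> e' * (2 * norm f)"
    proof -
      have "norm (SS t f - f) \<le> 2 * norm f"
        using norm_triangle_ineq4[of "SS t f" f] SS_norm_le[OF f(1) t(1)] by simp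
      then show ?thesis
        using Cauchy_Schwarz_ineq2[of "As v - g" "SS t f - f"] g(2) e'
        by (meson less_imp_le mult_mono norm_ge_zero order_trans)
    qed
    also have "\<bar>inner g (SS t f - f)\<bar> \<le> t * norm (As g) * norm f" by (rule inner_SS_minus_le[OF g(1) f(1) t(1)])
    also have "t * norm (As g) * norm f \<le> d * (norm (As g) + 1) * norm f"
      using t d by (intro mult_right_mono mult_mono) auto
    also have "d * (norm (As g) + 1) = e / (2 * CA)"
    proof -
      have "norm (As g) + 1 \<noteq> 0" using norm_ge_zero[of "As g"] by linarith
      then show ?thesis by (simp add: d_def)
    qed
    also have "e' * (2 * norm f) + e / (2 * CA) * norm f = (e / CA) * norm f"
      using CA_pos by (simp add: e'_def field_simps)
    also have "\<dots> \<le> (e / CA) * (CA * norm z)" using f(3) e CA_pos by (intro mult_left_mono) auto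
    also have "\<dots> = e * norm z" using CA_pos by simp
    finally show ?thesis by simp
  qed
  then show ?thesis using d by blast
qed

end

section \<open>Identification of the generator of \<open>T\<close> with \<open>AA\<close> on the
  embedded copy of H, and its inverse\<close>

context extended_semigroup begin

text \<open>Mean value estimate for \<open>inner v (SS s f) - s * inner (As v) f\<close>, whose
  derivative is \<open>inner (As v) (SS s f - f)\<close>. The dependence on \<open>v\<close> is only
  through \<open>norm (As v)\<close>, which is what convergence of difference quotients in the dual
  norm requires.\<close>

lemma inner_SS_taylor:
  assumes v: "v \<in> V" and f: "f \<in> H" and t: "0 \<le> t"
    and small: "\<And>r. 0 \<le> r \<Longrightarrow> r \<le> t \<Longrightarrow> norm (SS r f - f) \<le> e"
  shows "\<bar>inner v (SS t f - f) - t * inner (As v) f\<bar> \<le> t * norm (As v) * e"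
proof -
  \<comment> \<open>Both \<open>f\<close> and \<open>e\<close> are generalised, since the
    approximant \<open>h\<close> used below comes with the larger oscillation bound
    \<open>e + 2 * norm (f - h)\<close>.\<close>
  have on_dom: "\<bar>inner v (SS t f - f) - t * inner (As v) f\<bar> \<le> t * norm (As v) * e"
    if f: "f \<in> dom_A0 sbar" and small: "\<And>r. 0 \<le> r \<Longrightarrow> r \<le> t \<Longrightarrow> norm (SS r f - f) \<le> e" for f e
  proof -
    have "norm ((inner v (SS t f) - t * inner (As v) f) - (inner v (SS 0 f) - 0 * inner (As v) f))
        \<le> (norm (As v) * e) * norm (t - 0)"
    proof (rule differentiable_bound[where S = "{0..t}" and f' = "\<lambda>s d. d * inner (As v) (SS s f - f)"])
      fix s assume s: "s \<in> {0..t}"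
      have "inner v (A0 sbar \<mu> (SS s f)) = inner (As v) (SS s f)"
        using dp_AA[OF v, of "SS s f"] dp_em[OF v, of "A0 sbar \<mu> (SS s f)"] AA_dom_A0[OF SS_dom_A0(1)[OF f, of s]] s
        by simp
      moreover have "((\<lambda>s. inner v (SS s f)) has_derivative (\<lambda>d. inner v (d *\<^sub>R A0 sbar \<mu> (SS s f)))) (at s within {0..})"
        using SS_derivative[OF f, of s] s unfolding has_vector_derivative_def
        by (intro has_derivative_inner_right) auto
      ultimately have "((\<lambda>s. inner v (SS s f)) has_derivative (\<lambda>d. d * inner (As v) (SS s f))) (at s within {0..t})"
        by (auto intro: has_derivative_subset)
      from has_derivative_diff[OF this has_derivative_mult_left[OF has_derivative_ident, of "inner (As v) f"]]
      show "((\<lambda>s. inner v (SS s f) - s * inner (As v) f) has_derivative (\<lambda>d. d * inner (As v) (SS s f - f))) (at s within {0..t})"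
        by (simp add: inner_diff_right right_diff_distrib)
      have bd: "\<bar>inner (As v) (SS s f - f)\<bar> \<le> norm (As v) * e"
        using Cauchy_Schwarz_ineq2[of "As v" "SS s f - f"] mult_left_mono[OF small[of s], of "norm (As v)"] s
        by simp
      show "onorm (\<lambda>d. d * inner (As v) (SS s f - f)) \<le> norm (As v) * e"
      proof (rule onorm_bound)
        show "norm (d * inner (As v) (SS s f - f)) \<le> norm (As v) * e * norm d" for d
          using mult_right_mono[OF bd, of "\<bar>d\<bar>"] by (simp add: abs_mult mult.commute)
        show "0 \<le> norm (As v) * e" using bd by linarith
      qed
    qed (use t in auto)
    then show ?thesis using t S.S_0[OF dom_A0_H[OF f]]
      by (simp add: inner_diff_right mult.commute mult.left_commute algebra_simps)
  qed
  show ?thesis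
  proof (rule field_le_epsilon)
    fix \<delta> :: real assume \<delta>: "0 < \<delta>"
    define C where "C = 2 * norm v + 3 * (t * norm (As v))"
    have C: "0 \<le> C" using t by (simp add: C_def)
    obtain h where h: "h \<in> dom_A0 sbar" "norm (f - h) < \<delta> / (C + 1)"
      using dom_A0_dense[OF f, of "\<delta> / (C + 1)"] \<delta> C by auto
    have hH: "h \<in> H" by (rule dom_A0_H[OF h(1)])
    have fh: "f - h \<in> H" using f hH by (rule subspace_diff[OF subspace_H_space])
    have two: "norm (SS r (f - h) - (f - h)) \<le> 2 * norm (f - h)" if "0 \<le> r" for r
      using norm_triangle_ineq4[of "SS r (f - h)" "f - h"] SS_norm_le[OF fh that] by simp
    have "norm (SS r h - h) \<le> e + 2 * norm (f - h)" if "0 \<le> r" "r \<le> t" for r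
    proof -
      have dec: "SS r h - h = (SS r f - f) - (SS r (f - h) - (f - h))"
        using that by (simp add: S.S_diff[OF _ f hH])
      show ?thesis unfolding dec by (rule norm_triangle_le_diff) (use small[OF that] two that in \<open>auto intro: add_mono\<close>)
    qed
    then have "\<bar>inner v (SS t h - h) - t * inner (As v) h\<bar> \<le> t * norm (As v) * (e + 2 * norm (f - h))"
      by (intro on_dom[OF h(1)])
    moreover have "\<bar>inner v (SS t (f - h) - (f - h))\<bar> \<le> norm v * (2 * norm (f - h))"
      using Cauchy_Schwarz_ineq2[of v "SS t (f - h) - (f - h)"] mult_left_mono[OF two[OF t], of "norm v"] by simp
    moreover have "\<bar>t * inner (As v) (f - h)\<bar> \<le> t * (norm (As v) * norm (f - h))"
      using Cauchy_Schwarz_ineq2[of "As v" "f - h"] t by (simp add: abs_mult mult_left_mono)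
    moreover have "inner v (SS t f - f) - t * inner (As v) f =
        (inner v (SS t h - h) - t * inner (As v) h) + inner v (SS t (f - h) - (f - h)) - t * inner (As v) (f - h)"
      by (simp add: S.S_diff[OF t f hH] inner_diff_right algebra_simps)
    ultimately have "\<bar>inner v (SS t f - f) - t * inner (As v) f\<bar> \<le>
        t * norm (As v) * (e + 2 * norm (f - h)) + norm v * (2 * norm (f - h)) + t * (norm (As v) * norm (f - h))"
      by linarith
    also have "\<dots> = t * norm (As v) * e + C * norm (f - h)" by (simp add: C_def algebra_simps)
    also have "C * norm (f - h) \<le> (C + 1) * norm (f - h)" by (intro mult_right_mono) auto
    also have "(C + 1) * norm (f - h) \<le> \<delta>" using h(2) C by (simp add: field_simps)
    finally show "\<bar>inner v (SS t f - f) - t * inner (As v) f\<bar> \<le> t * norm (As v) * e + \<delta>" by simp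
  qed
qed

text \<open>\<open>inner_SS_taylor\<close> is uniform over the unit ball of \<open>V\<close>, and
  testing over that ball is the norm of V'.\<close>

lemma em_graph: assumes f: "f \<in> H" shows "(em f, AA f) \<in> generator_graph UNIV T"
proof -
  have "((\<lambda>t. (T t (em f) - em f) /\<^sub>R t) \<longlongrightarrow> AA f) (at_right 0)"
  proof (rule tendstoI)
    fix e :: real assume e: "0 < e"
    obtain d where d: "d > 0" "\<And>h. 0 \<le> h \<Longrightarrow> h < d \<Longrightarrow> norm (SS h f - f) < e / 2"
      using S.S_near_zero[OF f, of "e / 2"] e by auto
    have "\<forall>\<^sub>F t in at_right 0. t \<in> {0<..<d}" using d(1) by (rule eventually_at_right_real)
    then show "\<forall>\<^sub>F t in at_right 0. dist ((T t (em f) - em f) /\<^sub>R t) (AA f) < e"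
    proof eventually_elim
      case (elim t)
      then have t: "0 < t" "t < d" by auto
      have "norm ((T t (em f) - em f) /\<^sub>R t - AA f) \<le> e / 2"
      proof (rule dual_norm_le)
        fix v assume v: "v \<in> V"
        interpret linear "dp v" by (rule dp_linear[OF v])
        have "t * dp v ((T t (em f) - em f) /\<^sub>R t - AA f) = inner v (SS t f - f) - t * inner (As v) f"
        proof -
          have "dp v ((T t (em f) - em f) /\<^sub>R t - AA f) = inner v (SS t f - f) / t - inner (As v) f"
            using t by (simp add: T_em f diff scale dp_em[OF v] dp_AA[OF v] inner_diff_right divide_inverse mult.commute)
          then show ?thesis using t by (simp add: right_diff_distrib)
        qed
        moreover have "\<bar>inner v (SS t f - f) - t * inner (As v) f\<bar> \<le> t * norm (As v) * (e / 2)"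
          using t d(2) by (intro inner_SS_taylor v f) (auto intro!: less_imp_le)
        ultimately have "t * \<bar>dp v ((T t (em f) - em f) /\<^sub>R t - AA f)\<bar> \<le> t * (norm (As v) * (e / 2))"
          using t by (metis abs_mult abs_of_pos mult.assoc)
        then have "\<bar>dp v ((T t (em f) - em f) /\<^sub>R t - AA f)\<bar> \<le> norm (As v) * (e / 2)" using t by simp
        also have "\<dots> \<le> Vn v * (e / 2)" using e by (intro mult_right_mono norm_As_le_Vn) auto
        finally show "\<bar>dp v ((T t (em f) - em f) /\<^sub>R t - AA f)\<bar> \<le> e / 2 * Vn v" by (simp add: mult.commute)
      qed (use e in simp)
      then show ?case using e by (simp add: dist_norm)
    qed
  qed
  then show ?thesis by (simp add: generator_graph_def)
qed

text \<open>With \<open>AA f = y\<close>, the difference \<open>x - em f\<close> is in the kernel of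
  the generator, so its orbit is constant; the exponential decay of \<open>T\<close> leaves only
  0.\<close>

lemma graph_eq: assumes xy: "(x, y) \<in> generator_graph UNIV T" shows "\<exists>f\<in>H. x = em f \<and> y = AA f"
proof -
  obtain f where f: "f \<in> H" "AA f = y" using AA_surj[of y] by blast
  have "((\<lambda>t. (T t x - x) /\<^sub>R t - (T t (em f) - em f) /\<^sub>R t) \<longlongrightarrow> y - AA f) (at_right 0)"
    using xy em_graph[OF f(1)] by (intro tendsto_diff) (auto simp: generator_graph_def)
  moreover have "\<forall>\<^sub>F t in at_right 0. (T t x - x) /\<^sub>R t - (T t (em f) - em f) /\<^sub>R t = (T t (x - em f) - (x - em f)) /\<^sub>R t"
    using eventually_at_right_less[of 0]
    by eventually_elim (simp add: T.S_diff algebra_simps flip: scaleR_diff_right)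
  ultimately have "((\<lambda>t. (T t (x - em f) - (x - em f)) /\<^sub>R t) \<longlongrightarrow> 0) (at_right 0)"
    using f(2) by (simp add: filterlim_cong[OF refl refl])
  then have g0: "(x - em f, 0) \<in> generator_graph UNIV T" by (simp add: generator_graph_def)
  have const: "T t (x - em f) = x - em f" if t: "0 \<le> t" for t
  proof -
    have "((\<lambda>s. T s (x - em f)) has_vector_derivative 0) (at s within {0..})" if "s \<in> {0..}" for s
    proof -
      have "T s 0 = 0" using T.S_scale[of s 0 0] that by simp
      then show ?thesis using T.orbit_derivative[OF g0, of s] that by simp
    qed
    from has_vector_derivative_zero_constant[OF convex_real_interval(1) this]
    obtain c where "\<And>s. s \<in> {0..} \<Longrightarrow> T s (x - em f) = c" by blast
    from this[of t] this[of 0] show ?thesis using t T.S_0[of "x - em f"] by simp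
  qed
  have "(\<lambda>n. CA * exp (- \<mu> * real n) * norm (x - em f)) \<longlonglongrightarrow> CA * 0 * norm (x - em f)"
  proof (intro tendsto_intros)
    have "filterlim (\<lambda>n. - \<mu> * real n) at_bot sequentially"
      using filterlim_tendsto_neg_mult_at_bot[OF tendsto_const[of "- \<mu>"] _ filterlim_real_sequentially] \<mu> by simp
    then show "(\<lambda>n. exp (- \<mu> * real n)) \<longlonglongrightarrow> 0" by (rule filterlim_compose[OF exp_at_bot])
  qed
  then have "(\<lambda>n. CA * exp (- \<mu> * real n) * norm (x - em f)) \<longlonglongrightarrow> 0" by simp
  moreover have "norm (x - em f) \<le> CA * exp (- \<mu> * real n) * norm (x - em f)" for n
    using T_bound[of "real n" "x - em f"] const[of "real n"] by simp
  ultimately have "norm (x - em f) \<le> 0" by (intro LIMSEQ_le_const) auto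
  then show ?thesis using f by auto
qed

text \<open>The difference is orthogonal to \<open>V\<close>, and approximating it by elements of
  \<open>V\<close> cannot do better than its own norm, by Pythagoras; density makes that norm
  zero.\<close>

lemma em_inj: assumes "f \<in> H" "g \<in> H" "em f = em g" shows "f = g"
proof -
  have fg: "f - g \<in> H" using assms by (intro subspace_diff[OF subspace_H_space])
  have orth: "inner (f - g) v = 0" if v: "v \<in> V" for v
    using dp_em[OF v, of f] dp_em[OF v, of g] assms(3) by (simp add: inner_diff_right inner_commute[of _ v])
  have "norm (f - g) < e" if e: "0 < e" for e
  proof -
    obtain v where v: "v \<in> V" "norm ((f - g) - v) < e" using V_dense[OF fg e] by blast
    have "(norm ((f - g) - v))\<^sup>2 = (norm (f - g))\<^sup>2 + (norm v)\<^sup>2"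
      using dot_norm_neg[of "f - g" v] orth[OF v(1)] by simp
    then have "(norm (f - g))\<^sup>2 \<le> (norm ((f - g) - v))\<^sup>2" by simp
    then have "norm (f - g) \<le> norm ((f - g) - v)" by (rule power2_le_imp_le) simp
    then show ?thesis using v(2) by simp
  qed
  then have "norm (f - g) \<le> 0" by (meson less_irrefl not_le)
  then show ?thesis by simp
qed

lemma gen_dom_eq: "gen_dom T = em ` H"
  unfolding gen_dom_def using graph_eq em_graph by blast

lemma gen_em: assumes f: "f \<in> H" shows "gen T (em f) = AA f"
  unfolding gen_def
proof (rule the_equality)
  show "(em f, AA f) \<in> generator_graph UNIV T" by (rule em_graph[OF f])
  show "y = AA f" if "(em f, y) \<in> generator_graph UNIV T" for y
    using graph_eq[OF that] em_inj[OF f] by auto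
qed

lemma AA_inj: assumes "f \<in> H" "g \<in> H" "AA f = AA g" shows "f = g"
proof -
  have fg: "f - g \<in> H" using assms by (intro subspace_diff[OF subspace_H_space])
  then obtain v where v: "v \<in> V" "As v = f - g" using As_surj by blast
  have "inner (As v) (f - g) = 0"
    using dp_AA[OF v(1), of f] dp_AA[OF v(1), of g] assms(3) by (simp add: inner_diff_right)
  then show ?thesis using v(2) by simp
qed

lemma gen_inv_AA: assumes f: "f \<in> H" shows "gen_inv T (AA f) = em f"
  unfolding gen_inv_def
proof (rule inv_into_f_eq)
  show "inj_on (gen T) (gen_dom T)"
    unfolding gen_dom_eq by (auto intro!: inj_onI dest: AA_inj simp: gen_em)
qed (use f in \<open>auto simp: gen_dom_eq gen_em\<close>)

lemma gen_inv_range: "gen_inv T z \<in> em ` H" and gen_gen_inv: "gen T (gen_inv T z) = z"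
proof -
  obtain f where f: "f \<in> H" "AA f = z" using AA_surj[of z] by blast
  show "gen_inv T z \<in> em ` H" using gen_inv_AA[OF f(1)] f by auto
  show "gen T (gen_inv T z) = z" using gen_inv_AA[OF f(1)] f gen_em[OF f(1)] by simp
qed

lemma gen_inv_gen: assumes "x \<in> gen_dom T" shows "gen_inv T (gen T x) = x"
  using assms by (auto simp: gen_dom_eq gen_em gen_inv_AA)

lemma gen_inv_linear:
  "gen_inv T (z + w) = gen_inv T z + gen_inv T w" "gen_inv T (c *\<^sub>R z) = c *\<^sub>R gen_inv T z"
proof -
  obtain f where f: "f \<in> H" "AA f = z" using AA_surj[of z] by blast
  obtain g where g: "g \<in> H" "AA g = w" using AA_surj[of w] by blast
  have "AA (f + g) = z + w" "AA (c *\<^sub>R f) = c *\<^sub>R z"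
  proof -
    show "AA (f + g) = z + w"
    proof (rule dual_eqI)
      fix v assume v: "v \<in> V"
      interpret linear "dp v" by (rule dp_linear[OF v])
      show "dp v (AA (f + g)) = dp v (z + w)"
        unfolding f(2)[symmetric] g(2)[symmetric] by (simp add: add dp_AA[OF v] inner_add_right)
    qed
    show "AA (c *\<^sub>R f) = c *\<^sub>R z"
    proof (rule dual_eqI)
      fix v assume v: "v \<in> V"
      interpret linear "dp v" by (rule dp_linear[OF v])
      show "dp v (AA (c *\<^sub>R f)) = dp v (c *\<^sub>R z)"
        unfolding f(2)[symmetric] by (simp add: scale dp_AA[OF v])
    qed
  qed
  then show "gen_inv T (z + w) = gen_inv T z + gen_inv T w" "gen_inv T (c *\<^sub>R z) = c *\<^sub>R gen_inv T z"
    using gen_inv_AA f g subspace_add[OF subspace_H_space f(1) g(1)] subspace_scale[OF subspace_H_space f(1), of c]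
    by (metis em_linear(1), metis em_linear(2))
qed

lemma orbit_pairing_derivative:
  assumes v: "v \<in> V" and f: "f \<in> H" and t: "0 \<le> t"
  shows "((\<lambda>s. dp v (T s (em f))) has_real_derivative dp v (T t (AA f))) (at t within {0..})"
proof -
  have "((\<lambda>s. T s (em f)) has_derivative (\<lambda>d. d *\<^sub>R T t (AA f))) (at t within {0..})"
    using T.orbit_derivative[OF em_graph[OF f] t] unfolding has_vector_derivative_def .
  from bounded_linear.has_derivative[OF dp_bounded_linear[OF v] this]
  show ?thesis
    using linear_scale[OF dp_linear[OF v]]
    by (simp add: has_field_derivative_def mult_commute_abs)
qed

text \<open>Freezing negative times at 0 makes the flow continuous on the whole space, hence Borel,
  without any domain condition in later integrands.\<close>

lemma T_max_continuous: "continuous_on UNIV (\<lambda>(t, z). T (max 0 t) z)"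
proof -
  have "continuous_on UNIV ((\<lambda>(t, z). T t z) \<circ> (\<lambda>(t, z). (max 0 t, z)))"
  proof (rule continuous_on_compose)
    show "continuous_on UNIV (\<lambda>(t :: real, z :: 'd). (max 0 t, z))"
      by (auto intro!: continuous_intros simp: split_beta)
    show "continuous_on ((\<lambda>(t, z). (max 0 t, z)) ` UNIV) (\<lambda>(t, z). T t z)"
      by (rule continuous_on_subset[OF T_jointly_continuous]) auto
  qed
  then show ?thesis by (simp add: o_def split_beta)
qed

lemma orbit_measurable [measurable]: "(\<lambda>t. T (max 0 t) z) \<in> borel_measurable borel"
proof -
  have "continuous_on UNIV ((\<lambda>(t, z). T (max 0 t) z) \<circ> (\<lambda>t. (t, z)))"
    by (intro continuous_on_compose continuous_intros continuous_on_subset[OF T_max_continuous]) auto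
  then show ?thesis by (intro borel_measurable_continuous_onI) (simp add: o_def)
qed

lemma dp_T_bound: assumes v: "v \<in> V" and t: "0 \<le> t" shows "\<bar>dp v (T t z)\<bar> \<le> Vn v * CA * norm z"
  using dp_le[OF v, of "T t z"] mult_left_mono[OF T_bound'[OF t, of z], of "Vn v"] by simp

section \<open>The Laplace transform of an orbit, paired with \<alpha>, equals the pairing with the
  resolvent\<close>

context
  fixes lam :: real and r \<alpha> :: L2
  assumes lam: "0 < lam" and r: "r \<in> V" and \<alpha>: "\<alpha> \<in> V" and eq: "lam *\<^sub>R r - As r = \<alpha>"
begin

text \<open>The Laplace integrand is extended by zero to negative times, so that translation in time
  and Fubini act on the whole line.\<close>

definition lap :: "'d \<Rightarrow> real \<Rightarrow> real" where
  "lap z t = expk lam t * dp \<alpha> (T (max 0 t) z)"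

lemma lap_measurable [measurable]: "lap z \<in> borel_measurable borel"
proof -
  have "dp \<alpha> \<in> borel_measurable borel"
    by (intro borel_measurable_continuous_onI linear_continuous_on dp_bounded_linear \<alpha>)
  then have "(\<lambda>t. dp \<alpha> (T (max 0 t) z)) \<in> borel_measurable borel"
    by (rule measurable_compose[OF orbit_measurable])
  then show ?thesis unfolding lap_def by measurable
qed

lemma lap_bound: "\<bar>lap z t\<bar> \<le> expk lam t * (Vn \<alpha> * CA * norm z)"
  using dp_T_bound[OF \<alpha>, of "max 0 t" z] by (simp add: lap_def abs_mult mult_left_mono)

lemma lap_integrable: "integrable lborel (lap z)"
proof (rule Bochner_Integration.integrable_bound)
  show "integrable lborel (\<lambda>t. expk lam t * (Vn \<alpha> * CA * norm z))"
    using integrable_expk[OF lam] by simp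
  show "AE t in lborel. norm (lap z t) \<le> norm (expk lam t * (Vn \<alpha> * CA * norm z))"
    using lap_bound by (intro AE_I2) (metis abs_ge_self order_trans real_norm_def)
qed simp

lemma lap_norm_le: "\<bar>LBINT t. lap z t\<bar> \<le> (1 / lam) * (Vn \<alpha> * CA * norm z)"
proof -
  have "norm (LBINT t. lap z t) \<le> (LBINT t. expk lam t * (Vn \<alpha> * CA * norm z))"
    using integrable_expk[OF lam] lap_bound
    by (intro Bochner_Integration.integral_norm_bound_integral lap_integrable) auto
  then show ?thesis using integral_expk[OF lam] by simp
qed

text \<open>The resolvent equation for \<open>r\<close> says exactly that the discounted pairing
  \<open>G\<close> of \<open>r\<close> with the orbit has derivative \<open>- lap\<close>. It starts
  at \<open>dp r (em f)\<close> and dies out at infinity.\<close>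

lemma lap_em: assumes f: "f \<in> H" shows "(LBINT t. lap (em f) t) = dp r (em f)"
proof -
  define G where "G t = exp (- lam * t) * dp r (T t (em f))" for t
  have key: "dp r (T t (AA f)) = lam * dp r (T t (em f)) - dp \<alpha> (T t (em f))" if "0 \<le> t" for t
  proof -
    have "dp r (T t (AA f)) = inner (lam *\<^sub>R r - \<alpha>) (SS t f)"
      using T_AA[OF f that] eq by (simp add: dp_AA[OF r] algebra_simps)
    then show ?thesis using T_em[OF that f] by (simp add: dp_em r \<alpha> inner_diff_left)
  qed
  have der: "(G has_real_derivative - lap (em f) t) (at t within {0..})" if t: "0 \<le> t" for t
    unfolding G_def using orbit_pairing_derivative[OF r f t] key[OF t] t
    by (auto intro!: derivative_eq_intros simp: lap_def expk_def algebra_simps)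
  have cont: "continuous_on {0..a} (\<lambda>t. - lap (em f) t)" for a
  proof -
    have "continuous_on {0..a} (\<lambda>t. - (exp (- lam * t) * dp \<alpha> (T t (em f))))"
      by (intro continuous_intros bounded_linear.continuous_on[OF dp_bounded_linear[OF \<alpha>]]
          continuous_on_subset[OF T.orbit_continuous]) auto
    then show ?thesis by (rule continuous_on_eq) (auto simp: lap_def expk_def)
  qed
  have ftc: "(LBINT t. indicator {0..real n} t *\<^sub>R (- lap (em f) t)) = G (real n) - G 0" for n
  proof (rule integral_FTC_Icc)
    fix x assume x: "0 \<le> x" "x \<le> real n"
    have "(G has_real_derivative - lap (em f) x) (at x within {0..real n})"
      by (rule has_field_derivative_subset[OF der[OF x(1)]]) auto
    then show "(G has_vector_derivative - lap (em f) x) (at x within {0..real n})"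
      by (simp add: has_real_derivative_iff_has_vector_derivative)
  qed (use cont in auto)
  have "(\<lambda>n. LBINT t. indicator {0..real n} t *\<^sub>R lap (em f) t) \<longlonglongrightarrow> (LBINT t. lap (em f) t)"
  proof (rule integral_dominated_convergence[where w = "\<lambda>t. norm (lap (em f) t)"])
    show "AE t in lborel. (\<lambda>n. indicator {0..real n} t *\<^sub>R lap (em f) t) \<longlonglongrightarrow> lap (em f) t"
    proof (intro AE_I2 tendsto_eventually)
      fix t :: real
      show "\<forall>\<^sub>F n in sequentially. indicator {0..real n} t *\<^sub>R lap (em f) t = lap (em f) t"
        using eventually_ge_at_top[of "nat \<lceil>t\<rceil>"]
        by eventually_elim (auto simp: lap_def expk_def indicator_def nat_le_iff ceiling_le_iff)
    qed
    show "AE t in lborel. norm (indicator {0..real n} t *\<^sub>R lap (em f) t) \<le> norm (lap (em f) t)" for n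
      by (simp add: indicator_def)
  qed (auto intro: integrable_norm lap_integrable)
  moreover have "(LBINT t. indicator {0..real n} t *\<^sub>R lap (em f) t) = G 0 - G (real n)" for n
    using ftc[of n] by simp
  moreover have "(\<lambda>n. G (real n)) \<longlonglongrightarrow> 0"
  proof (rule Lim_null_comparison)
    show "\<forall>\<^sub>F n in sequentially. norm (G (real n)) \<le> exp (- lam * real n) * (Vn r * CA * norm (em f))"
      using dp_T_bound[OF r] by (intro always_eventually allI) (simp add: G_def abs_mult mult.assoc)
    have "filterlim (\<lambda>n. - lam * real n) at_bot sequentially"
      using filterlim_tendsto_neg_mult_at_bot[OF tendsto_const[of "- lam"] _ filterlim_real_sequentially] lam by simp
    then have "(\<lambda>n. exp (- lam * real n)) \<longlonglongrightarrow> 0" by (rule filterlim_compose[OF exp_at_bot])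
    then show "(\<lambda>n. exp (- lam * real n) * (Vn r * CA * norm (em f))) \<longlonglongrightarrow> 0"
      by (rule tendsto_mult_left_zero)
  qed
  then have "(\<lambda>n. G 0 - G (real n)) \<longlonglongrightarrow> G 0 - 0" by (rule tendsto_diff[OF tendsto_const])
  ultimately have "(LBINT t. lap (em f) t) = G 0" by (simp add: LIMSEQ_unique)
  then show ?thesis using T.S_0[of "em f"] by (simp add: G_def)
qed

text \<open>Every \<open>z\<close> is some \<open>AA f\<close>; replacing \<open>f\<close> by a
  nearby \<open>g\<close> in the domain turns \<open>AA g\<close> into an embedded element of
  H.\<close>

lemma em_dense: assumes "0 < e" shows "\<exists>f\<in>H. norm (z - em f) < e"
proof -
  obtain f where f: "f \<in> H" "AA f = z" using AA_surj[of z] by blast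
  obtain g where g: "g \<in> dom_A0 sbar" "norm (f - g) < e" using dom_A0_dense[OF f(1) assms] by blast
  have "norm (z - em (A0 sbar \<mu> g)) < e"
    using norm_AA_le[of "f - g"] g(2) f(2) AA_dom_A0[OF g(1)] by (simp add: AA_diff)
  moreover have "A0 sbar \<mu> g \<in> H" using SS_graph[OF g(1)] by (simp add: generator_graph_def)
  ultimately show ?thesis by blast
qed

lemma lap_eq: "(LBINT t. lap z t) = dp r z"
proof -
  define C where "C = (1 / lam) * (Vn \<alpha> * CA) + Vn r"
  have C: "0 \<le> C" using lam CA_pos by (simp add: C_def)
  interpret r: linear "dp r" by (rule dp_linear[OF r])
  interpret a: linear "dp \<alpha>" by (rule dp_linear[OF \<alpha>])
  have "\<bar>(LBINT t. lap z t) - dp r z\<bar> \<le> 0"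
  proof (rule field_le_epsilon)
    fix e :: real assume e: "0 < e"
    obtain f where f: "f \<in> H" "norm (z - em f) < e / (C + 1)" using em_dense[of "e / (C + 1)"] e C by auto
    have "lap z t = lap (z - em f) t + lap (em f) t" for t
      by (simp add: lap_def T.S_diff a.diff algebra_simps)
    then have "(LBINT t. lap z t) = (LBINT t. lap (z - em f) t) + dp r (em f)"
      using lap_em[OF f(1)] by (simp add: Bochner_Integration.integral_add lap_integrable)
    then have "(LBINT t. lap z t) - dp r z = (LBINT t. lap (z - em f) t) - dp r (z - em f)" by (simp add: r.diff)
    then have "\<bar>(LBINT t. lap z t) - dp r z\<bar> \<le> \<bar>LBINT t. lap (z - em f) t\<bar> + \<bar>dp r (z - em f)\<bar>" by linarith
    also have "\<dots> \<le> (1 / lam) * (Vn \<alpha> * CA * norm (z - em f)) + Vn r * norm (z - em f)"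
      by (intro add_mono lap_norm_le dp_le r)
    also have "\<dots> = C * norm (z - em f)" by (simp add: C_def algebra_simps)
    also have "\<dots> \<le> (C + 1) * norm (z - em f)" by (intro mult_right_mono) auto
    also have "\<dots> \<le> e" using f(2) C by (simp add: field_simps)
    finally show "\<bar>(LBINT t. lap z t) - dp r z\<bar> \<le> 0 + e" by simp
  qed
  then show ?thesis by simp
qed

end

end

section \<open>The control cost and its conjugate\<close>

locale control_cost = age_interval sbar for sbar :: ereal +
  fixes \<beta>0 \<epsilon> :: real and \<beta>1 :: "real \<Rightarrow> real" and q :: "real \<times> L2"
  assumes q: "q \<in> U_space sbar"
    and \<beta>1_meas: "set_borel_measurable lborel (einterval 0 sbar) \<beta>1"
    and \<beta>1_bdd: "\<exists>C. AE s in lborel. s \<in> einterval 0 sbar \<longrightarrow> \<bar>\<beta>1 s\<bar> \<le> C"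
    and \<epsilon>: "0 < \<epsilon>" and \<beta>0: "\<epsilon> \<le> \<beta>0"
    and \<beta>1_low: "AE s in lborel. s \<in> einterval 0 sbar \<longrightarrow> \<epsilon> \<le> \<beta>1 s"
begin

abbreviation "U \<equiv> U_space sbar"
abbreviation "hh \<equiv> h0 sbar \<beta>0 \<beta>1 q"
abbreviation "MM \<equiv> M_op sbar \<beta>0 \<beta>1"

text \<open>\<open>\<beta>1\<close> is controlled on the interval only, so this coefficient and the
  reciprocal \<open>mi\<close> are cut off there. \<open>NN\<close> is half the Hessian of the cost,
  and \<open>MM\<close> inverts \<open>2 NN\<close> on \<open>U\<close>.\<close>

definition m\<beta> :: "real \<Rightarrow> real" where "m\<beta> s = indicator (einterval 0 sbar) s * \<beta>1 s"
definition mi :: "real \<Rightarrow> real" where "mi s = indicator (einterval 0 sbar) s / (2 * \<beta>1 s)"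
definition NN :: "real \<times> L2 \<Rightarrow> real \<times> L2" where "NN u = (\<beta>0 * fst u, mult_L2 m\<beta> (snd u))"

lemma \<beta>0_pos: "0 < \<beta>0" using \<epsilon> \<beta>0 by simp

lemma m\<beta>_measurable [measurable]: "m\<beta> \<in> borel_measurable borel"
  using \<beta>1_meas unfolding set_borel_measurable_def m\<beta>_def by simp

lemma m\<beta>_bounded: "\<exists>C. ess_bounded m\<beta> C"
proof -
  obtain C where "AE s in lborel. s \<in> einterval 0 sbar \<longrightarrow> \<bar>\<beta>1 s\<bar> \<le> C" using \<beta>1_bdd by blast
  then have "AE s in lborel. \<bar>m\<beta> s\<bar> \<le> max C 0"
    by eventually_elim (auto simp: m\<beta>_def indicator_def abs_mult)
  then show ?thesis by (auto simp: ess_bounded_def)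
qed

lemma mi_bounded: "ess_bounded mi (1 / (2 * \<epsilon>))"
proof -
  have "mi = (\<lambda>s. indicator (einterval 0 sbar) s / (2 * m\<beta> s))"
    by (auto simp: mi_def m\<beta>_def indicator_def)
  then have "mi \<in> borel_measurable borel" by simp
  moreover have "AE s in lborel. \<bar>mi s\<bar> \<le> 1 / (2 * \<epsilon>)"
    using \<beta>1_low
  proof eventually_elim
    case (elim s)
    then show ?case using \<epsilon> by (auto simp: mi_def indicator_def frac_le)
  qed
  ultimately show ?thesis by (simp add: ess_bounded_def)
qed

lemma MM_eq: "MM u = (fst u / (2 * \<beta>0), mult_L2 mi (snd u))"
  by (simp add: M_op_def mult_L2_def mi_def)

lemma subspace_U: "subspace U"
  unfolding U_space_def using subspace_H_space[of sbar]
  by (auto intro!: subspaceI simp: zero_prod_def plus_prod_def scaleR_prod_def subspace_0 subspace_add subspace_scale)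

lemma bounded_linear_NN: "bounded_linear NN"
proof -
  obtain C where "ess_bounded m\<beta> C" using m\<beta>_bounded by blast
  from bounded_linear_mult_L2[OF this] show ?thesis
    unfolding NN_def
    by (intro bounded_linear_Pair bounded_linear_compose[of "mult_L2 m\<beta>" snd] bounded_linear_snd
        bounded_linear_compose[OF bounded_linear_mult_right bounded_linear_fst])
qed

lemma bounded_linear_MM: "bounded_linear MM"
proof -
  have "MM = (\<lambda>u. (fst u / (2 * \<beta>0), mult_L2 mi (snd u)))" by (rule ext) (rule MM_eq)
  then show ?thesis
    by (simp only:) (intro bounded_linear_Pair bounded_linear_compose[OF bounded_linear_mult_L2[OF mi_bounded] bounded_linear_snd]
        bounded_linear_compose[OF bounded_linear_divide bounded_linear_fst])
qed

lemma NN_selfadjoint: "inner (NN u) w = inner u (NN w)"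
proof -
  obtain C where "ess_bounded m\<beta> C" using m\<beta>_bounded by blast
  from mult_L2_selfadjoint[OF this] show ?thesis by (simp add: NN_def inner_prod_def)
qed

lemma MM_selfadjoint: "inner (MM u) w = inner u (MM w)"
  using mult_L2_selfadjoint[OF mi_bounded] by (simp add: MM_eq inner_prod_def)

lemma MM_mem: "u \<in> U \<Longrightarrow> MM u \<in> U"
  using mult_L2_H_space[OF mi_bounded] by (auto simp: MM_eq U_space_def)

lemma NN_MM: assumes u: "u \<in> U" shows "2 *\<^sub>R NN (MM u) = u"
proof -
  obtain C where C: "ess_bounded m\<beta> C" using m\<beta>_bounded by blast
  have uH: "snd u \<in> H" using u by (auto simp: U_space_def)
  have "2 *\<^sub>R mult_L2 m\<beta> (mult_L2 mi (snd u)) = snd u"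
  proof (rule L2_eqI)
    have "AE s in lborel. s \<notin> einterval 0 sbar \<longrightarrow> rep_L2 (snd u) s = 0" using uH by (simp add: H_space_def)
    then show "AE s in lborel. rep_L2 (2 *\<^sub>R mult_L2 m\<beta> (mult_L2 mi (snd u))) s = rep_L2 (snd u) s"
      using rep_mult_L2[OF C, of "mult_L2 mi (snd u)"] rep_mult_L2[OF mi_bounded, of "snd u"]
        rep_scaleR[of 2 "mult_L2 m\<beta> (mult_L2 mi (snd u))"] \<beta>1_low
    proof eventually_elim
      case (elim s)
      then show ?case using \<epsilon> by (cases "s \<in> einterval 0 sbar") (auto simp: m\<beta>_def mi_def)
    qed
  qed
  then show ?thesis using \<beta>0_pos by (cases u) (simp add: NN_def MM_eq scaleR_prod_def)
qed

lemma NN_coercive: assumes u: "u \<in> U" shows "\<epsilon> * (norm u)\<^sup>2 \<le> inner u (NN u)"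
proof -
  obtain C where C: "ess_bounded m\<beta> C" using m\<beta>_bounded by blast
  have uH: "snd u \<in> H" using u by (auto simp: U_space_def)
  have "\<epsilon> * (norm (snd u))\<^sup>2 \<le> inner (snd u) (mult_L2 m\<beta> (snd u))"
  proof -
    have "\<epsilon> * (norm (snd u))\<^sup>2 = (LBINT s. \<epsilon> * (rep_L2 (snd u) s)\<^sup>2)" by (simp add: norm_L2_integral)
    also have "\<dots> \<le> (LBINT s. m\<beta> s * (rep_L2 (snd u) s * rep_L2 (snd u) s))"
    proof (rule integral_mono_AE)
      show "integrable lborel (\<lambda>s. m\<beta> s * (rep_L2 (snd u) s * rep_L2 (snd u) s))"
        using square_integrable_mult[OF square_integrable_ess_bounded[OF C square_integrable_rep] square_integrable_rep, of "snd u" "snd u"]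
        by (simp add: mult.assoc)
      have "AE s in lborel. s \<notin> einterval 0 sbar \<longrightarrow> rep_L2 (snd u) s = 0" using uH by (simp add: H_space_def)
      then show "AE s in lborel. \<epsilon> * (rep_L2 (snd u) s)\<^sup>2 \<le> m\<beta> s * (rep_L2 (snd u) s * rep_L2 (snd u) s)"
        using \<beta>1_low
      proof eventually_elim
        case (elim s)
        then show ?case
          by (cases "s \<in> einterval 0 sbar") (auto simp: m\<beta>_def power2_eq_square intro!: mult_right_mono)
      qed
    qed simp
    also have "\<dots> = inner (snd u) (mult_L2 m\<beta> (snd u))"
      using inner_mult_L2[OF C, of "snd u" "snd u"] by (simp add: inner_commute)
    finally show ?thesis .
  qed
  moreover have "\<epsilon> * (fst u)\<^sup>2 \<le> \<beta>0 * (fst u)\<^sup>2" using \<beta>0 by (intro mult_right_mono) auto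
  moreover have "(norm u)\<^sup>2 = (fst u)\<^sup>2 + (norm (snd u))\<^sup>2"
    unfolding power2_norm_eq_inner by (simp add: inner_prod_def power2_eq_square)
  ultimately show ?thesis
    by (simp add: NN_def inner_prod_def power2_eq_square algebra_simps)
qed

lemma hh_eq: "hh u = inner u (NN u) + inner q u"
proof -
  obtain C where C: "ess_bounded m\<beta> C" using m\<beta>_bounded by blast
  have qH: "AE s in lborel. s \<notin> einterval 0 sbar \<longrightarrow> rep_L2 (snd q) s = 0"
    using q by (auto simp: U_space_def H_space_def)
  have i1: "integrable lborel (\<lambda>s. m\<beta> s * (rep_L2 (snd u) s * rep_L2 (snd u) s))"
    using square_integrable_mult[OF square_integrable_ess_bounded[OF C square_integrable_rep] square_integrable_rep, of "snd u" "snd u"]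
    by (simp add: mult.assoc)
  have "(LBINT s=0..sbar. rep_L2 (snd u) s * (\<beta>1 s * rep_L2 (snd u) s + rep_L2 (snd q) s)) =
      (LBINT s. indicator (einterval 0 sbar) s * (rep_L2 (snd u) s * (\<beta>1 s * rep_L2 (snd u) s + rep_L2 (snd q) s)))"
    using sbar_pos by (simp add: interval_lebesgue_integral_def set_lebesgue_integral_def)
  also have "\<dots> = (LBINT s. m\<beta> s * (rep_L2 (snd u) s * rep_L2 (snd u) s) +
      indicator (einterval 0 sbar) s * (rep_L2 (snd q) s * rep_L2 (snd u) s))"
    by (intro Bochner_Integration.integral_cong refl) (simp add: m\<beta>_def algebra_simps)
  also have "\<dots> = (LBINT s. m\<beta> s * (rep_L2 (snd u) s * rep_L2 (snd u) s) + rep_L2 (snd q) s * rep_L2 (snd u) s)"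
    by (intro integral_cong_AE, measurable, use qH in eventually_elim) (auto simp: indicator_def)
  also have "\<dots> = (LBINT s. m\<beta> s * (rep_L2 (snd u) s * rep_L2 (snd u) s)) + (LBINT s. rep_L2 (snd q) s * rep_L2 (snd u) s)"
    by (intro Bochner_Integration.integral_add i1) simp
  also have "\<dots> = inner (snd u) (mult_L2 m\<beta> (snd u)) + inner (snd q) (snd u)"
    using inner_mult_L2[OF C, of "snd u" "snd u"] by (simp add: inner_L2_integral[of "snd q"] inner_commute)
  finally show ?thesis by (simp add: h0_def NN_def inner_prod_def algebra_simps)
qed

text \<open>\<open>2 NN w = p - q\<close> makes \<open>w\<close> the critical point of the concave
  quadratic on the left. This one identity yields the conjugate, its gradient and, with coercivity,
  the quadratic growth in \<open>hh_minimal\<close>.\<close>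

lemma complete_square:
  assumes p: "p \<in> U" and u: "u \<in> U"
  defines "w \<equiv> MM (p - q)"
  shows "inner p u - hh u = inner (p - q) (MM (p - q)) / 2 - inner (u - w) (NN (u - w))"
proof -
  interpret N: bounded_linear NN by (rule bounded_linear_NN)
  have "p - q \<in> U" using p q by (rule subspace_diff[OF subspace_U])
  then have pq: "p - q = 2 *\<^sub>R NN w" unfolding w_def by (simp add: NN_MM)
  have "inner p u - hh u = inner (p - q) u - inner u (NN u)" by (simp add: hh_eq inner_diff_left)
  moreover have "inner (p - q) w / 2 = inner w (NN w)" by (simp add: pq NN_selfadjoint inner_commute)
  moreover have "inner (NN w) u = inner w (NN u)" by (rule NN_selfadjoint)
  moreover have "inner u (NN w) = inner (NN w) u" by (rule inner_commute)
  ultimately show ?thesis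
    unfolding w_def[symmetric] by (simp add: pq N.diff inner_diff_left inner_diff_right)
qed

lemma NN_nonneg: "u \<in> U \<Longrightarrow> 0 \<le> inner u (NN u)"
  using NN_coercive[of u] \<epsilon> by (meson less_imp_le mult_nonneg_nonneg order_trans zero_le_power2)

text \<open>The term with \<open>\<epsilon>\<close> is the strong convexity that has to pay for all
  first-order errors in \<open>short_time_gap\<close>.\<close>

lemma hh_minimal:
  assumes p: "p \<in> U" and u: "u \<in> U"
  defines "w \<equiv> MM (p - q)"
  shows "hh w - inner p w + \<epsilon> * (norm (u - w))\<^sup>2 \<le> hh u - inner p u"
proof -
  interpret N: bounded_linear NN by (rule bounded_linear_NN)
  have w: "w \<in> U" unfolding w_def using p q by (intro MM_mem subspace_diff[OF subspace_U])
  have "\<epsilon> * (norm (u - w))\<^sup>2 \<le> inner (u - w) (NN (u - w))"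
    using u w by (intro NN_coercive subspace_diff[OF subspace_U])
  then show ?thesis
    using complete_square[OF p u] complete_square[OF p w] by (simp add: w_def N.zero)
qed

lemma conjugate_eq:
  assumes p: "p \<in> U"
  shows "convex_conjugate_on U hh p = inner (p - q) (MM (p - q)) / 2"
  unfolding convex_conjugate_on_def
proof (rule cSup_eq_maximum)
  interpret N: bounded_linear NN by (rule bounded_linear_NN)
  have w: "MM (p - q) \<in> U" using p q by (intro MM_mem subspace_diff[OF subspace_U])
  then show "inner (p - q) (MM (p - q)) / 2 \<in> (\<lambda>u. inner p u - hh u) ` U"
    using complete_square[OF p w] by (intro image_eqI[OF _ w]) (simp add: N.zero)
  show "x \<le> inner (p - q) (MM (p - q)) / 2" if "x \<in> (\<lambda>u. inner p u - hh u) ` U" for x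
    using that complete_square[OF p] w by (auto intro!: NN_nonneg subspace_diff[OF subspace_U])
qed

lemma gradient_conjugate:
  assumes p: "p \<in> U"
  shows "gradient_on U (convex_conjugate_on U hh) p = MM (p - q)"
proof -
  interpret M: bounded_linear MM by (rule bounded_linear_MM)
  have w: "MM (p - q) \<in> U" using p q by (intro MM_mem subspace_diff[OF subspace_U])
  have "((\<lambda>p. inner (p - q) (MM (p - q)) / 2) has_derivative (\<lambda>d. inner (MM (p - q)) d)) (at p within U)"
  proof -
    have "((\<lambda>p. MM (p - q)) has_derivative (\<lambda>d. MM d)) (at p within U)"
      by (intro M.has_derivative) (auto intro!: derivative_eq_intros)
    moreover have "((\<lambda>p. p - q) has_derivative (\<lambda>d. d)) (at p within U)"
      by (auto intro!: derivative_eq_intros)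
    ultimately have "((\<lambda>p. inner (p - q) (MM (p - q))) has_derivative (\<lambda>d. inner (p - q) (MM d) + inner d (MM (p - q)))) (at p within U)"
      by (intro has_derivative_inner)
    then have "((\<lambda>p. inner (p - q) (MM (p - q)) * (1/2)) has_derivative (\<lambda>d. (inner (p - q) (MM d) + inner d (MM (p - q))) * (1/2))) (at p within U)"
      by (rule has_derivative_mult_left)
    moreover have "(inner (p - q) (MM d) + inner d (MM (p - q))) * (1/2) = inner (MM (p - q)) d" for d
      using MM_selfadjoint[of "p - q" d] inner_commute[of d "MM (p - q)"] by simp
    ultimately show ?thesis by simp
  qed
  then have der: "(convex_conjugate_on U hh has_derivative (\<lambda>d. inner (MM (p - q)) d)) (at p within U)"
    by (rule has_derivative_transform[OF p, rotated]) (rule conjugate_eq)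
  show ?thesis
    unfolding gradient_on_def
  proof (rule the_equality)
    show "MM (p - q) \<in> U \<and> (convex_conjugate_on U hh has_derivative (\<lambda>d. inner (MM (p - q)) d)) (at p within U)"
      using w der by blast
    fix g assume g: "g \<in> U \<and> (convex_conjugate_on U hh has_derivative (\<lambda>d. inner g d)) (at p within U)"
    \<comment> \<open>A derivative within \<open>U\<close> determines the gradient only along
      \<open>U\<close>. The difference of two candidates lies in \<open>U\<close>, so the line
      through \<open>p\<close> in that very direction suffices to show that it is orthogonal to
      itself.\<close>
    define k where "k = g - MM (p - q)"
    have k: "k \<in> U" using g w unfolding k_def by (intro subspace_diff[OF subspace_U]) auto
    have line: "((\<lambda>t. convex_conjugate_on U hh (p + t *\<^sub>R k)) has_real_derivative inner a k) (at 0)"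
      if "(convex_conjugate_on U hh has_derivative (\<lambda>d. inner a d)) (at p within U)" for a
    proof -
      have "((\<lambda>t. p + t *\<^sub>R k) has_derivative (\<lambda>t. t *\<^sub>R k)) (at 0)"
        by (auto intro!: derivative_eq_intros)
      moreover have "(\<lambda>t. p + t *\<^sub>R k) ` UNIV \<subseteq> U"
        using subspace_add[OF subspace_U p subspace_scale[OF subspace_U k]] by blast
      from has_derivative_subset[OF that this]
      have "(convex_conjugate_on U hh has_derivative (\<lambda>d. inner a d)) (at (p + 0 *\<^sub>R k) within (\<lambda>t. p + t *\<^sub>R k) ` UNIV)"
        by simp
      ultimately have "((\<lambda>t. convex_conjugate_on U hh (p + t *\<^sub>R k)) has_derivative (\<lambda>t. inner a (t *\<^sub>R k))) (at 0)"
        by (rule has_derivative_in_compose)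
      then show ?thesis by (simp add: has_field_derivative_def mult_commute_abs)
    qed
    have "inner g k = inner (MM (p - q)) k"
      using DERIV_unique[OF line line] g der by blast
    then have "inner k k = 0" by (simp add: k_def inner_diff_left)
    then show "g = MM (p - q)" by (simp add: k_def)
  qed
qed

end

section \<open>Trajectories and the cost functional\<close>

locale vintage_capital =
  extended_semigroup sbar \<mu> dp T + control_cost sbar \<beta>0 \<epsilon> \<beta>1 q
  for sbar :: ereal and \<mu> :: real and dp :: "L2 \<Rightarrow> 'd::{banach,second_countable_topology} \<Rightarrow> real"
    and T :: "real \<Rightarrow> 'd \<Rightarrow> 'd" and \<beta>0 \<epsilon> :: real and \<beta>1 :: "real \<Rightarrow> real" and q :: "real \<times> L2" +
  fixes lam L :: real and R R' :: "real \<Rightarrow> real" and \<alpha> :: L2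
  assumes lam: "0 < lam" and \<alpha>: "\<alpha> \<in> V"
    and R_deriv: "\<And>r. (R has_real_derivative R' r) (at r)"
    and R_concave: "concave_on UNIV R" and R_lip: "L-lipschitz_on UNIV R'"
begin

abbreviation "aa \<equiv> dp \<alpha>"

lemma R_le_tangent: "R s \<le> R r + R' r * (s - r)"
proof -
  have "- R' r * (s - r) \<le> - R s - - R r"
    using R_concave R_deriv[of r]
    by (intro convex_on_imp_above_tangent[where A = UNIV])
      (auto simp: concave_on_def intro!: derivative_eq_intros)
  then show ?thesis by simp
qed

lemma L_nonneg: "0 \<le> L" using R_lip by (rule lipschitz_on_nonneg)

text \<open>The tangent at \<open>s\<close>, evaluated at \<open>r\<close>, bounds
  \<open>R s\<close> from below with the slope \<open>R' s\<close>; trading it for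
  \<open>R' r\<close> costs \<open>L * (s - r)^2\<close> by the Lipschitz condition.\<close>

lemma R_ge_parabola: "R r + R' r * (s - r) - L * (s - r)\<^sup>2 \<le> R s"
proof -
  have "R r \<le> R s + R' s * (r - s)" by (rule R_le_tangent)
  moreover have "\<bar>R' s - R' r\<bar> \<le> L * \<bar>s - r\<bar>"
    using lipschitz_onD[OF R_lip, of s r] by (simp add: dist_real_def)
  then have "\<bar>(R' s - R' r) * (s - r)\<bar> \<le> L * \<bar>s - r\<bar> * \<bar>s - r\<bar>"
    unfolding abs_mult by (intro mult_right_mono) auto
  then have "\<bar>(R' s - R' r) * (s - r)\<bar> \<le> L * (s - r)\<^sup>2" by (simp add: power2_eq_square mult.assoc)
  ultimately show ?thesis by (simp add: algebra_simps)
qed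

lemma R_antimono: assumes "r \<le> s" shows "R' s \<le> R' r"
proof (cases "r = s")
  case False
  have "0 \<le> (R' r - R' s) * (s - r)"
    using R_le_tangent[of s r] R_le_tangent[of r s] by (simp add: algebra_simps)
  then show ?thesis using assms False by (simp add: zero_le_mult_iff)
qed simp

lemma R_continuous: "continuous_on UNIV R"
  using R_deriv by (meson DERIV_isCont continuous_at_imp_continuous_on)

text \<open>Growth at most quadratic keeps the revenue integrable along trajectories that are square
  integrable with the discount weight.\<close>

lemma R_bound: "\<bar>R s\<bar> \<le> \<bar>R 0\<bar> + \<bar>R' 0\<bar> + (\<bar>R' 0\<bar> + L) * s\<^sup>2"
proof -
  have "\<bar>R s - (R 0 + R' 0 * s)\<bar> \<le> L * s\<^sup>2"
    using R_le_tangent[of s 0] R_ge_parabola[of 0 s] L_nonneg by (simp add: abs_le_iff)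
  moreover have "\<bar>R' 0 * s\<bar> \<le> \<bar>R' 0\<bar> * (1 + s\<^sup>2)"
  proof -
    have "0 \<le> (\<bar>s\<bar> - 1)\<^sup>2" by simp
    then have "2 * \<bar>s\<bar> \<le> 1 + s\<^sup>2" by (simp add: power2_diff)
    then have "\<bar>s\<bar> \<le> 1 + s\<^sup>2" using abs_ge_zero[of s] by linarith
    then show ?thesis unfolding abs_mult by (intro mult_left_mono) auto
  qed
  ultimately show ?thesis by (simp add: algebra_simps)
qed

text \<open>The costate of an equilibrium is \<open>rr\<close> multiplied by minus the marginal
  revenue.\<close>

definition rr :: L2 where "rr = resolvent_A0_adj sbar \<mu> lam \<alpha>"

lemma rr: "rr \<in> V" "lam *\<^sub>R rr - As rr = \<alpha>"
proof -
  have aH: "\<alpha> \<in> H" using \<alpha> V_subset_H by blast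
  \<comment> \<open>\<open>lam - A0_adj\<close> is \<open>lam + \<mu>\<close> minus the weak
    derivative, so the depreciation rate adds to the discount rate.\<close>
  obtain v where v: "v \<in> V" "(lam + \<mu>) *\<^sub>R v - Dw v = \<alpha>"
    using resolvent_exists[of "lam + \<mu>", OF _ aH] lam \<mu> by auto
  then have "\<alpha> \<in> (\<lambda>v. lam *\<^sub>R v - As v) ` V"
    by (intro image_eqI[of _ _ v]) (auto simp: A0_adj_def algebra_simps)
  then show "rr \<in> V" "lam *\<^sub>R rr - As rr = \<alpha>"
    unfolding rr_def resolvent_A0_adj_def by (auto intro: inv_into_into f_inv_into_f[where f = "\<lambda>v. lam *\<^sub>R v - As v"])
qed

lemmas lapd = lap_def[OF lam rr(1) \<alpha> rr(2)]
lemmas lape = lap_eq[OF lam rr(1) \<alpha> rr(2)]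
lemmas lapi = lap_integrable[OF lam rr(1) \<alpha> rr(2)]
lemmas lapb = lap_bound[OF lam rr(1) \<alpha> rr(2)]

text \<open>Only the values of a control on \<open>(0, \<infinity>)\<close> matter; \<open>Ctrl\<close> normalises them to vanish elsewhere.\<close>

definition Ctrl :: "(real \<Rightarrow> real \<times> L2) set" where
  "Ctrl = {u. u \<in> borel_measurable borel \<and> (\<forall>\<tau>. u \<tau> \<in> U) \<and> (\<forall>\<tau>\<le>0. u \<tau> = 0) \<and>
    integrable lborel (\<lambda>\<tau>. expk lam \<tau> * (norm (u \<tau>))\<^sup>2)}"

definition nrm :: "(real \<Rightarrow> real \<times> L2) \<Rightarrow> real \<Rightarrow> real \<times> L2" where
  "nrm u \<tau> = indicator {0<..} \<tau> *\<^sub>R u \<tau>"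

lemma weight_eq: "0 < \<tau> \<Longrightarrow> (norm (exp (- lam * \<tau> / 2) *\<^sub>R (x :: real \<times> L2)))\<^sup>2 = expk lam \<tau> * (norm x)\<^sup>2"
proof -
  assume "0 < \<tau>"
  have "(exp (- lam * \<tau> / 2))\<^sup>2 = exp (- lam * \<tau>)" by (simp add: power2_eq_square flip: exp_add)
  then show ?thesis using \<open>0 < \<tau>\<close> by (simp add: power_mult_distrib expk_def)
qed

lemma controls_iff: "u \<in> controls sbar lam \<longleftrightarrow> nrm u \<in> Ctrl"
proof -
  have "(\<forall>\<tau>>0. u \<tau> \<in> U) \<longleftrightarrow> (\<forall>\<tau>. nrm u \<tau> \<in> U)"
    using subspace_0[OF subspace_U] by (auto simp: nrm_def indicator_def)
  moreover have "set_borel_measurable lborel {0<..} u \<longleftrightarrow> nrm u \<in> borel_measurable borel"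
  proof -
    have "nrm u = (\<lambda>x. indicator {0<..} x *\<^sub>R u x)" by (simp add: nrm_def fun_eq_iff)
    then show ?thesis by (simp add: set_borel_measurable_def)
  qed
  moreover have "set_integrable lborel {0<..} (\<lambda>\<tau>. (norm (exp (- lam * \<tau> / 2) *\<^sub>R u \<tau>))\<^sup>2) \<longleftrightarrow>
      integrable lborel (\<lambda>\<tau>. expk lam \<tau> * (norm (nrm u \<tau>))\<^sup>2)"
    unfolding set_integrable_def
  proof (rule Bochner_Integration.integrable_cong[OF refl])
    fix \<tau> :: real
    show "indicator {0<..} \<tau> *\<^sub>R (norm (exp (- lam * \<tau> / 2) *\<^sub>R u \<tau>))\<^sup>2 = expk lam \<tau> * (norm (nrm u \<tau>))\<^sup>2"
      using weight_eq[of \<tau> "u \<tau>"] by (cases "0 < \<tau>") (auto simp: nrm_def)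
  qed
  moreover have "\<forall>\<tau>\<le>0. nrm u \<tau> = 0" by (simp add: nrm_def)
  ultimately show ?thesis unfolding controls_def Ctrl_def mem_Collect_eq by blast
qed

lemma nrm_Ctrl: "u \<in> Ctrl \<Longrightarrow> nrm u = u"
  by (rule HOL.ext) (auto simp: nrm_def Ctrl_def indicator_def)

lemma Ctrl_mem: "u \<in> Ctrl \<Longrightarrow> u \<tau> \<in> U"
  and Ctrl_zero: "u \<in> Ctrl \<Longrightarrow> \<tau> \<le> 0 \<Longrightarrow> u \<tau> = 0"
  and Ctrl_measurable: "u \<in> Ctrl \<Longrightarrow> u \<in> borel_measurable borel"
  and Ctrl_square: "u \<in> Ctrl \<Longrightarrow> integrable lborel (\<lambda>\<tau>. expk lam \<tau> * (norm (u \<tau>))\<^sup>2)"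
  by (auto simp: Ctrl_def)

text \<open>The variation of constants integrand as a kernel on the whole plane, fit for Fubini. The
  point \<open>\<sigma> = 0\<close> is dropped because normalised controls vanish there, which
  changes no integral.\<close>

definition K :: "(real \<Rightarrow> real \<times> L2) \<Rightarrow> real \<Rightarrow> real \<Rightarrow> 'd" where
  "K u \<tau> \<sigma> = (if 0 < \<sigma> \<and> \<sigma> \<le> \<tau> then T (max 0 (\<tau> - \<sigma>)) (BB (u \<sigma>)) else 0)"

definition conv :: "(real \<Rightarrow> real \<times> L2) \<Rightarrow> real \<Rightarrow> 'd" where
  "conv u \<tau> = (LBINT \<sigma>. K u \<tau> \<sigma>)"

definition Y :: "'d \<Rightarrow> (real \<Rightarrow> real \<times> L2) \<Rightarrow> real \<Rightarrow> 'd" where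
  "Y x u \<tau> = T (max 0 \<tau>) x + conv u \<tau>"

definition run :: "'d \<Rightarrow> (real \<Rightarrow> real \<times> L2) \<Rightarrow> real \<Rightarrow> real" where
  "run x u \<tau> = expk lam \<tau> * (- R (aa (Y x u \<tau>)) + hh (u \<tau>))"

definition J :: "'d \<Rightarrow> (real \<Rightarrow> real \<times> L2) \<Rightarrow> real" where
  "J x u = (LBINT \<tau>. run x u \<tau>)"

abbreviation "\<Psi> \<equiv> value_function sbar lam dp T (\<lambda>x. - R (aa x)) hh"

lemma mild_eq: assumes "0 \<le> \<tau>" shows "mild_solution sbar dp T x u \<tau> = Y x (nrm u) \<tau>"
proof -
  have "(LINT \<sigma>:{0..\<tau>}|lborel. T (\<tau> - \<sigma>) (BB (u \<sigma>))) = conv (nrm u) \<tau>"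
    unfolding set_lebesgue_integral_def conv_def
    by (rule integral_discrete_difference[of "{0}"]) (auto simp: K_def nrm_def indicator_def)
  then show ?thesis using assms by (simp add: mild_solution_def Y_def)
qed

lemma value_function_eq: "\<Psi> x = (INF u\<in>Ctrl. J x u)"
proof -
  have cost: "(LINT \<tau>:{0<..}|lborel. exp (- lam * \<tau>) * (- R (aa (mild_solution sbar dp T x u \<tau>)) + hh (u \<tau>))) = J x (nrm u)" for u
    unfolding J_def set_lebesgue_integral_def
    by (rule integral_discrete_difference[of "{0}"]) (auto simp: run_def mild_eq expk_def indicator_def nrm_def)
  have "(\<lambda>u. J x (nrm u)) ` controls sbar lam = J x ` Ctrl"
    using controls_iff nrm_Ctrl by (auto simp: image_iff) (metis nrm_Ctrl controls_iff)?
  then show ?thesis unfolding value_function_def cost by simp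
qed

section \<open>Measurability and weighted integrability of trajectories and of the running
  cost\<close>

lemma BB_measurable: "BB \<in> borel_measurable borel"
  by (intro borel_measurable_continuous_onI linear_continuous_on bounded_linear_BB)

lemma norm_Ctrl_measurable:
  assumes "u \<in> borel_measurable borel" shows "(\<lambda>\<sigma>. norm (u \<sigma> :: real \<times> L2)) \<in> borel_measurable borel"
  by (rule measurable_compose[OF assms borel_measurable_continuous_onI]) (intro continuous_intros)

lemma K_measurable:
  assumes u: "u \<in> borel_measurable borel"
  shows "(\<lambda>(\<tau>, \<sigma>). K u \<tau> \<sigma>) \<in> borel_measurable (lborel \<Otimes>\<^sub>M lborel)"
proof -
  have [measurable]: "(\<lambda>\<sigma>. BB (u \<sigma>)) \<in> borel_measurable borel"
    by (rule measurable_compose[OF u BB_measurable])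
  have "(\<lambda>p. (fst p - snd p, BB (u (snd p)))) \<in> borel_measurable (lborel \<Otimes>\<^sub>M lborel)"
    by (rule borel_measurable_Pair) measurable
  from measurable_compose[OF this borel_measurable_continuous_onI[OF T_max_continuous]]
  have [measurable]: "(\<lambda>p. T (max 0 (fst p - snd p)) (BB (u (snd p)))) \<in> borel_measurable (lborel \<Otimes>\<^sub>M lborel)"
    by simp
  have "(\<lambda>p. if 0 < snd p \<and> snd p \<le> fst p then T (max 0 (fst p - snd p)) (BB (u (snd p))) else 0)
      \<in> borel_measurable (lborel \<Otimes>\<^sub>M lborel)"
    by measurable
  then show ?thesis by (simp add: K_def split_beta)
qed

lemma K_section_measurable:
  assumes u: "u \<in> borel_measurable borel"
  shows "K u \<tau> \<in> borel_measurable borel"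
  using measurable_compose[OF measurable_Pair1'[of \<tau> lborel lborel] K_measurable[OF u]] by simp

lemma conv_measurable: "u \<in> borel_measurable borel \<Longrightarrow> conv u \<in> borel_measurable borel"
  using lborel.borel_measurable_lebesgue_integral[OF K_measurable] by (simp add: conv_def[abs_def])

lemma K_bound: "norm (K u \<tau> \<sigma>) \<le> indicator {0..\<tau>} \<sigma> * (CA * CB * norm (u \<sigma>))"
proof (cases "0 < \<sigma> \<and> \<sigma> \<le> \<tau>")
  case True
  have "norm (K u \<tau> \<sigma>) \<le> CA * norm (BB (u \<sigma>))" using True T_bound' by (simp add: K_def)
  also have "\<dots> \<le> CA * (CB * norm (u \<sigma>))" using CA_pos norm_BB_le by (intro mult_left_mono) auto
  finally show ?thesis using True by (simp add: mult.assoc)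
next
  case False
  have "0 \<le> CA * CB * norm (u \<sigma>)" using CA_pos CB_nonneg by simp
  then show ?thesis using False by (auto simp: K_def indicator_def)
qed

lemma Ctrl_locally_integrable:
  assumes u: "u \<in> Ctrl"
  shows "integrable lborel (\<lambda>\<sigma>. indicator {0..\<tau>} \<sigma> * norm (u \<sigma>))"
    and "integrable lborel (\<lambda>\<sigma>. indicator {0..\<tau>} \<sigma> * (norm (u \<sigma>))\<^sup>2)"
proof -
  note [measurable] = norm_Ctrl_measurable[OF Ctrl_measurable[OF u]]
  have "integrable lborel (\<lambda>\<sigma>. exp (lam * \<tau>) * (expk lam \<sigma> * (norm (u \<sigma>))\<^sup>2))"
    using Ctrl_square[OF u] by simp
  then show sq: "integrable lborel (\<lambda>\<sigma>. indicator {0..\<tau>} \<sigma> * (norm (u \<sigma>))\<^sup>2)"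
  proof (rule Bochner_Integration.integrable_bound)
    show "AE \<sigma> in lborel. norm (indicator {0..\<tau>} \<sigma> * (norm (u \<sigma>))\<^sup>2)
        \<le> norm (exp (lam * \<tau>) * (expk lam \<sigma> * (norm (u \<sigma>))\<^sup>2))"
    proof (intro AE_I2)
      fix \<sigma>
      show "norm (indicator {0..\<tau>} \<sigma> * (norm (u \<sigma>))\<^sup>2) \<le> norm (exp (lam * \<tau>) * (expk lam \<sigma> * (norm (u \<sigma>))\<^sup>2))"
      proof (cases "0 \<le> \<sigma> \<and> \<sigma> \<le> \<tau>")
        case True
        have "1 \<le> exp (lam * \<tau>) * expk lam \<sigma>" using True lam by (simp add: expk_def flip: exp_add)
        then have "1 * (norm (u \<sigma>))\<^sup>2 \<le> (exp (lam * \<tau>) * expk lam \<sigma>) * (norm (u \<sigma>))\<^sup>2"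
          by (intro mult_right_mono) auto
        then show ?thesis using True by (simp add: mult.assoc)
      qed auto
    qed
  qed measurable
  have "integrable lborel (indicator {0..\<tau>} :: real \<Rightarrow> real)"
    by (rule integrable_real_indicator) (auto simp: emeasure_lborel_Icc_eq)
  from Bochner_Integration.integrable_add[OF this sq]
  show "integrable lborel (\<lambda>\<sigma>. indicator {0..\<tau>} \<sigma> * norm (u \<sigma>))"
  proof (rule Bochner_Integration.integrable_bound)
    show "AE \<sigma> in lborel. norm (indicator {0..\<tau>} \<sigma> * norm (u \<sigma>)) \<le>
        norm (indicator {0..\<tau>} \<sigma> + indicator {0..\<tau>} \<sigma> * (norm (u \<sigma>))\<^sup>2)"
    proof (intro AE_I2)
      fix \<sigma>
      have "0 \<le> (norm (u \<sigma>) - 1)\<^sup>2" by simp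
      then have "2 * norm (u \<sigma>) \<le> 1 + (norm (u \<sigma>))\<^sup>2" by (simp add: power2_diff)
      then have "norm (u \<sigma>) \<le> 1 + (norm (u \<sigma>))\<^sup>2" using norm_ge_zero[of "u \<sigma>"] by linarith
      then show "norm (indicator {0..\<tau>} \<sigma> * norm (u \<sigma>)) \<le> norm (indicator {0..\<tau>} \<sigma> + indicator {0..\<tau>} \<sigma> * (norm (u \<sigma>))\<^sup>2)"
        by (simp add: indicator_def)
    qed
  qed measurable
qed

lemma K_integrable: assumes u: "u \<in> Ctrl" shows "integrable lborel (K u \<tau>)"
proof (rule Bochner_Integration.integrable_bound)
  show "integrable lborel (\<lambda>\<sigma>. CA * CB * (indicator {0..\<tau>} \<sigma> * norm (u \<sigma>)))"
    using Ctrl_locally_integrable(1)[OF u] by simp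
  show "K u \<tau> \<in> borel_measurable lborel" using K_section_measurable[OF Ctrl_measurable[OF u]] by simp
  show "AE \<sigma> in lborel. norm (K u \<tau> \<sigma>) \<le> norm (CA * CB * (indicator {0..\<tau>} \<sigma> * norm (u \<sigma>)))"
    using K_bound CA_pos CB_nonneg by (intro AE_I2) (simp add: abs_mult mult_ac)
qed

text \<open>The root of the discount factors as \<open>exp (- lam / 2 * (\<tau> - \<sigma>))\<close>
  times \<open>exp (- lam / 2 * \<sigma>)\<close>: the first factor becomes an integrable
  convolution kernel, the second turns the control into a square integrable function.
  \<open>exp_convolution_square\<close> then acts as Young's inequality.\<close>

lemma conv_square_integrable:
  assumes u: "u \<in> Ctrl"
  shows "integrable lborel (\<lambda>\<tau>. expk lam \<tau> * (norm (conv u \<tau>))\<^sup>2)"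
proof -
  note um = Ctrl_measurable[OF u]
  note [measurable] = norm_Ctrl_measurable[OF um] conv_measurable[OF um]
  define \<phi> where "\<phi> \<sigma> = ennreal (CA * CB * (expk (lam / 2) \<sigma> * norm (u \<sigma>)))" for \<sigma>
  have [measurable]: "\<phi> \<in> borel_measurable borel" unfolding \<phi>_def by measurable
  have C: "0 \<le> CA * CB" using CA_pos CB_nonneg by simp
  have point: "ennreal (expk lam \<tau> * (norm (conv u \<tau>))\<^sup>2) \<le>
      (\<integral>\<^sup>+\<sigma>. ennreal (expk (lam / 2) (\<tau> - \<sigma>)) * \<phi> \<sigma> \<partial>lborel)\<^sup>2" for \<tau>
  proof -
    have "ennreal (norm (conv u \<tau>)) \<le> (\<integral>\<^sup>+\<sigma>. ennreal (norm (K u \<tau> \<sigma>)) \<partial>lborel)"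
      unfolding conv_def by (rule integral_norm_bound_ennreal[OF K_integrable[OF u]])
    then have "ennreal (expk (lam / 2) \<tau>) * ennreal (norm (conv u \<tau>)) \<le>
        ennreal (expk (lam / 2) \<tau>) * (\<integral>\<^sup>+\<sigma>. ennreal (norm (K u \<tau> \<sigma>)) \<partial>lborel)"
      by (rule mult_left_mono) simp
    also have "\<dots> = (\<integral>\<^sup>+\<sigma>. ennreal (expk (lam / 2) \<tau>) * ennreal (norm (K u \<tau> \<sigma>)) \<partial>lborel)"
      by (rule nn_integral_cmult[symmetric]) (use K_section_measurable[OF um] in measurable)
    also have "\<dots> \<le> (\<integral>\<^sup>+\<sigma>. ennreal (expk (lam / 2) (\<tau> - \<sigma>)) * \<phi> \<sigma> \<partial>lborel)"
    proof (rule nn_integral_mono)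
      fix \<sigma>
      have "expk (lam / 2) \<tau> * norm (K u \<tau> \<sigma>) \<le> expk (lam / 2) (\<tau> - \<sigma>) * (CA * CB * (expk (lam / 2) \<sigma> * norm (u \<sigma>)))"
      proof (cases "0 < \<sigma> \<and> \<sigma> \<le> \<tau>")
        case True
        then have e: "expk (lam / 2) \<tau> = expk (lam / 2) (\<tau> - \<sigma>) * expk (lam / 2) \<sigma>"
          by (simp add: expk_def algebra_simps add_divide_distrib diff_divide_distrib flip: exp_add)
        have "expk (lam / 2) \<tau> * norm (K u \<tau> \<sigma>) \<le> expk (lam / 2) \<tau> * (CA * CB * norm (u \<sigma>))"
          using K_bound[of u \<tau> \<sigma>] True by (intro mult_left_mono) auto
        then show ?thesis unfolding e by (simp add: mult_ac)
      next
        case False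
        then show ?thesis using C by (auto simp: K_def)
      qed
      then show "ennreal (expk (lam / 2) \<tau>) * ennreal (norm (K u \<tau> \<sigma>)) \<le> ennreal (expk (lam / 2) (\<tau> - \<sigma>)) * \<phi> \<sigma>"
        unfolding \<phi>_def by (simp add: ennreal_leI C flip: ennreal_mult)
    qed
    finally have "(ennreal (expk (lam / 2) \<tau>) * ennreal (norm (conv u \<tau>)))\<^sup>2 \<le>
        (\<integral>\<^sup>+\<sigma>. ennreal (expk (lam / 2) (\<tau> - \<sigma>)) * \<phi> \<sigma> \<partial>lborel)\<^sup>2"
      by (intro power_mono) auto
    moreover have "(ennreal (expk (lam / 2) \<tau>) * ennreal (norm (conv u \<tau>)))\<^sup>2 = ennreal (expk lam \<tau> * (norm (conv u \<tau>))\<^sup>2)"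
      using expk_square[of "lam / 2" \<tau>] by (simp add: ennreal_power power_mult_distrib flip: ennreal_mult)
    ultimately show ?thesis by simp
  qed
  have "(\<integral>\<^sup>+\<tau>. ennreal (expk lam \<tau> * (norm (conv u \<tau>))\<^sup>2) \<partial>lborel) \<le>
      (\<integral>\<^sup>+\<tau>. (\<integral>\<^sup>+\<sigma>. ennreal (expk (lam / 2) (\<tau> - \<sigma>)) * \<phi> \<sigma> \<partial>lborel)\<^sup>2 \<partial>lborel)"
    by (intro nn_integral_mono point)
  also have "\<dots> \<le> ennreal (1 / (lam / 2)) * (ennreal (1 / (lam / 2)) * (\<integral>\<^sup>+\<sigma>. (\<phi> \<sigma>)\<^sup>2 \<partial>lborel))"
    using lam by (intro exp_convolution_square(2)) auto
  also have "(\<integral>\<^sup>+\<sigma>. (\<phi> \<sigma>)\<^sup>2 \<partial>lborel) = (\<integral>\<^sup>+\<sigma>. ennreal ((CA * CB)\<^sup>2 * (expk lam \<sigma> * (norm (u \<sigma>))\<^sup>2)) \<partial>lborel)"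
    using expk_square[of "lam / 2"] C by (intro nn_integral_cong) (simp add: \<phi>_def ennreal_power power_mult_distrib)
  also have "\<dots> = ennreal (LBINT \<sigma>. (CA * CB)\<^sup>2 * (expk lam \<sigma> * (norm (u \<sigma>))\<^sup>2))"
    using Ctrl_square[OF u] by (intro nn_integral_eq_integral) auto
  also have "ennreal (1 / (lam / 2)) * (ennreal (1 / (lam / 2)) * \<dots>) < \<infinity>" by (simp add: ennreal_mult_less_top)
  finally show ?thesis by (intro integrableI_nonneg) auto
qed

lemma Y_measurable: "u \<in> Ctrl \<Longrightarrow> Y x u \<in> borel_measurable borel"
proof -
  assume u: "u \<in> Ctrl"
  note [measurable] = conv_measurable[OF Ctrl_measurable[OF u]]
  show ?thesis unfolding Y_def by measurable
qed

lemma Y_square_integrable: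
  assumes u: "u \<in> Ctrl"
  shows "integrable lborel (\<lambda>\<tau>. expk lam \<tau> * (norm (Y x u \<tau>))\<^sup>2)"
proof (rule Bochner_Integration.integrable_bound)
  show "integrable lborel (\<lambda>\<tau>. expk lam \<tau> * (2 * (CA * norm x)\<^sup>2) + 2 * (expk lam \<tau> * (norm (conv u \<tau>))\<^sup>2))"
    using integrable_expk[OF lam] conv_square_integrable[OF u] by simp
  note [measurable] = Y_measurable[OF u]
  show "(\<lambda>\<tau>. expk lam \<tau> * (norm (Y x u \<tau>))\<^sup>2) \<in> borel_measurable lborel" by measurable
  show "AE \<tau> in lborel. norm (expk lam \<tau> * (norm (Y x u \<tau>))\<^sup>2) \<le>
      norm (expk lam \<tau> * (2 * (CA * norm x)\<^sup>2) + 2 * (expk lam \<tau> * (norm (conv u \<tau>))\<^sup>2))"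
  proof (intro AE_I2)
    fix \<tau>
    have "norm (Y x u \<tau>) \<le> CA * norm x + norm (conv u \<tau>)"
      unfolding Y_def using norm_triangle_ineq[of "T (max 0 \<tau>) x" "conv u \<tau>"] T_bound'[of "max 0 \<tau>" x] by simp
    then have "(norm (Y x u \<tau>))\<^sup>2 \<le> (CA * norm x + norm (conv u \<tau>))\<^sup>2" by (intro power_mono) auto
    also have "\<dots> \<le> 2 * (CA * norm x)\<^sup>2 + 2 * (norm (conv u \<tau>))\<^sup>2"
      using sum_squares_bound[of "CA * norm x" "norm (conv u \<tau>)"] unfolding power2_sum by linarith
    finally have "expk lam \<tau> * (norm (Y x u \<tau>))\<^sup>2 \<le> expk lam \<tau> * (2 * (CA * norm x)\<^sup>2 + 2 * (norm (conv u \<tau>))\<^sup>2)"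
      by (intro mult_left_mono) auto
    also have "\<dots> = expk lam \<tau> * (2 * (CA * norm x)\<^sup>2) + 2 * (expk lam \<tau> * (norm (conv u \<tau>))\<^sup>2)"
      by (simp add: algebra_simps)
    finally show "norm (expk lam \<tau> * (norm (Y x u \<tau>))\<^sup>2) \<le>
      norm (expk lam \<tau> * (2 * (CA * norm x)\<^sup>2) + 2 * (expk lam \<tau> * (norm (conv u \<tau>))\<^sup>2))" by simp
  qed
qed

lemma aa_linear: "aa (x + y) = aa x + aa y" "aa (x - y) = aa x - aa y" "aa (c *\<^sub>R x) = c * aa x"
proof -
  interpret linear aa by (rule dp_linear[OF \<alpha>])
  show "aa (x + y) = aa x + aa y" "aa (x - y) = aa x - aa y" "aa (c *\<^sub>R x) = c * aa x"
    by (simp_all add: add diff scale)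
qed

lemma aa_Y_measurable: "u \<in> Ctrl \<Longrightarrow> (\<lambda>\<tau>. aa (Y x u \<tau>)) \<in> borel_measurable borel"
  by (rule measurable_compose[OF Y_measurable
        borel_measurable_continuous_onI[OF linear_continuous_on[OF dp_bounded_linear[OF \<alpha>]]]])

lemma aa_le: "\<bar>aa x\<bar> \<le> Vn \<alpha> * norm x" by (rule dp_le[OF \<alpha>])

lemma weighted_measurable:
  assumes [measurable]: "f \<in> borel_measurable borel"
  shows "(\<lambda>\<tau>. expk lam \<tau> * f \<tau>) \<in> borel_measurable lborel"
    and "(\<lambda>\<tau>. expk lam \<tau> * (f \<tau>)\<^sup>2) \<in> borel_measurable lborel"
  by measurable

lemma aa_Y_square_integrable:
  assumes u: "u \<in> Ctrl" shows "integrable lborel (\<lambda>\<tau>. expk lam \<tau> * (aa (Y x u \<tau>))\<^sup>2)"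
proof (rule Bochner_Integration.integrable_bound)
  show "integrable lborel (\<lambda>\<tau>. (Vn \<alpha>)\<^sup>2 * (expk lam \<tau> * (norm (Y x u \<tau>))\<^sup>2))"
    using Y_square_integrable[OF u] by simp
  show "AE \<tau> in lborel. norm (expk lam \<tau> * (aa (Y x u \<tau>))\<^sup>2) \<le> norm ((Vn \<alpha>)\<^sup>2 * (expk lam \<tau> * (norm (Y x u \<tau>))\<^sup>2))"
  proof (intro AE_I2)
    fix \<tau>
    have "\<bar>aa (Y x u \<tau>)\<bar>\<^sup>2 \<le> (Vn \<alpha> * norm (Y x u \<tau>))\<^sup>2" by (intro power_mono aa_le) auto
    then have "expk lam \<tau> * (aa (Y x u \<tau>))\<^sup>2 \<le> expk lam \<tau> * (Vn \<alpha> * norm (Y x u \<tau>))\<^sup>2"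
      by (intro mult_left_mono) auto
    then show "norm (expk lam \<tau> * (aa (Y x u \<tau>))\<^sup>2) \<le> norm ((Vn \<alpha>)\<^sup>2 * (expk lam \<tau> * (norm (Y x u \<tau>))\<^sup>2))"
      by (simp add: power_mult_distrib mult_ac)
  qed
qed (rule weighted_measurable(2)[OF aa_Y_measurable[OF u]])

lemma integrable_from_square:
  assumes [measurable]: "f \<in> borel_measurable borel" and f: "integrable lborel (\<lambda>\<tau>. expk lam \<tau> * (f \<tau>)\<^sup>2)"
  shows "integrable lborel (\<lambda>\<tau>. expk lam \<tau> * f \<tau>)"
proof (rule Bochner_Integration.integrable_bound[OF Bochner_Integration.integrable_add[OF integrable_expk[OF lam] f]])
  show "AE \<tau> in lborel. norm (expk lam \<tau> * f \<tau>) \<le> norm (expk lam \<tau> + expk lam \<tau> * (f \<tau>)\<^sup>2)"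
  proof (intro AE_I2)
    fix \<tau>
    have "0 \<le> (\<bar>f \<tau>\<bar> - 1)\<^sup>2" by simp
    then have "2 * \<bar>f \<tau>\<bar> \<le> 1 + (f \<tau>)\<^sup>2" by (simp add: power2_diff)
    then have "\<bar>f \<tau>\<bar> \<le> 1 + (f \<tau>)\<^sup>2" using abs_ge_zero[of "f \<tau>"] by linarith
    then have "expk lam \<tau> * \<bar>f \<tau>\<bar> \<le> expk lam \<tau> * (1 + (f \<tau>)\<^sup>2)" by (intro mult_left_mono) auto
    then show "norm (expk lam \<tau> * f \<tau>) \<le> norm (expk lam \<tau> + expk lam \<tau> * (f \<tau>)\<^sup>2)"
      by (simp add: abs_mult distrib_left)
  qed
qed measurable

lemma aa_Y_integrable: "u \<in> Ctrl \<Longrightarrow> integrable lborel (\<lambda>\<tau>. expk lam \<tau> * aa (Y x u \<tau>))"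
  by (rule integrable_from_square[OF aa_Y_measurable aa_Y_square_integrable])

lemma R_Y_integrable:
  assumes u: "u \<in> Ctrl" shows "integrable lborel (\<lambda>\<tau>. expk lam \<tau> * R (aa (Y x u \<tau>)))"
proof (rule Bochner_Integration.integrable_bound)
  have m: "(\<lambda>\<tau>. R (aa (Y x u \<tau>))) \<in> borel_measurable borel"
    by (rule measurable_compose[OF aa_Y_measurable[OF u] borel_measurable_continuous_onI[OF R_continuous]])
  show "(\<lambda>\<tau>. expk lam \<tau> * R (aa (Y x u \<tau>))) \<in> borel_measurable lborel"
    by (rule weighted_measurable(1)[OF m])
  show "integrable lborel (\<lambda>\<tau>. expk lam \<tau> * (\<bar>R 0\<bar> + \<bar>R' 0\<bar>) + (\<bar>R' 0\<bar> + L) * (expk lam \<tau> * (aa (Y x u \<tau>))\<^sup>2))"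
    using integrable_expk[OF lam] aa_Y_square_integrable[OF u] by simp
  show "AE \<tau> in lborel. norm (expk lam \<tau> * R (aa (Y x u \<tau>))) \<le>
      norm (expk lam \<tau> * (\<bar>R 0\<bar> + \<bar>R' 0\<bar>) + (\<bar>R' 0\<bar> + L) * (expk lam \<tau> * (aa (Y x u \<tau>))\<^sup>2))"
  proof (intro AE_I2)
    fix \<tau>
    have "expk lam \<tau> * \<bar>R (aa (Y x u \<tau>))\<bar> \<le> expk lam \<tau> * (\<bar>R 0\<bar> + \<bar>R' 0\<bar> + (\<bar>R' 0\<bar> + L) * (aa (Y x u \<tau>))\<^sup>2)"
      by (intro mult_left_mono R_bound) auto
    then show "norm (expk lam \<tau> * R (aa (Y x u \<tau>))) \<le>
      norm (expk lam \<tau> * (\<bar>R 0\<bar> + \<bar>R' 0\<bar>) + (\<bar>R' 0\<bar> + L) * (expk lam \<tau> * (aa (Y x u \<tau>))\<^sup>2))"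
      by (simp add: abs_mult algebra_simps)
  qed
qed

lemma continuous_on_hh: "continuous_on UNIV hh"
proof -
  have "hh = (\<lambda>u. inner u (NN u) + inner q u)" by (rule HOL.ext) (rule hh_eq)
  then show ?thesis
    by (simp only:) (intro continuous_intros linear_continuous_on[OF bounded_linear_NN])
qed

lemma hh_bound: "\<exists>C\<ge>0. \<forall>u. \<bar>hh u\<bar> \<le> C * (1 + (norm u)\<^sup>2)"
proof -
  interpret N: bounded_linear NN by (rule bounded_linear_NN)
  obtain B where B: "0 \<le> B" "\<And>u. norm (NN u) \<le> norm u * B" using N.nonneg_bounded by blast
  have "\<bar>hh u\<bar> \<le> (B + norm q) * (1 + (norm u)\<^sup>2)" for u
  proof -
    have "\<bar>inner u (NN u)\<bar> \<le> norm u * (norm u * B)"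
      using Cauchy_Schwarz_ineq2[of u "NN u"] mult_left_mono[OF B(2)[of u], of "norm u"] by simp
    moreover have "\<bar>inner q u\<bar> \<le> norm q * norm u" by (rule Cauchy_Schwarz_ineq2)
    moreover have "norm q * norm u \<le> norm q * (1 + (norm u)\<^sup>2)"
    proof -
      have "0 \<le> (norm u - 1)\<^sup>2" by simp
      then have "2 * norm u \<le> 1 + (norm u)\<^sup>2" by (simp add: power2_diff)
      then have "norm u \<le> 1 + (norm u)\<^sup>2" using norm_ge_zero[of u] by linarith
      then show ?thesis by (intro mult_left_mono) auto
    qed
    ultimately have "\<bar>hh u\<bar> \<le> norm u * (norm u * B) + norm q * (1 + (norm u)\<^sup>2)" unfolding hh_eq by linarith
    also have "norm u * (norm u * B) \<le> B * (1 + (norm u)\<^sup>2)" using B(1) by (simp add: power2_eq_square algebra_simps)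
    finally show ?thesis by (simp add: algebra_simps)
  qed
  then show ?thesis using B(1) by (intro exI[of _ "B + norm q"]) auto
qed

lemma hh_integrable:
  assumes u: "u \<in> Ctrl" shows "integrable lborel (\<lambda>\<tau>. expk lam \<tau> * hh (u \<tau>))"
proof -
  obtain C where C: "0 \<le> C" "\<And>u. \<bar>hh u\<bar> \<le> C * (1 + (norm u)\<^sup>2)" using hh_bound by blast
  have [measurable]: "(\<lambda>\<tau>. hh (u \<tau>)) \<in> borel_measurable borel"
    by (rule measurable_compose[OF Ctrl_measurable[OF u] borel_measurable_continuous_onI[OF continuous_on_hh]])
  show ?thesis
  proof (rule Bochner_Integration.integrable_bound)
    show "integrable lborel (\<lambda>\<tau>. C * (expk lam \<tau> + expk lam \<tau> * (norm (u \<tau>))\<^sup>2))"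
      using integrable_expk[OF lam] Ctrl_square[OF u] by simp
    show "AE \<tau> in lborel. norm (expk lam \<tau> * hh (u \<tau>)) \<le> norm (C * (expk lam \<tau> + expk lam \<tau> * (norm (u \<tau>))\<^sup>2))"
    proof (intro AE_I2)
      fix \<tau>
      have "expk lam \<tau> * \<bar>hh (u \<tau>)\<bar> \<le> expk lam \<tau> * (C * (1 + (norm (u \<tau>))\<^sup>2))" by (intro mult_left_mono C) auto
      then show "norm (expk lam \<tau> * hh (u \<tau>)) \<le> norm (C * (expk lam \<tau> + expk lam \<tau> * (norm (u \<tau>))\<^sup>2))"
        using C(1) by (simp add: abs_mult algebra_simps)
    qed
  qed measurable
qed

lemma run_integrable: assumes u: "u \<in> Ctrl" shows "integrable lborel (run x u)"
proof -
  have "run x u = (\<lambda>\<tau>. - (expk lam \<tau> * R (aa (Y x u \<tau>))) + expk lam \<tau> * hh (u \<tau>))"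
    by (simp add: run_def fun_eq_iff algebra_simps)
  then show ?thesis using R_Y_integrable[OF u] hh_integrable[OF u] by simp
qed

lemma dp_BB_integrable:
  assumes u: "u \<in> Ctrl" and v: "v \<in> V"
  shows "integrable lborel (\<lambda>\<tau>. expk lam \<tau> * dp v (BB (u \<tau>)))"
proof (rule integrable_from_square)
  have "continuous_on UNIV (\<lambda>w. dp v (BB w))"
    by (intro linear_continuous_on bounded_linear_compose[OF dp_bounded_linear[OF v] bounded_linear_BB])
  from measurable_compose[OF Ctrl_measurable[OF u] borel_measurable_continuous_onI[OF this]]
  show [measurable]: "(\<lambda>\<tau>. dp v (BB (u \<tau>))) \<in> borel_measurable borel" .
  show "integrable lborel (\<lambda>\<tau>. expk lam \<tau> * (dp v (BB (u \<tau>)))\<^sup>2)"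
  proof (rule Bochner_Integration.integrable_bound)
    show "integrable lborel (\<lambda>\<tau>. (Vn v * CB)\<^sup>2 * (expk lam \<tau> * (norm (u \<tau>))\<^sup>2))"
      using Ctrl_square[OF u] by simp
    show "AE \<tau> in lborel. norm (expk lam \<tau> * (dp v (BB (u \<tau>)))\<^sup>2) \<le> norm ((Vn v * CB)\<^sup>2 * (expk lam \<tau> * (norm (u \<tau>))\<^sup>2))"
    proof (intro AE_I2)
      fix \<tau>
      have "\<bar>dp v (BB (u \<tau>))\<bar> \<le> Vn v * CB * norm (u \<tau>)"
        using dp_le[OF v, of "BB (u \<tau>)"] mult_left_mono[OF norm_BB_le[of "u \<tau>"], of "Vn v"] by simp
      then have "\<bar>dp v (BB (u \<tau>))\<bar>\<^sup>2 \<le> (Vn v * CB * norm (u \<tau>))\<^sup>2" by (intro power_mono) auto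
      then have "expk lam \<tau> * (dp v (BB (u \<tau>)))\<^sup>2 \<le> expk lam \<tau> * (Vn v * CB * norm (u \<tau>))\<^sup>2"
        by (intro mult_left_mono) auto
      then show "norm (expk lam \<tau> * (dp v (BB (u \<tau>)))\<^sup>2) \<le> norm ((Vn v * CB)\<^sup>2 * (expk lam \<tau> * (norm (u \<tau>))\<^sup>2))"
        by (simp add: power_mult_distrib mult_ac)
    qed
  qed measurable
qed

lemma norm_u_integrable: assumes u: "u \<in> Ctrl" shows "integrable lborel (\<lambda>\<tau>. expk lam \<tau> * norm (u \<tau>))"
  using norm_Ctrl_measurable[OF Ctrl_measurable[OF u]] Ctrl_square[OF u] by (rule integrable_from_square)

lemma dp_conv:
  assumes u: "u \<in> Ctrl" and v: "v \<in> V"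
  shows "dp v (conv u \<tau>) = (LBINT \<sigma>. dp v (K u \<tau> \<sigma>))" "integrable lborel (\<lambda>\<sigma>. dp v (K u \<tau> \<sigma>))"
  unfolding conv_def
  using integral_bounded_linear[OF dp_bounded_linear[OF v] K_integrable[OF u]]
    integrable_bounded_linear[OF dp_bounded_linear[OF v] K_integrable[OF u]] by auto

text \<open>Fubini reduces the discounted integral of the convolution to the Laplace transform of the semigroup.\<close>

lemma discounted_aa_Y:
  assumes u: "u \<in> Ctrl"
  shows "(LBINT \<tau>. expk lam \<tau> * aa (Y x u \<tau>)) = dp rr x + (LBINT \<sigma>. expk lam \<sigma> * dp rr (BB (u \<sigma>)))"
proof -
  note um = Ctrl_measurable[OF u]
  note [measurable] = norm_Ctrl_measurable[OF um]
  have aK: "(\<lambda>p. expk lam (snd p) * aa (K u (snd p) (fst p))) \<in> borel_measurable (lborel \<Otimes>\<^sub>M lborel)"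
  proof -
    have "(\<lambda>p. K u (snd p) (fst p)) \<in> borel_measurable (lborel \<Otimes>\<^sub>M lborel)"
      using measurable_compose[OF measurable_pair_swap' K_measurable[OF um]] by (simp add: split_beta)
    from measurable_compose[OF this borel_measurable_continuous_onI[OF linear_continuous_on[OF dp_bounded_linear[OF \<alpha>]]]]
    have [measurable]: "(\<lambda>p. aa (K u (snd p) (fst p))) \<in> borel_measurable (lborel \<Otimes>\<^sub>M lborel)" .
    show ?thesis by measurable
  qed
  \<comment> \<open>Splitting the discount at time \<open>\<sigma>\<close> exhibits a translate of
    the Laplace integrand of \<open>BB (u \<sigma>)\<close>, so the inner integral over
    \<open>\<tau>\<close> is known. For \<open>\<sigma> \<le> 0\<close> both sides vanish with the
    control.\<close>
  have kernel: "expk lam \<tau> * aa (K u \<tau> \<sigma>) = expk lam \<sigma> * lap lam \<alpha> (BB (u \<sigma>)) (\<tau> - \<sigma>)" for \<tau> \<sigma>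
  proof (cases "0 < \<sigma>")
    case False
    then have "u \<sigma> = 0" using u by (simp add: Ctrl_zero)
    moreover have "T (max 0 (\<tau> - \<sigma>)) 0 = 0" using T.S_scale[of "max 0 (\<tau> - \<sigma>)" 0 0] by simp
    moreover have "BB 0 = 0" "aa 0 = 0" using linear_0[OF dp_linear[OF \<alpha>]] bounded_linear.axioms(1)[OF bounded_linear_BB] linear_0 by auto
    ultimately show ?thesis using False by (simp add: K_def lapd)
  next
    case True
    show ?thesis
    proof (cases "\<sigma> \<le> \<tau>")
      case s: True
      have "expk lam \<tau> = expk lam \<sigma> * expk lam (\<tau> - \<sigma>)"
        using True s by (simp add: expk_def algebra_simps flip: exp_add)
      then show ?thesis using True s by (simp add: K_def lapd)
    next
      case False
      then have "aa (K u \<tau> \<sigma>) = 0" using linear_0[OF dp_linear[OF \<alpha>]] by (simp add: K_def)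
      then show ?thesis using False by (simp add: lapd expk_def)
    qed
  qed
  have shift: "(LBINT \<tau>. f (\<tau> - \<sigma>)) = (LBINT \<tau>. f \<tau>)" for f :: "real \<Rightarrow> real" and \<sigma>
    using lborel_integral_real_affine[of 1 f "- \<sigma>"] by simp
  have shifti: "integrable lborel (\<lambda>\<tau>. f (\<tau> - \<sigma>))" if "integrable lborel f" for f :: "real \<Rightarrow> real" and \<sigma>
    using lborel_integrable_real_affine[OF that, of 1 "- \<sigma>"] by simp
  define C where "C = Vn \<alpha> * CA * CB / lam"
  have "integrable (lborel \<Otimes>\<^sub>M lborel) (\<lambda>p. expk lam (snd p) * aa (K u (snd p) (fst p)))"
  proof (rule lborel_pair.Fubini_integrable[OF aK])
    show "AE \<sigma> in lborel. integrable lborel (\<lambda>\<tau>. expk lam (snd (\<sigma>, \<tau>)) * aa (K u (snd (\<sigma>, \<tau>)) (fst (\<sigma>, \<tau>))))"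
      by (intro AE_I2) (simp add: kernel shifti lapi)
    show "integrable lborel (\<lambda>\<sigma>. LBINT \<tau>. norm (expk lam (snd (\<sigma>, \<tau>)) * aa (K u (snd (\<sigma>, \<tau>)) (fst (\<sigma>, \<tau>)))))"
    proof (rule Bochner_Integration.integrable_bound)
      show "integrable lborel (\<lambda>\<sigma>. C * (expk lam \<sigma> * norm (u \<sigma>)))" using norm_u_integrable[OF u] by simp
      show "(\<lambda>\<sigma>. LBINT \<tau>. norm (expk lam (snd (\<sigma>, \<tau>)) * aa (K u (snd (\<sigma>, \<tau>)) (fst (\<sigma>, \<tau>))))) \<in> borel_measurable lborel"
        by (rule lborel.borel_measurable_lebesgue_integral) (use aK in \<open>simp add: split_beta\<close>)
      show "AE \<sigma> in lborel. norm (LBINT \<tau>. norm (expk lam (snd (\<sigma>, \<tau>)) * aa (K u (snd (\<sigma>, \<tau>)) (fst (\<sigma>, \<tau>)))))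
          \<le> norm (C * (expk lam \<sigma> * norm (u \<sigma>)))"
      proof (intro AE_I2)
        fix \<sigma>
        have "(LBINT \<tau>. norm (expk lam \<tau> * aa (K u \<tau> \<sigma>))) = expk lam \<sigma> * (LBINT \<tau>. norm (lap lam \<alpha> (BB (u \<sigma>)) \<tau>))"
          unfolding kernel using shift[of "\<lambda>\<tau>. norm (expk lam \<sigma> * lap lam \<alpha> (BB (u \<sigma>)) \<tau>)" \<sigma>]
          by (simp add: abs_mult)
        also have "(LBINT \<tau>. norm (lap lam \<alpha> (BB (u \<sigma>)) \<tau>)) \<le> (LBINT \<tau>. expk lam \<tau> * (Vn \<alpha> * CA * norm (BB (u \<sigma>))))"
          using integrable_expk[OF lam] lapi lapb
          by (intro integral_mono integrable_norm) auto
        also have "\<dots> = (Vn \<alpha> * CA / lam) * norm (BB (u \<sigma>))" using integral_expk[OF lam] by simp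
        also have "\<dots> \<le> (Vn \<alpha> * CA / lam) * (CB * norm (u \<sigma>))"
          using lam CA_pos norm_BB_le by (intro mult_left_mono) auto
        finally have le: "(LBINT \<tau>. norm (expk lam \<tau> * aa (K u \<tau> \<sigma>))) \<le> expk lam \<sigma> * ((Vn \<alpha> * CA / lam) * (CB * norm (u \<sigma>)))"
          by (simp add: mult_left_mono)
        have "0 \<le> (LBINT \<tau>. norm (expk lam \<tau> * aa (K u \<tau> \<sigma>)))" by (intro integral_nonneg_AE AE_I2) simp
        moreover have "0 \<le> C" using lam CA_pos CB_nonneg by (simp add: C_def)
        moreover have "expk lam \<sigma> * ((Vn \<alpha> * CA / lam) * (CB * norm (u \<sigma>))) = C * (expk lam \<sigma> * norm (u \<sigma>))"
          by (simp add: C_def)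
        ultimately show "norm (LBINT \<tau>. norm (expk lam (snd (\<sigma>, \<tau>)) * aa (K u (snd (\<sigma>, \<tau>)) (fst (\<sigma>, \<tau>)))))
          \<le> norm (C * (expk lam \<sigma> * norm (u \<sigma>)))" using le by (simp add: abs_mult)
      qed
    qed
  qed
  moreover have "(\<lambda>p. expk lam (snd p) * aa (K u (snd p) (fst p))) = (\<lambda>(\<sigma>, \<tau>). expk lam \<tau> * aa (K u \<tau> \<sigma>))"
    by (rule HOL.ext) (simp only: split_beta)
  ultimately have "integrable (lborel \<Otimes>\<^sub>M lborel) (\<lambda>(\<sigma>, \<tau>). expk lam \<tau> * aa (K u \<tau> \<sigma>))" by (simp only:)
  from lborel_pair.Fubini_integral[OF this]
  have "(LBINT \<tau>. LBINT \<sigma>. expk lam \<tau> * aa (K u \<tau> \<sigma>)) = (LBINT \<sigma>. LBINT \<tau>. expk lam \<tau> * aa (K u \<tau> \<sigma>))" .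
  also have "\<dots> = (LBINT \<sigma>. expk lam \<sigma> * dp rr (BB (u \<sigma>)))"
  proof (intro Bochner_Integration.integral_cong refl)
    fix \<sigma>
    show "(LBINT \<tau>. expk lam \<tau> * aa (K u \<tau> \<sigma>)) = expk lam \<sigma> * dp rr (BB (u \<sigma>))"
      unfolding kernel using shift[of "\<lambda>\<tau>. expk lam \<sigma> * lap lam \<alpha> (BB (u \<sigma>)) \<tau>" \<sigma>] by (simp add: lape)
  qed
  finally have part: "(LBINT \<tau>. expk lam \<tau> * aa (conv u \<tau>)) = (LBINT \<sigma>. expk lam \<sigma> * dp rr (BB (u \<sigma>)))"
    by (simp add: dp_conv[OF u \<alpha>])
  have split: "expk lam \<tau> * aa (Y x u \<tau>) = lap lam \<alpha> x \<tau> + expk lam \<tau> * aa (conv u \<tau>)" for \<tau>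
    by (simp add: Y_def aa_linear lapd distrib_left)
  have "integrable lborel (\<lambda>\<tau>. expk lam \<tau> * aa (Y x u \<tau>) - lap lam \<alpha> x \<tau>)"
    by (intro Bochner_Integration.integrable_diff aa_Y_integrable u lapi)
  then have "integrable lborel (\<lambda>\<tau>. expk lam \<tau> * aa (conv u \<tau>))" by (simp add: split)
  then show ?thesis
    unfolding split by (simp add: part lape lapi Bochner_Integration.integral_add)
qed

end

section \<open>Equilibrium points\<close>

context vintage_capital begin

definition cst :: "real \<times> L2 \<Rightarrow> real \<Rightarrow> real \<times> L2" where
  "cst w \<tau> = (if 0 < \<tau> then w else 0)"

text \<open>The feedback for costate \<open>p\<close>: it is the gradient of the conjugate cost at
  \<open>- B_adj sbar p\<close>, and equivalently the minimiser of \<open>hh u + dp p (BB u)\<close>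
  over \<open>U\<close>.\<close>

definition ub :: "L2 \<Rightarrow> real \<times> L2" where
  "ub p = MM (- B_adj sbar p - q)"

lemma expk_const: "integrable lborel (\<lambda>\<tau>. expk lam \<tau> * c)" "(LBINT \<tau>. expk lam \<tau> * c) = c / lam"
  using integrable_expk[OF lam] integral_expk[OF lam] by simp_all

lemma cst_Ctrl: assumes w: "w \<in> U" shows "cst w \<in> Ctrl"
proof -
  have "cst w \<in> borel_measurable borel" unfolding cst_def by (intro measurable_If) auto
  moreover have "integrable lborel (\<lambda>\<tau>. expk lam \<tau> * (norm (cst w \<tau>))\<^sup>2)"
  proof -
    have "integrable lborel (\<lambda>\<tau>. expk lam \<tau> * (norm (cst w \<tau>))\<^sup>2) = integrable lborel (\<lambda>\<tau>. expk lam \<tau> * (norm w)\<^sup>2)"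
      by (rule integrable_discrete_difference[of "{0}"]) (auto simp: cst_def expk_def)
    then show ?thesis using integrable_expk[OF lam] by simp
  qed
  ultimately show ?thesis using w subspace_0[OF subspace_U] by (auto simp: Ctrl_def cst_def)
qed

text \<open>Since \<open>BB w = - AA f\<close>, the convolution integrates minus the derivative of
  the orbit of \<open>em f\<close> and cancels its displacement. Testing with \<open>V\<close>
  reduces this to the fundamental theorem for real functions.\<close>

lemma Y_cst:
  assumes f: "f \<in> H" and eq: "AA f + BB w = 0" and w: "w \<in> U" and \<tau>: "0 \<le> \<tau>"
  shows "Y (em f) (cst w) \<tau> = em f"
proof (rule dual_eqI)
  fix v assume v: "v \<in> V"
  interpret v: linear "dp v" by (rule dp_linear[OF v])
  have Bw: "BB w = (-1) *\<^sub>R AA f" using eq by (simp add: eq_neg_iff_add_eq_0 add.commute)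
  have TB: "dp v (T s (BB w)) = - dp v (T s (AA f))" if "0 \<le> s" for s
    unfolding Bw using that T.S_scale[of s "AA f" "-1"] v.scale[of "-1"] by simp
  \<comment> \<open>The integrand is put in the shape required by the time reversal
    \<open>\<sigma> \<mapsto> \<tau> - \<sigma>\<close>.\<close>
  have "dp v (conv (cst w) \<tau>) = (LBINT \<sigma>. indicator {0..\<tau>} (\<tau> + (-1) * \<sigma>) *\<^sub>R dp v (T (max 0 (\<tau> + (-1) * \<sigma>)) (BB w)))"
    unfolding dp_conv(1)[OF cst_Ctrl[OF w] v]
    by (rule integral_discrete_difference[of "{0}"]) (auto simp: K_def cst_def indicator_def v.zero)
  also have "\<dots> = (LBINT s. indicator {0..\<tau>} s *\<^sub>R dp v (T (max 0 s) (BB w)))"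
    by (subst lborel_integral_real_affine[of "-1" _ \<tau>]) auto
  also have "\<dots> = (LBINT s. indicator {0..\<tau>} s *\<^sub>R (- dp v (T s (AA f))))"
    by (intro Bochner_Integration.integral_cong refl) (auto simp: indicator_def TB)
  also have "\<dots> = - dp v (T \<tau> (em f)) - - dp v (T 0 (em f))"
  proof (rule integral_FTC_Icc[OF \<tau>])
    fix x assume x: "0 \<le> x" "x \<le> \<tau>"
    have "((\<lambda>s. dp v (T s (em f))) has_real_derivative dp v (T x (AA f))) (at x within {0..\<tau>})"
      by (rule has_field_derivative_subset[OF orbit_pairing_derivative[OF v f x(1)]]) auto
    then show "((\<lambda>s. - dp v (T s (em f))) has_vector_derivative - dp v (T x (AA f))) (at x within {0..\<tau>})"
      by (simp add: has_real_derivative_iff_has_vector_derivative[symmetric] DERIV_minus)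
  next
    show "continuous_on {0..\<tau>} (\<lambda>s. - dp v (T s (AA f)))"
      by (intro continuous_intros bounded_linear.continuous_on[OF dp_bounded_linear[OF v]]
          continuous_on_subset[OF T.orbit_continuous]) auto
  qed
  finally show "dp v (Y (em f) (cst w) \<tau>) = dp v (em f)"
    using \<tau> T.S_0[of "em f"] by (simp add: Y_def v.add)
qed

lemma Y_add: "0 \<le> \<tau> \<Longrightarrow> Y (x + z) u \<tau> = Y x u \<tau> + T \<tau> z"
  by (simp add: Y_def T.S_add)

text \<open>Replacing \<open>R\<close> by its tangent at \<open>s\<close> makes the revenue affine
  in the state, and \<open>discounted_aa_Y\<close> expresses the result through \<open>rr\<close>.
  What remains under the integral depends on the control pointwise in time.\<close>

lemma J_lower:
  assumes u: "u \<in> Ctrl"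
  shows "(- R s + R' s * s) / lam - R' s * dp rr x + (LBINT \<tau>. expk lam \<tau> * (hh (u \<tau>) - R' s * dp rr (BB (u \<tau>)))) \<le> J x u"
proof -
  have i: "integrable lborel (\<lambda>\<tau>. expk lam \<tau> * (- R s + R' s * s) - R' s * (expk lam \<tau> * aa (Y x u \<tau>)))"
    using expk_const(1) aa_Y_integrable[OF u] by (intro Bochner_Integration.integrable_diff) auto
  have "(LBINT \<tau>. (expk lam \<tau> * (- R s + R' s * s) - R' s * (expk lam \<tau> * aa (Y x u \<tau>))) + expk lam \<tau> * hh (u \<tau>)) \<le> J x u"
    unfolding J_def
  proof (rule integral_mono[OF Bochner_Integration.integrable_add[OF i hh_integrable[OF u]] run_integrable[OF u]])
    fix \<tau>
    have "expk lam \<tau> * (- R s - R' s * (aa (Y x u \<tau>) - s) + hh (u \<tau>)) \<le> run x u \<tau>"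
      unfolding run_def using R_le_tangent[of "aa (Y x u \<tau>)" s] by (intro mult_left_mono) auto
    then show "(expk lam \<tau> * (- R s + R' s * s) - R' s * (expk lam \<tau> * aa (Y x u \<tau>))) + expk lam \<tau> * hh (u \<tau>) \<le> run x u \<tau>"
      by (simp add: algebra_simps)
  qed
  moreover have "(LBINT \<tau>. (expk lam \<tau> * (- R s + R' s * s) - R' s * (expk lam \<tau> * aa (Y x u \<tau>))) + expk lam \<tau> * hh (u \<tau>))
      = (- R s + R' s * s) / lam - R' s * (dp rr x + (LBINT \<tau>. expk lam \<tau> * dp rr (BB (u \<tau>)))) + (LBINT \<tau>. expk lam \<tau> * hh (u \<tau>))"
    using expk_const aa_Y_integrable[OF u]
    by (simp only: Bochner_Integration.integral_add[OF i hh_integrable[OF u]] Bochner_Integration.integral_diff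
        integrable_mult_right integral_mult_right_zero discounted_aa_Y[OF u])
  moreover have "(LBINT \<tau>. expk lam \<tau> * (hh (u \<tau>) - R' s * dp rr (BB (u \<tau>)))) =
      (LBINT \<tau>. expk lam \<tau> * hh (u \<tau>)) - R' s * (LBINT \<tau>. expk lam \<tau> * dp rr (BB (u \<tau>)))"
  proof -
    have "(LBINT \<tau>. expk lam \<tau> * (hh (u \<tau>) - R' s * dp rr (BB (u \<tau>)))) =
      (LBINT \<tau>. expk lam \<tau> * hh (u \<tau>) - R' s * (expk lam \<tau> * dp rr (BB (u \<tau>))))"
      by (intro Bochner_Integration.integral_cong refl) (simp add: algebra_simps)
    then show ?thesis
      using hh_integrable[OF u] dp_BB_integrable[OF u rr(1)] by simp
  qed
  ultimately show ?thesis by (simp add: algebra_simps)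
qed

lemma pairing_bound: "v \<in> V \<Longrightarrow> \<bar>dp v (BB w)\<bar> \<le> Vn v * CB * norm w"
  using dp_le[of v "BB w"] mult_left_mono[OF norm_BB_le[of w], of "Vn v"] by simp

text \<open>With the tangent of \<open>R\<close> at 0, the control enters linearly with coefficient
  at most \<open>m\<close> and quadratically with coefficient at least \<open>\<epsilon>\<close>;
  half of the quadratic term absorbs the linear one by Young's inequality.\<close>

lemma J_coercive: "\<exists>c. \<forall>u\<in>Ctrl. c + \<epsilon> / 2 * (LBINT \<tau>. expk lam \<tau> * (norm (u \<tau>))\<^sup>2) \<le> J x u"
proof -
  define m where "m = norm q + \<bar>R' 0\<bar> * (Vn rr * CB)"
  have point: "\<epsilon> / 2 * (norm w)\<^sup>2 - m\<^sup>2 / (2 * \<epsilon>) \<le> hh w - R' 0 * dp rr (BB w)" if w: "w \<in> U" for w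
  proof -
    have "\<epsilon> * (norm w)\<^sup>2 - norm q * norm w \<le> hh w"
      using NN_coercive[OF w] Cauchy_Schwarz_ineq2[of q w] unfolding hh_eq by linarith
    moreover have "\<bar>R' 0 * dp rr (BB w)\<bar> \<le> \<bar>R' 0\<bar> * (Vn rr * CB * norm w)"
      unfolding abs_mult by (intro mult_left_mono pairing_bound rr) auto
    ultimately have "\<epsilon> * (norm w)\<^sup>2 - m * norm w \<le> hh w - R' 0 * dp rr (BB w)"
      unfolding m_def by (simp add: algebra_simps abs_le_iff)
    moreover have "m * norm w \<le> \<epsilon> / 2 * (norm w)\<^sup>2 + m\<^sup>2 / (2 * \<epsilon>)"
    proof -
      have "0 \<le> (\<epsilon> * norm w - m)\<^sup>2 / (2 * \<epsilon>)" using \<epsilon> by simp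
      also have "\<dots> = \<epsilon> / 2 * (norm w)\<^sup>2 + m\<^sup>2 / (2 * \<epsilon>) - m * norm w"
        using \<epsilon> by (simp add: power2_diff field_simps power2_eq_square)
      finally show ?thesis by simp
    qed
    ultimately show ?thesis by (simp add: algebra_simps)
  qed
  define c where "c = (- R 0) / lam - R' 0 * dp rr x - m\<^sup>2 / (2 * \<epsilon>) / lam"
  have "c + \<epsilon> / 2 * (LBINT \<tau>. expk lam \<tau> * (norm (u \<tau>))\<^sup>2) \<le> J x u" if u: "u \<in> Ctrl" for u
  proof -
    have "(LBINT \<tau>. \<epsilon> / 2 * (expk lam \<tau> * (norm (u \<tau>))\<^sup>2) - expk lam \<tau> * (m\<^sup>2 / (2 * \<epsilon>)))
        \<le> (LBINT \<tau>. expk lam \<tau> * (hh (u \<tau>) - R' 0 * dp rr (BB (u \<tau>))))"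
    proof (rule integral_mono)
      show "integrable lborel (\<lambda>\<tau>. \<epsilon> / 2 * (expk lam \<tau> * (norm (u \<tau>))\<^sup>2) - expk lam \<tau> * (m\<^sup>2 / (2 * \<epsilon>)))"
        using Ctrl_square[OF u] expk_const(1) by (intro Bochner_Integration.integrable_diff) auto
      have "integrable lborel (\<lambda>\<tau>. expk lam \<tau> * hh (u \<tau>) - R' 0 * (expk lam \<tau> * dp rr (BB (u \<tau>))))"
        using hh_integrable[OF u] dp_BB_integrable[OF u rr(1)] by simp
      then show "integrable lborel (\<lambda>\<tau>. expk lam \<tau> * (hh (u \<tau>) - R' 0 * dp rr (BB (u \<tau>))))"
        by (simp add: algebra_simps)
      show "\<epsilon> / 2 * (expk lam \<tau> * (norm (u \<tau>))\<^sup>2) - expk lam \<tau> * (m\<^sup>2 / (2 * \<epsilon>))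
        \<le> expk lam \<tau> * (hh (u \<tau>) - R' 0 * dp rr (BB (u \<tau>)))" for \<tau>
        using mult_left_mono[OF point[OF Ctrl_mem[OF u, of \<tau>]], of "expk lam \<tau>"] by (simp add: algebra_simps)
    qed
    moreover have "(LBINT \<tau>. \<epsilon> / 2 * (expk lam \<tau> * (norm (u \<tau>))\<^sup>2) - expk lam \<tau> * (m\<^sup>2 / (2 * \<epsilon>)))
        = \<epsilon> / 2 * (LBINT \<tau>. expk lam \<tau> * (norm (u \<tau>))\<^sup>2) - m\<^sup>2 / (2 * \<epsilon>) / lam"
      using Ctrl_square[OF u] expk_const
      by (simp only: Bochner_Integration.integral_diff integrable_mult_right integral_mult_right_zero)
    ultimately show ?thesis using J_lower[OF u, of 0 x] unfolding c_def by simp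
  qed
  then show ?thesis by blast
qed

text \<open>A real infimum bounds its members from below only if the set is bounded below, so every
  upper estimate of \<Psi> by a particular control depends on this.\<close>

lemma J_bdd_below: "bdd_below (J x ` Ctrl)"
proof -
  obtain c where c: "\<And>u. u \<in> Ctrl \<Longrightarrow> c + \<epsilon> / 2 * (LBINT \<tau>. expk lam \<tau> * (norm (u \<tau>))\<^sup>2) \<le> J x u"
    using J_coercive by blast
  show ?thesis
  proof (rule bdd_belowI2)
    fix u assume u: "u \<in> Ctrl"
    have "0 \<le> (LBINT \<tau>. expk lam \<tau> * (norm (u \<tau>))\<^sup>2)" by (intro integral_nonneg_AE AE_I2) simp
    then have "0 \<le> \<epsilon> / 2 * (LBINT \<tau>. expk lam \<tau> * (norm (u \<tau>))\<^sup>2)" using \<epsilon> by simp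
    then show "c \<le> J x u" using c[OF u] by linarith
  qed
qed

lemma Ctrl_nonempty: "Ctrl \<noteq> {}"
  using cst_Ctrl[OF subspace_0[OF subspace_U]] by blast

lemma value_le: "u \<in> Ctrl \<Longrightarrow> \<Psi> x \<le> J x u"
  unfolding value_function_eq by (rule cINF_lower[OF J_bdd_below])

lemma value_ge: "(\<And>u. u \<in> Ctrl \<Longrightarrow> c \<le> J x u) \<Longrightarrow> c \<le> \<Psi> x"
  unfolding value_function_eq by (rule cINF_greatest[OF Ctrl_nonempty])

lemma value_near: assumes "0 < e" shows "\<exists>u\<in>Ctrl. J x u < \<Psi> x + e"
  using value_ge[of "\<Psi> x + e" x] assms by (force simp: not_less)

lemma B_adj_U: "p \<in> V \<Longrightarrow> - B_adj sbar p \<in> U"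
  using V_subset_H subspace_neg[OF subspace_H_space] by (auto simp: B_adj_def U_space_def)

lemma ub_U: "p \<in> V \<Longrightarrow> ub p \<in> U"
  unfolding ub_def using q by (intro MM_mem subspace_diff[OF subspace_U] B_adj_U)

lemma ub_minimal:
  assumes p: "p \<in> V" and u: "u \<in> U"
  shows "hh (ub p) + dp p (BB (ub p)) + \<epsilon> * (norm (u - ub p))\<^sup>2 \<le> hh u + dp p (BB u)"
  using hh_minimal[OF B_adj_U[OF p] u] by (simp add: ub_def dp_BB[OF p])

lemma J_cst:
  assumes f: "f \<in> H" and eq: "AA f + BB w = 0" and w: "w \<in> U"
  shows "J (em f) (cst w) = (- R (aa (em f)) + hh w) / lam"
proof -
  have "J (em f) (cst w) = (LBINT \<tau>. expk lam \<tau> * (- R (aa (em f)) + hh w))"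
    unfolding J_def
  proof (rule integral_discrete_difference[of "{0}"])
    fix \<tau> :: real assume "\<tau> \<notin> {0}"
    then show "run (em f) (cst w) \<tau> = expk lam \<tau> * (- R (aa (em f)) + hh w)"
      using Y_cst[OF f eq w, of \<tau>] by (cases "0 < \<tau>") (auto simp: run_def cst_def expk_def)
  qed auto
  then show ?thesis by (simp add: integral_expk[OF lam])
qed

text \<open>Two evaluations of one integral: directly, the trajectory being constant, and through
  \<open>discounted_aa_Y\<close>. It reconciles the affine lower bound for \<Psi> with the cost of
  the constant control.\<close>

lemma discounted_cst:
  assumes f: "f \<in> H" and eq: "AA f + BB w = 0" and w: "w \<in> U"
  shows "aa (em f) / lam = dp rr (em f) + dp rr (BB w) / lam"
proof -
  have "(LBINT \<tau>. expk lam \<tau> * aa (Y (em f) (cst w) \<tau>)) = (LBINT \<tau>. expk lam \<tau> * aa (em f))"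
    by (rule integral_discrete_difference[of "{0}"]) (use Y_cst[OF f eq w] in \<open>auto simp: expk_def\<close>)
  moreover have "(LBINT \<tau>. expk lam \<tau> * dp rr (BB (cst w \<tau>))) = (LBINT \<tau>. expk lam \<tau> * dp rr (BB w))"
    by (rule integral_discrete_difference[of "{0}"]) (auto simp: expk_def cst_def)
  ultimately show ?thesis using discounted_aa_Y[OF cst_Ctrl[OF w], of "em f"] by (simp add: integral_expk[OF lam])
qed

lemma costate: "(- R' s) *\<^sub>R rr \<in> V" "dp ((- R' s) *\<^sub>R rr) z = - R' s * dp rr z"
  by (rule V_closed(2)[OF rr(1)], rule dp_scale[OF rr(1)])

text \<open>Keeping the control and moving the initial state by \<open>z\<close> shifts the
  trajectory by the orbit of \<open>z\<close>; \<open>R_ge_parabola\<close> linearises the revenue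
  with a quadratic error. \<open>w\<close> may be any control that holds \<open>em f\<close> in
  place: the slope sees \<open>f\<close> only, which is decisive when \<open>w\<close> stems from an
  unknown costate.\<close>

lemma J_cst_upper:
  assumes f: "f \<in> H" and eq: "AA f + BB w = 0" and w: "w \<in> U"
  defines "p \<equiv> (- R' (aa (em f))) *\<^sub>R rr"
  shows "J (em f + z) (cst w) \<le> J (em f) (cst w) + dp p z + L * (Vn \<alpha> * CA)\<^sup>2 / lam * (norm z)\<^sup>2"
proof -
  define s where "s = aa (em f)"
  define c where "c = - R s + hh w"
  have "J (em f + z) (cst w) \<le> (LBINT \<tau>. expk lam \<tau> * (c + L * (Vn \<alpha> * CA * norm z)\<^sup>2) - R' s * lap lam \<alpha> z \<tau>)"
    unfolding J_def
  proof (rule integral_mono_AE)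
    show "integrable lborel (run (em f + z) (cst w))" by (rule run_integrable[OF cst_Ctrl[OF w]])
    show "integrable lborel (\<lambda>\<tau>. expk lam \<tau> * (c + L * (Vn \<alpha> * CA * norm z)\<^sup>2) - R' s * lap lam \<alpha> z \<tau>)"
      using expk_const(1) lapi by (intro Bochner_Integration.integrable_diff integrable_mult_right) auto
    have "AE \<tau> in lborel. \<tau> \<noteq> (0::real)" by (rule AE_lborel_singleton)
    then show "AE \<tau> in lborel. run (em f + z) (cst w) \<tau> \<le> expk lam \<tau> * (c + L * (Vn \<alpha> * CA * norm z)\<^sup>2) - R' s * lap lam \<alpha> z \<tau>"
    proof eventually_elim
      case (elim \<tau>)
      show ?case
      proof (cases "0 < \<tau>")
        case False
        then show ?thesis using elim by (simp add: run_def expk_def lapd)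
      next
        case True
        let ?d = "aa (T \<tau> z)"
        have aY: "aa (Y (em f + z) (cst w) \<tau>) = s + ?d"
          using True Y_cst[OF f eq w, of \<tau>] by (simp add: Y_add aa_linear s_def)
        have "- R (s + ?d) \<le> - R s - R' s * ?d + L * ?d\<^sup>2"
          using R_ge_parabola[of s "s + ?d"] by simp
        moreover have "\<bar>?d\<bar>\<^sup>2 \<le> (Vn \<alpha> * CA * norm z)\<^sup>2"
          using dp_T_bound[OF \<alpha>, of \<tau> z] True by (intro power_mono) auto
        then have "L * ?d\<^sup>2 \<le> L * (Vn \<alpha> * CA * norm z)\<^sup>2" using L_nonneg by (intro mult_left_mono) auto
        ultimately have "- R (s + ?d) + hh w \<le> c + L * (Vn \<alpha> * CA * norm z)\<^sup>2 - R' s * ?d" unfolding c_def by linarith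
        then have "expk lam \<tau> * (- R (s + ?d) + hh w) \<le> expk lam \<tau> * (c + L * (Vn \<alpha> * CA * norm z)\<^sup>2 - R' s * ?d)"
          by (intro mult_left_mono) auto
        then show ?thesis
          using True by (simp add: run_def aY cst_def lapd right_diff_distrib mult_ac)
      qed
    qed
  qed
  also have "\<dots> = (c + L * (Vn \<alpha> * CA * norm z)\<^sup>2) / lam - R' s * dp rr z"
    by (simp only: Bochner_Integration.integral_diff[OF expk_const(1) integrable_mult_right[OF lapi]] expk_const(2)
        integral_mult_right_zero lape)
  also have "\<dots> = J (em f) (cst w) + dp p z + L * (Vn \<alpha> * CA)\<^sup>2 / lam * (norm z)\<^sup>2"
    using J_cst[OF f eq w] costate(2)[of "aa (em f)" z]
    by (simp add: p_def c_def s_def add_divide_distrib power_mult_distrib mult.assoc)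
  finally show ?thesis .
qed

lemma stationary_optimal:
  assumes f: "f \<in> H"
  defines "p \<equiv> (- R' (aa (em f))) *\<^sub>R rr"
  assumes eq: "AA f + BB (ub p) = 0"
  shows "(\<Psi> has_derivative dp p) (at (em f))"
proof -
  define s where "s = aa (em f)"
  have pV: "p \<in> V" and dpp: "dp p z = - R' s * dp rr z" for z
    unfolding p_def s_def by (rule costate)+
  note w = ub_U[OF pV]
  \<comment> \<open>For the tangent at \<open>s\<close> the pointwise integrand of
    \<open>J_lower\<close> is the Hamiltonian of \<open>p\<close>, which \<open>ub p\<close>
    minimises at each time, whatever the initial state.\<close>
  have lower: "J (em f) (cst (ub p)) + dp p z \<le> J (em f + z) u" if u: "u \<in> Ctrl" for z u
  proof -
    interpret r: linear "dp rr" by (rule dp_linear[OF rr(1)])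
    have "(LBINT \<tau>. expk lam \<tau> * (hh (ub p) + dp p (BB (ub p)))) \<le>
        (LBINT \<tau>. expk lam \<tau> * (hh (u \<tau>) - R' s * dp rr (BB (u \<tau>))))"
    proof (rule integral_mono[OF expk_const(1)])
      have "integrable lborel (\<lambda>\<tau>. expk lam \<tau> * hh (u \<tau>) - R' s * (expk lam \<tau> * dp rr (BB (u \<tau>))))"
        using hh_integrable[OF u] dp_BB_integrable[OF u rr(1)] by simp
      then show "integrable lborel (\<lambda>\<tau>. expk lam \<tau> * (hh (u \<tau>) - R' s * dp rr (BB (u \<tau>))))"
        by (simp add: algebra_simps)
      fix \<tau>
      have "0 \<le> \<epsilon> * (norm (u \<tau> - ub p))\<^sup>2" using \<epsilon> by simp
      then have "hh (ub p) + dp p (BB (ub p)) \<le> hh (u \<tau>) - R' s * dp rr (BB (u \<tau>))"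
        using ub_minimal[OF pV Ctrl_mem[OF u, of \<tau>]] dpp[of "BB (u \<tau>)"] by linarith
      then show "expk lam \<tau> * (hh (ub p) + dp p (BB (ub p))) \<le> expk lam \<tau> * (hh (u \<tau>) - R' s * dp rr (BB (u \<tau>)))"
        by (intro mult_left_mono) auto
    qed
    then have "(- R s + R' s * s) / lam - R' s * dp rr (em f + z) + (hh (ub p) + dp p (BB (ub p))) / lam \<le> J (em f + z) u"
      using J_lower[OF u, of s "em f + z"] by (simp add: integral_expk[OF lam])
    \<comment> \<open>The bracket multiplied by \<open>R' s\<close> on the right-hand side is zero
      by \<open>discounted_cst\<close>.\<close>
    moreover have "(- R s + R' s * s) / lam - R' s * dp rr (em f + z) + (hh (ub p) + dp p (BB (ub p))) / lam =
      J (em f) (cst (ub p)) + dp p z + R' s * (s / lam - (dp rr (em f) + dp rr (BB (ub p)) / lam))"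
      unfolding J_cst[OF f eq w] dpp r.add s_def[symmetric] using lam by (simp add: field_simps)
    ultimately show ?thesis using discounted_cst[OF f eq w] by (simp add: s_def)
  qed
  define C where "C = L * (Vn \<alpha> * CA)\<^sup>2 / lam"
  have C: "0 \<le> C" using L_nonneg lam by (simp add: C_def)
  interpret p: linear "dp p" by (rule dp_linear[OF pV])
  have ge: "J (em f) (cst (ub p)) + dp p z \<le> \<Psi> (em f + z)" for z by (rule value_ge) (rule lower)
  have le: "\<Psi> (em f + z) \<le> J (em f) (cst (ub p)) + dp p z + C * (norm z)\<^sup>2" for z
    using value_le[OF cst_Ctrl[OF w], of "em f + z"] J_cst_upper[OF f eq w, of z]
    unfolding C_def p_def by linarith
  have base: "\<Psi> (em f) = J (em f) (cst (ub p))" using ge[of 0] le[of 0] by (simp add: p.zero)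
  show ?thesis
    unfolding has_derivative_at_alt
  proof (intro conjI allI impI)
    show "bounded_linear (dp p)" by (rule dp_bounded_linear[OF pV])
    fix e :: real assume e: "0 < e"
    show "\<exists>d>0. \<forall>y. norm (y - em f) < d \<longrightarrow> norm (\<Psi> y - \<Psi> (em f) - dp p (y - em f)) \<le> e * norm (y - em f)"
    proof (intro exI[of _ "e / (C + 1)"] conjI allI impI)
      show "0 < e / (C + 1)" using e C by simp
      fix y assume y: "norm (y - em f) < e / (C + 1)"
      have "\<bar>\<Psi> y - \<Psi> (em f) - dp p (y - em f)\<bar> \<le> C * (norm (y - em f))\<^sup>2"
        using ge[of "y - em f"] le[of "y - em f"] C by (simp add: base abs_le_iff)
      also have "\<dots> \<le> (C + 1) * norm (y - em f) * norm (y - em f)"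
        by (simp add: power2_eq_square mult.assoc mult_right_mono)
      also have "\<dots> \<le> e * norm (y - em f)"
        using y C by (intro mult_right_mono) (auto simp: field_simps)
      finally show "norm (\<Psi> y - \<Psi> (em f) - dp p (y - em f)) \<le> e * norm (y - em f)" by simp
    qed
  qed
qed

end

context vintage_capital begin

subsection \<open>Dynamic programming\<close>

definition sh :: "real \<Rightarrow> (real \<Rightarrow> real \<times> L2) \<Rightarrow> real \<Rightarrow> real \<times> L2" where
  "sh t u \<tau> = (if 0 < \<tau> then u (t + \<tau>) else 0)"

lemma sh_Ctrl: assumes u: "u \<in> Ctrl" and t: "0 \<le> t" shows "sh t u \<in> Ctrl"
proof -
  note um = Ctrl_measurable[OF u]
  have "(\<lambda>\<tau>. u (t + \<tau>)) \<in> borel_measurable borel" by (rule measurable_compose[OF _ um]) simp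
  then have m: "sh t u \<in> borel_measurable borel" unfolding sh_def by (intro measurable_If) auto
  have "integrable lborel (\<lambda>\<tau>. exp (lam * t) * (expk lam (t + 1 * \<tau>) * (norm (u (t + 1 * \<tau>)))\<^sup>2))"
    using lborel_integrable_real_affine[OF Ctrl_square[OF u], of 1 t] by simp
  then have "integrable lborel (\<lambda>\<tau>. expk lam \<tau> * (norm (sh t u \<tau>))\<^sup>2)"
  proof (rule Bochner_Integration.integrable_bound)
    show "(\<lambda>\<tau>. expk lam \<tau> * (norm (sh t u \<tau>))\<^sup>2) \<in> borel_measurable lborel"
      by (rule weighted_measurable(2)[OF norm_Ctrl_measurable[OF m]])
    show "AE \<tau> in lborel. norm (expk lam \<tau> * (norm (sh t u \<tau>))\<^sup>2) \<le>
        norm (exp (lam * t) * (expk lam (t + 1 * \<tau>) * (norm (u (t + 1 * \<tau>)))\<^sup>2))"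
    proof (intro AE_I2)
      fix \<tau>
      show "norm (expk lam \<tau> * (norm (sh t u \<tau>))\<^sup>2) \<le> norm (exp (lam * t) * (expk lam (t + 1 * \<tau>) * (norm (u (t + 1 * \<tau>)))\<^sup>2))"
      proof (cases "0 < \<tau>")
        case True
        have "exp (lam * t) * exp (- (lam * (t + \<tau>))) = exp (- (lam * \<tau>))" by (simp add: algebra_simps flip: exp_add)
        then show ?thesis using True t by (simp add: sh_def expk_def mult.assoc[symmetric])
      qed (simp add: sh_def)
    qed
  qed
  then show ?thesis using m Ctrl_mem[OF u] subspace_0[OF subspace_U] by (auto simp: Ctrl_def sh_def)
qed

lemma T_zero: "0 \<le> t \<Longrightarrow> T t 0 = 0"
  using T.S_scale[of t 0 0] by simp

text \<open>Controls exerted up to time \<open>t\<close> are transported by the semigroup property,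
  later ones are a translate; the kernel splits accordingly at \<open>\<sigma> = t\<close>.\<close>

lemma conv_flow:
  assumes u: "u \<in> Ctrl" and t: "0 \<le> t" and \<tau>: "0 \<le> \<tau>"
  shows "conv u (t + \<tau>) = T \<tau> (conv u t) + conv (sh t u) \<tau>"
proof -
  have split: "K u (t + \<tau>) \<sigma> = T \<tau> (K u t \<sigma>) + K (sh t u) \<tau> (\<sigma> - t)" for \<sigma>
  proof -
    consider "\<sigma> \<le> 0" | "0 < \<sigma>" "\<sigma> \<le> t" | "t < \<sigma>" using t by linarith
    then show ?thesis
    proof cases
      case 2
      have "T (\<tau> + (t - \<sigma>)) (BB (u \<sigma>)) = T \<tau> (T (t - \<sigma>) (BB (u \<sigma>)))"
        using 2 \<tau> by (intro T.S_semigroup) auto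
      then show ?thesis using 2 \<tau> by (simp add: K_def add.commute add_diff_eq)
    next
      case 3
      then show ?thesis using t \<tau> by (auto simp: K_def sh_def T_zero algebra_simps)
    qed (use t \<tau> in \<open>auto simp: K_def T_zero\<close>)
  qed
  have i1: "integrable lborel (\<lambda>\<sigma>. T \<tau> (K u t \<sigma>))" "(LBINT \<sigma>. T \<tau> (K u t \<sigma>)) = T \<tau> (conv u t)"
    unfolding conv_def
    using integrable_bounded_linear[OF T_linear[OF \<tau>] K_integrable[OF u]]
      integral_bounded_linear[OF T_linear[OF \<tau>] K_integrable[OF u]] by auto
  have i2: "integrable lborel (\<lambda>\<sigma>. K (sh t u) \<tau> (\<sigma> - t))" "(LBINT \<sigma>. K (sh t u) \<tau> (\<sigma> - t)) = conv (sh t u) \<tau>"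
    unfolding conv_def
    using lborel_integrable_real_affine[OF K_integrable[OF sh_Ctrl[OF u t], of \<tau>], of 1 "- t"]
      lborel_integral_real_affine[of 1 "K (sh t u) \<tau>" "- t"] by simp_all
  show ?thesis
    unfolding conv_def[of u "t + \<tau>"] split Bochner_Integration.integral_add[OF i1(1) i2(1)] i1(2) i2(2) ..
qed

lemma Y_flow:
  assumes u: "u \<in> Ctrl" and t: "0 \<le> t" and \<tau>: "0 \<le> \<tau>"
  shows "Y x u (t + \<tau>) = Y (Y x u t) (sh t u) \<tau>"
proof -
  have m: "max 0 (t + \<tau>) = \<tau> + t" "max 0 t = t" "max 0 \<tau> = \<tau>" using t \<tau> by auto
  show ?thesis
    unfolding Y_def conv_flow[OF assms] m using t \<tau> by (simp add: T.S_semigroup T.S_add add.assoc)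
qed

text \<open>The additive form of dynamic programming for a fixed control: by \<open>Y_flow\<close>
  the cost after \<open>t\<close> is the discounted cost of the shifted control from the state
  reached.\<close>

lemma J_split:
  assumes u: "u \<in> Ctrl" and t: "0 \<le> t"
  shows "J x u = (LBINT \<tau>. indicator {0..t} \<tau> * run x u \<tau>) + exp (- lam * t) * J (Y x u t) (sh t u)"
proof -
  have i: "integrable lborel (\<lambda>\<tau>. indicator A \<tau> * run x u \<tau>)" if "A \<in> sets lborel" for A
    using integrable_mult_indicator[OF that run_integrable[OF u]] by simp
  have "J x u = (LBINT \<tau>. indicator {0..t} \<tau> * run x u \<tau> + indicator {t<..} \<tau> * run x u \<tau>)"
    unfolding J_def
    by (intro Bochner_Integration.integral_cong refl) (use t in \<open>auto simp: indicator_def run_def expk_def\<close>)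
  also have "\<dots> = (LBINT \<tau>. indicator {0..t} \<tau> * run x u \<tau>) + (LBINT \<tau>. indicator {t<..} \<tau> * run x u \<tau>)"
    by (intro Bochner_Integration.integral_add i) auto
  also have "(LBINT \<tau>. indicator {t<..} \<tau> * run x u \<tau>) = (LBINT \<tau>. indicator {t<..} (t + 1 * \<tau>) * run x u (t + 1 * \<tau>))"
    using lborel_integral_real_affine[of 1 "\<lambda>\<tau>. indicator {t<..} \<tau> * run x u \<tau>" t] by simp
  also have "\<dots> = (LBINT \<tau>. exp (- lam * t) * run (Y x u t) (sh t u) \<tau>)"
  proof (rule integral_discrete_difference[of "{0}"])
    fix \<tau> :: real assume "\<tau> \<notin> {0}"
    show "indicator {t<..} (t + 1 * \<tau>) * run x u (t + 1 * \<tau>) = exp (- lam * t) * run (Y x u t) (sh t u) \<tau>"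
    proof (cases "0 < \<tau>")
      case True
      have "exp (- lam * t) * exp (- lam * \<tau>) = exp (- lam * (t + \<tau>))" by (simp add: algebra_simps flip: exp_add)
      then show ?thesis using True t Y_flow[OF u t, of \<tau> x]
        by (simp add: run_def sh_def expk_def mult.assoc[symmetric])
    next
      case False
      then show ?thesis using \<open>\<tau> \<notin> {0}\<close> by (auto simp: run_def expk_def)
    qed
  qed auto
  finally show ?thesis by (simp add: J_def)
qed

subsection \<open>The gradient of the value function at an equilibrium\<close>

lemma BB_linear: "BB (u + w) = BB u + BB w" "BB (u - w) = BB u - BB w" "BB (c *\<^sub>R u) = c *\<^sub>R BB u" "BB 0 = 0"
proof -
  interpret bounded_linear BB by (rule bounded_linear_BB)
  show "BB (u + w) = BB u + BB w" "BB (u - w) = BB u - BB w" "BB (c *\<^sub>R u) = c *\<^sub>R BB u" "BB 0 = 0"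
    by (simp_all add: add diff scaleR zero)
qed

lemma deviation_measurable:
  assumes u: "u \<in> Ctrl" shows "(\<lambda>\<sigma>. norm (u \<sigma> - w)) \<in> borel_measurable borel"
  by (rule measurable_compose[OF Ctrl_measurable[OF u] borel_measurable_continuous_onI]) (intro continuous_intros)

lemma deviation_integrable:
  assumes u: "u \<in> Ctrl"
  shows "integrable lborel (\<lambda>\<sigma>. indicator {0..\<tau>} \<sigma> * norm (u \<sigma> - w))"
    and "integrable lborel (\<lambda>\<sigma>. indicator {0..\<tau>} \<sigma> * (norm (u \<sigma> - w))\<^sup>2)"
proof -
  note [measurable] = deviation_measurable[OF u]
  have one: "integrable lborel (indicator {0..\<tau>} :: real \<Rightarrow> real)"
    by (rule integrable_real_indicator) (auto simp: emeasure_lborel_Icc_eq)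
  have ci: "integrable lborel (\<lambda>\<sigma>. c * indicator {0..\<tau>} \<sigma> + g \<sigma>)" if "integrable lborel g"
    for c :: real and g :: "real \<Rightarrow> real"
    using one that by simp
  show "integrable lborel (\<lambda>\<sigma>. indicator {0..\<tau>} \<sigma> * norm (u \<sigma> - w))"
  proof (rule Bochner_Integration.integrable_bound[OF ci[OF Ctrl_locally_integrable(1)[OF u, of \<tau>], of "norm w"]])
    show "AE \<sigma> in lborel. norm (indicator {0..\<tau>} \<sigma> * norm (u \<sigma> - w)) \<le>
        norm (norm w * indicator {0..\<tau>} \<sigma> + indicator {0..\<tau>} \<sigma> * norm (u \<sigma>))"
      using norm_triangle_ineq4[of "u _" w] by (intro AE_I2) (simp add: indicator_def add.commute)
  qed measurable
  show "integrable lborel (\<lambda>\<sigma>. indicator {0..\<tau>} \<sigma> * (norm (u \<sigma> - w))\<^sup>2)"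
  proof (rule Bochner_Integration.integrable_bound[OF ci[OF integrable_mult_right[OF Ctrl_locally_integrable(2)[OF u, of \<tau>], of 2], of "2 * (norm w)\<^sup>2"]])
    show "AE \<sigma> in lborel. norm (indicator {0..\<tau>} \<sigma> * (norm (u \<sigma> - w))\<^sup>2) \<le>
        norm (2 * (norm w)\<^sup>2 * indicator {0..\<tau>} \<sigma> + 2 * (indicator {0..\<tau>} \<sigma> * (norm (u \<sigma>))\<^sup>2))"
    proof (intro AE_I2)
      fix \<sigma>
      have "(norm (u \<sigma> - w))\<^sup>2 \<le> (norm (u \<sigma>) + norm w)\<^sup>2" by (intro power_mono norm_triangle_ineq4) auto
      also have "\<dots> \<le> 2 * (norm w)\<^sup>2 + 2 * (norm (u \<sigma>))\<^sup>2"
        using sum_squares_bound[of "norm (u \<sigma>)" "norm w"] unfolding power2_sum by linarith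
      finally show "norm (indicator {0..\<tau>} \<sigma> * (norm (u \<sigma> - w))\<^sup>2) \<le>
        norm (2 * (norm w)\<^sup>2 * indicator {0..\<tau>} \<sigma> + 2 * (indicator {0..\<tau>} \<sigma> * (norm (u \<sigma>))\<^sup>2))"
        by (simp add: indicator_def)
    qed
  qed measurable
qed

text \<open>The integrated distance to the constant control governs the state deviation, whereas
  strong convexity pays in the squared distance; the comparison of the two is made pointwise in
  \<open>short_time_gap\<close>.\<close>

definition dev :: "(real \<Rightarrow> real \<times> L2) \<Rightarrow> real \<times> L2 \<Rightarrow> real \<Rightarrow> real" where
  "dev u w \<tau> = (LBINT \<sigma>. indicator {0..\<tau>} \<sigma> * norm (u \<sigma> - w))"

lemma dev_mono: assumes u: "u \<in> Ctrl" and "\<tau> \<le> t" shows "dev u w \<tau> \<le> dev u w t"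
  unfolding dev_def
  by (intro integral_mono deviation_integrable u) (use assms(2) in \<open>auto simp: indicator_def\<close>)

lemma dev_nonneg: "0 \<le> dev u w t"
  unfolding dev_def by (intro integral_nonneg_AE AE_I2) simp

context
  fixes f :: L2 and w :: "real \<times> L2"
  assumes f: "f \<in> H" and w: "w \<in> U" and stat: "AA f + BB w = 0"
begin

lemma Y_minus_stationary:
  assumes u: "u \<in> Ctrl" and \<tau>: "0 \<le> \<tau>"
  shows "Y (em f) u \<tau> - em f = (LBINT \<sigma>. K u \<tau> \<sigma> - K (cst w) \<tau> \<sigma>)"
proof -
  have "Y (em f) u \<tau> - Y (em f) (cst w) \<tau> = conv u \<tau> - conv (cst w) \<tau>" by (simp add: Y_def)
  then show ?thesis
    using Y_cst[OF f stat w \<tau>] Bochner_Integration.integral_diff[OF K_integrable[OF u] K_integrable[OF cst_Ctrl[OF w]]]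
    by (simp add: conv_def)
qed

lemma K_minus: "K u \<tau> \<sigma> - K (cst w) \<tau> \<sigma> = (if 0 < \<sigma> \<and> \<sigma> \<le> \<tau> then T (\<tau> - \<sigma>) (BB (u \<sigma> - w)) else 0)"
  by (simp add: K_def cst_def BB_linear T.S_diff)

lemma Y_deviation:
  assumes u: "u \<in> Ctrl" and \<tau>: "0 \<le> \<tau>"
  shows "norm (Y (em f) u \<tau> - em f) \<le> CA * CB * dev u w \<tau>"
proof -
  have "norm (Y (em f) u \<tau> - em f) \<le> (LBINT \<sigma>. CA * CB * (indicator {0..\<tau>} \<sigma> * norm (u \<sigma> - w)))"
    unfolding Y_minus_stationary[OF u \<tau>]
  proof (rule Bochner_Integration.integral_norm_bound_integral)
    show "integrable lborel (\<lambda>\<sigma>. K u \<tau> \<sigma> - K (cst w) \<tau> \<sigma>)"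
      by (intro Bochner_Integration.integrable_diff K_integrable u cst_Ctrl w)
    show "integrable lborel (\<lambda>\<sigma>. CA * CB * (indicator {0..\<tau>} \<sigma> * norm (u \<sigma> - w)))"
      using deviation_integrable(1)[OF u] by simp
    fix \<sigma>
    have "norm (T (\<tau> - \<sigma>) (BB (u \<sigma> - w))) \<le> CA * (CB * norm (u \<sigma> - w))" if "\<sigma> \<le> \<tau>"
      by (rule order_trans[OF T_bound' mult_left_mono[OF norm_BB_le]]) (use that CA_pos in auto)
    moreover have "0 \<le> CA * CB * norm (u \<sigma> - w)" using CA_pos CB_nonneg by simp
    ultimately show "norm (K u \<tau> \<sigma> - K (cst w) \<tau> \<sigma>) \<le> CA * CB * (indicator {0..\<tau>} \<sigma> * norm (u \<sigma> - w))"
      unfolding K_minus by (simp add: indicator_def mult.assoc)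
  qed
  then show ?thesis by (simp add: dev_def)
qed

text \<open>To first order the state moves by the integral of \<open>BB (u - w)\<close>. The
  semigroup factor in front is moved onto \<open>p\<close>, and \<open>adj\<close> says that
  removing it costs at most \<open>\<delta>\<close> times the size of the forcing.\<close>

lemma pairing_end:
  assumes u: "u \<in> Ctrl" and t: "0 \<le> t" and p: "p \<in> V"
    and adj: "\<And>s z. 0 \<le> s \<Longrightarrow> s \<le> t \<Longrightarrow> \<bar>dp p (T s z - z)\<bar> \<le> \<delta> * norm z" and \<delta>: "0 \<le> \<delta>"
  shows "(LBINT \<sigma>. indicator {0..t} \<sigma> * dp p (BB (u \<sigma> - w))) - \<delta> * CB * dev u w t \<le> dp p (Y (em f) u t - em f)"
    and "integrable lborel (\<lambda>\<sigma>. indicator {0..t} \<sigma> * dp p (BB (u \<sigma> - w)))"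
proof -
  interpret p: linear "dp p" by (rule dp_linear[OF p])
  have m: "(\<lambda>\<sigma>. dp p (BB (u \<sigma> - w))) \<in> borel_measurable borel"
    by (rule measurable_compose[OF Ctrl_measurable[OF u] borel_measurable_continuous_onI])
      (intro continuous_intros bounded_linear.continuous_on[OF dp_bounded_linear[OF p]]
        bounded_linear.continuous_on[OF bounded_linear_BB])
  show i: "integrable lborel (\<lambda>\<sigma>. indicator {0..t} \<sigma> * dp p (BB (u \<sigma> - w)))"
  proof (rule Bochner_Integration.integrable_bound)
    show "integrable lborel (\<lambda>\<sigma>. Vn p * CB * (indicator {0..t} \<sigma> * norm (u \<sigma> - w)))"
      using deviation_integrable(1)[OF u] by simp
    show "(\<lambda>\<sigma>. indicator {0..t} \<sigma> * dp p (BB (u \<sigma> - w))) \<in> borel_measurable lborel"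
      using m by (intro borel_measurable_times) auto
    show "AE \<sigma> in lborel. norm (indicator {0..t} \<sigma> * dp p (BB (u \<sigma> - w))) \<le> norm (Vn p * CB * (indicator {0..t} \<sigma> * norm (u \<sigma> - w)))"
      using pairing_bound[OF p] CB_nonneg by (intro AE_I2) (simp add: indicator_def abs_mult)
  qed
  have ik: "integrable lborel (\<lambda>\<sigma>. K u t \<sigma> - K (cst w) t \<sigma>)"
    by (intro Bochner_Integration.integrable_diff K_integrable u cst_Ctrl w)
  have "(LBINT \<sigma>. indicator {0..t} \<sigma> * dp p (BB (u \<sigma> - w))) - \<delta> * CB * dev u w t =
      (LBINT \<sigma>. indicator {0..t} \<sigma> * dp p (BB (u \<sigma> - w)) - \<delta> * CB * (indicator {0..t} \<sigma> * norm (u \<sigma> - w)))"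
    unfolding dev_def
    using Bochner_Integration.integral_diff[OF i integrable_mult_right[OF deviation_integrable(1)[OF u, of t w], of "\<delta> * CB"]] by simp
  also have "\<dots> \<le> (LBINT \<sigma>. dp p (K u t \<sigma> - K (cst w) t \<sigma>))"
  proof (rule integral_mono_AE)
    show "integrable lborel (\<lambda>\<sigma>. indicator {0..t} \<sigma> * dp p (BB (u \<sigma> - w)) - \<delta> * CB * (indicator {0..t} \<sigma> * norm (u \<sigma> - w)))"
      using i deviation_integrable(1)[OF u] by (intro Bochner_Integration.integrable_diff integrable_mult_right)
    show "integrable lborel (\<lambda>\<sigma>. dp p (K u t \<sigma> - K (cst w) t \<sigma>))"
      by (rule integrable_bounded_linear[OF dp_bounded_linear[OF p] ik])
    have "AE \<sigma> in lborel. \<sigma> \<noteq> (0::real)" by (rule AE_lborel_singleton)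
    then show "AE \<sigma> in lborel. indicator {0..t} \<sigma> * dp p (BB (u \<sigma> - w)) - \<delta> * CB * (indicator {0..t} \<sigma> * norm (u \<sigma> - w))
        \<le> dp p (K u t \<sigma> - K (cst w) t \<sigma>)"
    proof eventually_elim
      case (elim \<sigma>)
      show ?case
      proof (cases "0 < \<sigma> \<and> \<sigma> \<le> t")
        case True
        have "dp p (BB (u \<sigma> - w)) - dp p (T (t - \<sigma>) (BB (u \<sigma> - w))) \<le> \<delta> * norm (BB (u \<sigma> - w))"
          using adj[of "t - \<sigma>" "BB (u \<sigma> - w)"] True by (simp add: p.diff abs_le_iff)
        also have "\<dots> \<le> \<delta> * (CB * norm (u \<sigma> - w))" by (intro mult_left_mono norm_BB_le \<delta>)
        finally show ?thesis using True by (simp add: K_minus)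
      next
        case False
        then show ?thesis using elim by (auto simp: K_minus p.zero)
      qed
    qed
  qed
  also have "\<dots> = dp p (Y (em f) u t - em f)"
    unfolding Y_minus_stationary[OF u t] by (rule integral_bounded_linear[OF dp_bounded_linear[OF p] ik])
  finally show "(LBINT \<sigma>. indicator {0..t} \<sigma> * dp p (BB (u \<sigma> - w))) - \<delta> * CB * dev u w t \<le> dp p (Y (em f) u t - em f)" .
qed

end

lemma short_time_weight: "integrable lborel (\<lambda>\<tau>. indicator {0..t} \<tau> * expk lam \<tau>)"
  "0 \<le> t \<Longrightarrow> (LBINT \<tau>. indicator {0..t} \<tau> * expk lam \<tau>) = (1 - exp (- lam * t)) / lam"
proof -
  show i: "integrable lborel (\<lambda>\<tau>. indicator {0..t} \<tau> * expk lam \<tau>)"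
    using integrable_mult_indicator[OF _ integrable_expk[OF lam], of "{0..t}"] by simp
  assume t: "0 \<le> t"
  have "(LBINT \<tau>. indicator {0..t} \<tau> *\<^sub>R exp (- lam * \<tau>)) = (- exp (- lam * t) / lam) - (- exp (- lam * 0) / lam)"
  proof (rule integral_FTC_Icc[OF t])
    show "((\<lambda>\<tau>. - exp (- lam * \<tau>) / lam) has_vector_derivative exp (- lam * x)) (at x within {0..t})" for x
      using lam by (auto intro!: derivative_eq_intros simp flip: has_real_derivative_iff_has_vector_derivative)
  qed (intro continuous_intros)
  moreover have "(LBINT \<tau>. indicator {0..t} \<tau> *\<^sub>R exp (- lam * \<tau>)) = (LBINT \<tau>. indicator {0..t} \<tau> * expk lam \<tau>)"
    by (intro Bochner_Integration.integral_cong refl) (auto simp: indicator_def expk_def)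
  ultimately show "(LBINT \<tau>. indicator {0..t} \<tau> * expk lam \<tau>) = (1 - exp (- lam * t)) / lam"
    using lam by (simp add: field_simps)
qed

text \<open>The term linear in the control deviation is the one that
  the dynamic programming principle cancels.\<close>

lemma running_cost_lower:
  assumes f: "f \<in> H" and p: "p \<in> V" and stat: "AA f + BB (ub p) = 0" and u: "u \<in> Ctrl" and t: "0 \<le> t"
    and pi: "integrable lborel (\<lambda>\<sigma>. indicator {0..t} \<sigma> * dp p (BB (u \<sigma> - ub p)))"
  defines "E \<equiv> exp (- lam * t)"
  shows "(1 - E) * J (em f) (cst (ub p)) - E * (LBINT \<sigma>. indicator {0..t} \<sigma> * dp p (BB (u \<sigma> - ub p)))
      - (t * \<bar>R' (aa (em f))\<bar> * Vn \<alpha> * CA * CB + (1 - E) * Vn p * CB) * dev u (ub p) t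
      + \<epsilon> * E * (LBINT \<sigma>. indicator {0..t} \<sigma> * (norm (u \<sigma> - ub p))\<^sup>2)
    \<le> (LBINT \<tau>. indicator {0..t} \<tau> * run (em f) u \<tau>)"
proof -
  define w where "w = ub p"
  define s where "s = aa (em f)"
  define c1 where "c1 = - R s + hh w"
  define c2 where "c2 = \<bar>R' s\<bar> * Vn \<alpha> * CA * CB * dev u w t"
  have wU: "w \<in> U" unfolding w_def by (rule ub_U[OF p])
  interpret p: linear "dp p" by (rule dp_linear[OF p])
  have E: "0 < E" "E \<le> 1" using lam t by (auto simp: E_def)
  have one: "integrable lborel (indicator {0..t} :: real \<Rightarrow> real)"
    by (rule integrable_real_indicator) (auto simp: emeasure_lborel_Icc_eq)
  have onev: "(LBINT \<tau>. indicator {0..t} \<tau>) = t" using t by simp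
  define g1 where "g1 \<tau> = c1 * (indicator {0..t} \<tau> * expk lam \<tau>)" for \<tau>
  define g2 where "g2 \<tau> = c2 * indicator {0..t} \<tau>" for \<tau> :: real
  define g3 where "g3 \<tau> = E * (indicator {0..t} \<tau> * dp p (BB (u \<tau> - w)))" for \<tau>
  define g4 where "g4 \<tau> = (1 - E) * Vn p * CB * (indicator {0..t} \<tau> * norm (u \<tau> - w))" for \<tau>
  define g5 where "g5 \<tau> = \<epsilon> * E * (indicator {0..t} \<tau> * (norm (u \<tau> - w))\<^sup>2)" for \<tau>
  have i1: "integrable lborel g1" and v1: "(LBINT \<tau>. g1 \<tau>) = c1 * ((1 - E) / lam)"
    unfolding g1_def E_def using short_time_weight t by auto
  have i2: "integrable lborel g2" and v2: "(LBINT \<tau>. g2 \<tau>) = c2 * t"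
    unfolding g2_def using one onev by auto
  have i3: "integrable lborel g3" and v3: "(LBINT \<tau>. g3 \<tau>) = E * (LBINT \<sigma>. indicator {0..t} \<sigma> * dp p (BB (u \<sigma> - w)))"
    unfolding g3_def w_def using pi by auto
  have i4: "integrable lborel g4" and v4: "(LBINT \<tau>. g4 \<tau>) = (1 - E) * Vn p * CB * dev u w t"
    unfolding g4_def dev_def using deviation_integrable(1)[OF u] by auto
  have i5: "integrable lborel g5" and v5: "(LBINT \<tau>. g5 \<tau>) = \<epsilon> * E * (LBINT \<sigma>. indicator {0..t} \<sigma> * (norm (u \<sigma> - w))\<^sup>2)"
    unfolding g5_def using deviation_integrable(2)[OF u] by auto
  have iA: "integrable lborel (\<lambda>\<tau>. g1 \<tau> - g2 \<tau>)" using i1 i2 by (rule Bochner_Integration.integrable_diff)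
  have iB: "integrable lborel (\<lambda>\<tau>. g1 \<tau> - g2 \<tau> - g3 \<tau>)" using iA i3 by (rule Bochner_Integration.integrable_diff)
  have iC: "integrable lborel (\<lambda>\<tau>. g1 \<tau> - g2 \<tau> - g3 \<tau> - g4 \<tau>)" using iB i4 by (rule Bochner_Integration.integrable_diff)
  have "(LBINT \<tau>. g1 \<tau> - g2 \<tau> - g3 \<tau> - g4 \<tau> + g5 \<tau>) \<le> (LBINT \<tau>. indicator {0..t} \<tau> * run (em f) u \<tau>)"
  proof (rule integral_mono[OF Bochner_Integration.integrable_add[OF iC i5]])
    show "integrable lborel (\<lambda>\<tau>. indicator {0..t} \<tau> * run (em f) u \<tau>)"
      using integrable_mult_indicator[OF _ run_integrable[OF u], of "{0..t}"] by simp
    fix \<tau>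
    show "g1 \<tau> - g2 \<tau> - g3 \<tau> - g4 \<tau> + g5 \<tau> \<le> indicator {0..t} \<tau> * run (em f) u \<tau>"
    proof (cases "\<tau> \<in> {0..t}")
      case False
      then show ?thesis unfolding g1_def g2_def g3_def g4_def g5_def by simp
    next
      case True
      then have \<tau>: "0 \<le> \<tau>" "\<tau> \<le> t" by auto
      define e where "e = expk lam \<tau>"
      define n where "n = norm (u \<tau> - w)"
      define \<pi> where "\<pi> = dp p (BB (u \<tau> - w))"
      have e: "E \<le> e" "e \<le> 1" using \<tau> lam by (auto simp: e_def E_def expk_def)
      have Yd: "norm (Y (em f) u \<tau> - em f) \<le> CA * CB * dev u w t"
        by (rule order_trans[OF Y_deviation[OF f wU stat[folded w_def] u \<tau>(1)] mult_left_mono[OF dev_mono[OF u \<tau>(2)]]])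
          (use CA_pos CB_nonneg in simp)
      have "\<bar>R' s * (aa (Y (em f) u \<tau>) - s)\<bar> \<le> c2"
      proof -
        have "\<bar>aa (Y (em f) u \<tau>) - s\<bar> \<le> Vn \<alpha> * (CA * CB * dev u w t)"
          using aa_le[of "Y (em f) u \<tau> - em f"] mult_left_mono[OF Yd, of "Vn \<alpha>"] by (simp add: aa_linear s_def)
        then show ?thesis unfolding abs_mult c2_def using mult_left_mono[of _ _ "\<bar>R' s\<bar>"] by (simp add: mult.assoc)
      qed
      then have gR: "- R s - c2 \<le> - R (aa (Y (em f) u \<tau>))" using R_le_tangent[of "aa (Y (em f) u \<tau>)" s] by linarith
      have gh: "hh w - \<pi> + \<epsilon> * n\<^sup>2 \<le> hh (u \<tau>)"
        using ub_minimal[OF p Ctrl_mem[OF u, of \<tau>]] by (simp add: w_def n_def \<pi>_def BB_linear p.diff)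
      have c2: "0 \<le> c2" using CA_pos CB_nonneg dev_nonneg unfolding c2_def by (intro mult_nonneg_nonneg) auto
      have pib: "\<bar>\<pi>\<bar> \<le> Vn p * CB * n" unfolding \<pi>_def n_def by (rule pairing_bound[OF p])
      have pb: "0 \<le> Vn p * CB * n" using pib by linarith
      have a: "c1 * e - c2 - e * \<pi> + \<epsilon> * E * n\<^sup>2 \<le> run (em f) u \<tau>"
      proof -
        have "e * (- R s - c2 + (hh w - \<pi> + \<epsilon> * n\<^sup>2)) \<le> run (em f) u \<tau>"
          unfolding run_def e_def[symmetric] using gR gh e E by (intro mult_left_mono add_mono) auto
        moreover have "e * c2 \<le> 1 * c2" using e c2 by (intro mult_right_mono) auto
        moreover have "E * (\<epsilon> * n\<^sup>2) \<le> e * (\<epsilon> * n\<^sup>2)" using e \<epsilon> by (intro mult_right_mono) auto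
        ultimately show ?thesis unfolding c1_def by (simp add: algebra_simps)
      qed
      \<comment> \<open>The discount inside the linear term is frozen at its final value
        \<open>E\<close>, so that the term matches the one produced by the value at time
        \<open>t\<close>; the price has the small factor \<open>1 - E\<close>.\<close>
      have b: "e * \<pi> \<le> E * \<pi> + (1 - E) * (Vn p * CB * n)"
      proof -
        have "(e - E) * \<pi> \<le> (e - E) * (Vn p * CB * n)" using e pib by (intro mult_left_mono) auto
        also have "\<dots> \<le> (1 - E) * (Vn p * CB * n)" using e pb by (intro mult_right_mono) auto
        finally show ?thesis by (simp add: algebra_simps)
      qed
      have "g1 \<tau> - g2 \<tau> - g3 \<tau> - g4 \<tau> + g5 \<tau> = c1 * e - c2 - E * \<pi> - (1 - E) * (Vn p * CB * n) + \<epsilon> * E * n\<^sup>2"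
        using True unfolding g1_def g2_def g3_def g4_def g5_def e_def n_def \<pi>_def by (simp add: mult.assoc)
      then show ?thesis using a b True by simp
    qed
  qed
  moreover have "(LBINT \<tau>. g1 \<tau> - g2 \<tau> - g3 \<tau> - g4 \<tau> + g5 \<tau>) =
      c1 * ((1 - E) / lam) - c2 * t - E * (LBINT \<sigma>. indicator {0..t} \<sigma> * dp p (BB (u \<sigma> - w)))
      - (1 - E) * Vn p * CB * dev u w t + \<epsilon> * E * (LBINT \<sigma>. indicator {0..t} \<sigma> * (norm (u \<sigma> - w))\<^sup>2)"
    by (simp only: Bochner_Integration.integral_add[OF iC i5] Bochner_Integration.integral_diff[OF iB i4]
        Bochner_Integration.integral_diff[OF iA i3] Bochner_Integration.integral_diff[OF i1 i2] v1 v2 v3 v4 v5)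
  moreover have "(1 - E) * J (em f) (cst (ub p)) = c1 * ((1 - E) / lam)"
    using J_cst[OF f stat ub_U[OF p]] by (simp add: c1_def s_def w_def)
  ultimately show ?thesis
    unfolding w_def[symmetric] s_def[symmetric] by (simp add: c2_def algebra_simps)
qed

end

context vintage_capital begin

text \<open>\<open>J_split\<close> adds the running cost on \<open>[0,t]\<close> and
  \<open>E\<close> times the cost from the state reached, which is at least \<Psi> there. The linear
  terms \<open>E * PB\<close> of \<open>running_cost_lower\<close> and of the expansion
  \<open>low\<close> cancel. What remains is a gain \<open>\<epsilon> * E * Q\<close> against a loss
  \<open>m * D\<close>, where \<open>m\<close> collects all errors.\<close>

lemma short_time_gap:
  assumes f: "f \<in> H" and p: "p \<in> V" and stat: "AA f + BB (ub p) = 0" and u: "u \<in> Ctrl"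
    and t: "0 \<le> t" and \<delta>: "0 \<le> \<delta>"
    and adj: "\<And>s z. 0 \<le> s \<Longrightarrow> s \<le> t \<Longrightarrow> \<bar>dp p (T s z - z)\<bar> \<le> \<delta> * norm z"
    and low: "\<Psi> (em f) + dp p (Y (em f) u t - em f) - \<delta> * norm (Y (em f) u t - em f) \<le> \<Psi> (Y (em f) u t)"
  defines "E \<equiv> exp (- lam * t)"
  defines "m \<equiv> t * \<bar>R' (aa (em f))\<bar> * Vn \<alpha> * CA * CB + (1 - E) * Vn p * CB + \<delta> * (CB + CA * CB)"
  shows "(1 - E) * (J (em f) (cst (ub p)) - \<Psi> (em f)) - t * (m\<^sup>2 / (4 * \<epsilon> * E)) \<le> J (em f) u - \<Psi> (em f)"
proof -
  define w where "w = ub p"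
  define PB where "PB = (LBINT \<sigma>. indicator {0..t} \<sigma> * dp p (BB (u \<sigma> - w)))"
  define D where "D = dev u w t"
  define Q where "Q = (LBINT \<sigma>. indicator {0..t} \<sigma> * (norm (u \<sigma> - w))\<^sup>2)"
  define k where "k = t * \<bar>R' (aa (em f))\<bar> * Vn \<alpha> * CA * CB + (1 - E) * Vn p * CB"
  have wU: "w \<in> U" unfolding w_def by (rule ub_U[OF p])
  have E: "0 < E" "E \<le> 1" using lam t by (auto simp: E_def)
  have D: "0 \<le> D" unfolding D_def by (rule dev_nonneg)
  note pe = pairing_end[OF f wU stat[folded w_def] u t p adj \<delta>]
  have run: "(1 - E) * J (em f) (cst w) - E * PB - k * D + \<epsilon> * E * Q \<le> (LBINT \<tau>. indicator {0..t} \<tau> * run (em f) u \<tau>)"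
    using running_cost_lower[OF f p stat u t pe(2)[unfolded w_def]]
    unfolding E_def PB_def D_def Q_def k_def w_def .
  have "\<delta> * norm (Y (em f) u t - em f) \<le> \<delta> * (CA * CB * D)"
    unfolding D_def by (intro mult_left_mono Y_deviation[OF f wU stat[folded w_def] u t] \<delta>)
  then have "\<Psi> (em f) + PB - \<delta> * (CB + CA * CB) * D \<le> \<Psi> (Y (em f) u t)"
    using low pe(1) unfolding PB_def[symmetric] D_def[symmetric] by (simp add: algebra_simps)
  also have "\<dots> \<le> J (Y (em f) u t) (sh t u)" by (rule value_le[OF sh_Ctrl[OF u t]])
  finally have "E * (\<Psi> (em f) + PB - \<delta> * (CB + CA * CB) * D) \<le> E * J (Y (em f) u t) (sh t u)"
    using E by (intro mult_left_mono) auto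
  moreover have "E * (\<delta> * (CB + CA * CB) * D) \<le> 1 * (\<delta> * (CB + CA * CB) * D)"
    using E \<delta> D CA_pos CB_nonneg by (intro mult_right_mono mult_nonneg_nonneg add_nonneg_nonneg) auto
  ultimately have "(1 - E) * (J (em f) (cst w) - \<Psi> (em f)) + (\<epsilon> * E * Q - m * D) \<le> J (em f) u - \<Psi> (em f)"
    using run J_split[OF u t, of "em f"] unfolding m_def k_def E_def[symmetric] by (simp add: algebra_simps)
  \<comment> \<open>Completing the square at each time: a deviation \<open>n\<close> contributes
    \<open>\<epsilon> * E * n^2 - m * n\<close>, which is at least
    \<open>- m^2 / (4 * \<epsilon> * E)\<close>, over an interval of length
    \<open>t\<close>.\<close>
  moreover have "- (t * (m\<^sup>2 / (4 * \<epsilon> * E))) \<le> \<epsilon> * E * Q - m * D"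
  proof -
    have one: "integrable lborel (indicator {0..t} :: real \<Rightarrow> real)"
      by (rule integrable_real_indicator) (auto simp: emeasure_lborel_Icc_eq)
    note i1 = integrable_mult_right[OF deviation_integrable(2)[OF u, of t w], of "\<epsilon> * E"]
    note i2 = integrable_mult_right[OF deviation_integrable(1)[OF u, of t w], of m]
    note i3 = integrable_mult_right[OF one, of "m\<^sup>2 / (4 * \<epsilon> * E)"]
    have "0 \<le> (LBINT \<sigma>. \<epsilon> * E * (indicator {0..t} \<sigma> * (norm (u \<sigma> - w))\<^sup>2) - m * (indicator {0..t} \<sigma> * norm (u \<sigma> - w))
        + m\<^sup>2 / (4 * \<epsilon> * E) * indicator {0..t} \<sigma>)"
    proof (intro integral_nonneg_AE AE_I2)
      fix \<sigma>
      define n where "n = norm (u \<sigma> - w)"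
      have "0 \<le> (2 * (\<epsilon> * E) * n - m)\<^sup>2 / (4 * \<epsilon> * E)" using \<epsilon> E by simp
      also have "\<dots> = \<epsilon> * E * n\<^sup>2 - m * n + m\<^sup>2 / (4 * \<epsilon> * E)"
        using \<epsilon> E by (simp add: power2_diff field_simps power2_eq_square)
      finally show "0 \<le> \<epsilon> * E * (indicator {0..t} \<sigma> * (norm (u \<sigma> - w))\<^sup>2) - m * (indicator {0..t} \<sigma> * norm (u \<sigma> - w))
          + m\<^sup>2 / (4 * \<epsilon> * E) * indicator {0..t} \<sigma>"
        by (simp add: n_def indicator_def)
    qed
    also have "\<dots> = \<epsilon> * E * Q - m * D + m\<^sup>2 / (4 * \<epsilon> * E) * t"
      unfolding Bochner_Integration.integral_add[OF Bochner_Integration.integrable_diff[OF i1 i2] i3]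
        Bochner_Integration.integral_diff[OF i1 i2] Q_def D_def dev_def
      using t by simp
    finally show ?thesis by (simp add: mult.commute)
  qed
  ultimately show ?thesis unfolding w_def by linarith
qed

text \<open>From \<open>norm u \<le> 1 / (4 * s) + s * (norm u)^2\<close> with a free weight
  \<open>s\<close>: it is spent first, to make the energy term small for all nearly optimal controls
  at once, and \<open>t\<close> is chosen afterwards.\<close>

lemma dev_small:
  assumes u: "u \<in> Ctrl" and t: "0 \<le> t" "t \<le> 1" and s: "0 < s"
  shows "dev u w t \<le> t * (norm w + 1 / (4 * s)) + s * exp lam * (LBINT \<tau>. expk lam \<tau> * (norm (u \<tau>))\<^sup>2)"
proof -
  have one: "integrable lborel (indicator {0..t} :: real \<Rightarrow> real)"
    by (rule integrable_real_indicator) (auto simp: emeasure_lborel_Icc_eq)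
  note i1 = integrable_mult_right[OF one, of "norm w + 1 / (4 * s)"]
  note i2 = integrable_mult_right[OF Ctrl_square[OF u], of "s * exp lam"]
  have "dev u w t \<le> (LBINT \<sigma>. (norm w + 1 / (4 * s)) * indicator {0..t} \<sigma> + s * exp lam * (expk lam \<sigma> * (norm (u \<sigma>))\<^sup>2))"
    unfolding dev_def
  proof (rule integral_mono[OF deviation_integrable(1)[OF u] Bochner_Integration.integrable_add[OF i1 i2]])
    fix \<sigma>
    show "indicator {0..t} \<sigma> * norm (u \<sigma> - w) \<le> (norm w + 1 / (4 * s)) * indicator {0..t} \<sigma> + s * exp lam * (expk lam \<sigma> * (norm (u \<sigma>))\<^sup>2)"
    proof (cases "\<sigma> \<in> {0..t}")
      case False
      then show ?thesis using s by simp
    next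
      case True
      have "lam * \<sigma> \<le> lam * 1" using True t lam by (intro mult_left_mono) auto
      then have "1 \<le> exp lam * expk lam \<sigma>" using True by (simp add: expk_def flip: exp_add)
      then have "1 * (s * (norm (u \<sigma>))\<^sup>2) \<le> (exp lam * expk lam \<sigma>) * (s * (norm (u \<sigma>))\<^sup>2)"
        using s by (intro mult_right_mono) auto
      moreover have "norm (u \<sigma>) \<le> 1 / (4 * s) + s * (norm (u \<sigma>))\<^sup>2"
      proof -
        have "0 \<le> (2 * s * norm (u \<sigma>) - 1)\<^sup>2 / (4 * s)" using s by simp
        also have "\<dots> = 1 / (4 * s) + s * (norm (u \<sigma>))\<^sup>2 - norm (u \<sigma>)"
          using s by (simp add: power2_diff field_simps power2_eq_square)
        finally show ?thesis by simp
      qed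
      moreover have "norm (u \<sigma> - w) \<le> norm (u \<sigma>) + norm w" by (rule norm_triangle_ineq4)
      ultimately have "norm (u \<sigma> - w) \<le> (norm w + 1 / (4 * s)) + (exp lam * expk lam \<sigma>) * (s * (norm (u \<sigma>))\<^sup>2)" by linarith
      then show ?thesis using True by (simp add: mult_ac)
    qed
  qed
  also have "\<dots> = t * (norm w + 1 / (4 * s)) + s * exp lam * (LBINT \<tau>. expk lam \<tau> * (norm (u \<tau>))\<^sup>2)"
    unfolding Bochner_Integration.integral_add[OF i1 i2] using t by simp
  finally show ?thesis .
qed

text \<open>By strong convexity of the cost, \<open>short_time_gap\<close> leaves a
  remainder that is \<open>o(t)\<close>, while the gap itself enters with the factor \<open>1 - exp (- lam * t)\<close>.\<close>

lemma stationary_value: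
  assumes f: "f \<in> H" and p: "p \<in> V" and stat: "AA f + BB (ub p) = 0"
    and der: "(\<Psi> has_derivative dp p) (at (em f))"
  shows "\<Psi> (em f) = J (em f) (cst (ub p))"
proof -
  define w where "w = ub p"
  define x where "x = em f"
  define G where "G = J x (cst w) - \<Psi> x"
  have wU: "w \<in> U" unfolding w_def by (rule ub_U[OF p])
  have G0: "0 \<le> G" using value_le[OF cst_Ctrl[OF wU], of x] by (simp add: G_def)
  obtain c where c: "\<And>u. u \<in> Ctrl \<Longrightarrow> c + \<epsilon> / 2 * (LBINT \<tau>. expk lam \<tau> * (norm (u \<tau>))\<^sup>2) \<le> J x u"
    using J_coercive by blast
  \<comment> \<open>By coercivity this bounds the discounted energy of every control whose cost
    exceeds the infimum by less than 1.\<close>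
  define B where "B = 2 / \<epsilon> * \<bar>\<Psi> x + 1 - c\<bar>"
  have B: "0 \<le> B" using \<epsilon> by (simp add: B_def)
  have near: "(LBINT \<tau>. expk lam \<tau> * (norm (u \<tau>))\<^sup>2) \<le> B" if "u \<in> Ctrl" "J x u < \<Psi> x + 1" for u
  proof -
    have "\<epsilon> / 2 * (LBINT \<tau>. expk lam \<tau> * (norm (u \<tau>))\<^sup>2) \<le> \<bar>\<Psi> x + 1 - c\<bar>" using c[OF that(1)] that(2) by linarith
    then show ?thesis using \<epsilon> by (simp add: B_def field_simps)
  qed
  define C1 where "C1 = CA * CB + 1"
  have C1: "0 < C1" "CA * CB \<le> C1" using CA_pos CB_nonneg by (auto simp: C1_def intro: add_nonneg_pos)
  \<comment> \<open>Each summand of \<open>m\<close> below becomes a multiple of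
    \<open>\<delta>\<close> once \<open>t \<le> \<delta>\<close> and
    \<open>1 - E \<le> lam * t\<close>; \<open>c5\<close> collects the factors.\<close>
  define c5 where "c5 = \<bar>R' (aa x)\<bar> * Vn \<alpha> * CA * CB + lam * (Vn p * CB) + (CB + CA * CB)"
  define E0 where "E0 = exp (- lam)"
  have E0: "0 < E0" by (simp add: E0_def)
  define C where "C = c5\<^sup>2 / (4 * \<epsilon> * E0) / (lam * E0)"
  have C: "0 \<le> C" using \<epsilon> lam E0 by (simp add: C_def)
  \<comment> \<open>Order of choices: \<open>\<delta>\<close> yields \<open>\<rho>\<close> and
    \<open>d1\<close>, then come \<open>s\<close> and \<open>t\<close>, and only then a nearly
    optimal control. Hence the estimates are uniform over all controls with cost below
    \<open>\<Psi> x + 1\<close>.\<close>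
  have main: "G \<le> \<delta> * C" if \<delta>: "0 < \<delta>" "\<delta> < 1" for \<delta>
  proof -
    obtain \<rho> where \<rho>: "0 < \<rho>" "\<And>y. norm (y - x) < \<rho> \<Longrightarrow> norm (\<Psi> y - \<Psi> x - dp p (y - x)) \<le> \<delta> * norm (y - x)"
      using der \<delta>(1) unfolding has_derivative_at_alt x_def by blast
    obtain d1 where d1: "0 < d1" "\<And>t z. 0 \<le> t \<Longrightarrow> t \<le> d1 \<Longrightarrow> \<bar>dp p (T t z - z)\<bar> \<le> \<delta> * norm z"
      using T_adjoint_continuous[OF p \<delta>(1)] by blast
    \<comment> \<open>With this weight the energy part of \<open>dev_small\<close> moves the state
      by less than half of \<open>\<rho>\<close>; the bound on \<open>t\<close> below allots the
      other half to the part proportional to \<open>t\<close>.\<close>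
    define s where "s = \<rho> / (2 * C1 * exp lam * (B + 1))"
    have s: "0 < s" using \<rho>(1) C1 B by (simp add: s_def)
    define a where "a = norm w + 1 / (4 * s) + 1"
    have a: "0 < a" using s by (simp add: a_def add_nonneg_pos)
    define t where "t = min (min 1 \<delta>) (min d1 (\<rho> / (2 * C1 * a)))"
    have t: "0 < t" "t \<le> 1" "t \<le> \<delta>" "t \<le> d1" "t \<le> \<rho> / (2 * C1 * a)"
      using \<delta> d1(1) \<rho>(1) C1 a by (auto simp: t_def)
    define E where "E = exp (- lam * t)"
    define m where "m = t * \<bar>R' (aa x)\<bar> * Vn \<alpha> * CA * CB + (1 - E) * Vn p * CB + \<delta> * (CB + CA * CB)"
    have E: "0 < E" "E \<le> 1" "E0 \<le> E" using lam t by (auto simp: E_def E0_def)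
    have E1: "1 - E \<le> lam * t" using exp_ge_add_one_self[of "- lam * t"] by (simp add: E_def)
    \<comment> \<open>The gap must keep a factor proportional to \<open>t\<close>, the order of the
      remainder, so that \<open>t\<close> can be cancelled and only the smallness of
      \<open>m\<close> counts.\<close>
    have E2: "lam * t * E \<le> 1 - E"
    proof -
      have "(1 + lam * t) * E \<le> exp (lam * t) * E" using E by (intro mult_right_mono exp_ge_add_one_self) auto
      also have "\<dots> = 1" by (simp add: E_def flip: exp_add)
      finally show ?thesis by (simp add: algebra_simps)
    qed
    have m: "0 \<le> m" "m \<le> \<delta> * c5"
    proof -
      show "0 \<le> m" using t \<delta> E CA_pos CB_nonneg unfolding m_def
        by (intro add_nonneg_nonneg mult_nonneg_nonneg) auto
      have "t * (\<bar>R' (aa x)\<bar> * Vn \<alpha> * CA * CB) \<le> \<delta> * (\<bar>R' (aa x)\<bar> * Vn \<alpha> * CA * CB)"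
        using t CA_pos CB_nonneg by (intro mult_right_mono mult_nonneg_nonneg) auto
      moreover have "(1 - E) * (Vn p * CB) \<le> (lam * \<delta>) * (Vn p * CB)"
        using order_trans[OF E1 mult_left_mono[OF t(3)]] lam CB_nonneg by (intro mult_right_mono) auto
      ultimately show "m \<le> \<delta> * c5" unfolding m_def c5_def by (simp add: algebra_simps)
    qed
    have close: "norm (Y x u t - x) < \<rho>" if u: "u \<in> Ctrl" "J x u < \<Psi> x + 1" for u
    proof -
      have "norm (Y x u t - x) \<le> CA * CB * dev u w t"
        unfolding x_def using t by (intro Y_deviation[OF f wU stat[folded w_def] u(1)]) auto
      also have "\<dots> \<le> C1 * dev u w t" using C1 dev_nonneg by (intro mult_right_mono) auto
      also have "dev u w t \<le> t * (norm w + 1 / (4 * s)) + s * exp lam * (LBINT \<tau>. expk lam \<tau> * (norm (u \<tau>))\<^sup>2)"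
        using t s by (intro dev_small u) auto
      also have "\<dots> \<le> t * a + s * exp lam * B"
        using t s near[OF u] by (intro add_mono mult_left_mono) (auto simp: a_def)
      also have "C1 * (t * a + s * exp lam * B) < \<rho>"
      proof -
        have "C1 * (t * a) \<le> \<rho> / 2" using t(5) C1 a by (simp add: field_simps)
        moreover have "C1 * (s * exp lam * B) < \<rho> / 2"
        proof -
          have "C1 * (s * exp lam * B) < C1 * (s * exp lam * (B + 1))" using C1 s by simp
          also have "\<dots> = \<rho> / 2"
          proof -
            have "2 * C1 * exp lam * (B + 1) \<noteq> 0" using C1 B by simp
            then have "s * (2 * C1 * exp lam * (B + 1)) = \<rho>" unfolding s_def by (rule nonzero_eq_divide_eq[THEN iffD1, OF _ refl])
            then show ?thesis by (simp add: mult_ac)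
          qed
          finally show ?thesis .
        qed
        ultimately show ?thesis by (simp add: distrib_left)
      qed
      finally show ?thesis using C1 by simp
    qed
    have "(1 - E) * G - t * (m\<^sup>2 / (4 * \<epsilon> * E)) \<le> 0"
    proof (rule field_le_epsilon)
      fix e :: real assume e: "0 < e"
      obtain u where u: "u \<in> Ctrl" "J x u < \<Psi> x + min e 1" using value_near[of "min e 1" x] e by auto
      have "(1 - E) * G - t * (m\<^sup>2 / (4 * \<epsilon> * E)) \<le> J x u - \<Psi> x"
        unfolding G_def E_def m_def x_def w_def
      proof (rule short_time_gap[OF f p stat u(1)])
        show "\<Psi> (em f) + dp p (Y (em f) u t - em f) - \<delta> * norm (Y (em f) u t - em f) \<le> \<Psi> (Y (em f) u t)"
          using \<rho>(2)[of "Y x u t"] close[OF u(1)] u(2) by (simp add: x_def abs_le_iff)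
      qed (use t \<delta> d1(2) in auto)
      then show "(1 - E) * G - t * (m\<^sup>2 / (4 * \<epsilon> * E)) \<le> 0 + e" using u(2) by simp
    qed
    moreover have "lam * t * E * G \<le> (1 - E) * G" using E2 G0 by (rule mult_right_mono)
    ultimately have "t * (lam * E * G) \<le> t * (m\<^sup>2 / (4 * \<epsilon> * E))" by (simp add: algebra_simps)
    then have "lam * E * G \<le> m\<^sup>2 / (4 * \<epsilon> * E)" using t(1) by (rule mult_left_le_imp_le)
    also have "\<dots> \<le> (\<delta> * c5)\<^sup>2 / (4 * \<epsilon> * E0)"
      using m E E0 \<epsilon> by (intro frac_le power_mono) auto
    also have "\<dots> \<le> \<delta> * (c5\<^sup>2 / (4 * \<epsilon> * E0))"
    proof -
      have "\<delta>\<^sup>2 * (c5\<^sup>2 / (4 * \<epsilon> * E0)) \<le> \<delta> * (c5\<^sup>2 / (4 * \<epsilon> * E0))"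
        using \<delta> \<epsilon> E0 by (intro mult_right_mono) (auto simp: power2_eq_square mult_left_le)
      then show ?thesis by (simp add: power_mult_distrib)
    qed
    finally have "lam * E * G \<le> \<delta> * (c5\<^sup>2 / (4 * \<epsilon> * E0))" .
    moreover have "lam * E0 * G \<le> lam * E * G" using E(3) lam G0 by (intro mult_right_mono mult_left_mono) auto
    ultimately have "lam * E0 * G \<le> \<delta> * (c5\<^sup>2 / (4 * \<epsilon> * E0))" by linarith
    then have "G * (lam * E0) \<le> \<delta> * (c5\<^sup>2 / (4 * \<epsilon> * E0))" by (simp only: mult_ac)
    then have "G \<le> \<delta> * (c5\<^sup>2 / (4 * \<epsilon> * E0)) / (lam * E0)"
      using lam E0 by (subst pos_le_divide_eq) auto
    then show ?thesis unfolding C_def by (simp only: times_divide_eq_right)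
  qed
  have "G \<le> 0"
  proof (rule field_le_epsilon)
    fix e :: real assume e: "0 < e"
    define \<delta> where "\<delta> = min (1/2) (e / (C + 1))"
    have "0 < \<delta>" "\<delta> < 1" using e C by (auto simp: \<delta>_def)
    then have "G \<le> \<delta> * C" by (rule main)
    also have "\<dots> \<le> e / (C + 1) * (C + 1)" using C e by (intro mult_mono) (auto simp: \<delta>_def)
    finally show "G \<le> 0 + e" using C by simp
  qed
  then show ?thesis using G0 by (simp add: G_def x_def w_def)
qed

text \<open>By \<open>stationary_value\<close> the parabola of \<open>J_cst_upper\<close> touches
  \<Psi> from above at \<open>x\<close>. Comparing both first-order expansions along a short
  multiple of \<open>z\<close> gives \<open>dp p z \<le> dp p0 z\<close>, and replacing
  \<open>z\<close> by \<open>- z\<close> gives equality.\<close>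

lemma stationary_gradient:
  assumes f: "f \<in> H" and p: "p \<in> V" and stat: "AA f + BB (ub p) = 0"
    and der: "(\<Psi> has_derivative dp p) (at (em f))"
  shows "p = (- R' (aa (em f))) *\<^sub>R rr"
proof -
  define p0 where "p0 = (- R' (aa (em f))) *\<^sub>R rr"
  define x where "x = em f"
  have p0: "p0 \<in> V" unfolding p0_def by (rule costate)
  interpret p: linear "dp p" by (rule dp_linear[OF p])
  interpret p0: linear "dp p0" by (rule dp_linear[OF p0])
  define C where "C = L * (Vn \<alpha> * CA)\<^sup>2 / lam"
  have C: "0 \<le> C" using L_nonneg lam by (simp add: C_def)
  have upper: "\<Psi> (x + z) \<le> \<Psi> x + dp p0 z + C * (norm z)\<^sup>2" for z
    using value_le[OF cst_Ctrl[OF ub_U[OF p]], of "x + z"] J_cst_upper[OF f stat ub_U[OF p], of z]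
      stationary_value[OF f p stat der]
    unfolding C_def p0_def x_def by linarith
  have le: "dp p z \<le> dp p0 z" for z
  proof (rule field_le_epsilon)
    fix e :: real assume e: "0 < e"
    define N where "N = norm z + 1"
    have z1: "0 < N" "norm z \<le> N" using norm_ge_zero[of z] by (auto simp: N_def intro: add_nonneg_pos)
    define e' where "e' = e / (2 * N)"
    have e': "0 < e'" using e z1 by (simp add: e'_def)
    obtain d where d: "0 < d" "\<And>y. norm (y - x) < d \<Longrightarrow> norm (\<Psi> y - \<Psi> x - dp p (y - x)) \<le> e' * norm (y - x)"
      using der e' unfolding has_derivative_at_alt x_def by blast
    define K where "K = C * (norm z)\<^sup>2 + 1"
    have C1: "0 < K" "C * (norm z)\<^sup>2 \<le> K" using C by (simp_all add: K_def add_nonneg_pos)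
    define t where "t = min (d / N / 2) (e / (2 * K))"
    have t: "0 < t" "t \<le> d / N / 2" "t \<le> e / (2 * K)"
      using d(1) e z1 C1 by (auto simp: t_def)
    have "t * norm z \<le> d / N / 2 * N" using t z1 by (intro mult_mono) auto
    also have "\<dots> < d" using d(1) z1 by simp
    finally have "norm ((x + t *\<^sub>R z) - x) < d" using t(1) by simp
    from d(2)[OF this] have "\<Psi> x + dp p (t *\<^sub>R z) - e' * norm (t *\<^sub>R z) \<le> \<Psi> (x + t *\<^sub>R z)" by (simp add: abs_le_iff)
    also have "\<dots> \<le> \<Psi> x + dp p0 (t *\<^sub>R z) + C * (norm (t *\<^sub>R z))\<^sup>2" by (rule upper)
    finally have "t * dp p z \<le> t * (dp p0 z + e' * norm z + t * (C * (norm z)\<^sup>2))"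
      using t(1) by (simp add: p.scale p0.scale power_mult_distrib power2_eq_square algebra_simps)
    then have "dp p z \<le> dp p0 z + e' * norm z + t * (C * (norm z)\<^sup>2)" using t(1) by simp
    moreover have "e' * norm z \<le> e' * N" using e' z1(2) by (intro mult_left_mono) auto
    moreover have "e' * N = e / 2" using z1 by (simp add: e'_def)
    moreover have "t * (C * (norm z)\<^sup>2) \<le> e / (2 * K) * K"
      using t C C1 by (intro mult_mono) auto
    moreover have "e / (2 * K) * K = e / 2" using C1 by simp
    ultimately show "dp p z \<le> dp p0 z + e" by linarith
  qed
  have "dp p z = dp p0 z" for z using le[of z] le[of "- z"] by (simp add: p.neg p0.neg)
  \<comment> \<open>The functional represented by \<open>p - p0\<close> itself is an admissible test
    element of V'.\<close>
  then have "inner (p - p0) (p - p0) = 0"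
    using dp_em[OF V_closed(3)[OF p p0], of "p - p0"] dp_diff[OF p p0] by simp
  then have "p = p0" by simp
  then show ?thesis by (simp only: p0_def)
qed

subsection \<open>Characterisation of the equilibria\<close>

definition x1 :: 'd where "x1 = - gen_inv T (BB (MM (B_adj sbar rr)))"
definition x2 :: 'd where "x2 = gen_inv T (BB (MM q))"

lemma BB_ub_costate: "BB (ub (c *\<^sub>R rr)) = - c *\<^sub>R BB (MM (B_adj sbar rr)) - BB (MM q)"
proof -
  interpret M: bounded_linear MM by (rule bounded_linear_MM)
  have "B_adj sbar (c *\<^sub>R rr) = c *\<^sub>R B_adj sbar rr" using ev0_linear(2)[OF rr(1)] by (simp add: B_adj_def)
  then have "ub (c *\<^sub>R rr) = (- c) *\<^sub>R MM (B_adj sbar rr) - MM q"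
    by (simp add: ub_def M.diff M.neg M.scaleR)
  then show ?thesis by (simp only: BB_linear)
qed

text \<open>For a costate proportional to \<open>rr\<close>, the closed loop equation is affine and
  solved by inverting the generator (\<open>solve\<close>). \<open>stationary_gradient\<close>
  forces the costate to be of this kind with factor given by \<open>R'\<close>, and
  \<open>stationary_optimal\<close> shows that this costate is indeed the derivative of
  \<Psi>.\<close>

lemma equilibrium_iff:
  "is_equilibrium sbar lam dp T (\<lambda>x. - R (aa x)) hh x \<longleftrightarrow> x = x2 + R' (aa x) *\<^sub>R x1"
proof -
  have grad: "gradient_on U (convex_conjugate_on U hh) (- B_adj sbar p) = ub p" if "p \<in> V" for p
    unfolding ub_def by (rule gradient_conjugate[OF B_adj_U[OF that]])
  have solve: "x = x2 + \<eta> *\<^sub>R x1 \<longleftrightarrow> x \<in> gen_dom T \<and> gen T x + BB (ub ((- \<eta>) *\<^sub>R rr)) = 0" for \<eta>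
  proof -
    define y where "y = BB (MM q) + (- \<eta>) *\<^sub>R BB (MM (B_adj sbar rr))"
    have inv: "gen_inv T y = x2 + \<eta> *\<^sub>R x1"
      unfolding y_def gen_inv_linear x1_def x2_def by simp
    have "gen T x + BB (ub ((- \<eta>) *\<^sub>R rr)) = 0 \<longleftrightarrow> gen T x = y"
      unfolding BB_ub_costate y_def by (auto simp: algebra_simps)
    moreover have "x \<in> gen_dom T \<and> gen T x = y \<longleftrightarrow> x = gen_inv T y"
      using gen_inv_gen[of x] gen_gen_inv[of y] gen_inv_range[of y] gen_dom_eq by auto
    ultimately show ?thesis by (simp add: inv)
  qed
  show ?thesis
  proof
    assume "is_equilibrium sbar lam dp T (\<lambda>x. - R (aa x)) hh x"
    then obtain p where x: "x \<in> gen_dom T" and p: "p \<in> V" "(\<Psi> has_derivative dp p) (at x)"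
      and eq: "gen T x + BB (ub p) = 0"
      unfolding is_equilibrium_def using grad by (elim conjE bexE) simp
    obtain f where f: "f \<in> H" "x = em f" using x by (auto simp: gen_dom_eq)
    have pe: "p = (- R' (aa x)) *\<^sub>R rr"
      unfolding f(2) using p eq by (intro stationary_gradient f) (auto simp: f gen_em)
    show "x = x2 + R' (aa x) *\<^sub>R x1" using x eq unfolding pe by (intro iffD2[OF solve] conjI)
  next
    assume x: "x = x2 + R' (aa x) *\<^sub>R x1"
    define p where "p = (- R' (aa x)) *\<^sub>R rr"
    have pV: "p \<in> V" unfolding p_def by (rule costate)
    have dom: "x \<in> gen_dom T" and eq: "gen T x + BB (ub p) = 0"
      using iffD1[OF solve x] by (auto simp: p_def)
    obtain f where f: "f \<in> H" "x = em f" using dom by (auto simp: gen_dom_eq)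
    have "(\<Psi> has_derivative dp p) (at x)"
      unfolding f(2) p_def using eq by (intro stationary_optimal) (auto simp: f gen_em p_def)
    then show "is_equilibrium sbar lam dp T (\<lambda>x. - R (aa x)) hh x"
      unfolding is_equilibrium_def using dom pV eq grad[OF pV] by (intro conjI bexI[of _ p]) auto
  qed
qed

lemma x1_x2_range: "x2 + \<eta> *\<^sub>R x1 \<in> em ` H"
proof -
  obtain f g where f: "f \<in> H" "x2 = em f" and g: "g \<in> H" "gen_inv T (BB (MM (B_adj sbar rr))) = em g"
    using gen_inv_range[of "BB (MM q)"] gen_inv_range[of "BB (MM (B_adj sbar rr))"] unfolding x2_def by blast
  have "x2 + \<eta> *\<^sub>R x1 = em (f + (- \<eta>) *\<^sub>R g)"
    unfolding em_linear by (simp add: f(2) g(2) x1_def)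
  moreover have "f + (- \<eta>) *\<^sub>R g \<in> H"
    using f(1) g(1) by (intro subspace_add[OF subspace_H_space] subspace_scale[OF subspace_H_space])
  ultimately show ?thesis by blast
qed

section \<open>Sign of the feedback coefficient and the scalar fixed point equation\<close>

lemma inner_nonneg:
  assumes f: "f \<in> H" and "AE s in lborel. s \<in> einterval 0 sbar \<longrightarrow> 0 \<le> rep_L2 f s"
    and "AE s in lborel. s \<in> einterval 0 sbar \<longrightarrow> 0 \<le> rep_L2 g s"
  shows "0 \<le> inner f g"
proof -
  have "AE s in lborel. s \<notin> einterval 0 sbar \<longrightarrow> rep_L2 f s = 0" using f by (simp add: H_space_def)
  then have "AE s in lborel. 0 \<le> rep_L2 f s * rep_L2 g s"
    using assms(2,3) by eventually_elim (auto intro: mult_nonneg_nonneg)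
  then show ?thesis unfolding inner_L2_integral by (rule integral_nonneg_AE)
qed

text \<open>Writing \<alpha> as \<open>- As v\<close>, the generator is moved off \<open>x1\<close>
  by duality and its inverse cancels: the pairing becomes that of \<open>B_adj sbar v\<close> with
  \<open>MM (B_adj sbar rr)\<close>. All factors are nonnegative, as both resolvents preserve the
  sign and the cost weights are positive.\<close>

lemma aa_x1_nonneg:
  assumes pos: "AE s in lborel. s \<in> einterval 0 sbar \<longrightarrow> 0 \<le> rep_L2 \<alpha> s"
  shows "0 \<le> aa x1"
proof -
  have \<alpha>H: "\<alpha> \<in> H" using \<alpha> V_subset_H by blast
  have r: "AE s in lborel. s \<in> einterval 0 sbar \<longrightarrow> 0 \<le> rep_L2 rr s" "0 \<le> ev rr 0"
  proof -
    obtain v where v: "v \<in> V" "(lam + \<mu>) *\<^sub>R v - Dw v = \<alpha>"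
      "AE s in lborel. s \<in> einterval 0 sbar \<longrightarrow> 0 \<le> rep_L2 v s" "0 \<le> ev v 0"
      using resolvent_exists[of "lam + \<mu>", OF _ \<alpha>H] lam \<mu> pos by auto
    \<comment> \<open>\<open>rr\<close> is defined by inversion and carries no sign information;
      uniqueness identifies it with the nonnegative solution \<open>v\<close>.\<close>
    have "(lam + \<mu>) *\<^sub>R (v - rr) - Dw (v - rr) = 0"
      using v(1,2) rr As_diff[OF v(1) rr(1)] by (simp add: A0_adj_def algebra_simps)
    then have "v = rr"
      using resolvent_norm_le[OF V_closed(3)[OF v(1) rr(1)], of "lam + \<mu>"] lam \<mu> by simp
    then show "AE s in lborel. s \<in> einterval 0 sbar \<longrightarrow> 0 \<le> rep_L2 rr s" "0 \<le> ev rr 0" using v by auto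
  qed
  obtain v where v: "v \<in> V" "\<mu> *\<^sub>R v - Dw v = \<alpha>"
    "AE s in lborel. s \<in> einterval 0 sbar \<longrightarrow> 0 \<le> rep_L2 v s" "0 \<le> ev v 0"
    using resolvent_exists[OF \<mu> \<alpha>H] pos by blast
  have As: "As v = - \<alpha>" using v(2) by (simp add: A0_adj_def algebra_simps)
  define u where "u = MM (B_adj sbar rr)"
  obtain f where f: "f \<in> H" "AA f = BB u" using AA_surj by blast
  have "x1 = - em f" unfolding x1_def u_def[symmetric] f(2)[symmetric] by (simp add: gen_inv_AA[OF f(1)])
  then have "aa x1 = - inner \<alpha> f"
    using linear_neg[OF dp_linear[OF \<alpha>]] by (simp add: dp_em[OF \<alpha>])
  also have "\<dots> = dp v (BB u)" using f(2) dp_AA[OF v(1), of f] As by simp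
  also have "\<dots> = ev v 0 * fst u + inner v (snd u)" by (simp add: dp_BB[OF v(1)] B_adj_def inner_prod_def)
  also have "\<dots> \<ge> 0"
  proof (intro add_nonneg_nonneg mult_nonneg_nonneg v(4) inner_nonneg v(3))
    show "v \<in> H" using v(1) V_subset_H by blast
    show "0 \<le> fst u" using r(2) \<beta>0_pos by (simp add: u_def MM_eq B_adj_def)
    have "AE s in lborel. s \<in> einterval 0 sbar \<longrightarrow> 0 \<le> rep_L2 (mult_L2 mi rr) s"
      using rep_mult_L2[OF mi_bounded, of rr] r(1) \<beta>1_low
      by eventually_elim (use \<epsilon> in \<open>auto simp: mi_def\<close>)
    then show "AE s in lborel. s \<in> einterval 0 sbar \<longrightarrow> 0 \<le> rep_L2 (snd u) s"
      by (simp add: u_def MM_eq B_adj_def)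
  qed
  finally show ?thesis .
qed

text \<open>Since \<open>R'\<close> is decreasing and \<open>b \<ge> 0\<close>, the function
  \<open>\<phi>\<close> grows at least as fast as the identity, which excludes two zeros and makes a
  sign change available.\<close>

lemma fixed_point_unique_existence:
  assumes b: "0 \<le> b" and cont: "continuous_on UNIV R'"
  shows "\<exists>!\<eta>. \<eta> = R' (a + \<eta> * b)"
proof -
  define \<phi> where "\<phi> \<eta> = \<eta> - R' (a + \<eta> * b)" for \<eta>
  have mono: "\<eta> - \<zeta> \<le> \<phi> \<eta> - \<phi> \<zeta>" if "\<zeta> \<le> \<eta>" for \<eta> \<zeta>
    unfolding \<phi>_def using R_antimono[of "a + \<zeta> * b" "a + \<eta> * b"] mult_right_mono[OF that b] by simp
  \<comment> \<open>At 0 the value of \<open>\<phi>\<close> is \<open>- R' a\<close>; with growth at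
    least one, the zero is reached no further away than \<open>R' a\<close>, on either side.\<close>
  have "continuous_on {min 0 (R' a)..max 0 (R' a)} \<phi>"
    unfolding \<phi>_def by (intro continuous_intros continuous_on_compose2[OF cont]) auto
  moreover have "\<phi> 0 = - R' a" by (simp add: \<phi>_def)
  then have "\<phi> (min 0 (R' a)) \<le> 0" "0 \<le> \<phi> (max 0 (R' a))"
    using mono[of "min 0 (R' a)" 0] mono[of 0 "max 0 (R' a)"] by auto
  moreover have "min 0 (R' a) \<le> max 0 (R' a)" by linarith
  ultimately obtain \<eta> where "\<phi> \<eta> = 0"
    using IVT'[of \<phi> "min 0 (R' a)" 0 "max 0 (R' a)"] by auto
  moreover have "\<zeta> = \<eta>" if "\<phi> \<zeta> = 0" for \<zeta>
    using mono[of \<zeta> \<eta>] mono[of \<eta> \<zeta>] that \<open>\<phi> \<eta> = 0\<close> by linarith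
  ultimately have "\<exists>!\<eta>. \<phi> \<eta> = 0" by blast
  then show ?thesis unfolding \<phi>_def right_minus_eq .
qed

end

theorem lemma5p1:
  fixes sbar :: ereal
    and \<mu> lam \<epsilon> \<beta>0 :: real
    and \<beta>1 R R' :: "real \<Rightarrow> real"
    and q :: "real \<times> L2"
    and \<alpha> :: L2
    and dp :: "L2 \<Rightarrow> 'd::{banach,second_countable_topology} \<Rightarrow> real"
    and T :: "real \<Rightarrow> 'd \<Rightarrow> 'd"
    and w1 w2 :: 'd
    and E :: "'d set"
  assumes "0 < sbar" and "0 < \<mu>" and "0 < lam"
    and "is_dual_of_V sbar \<mu> dp"
    and "is_extended_semigroup sbar \<mu> dp T"
    and "\<alpha> \<in> V_space sbar"
    and "AE s in lborel. s \<in> einterval 0 sbar \<longrightarrow> 0 \<le> rep_L2 \<alpha> s"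
    and "q \<in> U_space sbar"
    and "set_borel_measurable lborel (einterval 0 sbar) \<beta>1"
    and "\<exists>C. AE s in lborel. s \<in> einterval 0 sbar \<longrightarrow> \<bar>\<beta>1 s\<bar> \<le> C"
    and "0 < \<epsilon>" and "\<epsilon> \<le> \<beta>0"
    and "AE s in lborel. s \<in> einterval 0 sbar \<longrightarrow> \<epsilon> \<le> \<beta>1 s"
    and "\<And>r. (R has_real_derivative R' r) (at r)"
    and "continuous_on UNIV R'"
    and "concave_on UNIV R"
    and "\<exists>L. L-lipschitz_on UNIV R'"
    and "w1 = - gen_inv T (B_op sbar dp (M_op sbar \<beta>0 \<beta>1 (B_adj sbar (resolvent_A0_adj sbar \<mu> lam \<alpha>))))"
    and "w2 = gen_inv T (B_op sbar dp (M_op sbar \<beta>0 \<beta>1 q))"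
    and "E = {x \<in> emb sbar dp ` H_space sbar.
          is_equilibrium sbar lam dp T (\<lambda>x. - R (dp \<alpha> x)) (h0 sbar \<beta>0 \<beta>1 q) x}"
  shows "((\<exists>x. x \<in> E) \<longleftrightarrow> (\<exists>\<eta>. \<eta> = R' (dp \<alpha> (w2 + \<eta> *\<^sub>R w1)))) \<and>
    (\<forall>x \<eta>. x \<in> E \<and> \<eta> = R' (dp \<alpha> (w2 + \<eta> *\<^sub>R w1)) \<longrightarrow> x = w2 + \<eta> *\<^sub>R w1) \<and>
    ((\<forall>r d. (R' has_real_derivative d) (at r) \<longrightarrow> d \<le> 0) \<longrightarrow> (\<exists>!x. x \<in> E))"
proof -
  obtain L where L: "L-lipschitz_on UNIV R'" using assms(17) by blast
  interpret vintage_capital sbar \<mu> dp T \<beta>0 \<epsilon> \<beta>1 q lam L R R' \<alpha>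
    by unfold_locales (fact assms L)+
  have w: "w1 = x1" "w2 = x2" using assms(18,19) by (simp_all only: x1_def x2_def rr_def)
  define F where "F \<eta> = R' (aa (w2 + \<eta> *\<^sub>R w1))" for \<eta>
  have "F = (\<lambda>\<eta>. R' (aa w2 + \<eta> * aa w1))" by (simp add: F_def aa_linear fun_eq_iff)
  then obtain \<xi> where \<xi>: "\<xi> = F \<xi>" "\<And>\<eta>. \<eta> = F \<eta> \<Longrightarrow> \<eta> = \<xi>"
    using fixed_point_unique_existence[of "aa w1" "aa w2", OF _ assms(15)] aa_x1_nonneg[OF assms(7)]
    unfolding w by metis
  have E: "x \<in> E \<longleftrightarrow> x = w2 + R' (aa x) *\<^sub>R w1" for x
    unfolding assms(20) w mem_Collect_eq equilibrium_iff using x1_x2_range[of "R' (aa x)"] by metis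
  \<comment> \<open>An equation for a point of V' becomes a scalar one: if
    \<open>x = w2 + R' (aa x) *\<^sub>R w1\<close>, then \<open>R' (aa x)\<close> is a fixed point
    of \<open>F\<close>, hence equal to \<open>\<xi>\<close>.\<close>
  have "x \<in> E \<longleftrightarrow> x = w2 + \<xi> *\<^sub>R w1" for x
    unfolding E using \<xi> unfolding F_def by metis
  then show ?thesis using \<xi> unfolding F_def by metis
qed

end
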